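(* Let $1<q<\infty$ and $\alpha>-1$. There is a constant $C_q>0$, not depending on $f$, such that for every $f\in\mathcal{A}^1_\alpha$ there exist a sequence $\{a_i\}$ of $(1,q)_\alpha$-atoms and a sequence $\{\lambda_i\}$ of complex numbers such that $$f=\sum_i\lambda_iP_\alpha a_i\quad\text{and}\quad\sum_i|\lambda_i|\le C_q\|f\|_{1,\alpha}.$$ Moreover, $$\|f\|_{1,\alpha}\approx\inf\sum_i|\lambda_i|,$$ where the infimum is taken over all decompositions $f=\sum_i\lambda_iP_\alpha a_i$ with $(1,q)_\alpha$-atoms $a_i$ and $\lambda_i\in\mathbb{C}$, $\sum_i|\lambda_i|<\infty$, and the constants implied by $\approx$ depend only on $\alpha,n$ and $q$.
   Context: Fix a positive integer $n$. $\mathbb{B}_n=\{z\in\mathbb{C}^n:|z|<1\}$ is the open unit ball, $\mathbb{S}_n$ its boundary, $\langle z,w\rangle=\sum_k z_k\overline{w_k}$. $dv$ is Lebesgue measure on $\mathbb{B}_n$ normalized to be a probability measure; for $\alpha>-1$, $dv_\alpha(z)=c_\alpha(1-|z|^2)^\alpha dv(z)$ with $c_\alpha=\Gamma(n+\alpha+1)/[n!\,\Gamma(\alpha+1)]$, a probability measure. $\mathcal{A}^1_\alpha$ is the space of holomorphic $f$ on $\mathbb{B}_n$ with $\|f\|_{1,\alpha}=\int_{\mathbb{B}_n}|f|\,dv_\alpha<\infty$. The Bergman projection is $$P_\alpha f(z)=\int_{\mathbb{B}_n}\frac{f(w)}{(1-\langle z,w\rangle)^{n+1+\alpha}}\,dv_\alpha(w),\qquad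 f\in L^1(\mathbb{B}_n,dv_\alpha),\ z\in\mathbb{B}_n.$$ Let $d(z,w)=|1-\langle z,w\rangle|^{1/2}$ for $z,w\in\overline{\mathbb{B}}_n$. For $\zeta\in\mathbb{S}_n$ and $r>0$, the set $Q_r(\zeta)=\{z\in\mathbb{B}_n:d(z,\zeta)<r\}$ is called a Carleson tube. For $1<q<\infty$, a function $a\in L^q(\mathbb{B}_n,dv_\alpha)$ is a $(1,q)_\alpha$-atom if there is a Carleson tube $Q$ such that (1) $a$ is supported in $Q$; (2) $\|a\|_{L^q(\mathbb{B}_n,dv_\alpha)}\le v_\alpha(Q)^{\frac1q-1}$; (3) $\int_{\mathbb{B}_n}a\,dv_\alpha=0$. The constant function $1$ is also considered to be a $(1,q)_\alpha$-atom. Series $\sum_i\lambda_iP_\alpha a_i$ are understood to converge in the norm of $\mathcal{A}^1_\alpha$. $X\approx Y$ means $C^{-1}Y\le X\le CY$ for some constant $C>0$ not depending on $f$. *)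

theory Defs
  imports "HOL-Analysis.Analysis"
begin

text \<open>
  \<open>\<complex>\<^sup>n\<close> is \<^typ>\<open>complex ^ 'n\<close> with \<open>n = CARD('n)\<close>; its library norm is the Hermitian norm, so
  the open unit ball is \<^term>\<open>ball (0 :: complex ^ 'n) 1\<close>. Functions on the ball are total functions
  whose values outside the ball are irrelevant.
\<close>

definition hinner :: "complex ^ 'n \<Rightarrow> complex ^ 'n \<Rightarrow> complex" where
  "hinner z w = (\<Sum>k\<in>UNIV. z $ k * cnj (w $ k))"

text \<open>Holomorphy in several variables: the Frechet derivative exists and is complex linear.\<close>

definition holomorphic_sv :: "(complex ^ 'n \<Rightarrow> complex) \<Rightarrow> (complex ^ 'n) set \<Rightarrow> bool" where
  "holomorphic_sv f U \<longleftrightarrow>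
     (\<forall>z\<in>U. \<exists>D. (f has_derivative D) (at z) \<and> (\<forall>c v. D (c *s v) = c * D v))"

text \<open>
  The measures have the ball itself as underlying space, so that measurability and integrability
  do not see values outside the ball.
\<close>

definition ball_measure :: "(complex ^ 'n) measure" where
  "ball_measure = uniform_measure (lebesgue_on (ball 0 1)) (ball 0 1)"

definition weight_const :: "nat \<Rightarrow> real \<Rightarrow> real" where
  "weight_const n \<alpha> = Gamma (real n + \<alpha> + 1) / (fact n * Gamma (\<alpha> + 1))"

definition weighted_measure :: "real \<Rightarrow> (complex ^ 'n) measure" where
  "weighted_measure \<alpha> =
     density ball_measure
       (\<lambda>z. ennreal (weight_const CARD('n) \<alpha> * (1 - (norm z)\<^sup>2) powr \<alpha>))"

definition Lq_fun :: "'a measure \<Rightarrow> real \<Rightarrow> ('a \<Rightarrow> complex) set" where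
  "Lq_fun M q = {a \<in> borel_measurable M. integrable M (\<lambda>z. cmod (a z) powr q)}"

definition Lq_norm :: "'a measure \<Rightarrow> real \<Rightarrow> ('a \<Rightarrow> complex) \<Rightarrow> real" where
  "Lq_norm M q a = (\<integral>z. cmod (a z) powr q \<partial>M) powr (1 / q)"

definition bergman_space :: "real \<Rightarrow> (complex ^ 'n \<Rightarrow> complex) set" where
  "bergman_space \<alpha> =
     {f. holomorphic_sv f (ball 0 1) \<and> integrable (weighted_measure \<alpha>) (\<lambda>z. cmod (f z))}"

definition bergman_norm :: "real \<Rightarrow> (complex ^ 'n \<Rightarrow> complex) \<Rightarrow> real" where
  "bergman_norm \<alpha> f = (\<integral>z. cmod (f z) \<partial>weighted_measure \<alpha>)"

text \<open>
  The power is the principal branch, which is holomorphic here because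
  \<open>1 - hinner z w\<close> has positive real part for \<open>z, w\<close> in the ball.
\<close>

definition bergman_proj ::
    "real \<Rightarrow> (complex ^ 'n \<Rightarrow> complex) \<Rightarrow> complex ^ 'n \<Rightarrow> complex" where
  "bergman_proj \<alpha> f z =
     (\<integral>w. f w / (1 - hinner z w) powr complex_of_real (real CARD('n) + 1 + \<alpha>)
        \<partial>weighted_measure \<alpha>)"

definition qdist :: "complex ^ 'n \<Rightarrow> complex ^ 'n \<Rightarrow> real" where
  "qdist z w = sqrt (cmod (1 - hinner z w))"

definition carleson_tube :: "complex ^ 'n \<Rightarrow> real \<Rightarrow> (complex ^ 'n) set" where
  "carleson_tube \<zeta> r = {z \<in> ball 0 1. qdist z \<zeta> < r}"

definition is_carleson_tube :: "(complex ^ 'n) set \<Rightarrow> bool" where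
  "is_carleson_tube Q \<longleftrightarrow> (\<exists>\<zeta>\<in>sphere 0 1. \<exists>r>0. Q = carleson_tube \<zeta> r)"

text \<open>
  Elements of \<open>L\<^sup>q\<close> are represented by functions, so the support condition and equality with the
  constant \<open>1\<close> are understood up to null sets.
\<close>

definition is_atom :: "real \<Rightarrow> real \<Rightarrow> (complex ^ 'n \<Rightarrow> complex) \<Rightarrow> bool" where
  "is_atom q \<alpha> a \<longleftrightarrow>
     a \<in> Lq_fun (weighted_measure \<alpha>) q \<and>
     ((AE z in weighted_measure \<alpha>. a z = 1) \<or>
      (\<exists>Q. is_carleson_tube Q \<and>
         (AE z in weighted_measure \<alpha>. z \<notin> Q \<longrightarrow> a z = 0) \<and>
         Lq_norm (weighted_measure \<alpha>) q a \<le> measure (weighted_measure \<alpha>) Q powr (1 / q - 1) \<and>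
         (\<integral>z. a z \<partial>weighted_measure \<alpha>) = 0))"

text \<open>
  Membership of the terms and of the sum in the Bergman space is explicit because the library
  integral of a non-integrable function is \<open>0\<close>.
\<close>

definition bergman_sums ::
    "real \<Rightarrow> (nat \<Rightarrow> complex ^ 'n \<Rightarrow> complex) \<Rightarrow> (complex ^ 'n \<Rightarrow> complex) \<Rightarrow> bool" where
  "bergman_sums \<alpha> g f \<longleftrightarrow>
     (\<forall>i. g i \<in> bergman_space \<alpha>) \<and> f \<in> bergman_space \<alpha> \<and>
     (\<lambda>N. bergman_norm \<alpha> (\<lambda>z. f z - (\<Sum>i<N. g i z))) \<longlonglongrightarrow> 0"

definition atomic_decomposition ::
    "real \<Rightarrow> real \<Rightarrow> (complex ^ 'n \<Rightarrow> complex) \<Rightarrow>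
     (nat \<Rightarrow> complex ^ 'n \<Rightarrow> complex) \<Rightarrow> (nat \<Rightarrow> complex) \<Rightarrow> bool" where
  "atomic_decomposition q \<alpha> f a l \<longleftrightarrow>
     (\<forall>i. is_atom q \<alpha> (a i)) \<and>
     summable (\<lambda>i. cmod (l i)) \<and>
     bergman_sums \<alpha> (\<lambda>i z. l i * bergman_proj \<alpha> (a i) z) f"

definition atomic_norm :: "real \<Rightarrow> real \<Rightarrow> (complex ^ 'n \<Rightarrow> complex) \<Rightarrow> real" where
  "atomic_norm q \<alpha> f = Inf {\<Sum>i. cmod (l i) |a l. atomic_decomposition q \<alpha> f a l}"

end

theory Submission imports Defs "HOL-Complex_Analysis.Cauchy_Integral_Formula" begin

text \<open>
  Write \<open>\<rho>(w) = 1 - |w|\<^sup>2\<close> and \<open>s = n + 1 + \<alpha>\<close>, the exponent of the kernel of the projection.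

  Why a decomposition exists. Up to a constant, every \<open>f\<close> in the Bergman space is the integral of
  \<open>f(w) * k\<^sub>w\<close> against the weighted measure, with the normalised kernels
  \<open>k\<^sub>w(z) = \<rho>(w) * (1 - \<langle>z, w\<rangle>) powr -(s + 1)\<close>; this is the reproducing formula for the weight with
  exponent \<open>\<alpha> + 1\<close> (\<open>bergman_reproducing\<close>). So \<open>f\<close> is an average of the \<open>k\<^sub>w\<close> with total mass
  proportional to its norm, and it suffices to place all \<open>k\<^sub>w\<close> in one multiple of the closed
  absolutely convex hull of the projected atoms (\<open>atomic_hull_normalised_kernel\<close>). The hull is stable
  under averages, so it contains \<open>f\<close> up to a constant times its norm (\<open>bergman_space_subset_hull\<close>),
  and repeated approximation of the remainder turns membership in the hull into an absolutely
  summable series (\<open>hull_imp_decomposition\<close>).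

  Why the normalised kernels lie in the hull. Since \<open>1 = (1 - \<langle>z, w\<rangle>) + \<langle>z, w\<rangle>\<close>, the kernel \<open>k\<^sub>w\<close> is
  \<open>\<rho>(w)\<close> times the sum of \<open>(1 - \<langle>z, w\<rangle>) powr -s\<close> and a multiple of its radial derivative. The kernel
  is antiholomorphic in its second variable. Hence the derivative is the projection of a linear
  function on a Bergman cell around \<open>w\<close>; this function has mean zero and is a multiple of order
  \<open>1 / (1 - |w|)\<close> of an atom. Likewise the kernel itself is the projection of the normalised indicator
  function of the cell. That function lacks mean zero, but the difference of two of them at
  distances \<open>\<delta>\<close> and \<open>2 * \<delta>\<close> from the sphere is a bounded multiple of an atom, and moving inwards in
  such steps ends at the constant function. The cost grows more slowly than \<open>1 / \<delta>\<close>, and the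
  factor \<open>\<rho>(w)\<close> absorbs both costs. All mean values are computed as averages over circles of unitary
  maps (\<open>integral_eq_circle_coefficient\<close>).

  Why the sum of the coefficients dominates the norm. Projections of atoms are bounded in norm
  (\<open>proj_atom_bound\<close>). Near the tube of the atom, the kernel is integrated in absolute value; this
  costs a small negative power of \<open>\<rho>\<close>, which Hoelder's inequality absorbs because \<open>q > 1\<close>. Away from
  the tube, the vanishing mean of the atom brings in the difference of two kernels, whose decay is
  integrable. Both parts rest on the volumes of tubes with respect to powers of \<open>\<rho>\<close>, which follow
  from the behaviour of Lebesgue measure under unitary maps and anisotropic dilations.
\<close>

section \<open>The Hermitian inner product\<close>

lemma hinner_add_left: "hinner (a + b) w = hinner a w + hinner b w"
  by (simp add: hinner_def algebra_simps sum.distrib)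

lemma hinner_add_right: "hinner w (a + b) = hinner w a + hinner w b"
  by (simp add: hinner_def algebra_simps sum.distrib)

lemma hinner_diff_left: "hinner (a - b) w = hinner a w - hinner b w"
  by (simp add: hinner_def algebra_simps sum_subtractf)

lemma hinner_diff_right: "hinner w (a - b) = hinner w a - hinner w b"
  by (simp add: hinner_def algebra_simps sum_subtractf)

lemma hinner_minus_left: "hinner (- a) w = - hinner a w"
  by (simp add: hinner_def sum_negf)

lemma hinner_scale_left: "hinner (c *s v) w = c * hinner v w"
  by (simp add: hinner_def sum_distrib_left mult.assoc)

lemma hinner_scale_right: "hinner v (c *s w) = cnj c * hinner v w"
  by (simp add: hinner_def sum_distrib_left mult_ac)

lemma scaleR_eq_scale: "r *\<^sub>R (v :: complex ^ 'n) = complex_of_real r *s v"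
  by (simp add: vec_eq_iff scaleR_conv_of_real[where 'a = complex])

lemma hinner_scaleR_left: "hinner (r *\<^sub>R v) w = complex_of_real r * hinner v w"
  by (simp add: scaleR_eq_scale hinner_scale_left)

lemma hinner_scaleR_right: "hinner v (r *\<^sub>R w) = complex_of_real r * hinner v w"
  by (simp add: scaleR_eq_scale hinner_scale_right)

lemma hinner_0_right [simp]: "hinner w 0 = 0"
  by (simp add: hinner_def)

lemma cnj_hinner: "cnj (hinner v w) = hinner w v"
  by (simp add: hinner_def mult.commute)

lemma hinner_commute_cmod: "cmod (hinner v w) = cmod (hinner w v)"
  by (metis cnj_hinner complex_mod_cnj)

lemma cmod_one_minus_hinner_commute: "cmod (1 - hinner v w) = cmod (1 - hinner w v)"
  by (metis cnj_hinner complex_mod_cnj complex_cnj_diff complex_cnj_one)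

lemma inner_eq_Re_hinner: "v \<bullet> w = Re (hinner v w)"
  by (simp add: hinner_def inner_vec_def inner_complex_def)

lemma Im_hinner_self: "Im (hinner v v) = 0"
  by (simp add: hinner_def)

lemma hinner_self: "hinner v v = complex_of_real ((norm v)\<^sup>2)"
  by (simp add: complex_eq_iff inner_eq_Re_hinner[symmetric] power2_norm_eq_inner Im_hinner_self)

lemma norm_scale: "norm (c *s (v :: complex ^ 'n)) = cmod c * norm v"
  by (simp add: norm_vec_def norm_mult L2_set_right_distrib)

lemma cmod_hinner_le: "cmod (hinner v w) \<le> norm v * norm w"
proof (cases "hinner v w = 0")
  case False
  \<comment> \<open>Rotating \<open>v\<close> by the phase of \<open>hinner v w\<close> reduces to the real Cauchy--Schwarz inequality.\<close>
  define u where "u = cnj (sgn (hinner v w))"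
  have u: "cmod u = 1" using False by (simp add: u_def norm_sgn)
  have "u * hinner v w = complex_of_real (cmod (hinner v w))"
    using False by (simp add: u_def sgn_eq complex_norm_square[symmetric] power2_eq_square field_simps
        mult.commute[of "cnj _"])
  then have "cmod (hinner v w) = Re (hinner (u *s v) w)"
    by (simp add: hinner_scale_left)
  also have "\<dots> = (u *s v) \<bullet> w" by (simp add: inner_eq_Re_hinner)
  also have "\<dots> \<le> norm (u *s v) * norm w" by (rule norm_cauchy_schwarz)
  finally show ?thesis by (simp add: norm_scale u)
qed simp

lemma hinner_axis_right: "hinner v (axis k u) = v $ k * cnj u"
proof -
  have "hinner v (axis k u) = (\<Sum>j\<in>UNIV. if j = k then v $ k * cnj u else 0)"
    unfolding hinner_def by (rule sum.cong) (auto simp: axis_def)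
  then show ?thesis by simp
qed

lemma continuous_on_hinner [continuous_intros]:
  fixes f g :: "'a::topological_space \<Rightarrow> complex ^ 'n"
  shows "continuous_on S f \<Longrightarrow> continuous_on S g \<Longrightarrow> continuous_on S (\<lambda>x. hinner (f x) (g x))"
  unfolding hinner_def by (intro continuous_intros)

lemma borel_measurable_hinner [measurable (raw)]:
  fixes f g :: "'a \<Rightarrow> complex ^ 'n"
  assumes "f \<in> borel_measurable M" "g \<in> borel_measurable M"
  shows "(\<lambda>x. hinner (f x) (g x)) \<in> borel_measurable M"
  by (rule borel_measurable_continuous_Pair[OF assms]) (intro continuous_intros)

text \<open>The Hermitian version of Pythagoras, for the component along a unit vector.\<close>

lemma norm_orthogonal_part:
  assumes "norm \<zeta> = 1"
  shows "(norm (v - hinner v \<zeta> *s \<zeta>))\<^sup>2 = (norm v)\<^sup>2 - (cmod (hinner v \<zeta>))\<^sup>2"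
proof -
  let ?c = "hinner v \<zeta>"
  have 1: "hinner \<zeta> \<zeta> = 1" using assms by (simp add: hinner_self)
  have "complex_of_real ((norm (v - ?c *s \<zeta>))\<^sup>2) = hinner (v - ?c *s \<zeta>) (v - ?c *s \<zeta>)"
    by (simp add: hinner_self)
  also have "\<dots> = hinner v v - ?c * cnj ?c"
    by (simp add: hinner_diff_left hinner_diff_right hinner_scale_left hinner_scale_right 1
        cnj_hinner algebra_simps)
  also have "\<dots> = complex_of_real ((norm v)\<^sup>2 - (cmod ?c)\<^sup>2)"
    by (simp add: hinner_self complex_norm_square[symmetric])
  finally show ?thesis using of_real_eq_iff by blast
qed

lemma hinner_split:
  assumes "norm \<zeta> = 1"
  shows "hinner z w = hinner z \<zeta> * hinner \<zeta> w
           + hinner (z - hinner z \<zeta> *s \<zeta>) (w - hinner w \<zeta> *s \<zeta>)"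
proof -
  have 1: "hinner \<zeta> \<zeta> = 1" using assms by (simp add: hinner_self)
  show ?thesis
    by (simp add: hinner_diff_left hinner_diff_right hinner_scale_left hinner_scale_right 1
        cnj_hinner algebra_simps)
qed

section \<open>Invariance of Lebesgue measure\<close>

lemma nn_integral_lborel_translate:
  fixes g :: "'a::euclidean_space \<Rightarrow> ennreal"
  assumes [measurable]: "g \<in> borel_measurable borel"
  shows "(\<integral>\<^sup>+x. g (a + x) \<partial>lborel) = (\<integral>\<^sup>+x. g x \<partial>lborel)"
proof -
  have "(\<integral>\<^sup>+x. g x \<partial>lborel) = (\<integral>\<^sup>+x. g x \<partial>distr lborel borel ((+) a))"
    by (simp add: lborel_distr_plus)
  then show ?thesis by (simp add: nn_integral_distr)
qed

lemma nn_integral_lborel_reflect: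
  fixes g :: "'a::euclidean_space \<Rightarrow> ennreal"
  assumes [measurable]: "g \<in> borel_measurable borel"
  shows "(\<integral>\<^sup>+x. g (a - x) \<partial>lborel) = (\<integral>\<^sup>+x. g x \<partial>lborel)"
proof -
  have *: "lborel = density (distr lborel borel (\<lambda>x. a + (-1) *\<^sub>R x)) (\<lambda>_. ennreal (\<bar>-1\<bar> ^ DIM('a)))"
    by (rule lborel_affine) simp
  have "(\<integral>\<^sup>+x. g x \<partial>lborel) = (\<integral>\<^sup>+x. g x \<partial>distr lborel borel (\<lambda>x. a + (-1) *\<^sub>R x))"
    by (subst *) (simp add: nn_integral_density)
  then show ?thesis by (simp add: nn_integral_distr)
qed

text \<open>
  The image of Lebesgue measure under an orthogonal map is translation invariant and agrees with
  Lebesgue measure on the unit ball. Integrating \<open>indicator A x * indicator B y\<close> in two ways over the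
  product of two translation invariant measures shows that they are proportional, so the two
  measures are equal.
\<close>

lemma lborel_distr_orthogonal:
  fixes T :: "'a::euclidean_space \<Rightarrow> 'a"
  assumes T: "orthogonal_transformation T"
  shows "distr lborel borel T = lborel"
proof (rule measure_eqI)
  have lin: "linear T" using T by (rule orthogonal_transformation_linear)
  have [measurable]: "T \<in> borel_measurable borel"
    using lin by (intro borel_measurable_continuous_onI linear_continuous_on linear_conv_bounded_linear[THEN iffD1])
  define S where "S = inv T"
  have TS: "T (S y) = y" for y
    using orthogonal_transformation_surj[OF T] by (simp add: S_def surj_f_inv_f)
  have S: "orthogonal_transformation S" unfolding S_def using T by (rule orthogonal_transformation_inv)
  have [measurable]: "S \<in> borel_measurable borel"
    using orthogonal_transformation_linear[OF S]
    by (intro borel_measurable_continuous_onI linear_continuous_on linear_conv_bounded_linear[THEN iffD1])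
  show "sets (distr lborel borel T) = sets lborel" by simp
  fix A assume "A \<in> sets (distr lborel borel T)"
  then have [measurable]: "A \<in> sets borel" by simp
  define B :: "'a set" where "B = ball 0 1"
  have [measurable]: "B \<in> sets borel" by (simp add: B_def)
  have vB: "emeasure lborel B \<noteq> 0" "emeasure lborel B \<noteq> \<infinity>"
    using less_imp_neq[OF unit_ball_vol_pos[of "real DIM('a)"]] by (auto simp: B_def emeasure_ball)
  have BT: "indicator B (T x) = (indicator B x :: ennreal)" for x
    using orthogonal_transformation_norm[OF T] by (simp add: B_def indicator_def)
  have "emeasure (distr lborel borel T) A * emeasure lborel B
      = (\<integral>\<^sup>+x. indicator A (T x) * (\<integral>\<^sup>+y. indicator B y \<partial>lborel) \<partial>lborel)"
    by (simp add: nn_integral_multc flip: nn_integral_indicator)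
       (simp add: nn_integral_distr del: nn_integral_indicator)
  also have "\<dots> = (\<integral>\<^sup>+x. indicator A (T x) * (\<integral>\<^sup>+y. indicator B (T x + y) \<partial>lborel) \<partial>lborel)"
    by (subst nn_integral_lborel_translate) simp_all
  also have "\<dots> = (\<integral>\<^sup>+x. (\<integral>\<^sup>+y. indicator A (T x) * indicator B (T x + y) \<partial>lborel) \<partial>lborel)"
    by (simp add: nn_integral_cmult)
  also have "\<dots> = (\<integral>\<^sup>+y. (\<integral>\<^sup>+x. indicator A (T x) * indicator B (T x + y) \<partial>lborel) \<partial>lborel)"
    by (rule lborel_pair.Fubini'[symmetric]) simp
  also have "\<dots> = (\<integral>\<^sup>+y. (\<integral>\<^sup>+x. indicator A (T x - y) * indicator B (T x) \<partial>lborel) \<partial>lborel)"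
  proof (rule nn_integral_cong)
    fix y
    have "(\<integral>\<^sup>+x. indicator A (T x) * indicator B (T x + y) \<partial>lborel)
        = (\<integral>\<^sup>+x. indicator A (T (- S y + x)) * indicator B (T (- S y + x) + y) \<partial>lborel)"
      by (rule nn_integral_lborel_translate[symmetric]) simp
    then show "(\<integral>\<^sup>+x. indicator A (T x) * indicator B (T x + y) \<partial>lborel)
        = (\<integral>\<^sup>+x. indicator A (T x - y) * indicator B (T x) \<partial>lborel)"
      by (simp add: linear_add[OF lin] linear_neg[OF lin] linear_diff[OF lin] TS)
  qed
  also have "\<dots> = (\<integral>\<^sup>+x. (\<integral>\<^sup>+y. indicator A (T x - y) * indicator B (T x) \<partial>lborel) \<partial>lborel)"
    by (rule lborel_pair.Fubini') simp
  also have "\<dots> = (\<integral>\<^sup>+x. (\<integral>\<^sup>+y. indicator A y \<partial>lborel) * indicator B (T x) \<partial>lborel)"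
  proof (rule nn_integral_cong)
    fix x
    have "(\<integral>\<^sup>+y. indicator A (T x - y) \<partial>lborel) = (\<integral>\<^sup>+y. indicator A y \<partial>lborel)"
      by (rule nn_integral_lborel_reflect) simp
    then show "(\<integral>\<^sup>+y. indicator A (T x - y) * indicator B (T x) \<partial>lborel)
        = (\<integral>\<^sup>+y. indicator A y \<partial>lborel) * indicator B (T x)"
      by (simp add: nn_integral_multc)
  qed
  also have "\<dots> = emeasure lborel A * emeasure lborel B"
    by (simp add: nn_integral_cmult BT)
  finally have "emeasure lborel B * emeasure (distr lborel borel T) A = emeasure lborel B * emeasure lborel A"
    by (simp add: mult.commute)
  then show "emeasure (distr lborel borel T) A = emeasure lborel A"
    using vB by (simp add: ennreal_mult_cancel_left)
qed

definition unitary_map :: "(complex ^ 'n \<Rightarrow> complex ^ 'n) \<Rightarrow> bool" where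
  "unitary_map U \<longleftrightarrow> (\<forall>v w. U (v + w) = U v + U w) \<and> (\<forall>c v. U (c *s v) = c *s U v) \<and>
     (\<forall>v w. hinner (U v) (U w) = hinner v w)"

lemma unitary_mapI:
  "(\<And>v w. U (v + w) = U v + U w) \<Longrightarrow> (\<And>c v. U (c *s v) = c *s U v) \<Longrightarrow>
     (\<And>v w. hinner (U v) (U w) = hinner v w) \<Longrightarrow> unitary_map U"
  by (simp add: unitary_map_def)

lemma unitary_map_orthogonal: "unitary_map U \<Longrightarrow> orthogonal_transformation U"
  by (auto simp: unitary_map_def orthogonal_transformation_def inner_eq_Re_hinner scaleR_eq_scale
      intro!: linearI)

lemma unitary_map_norm: "unitary_map U \<Longrightarrow> norm (U v) = norm v"
  using unitary_map_orthogonal orthogonal_transformation_norm by blast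

lemma borel_measurable_unitary: "unitary_map U \<Longrightarrow> U \<in> borel_measurable borel"
  by (intro borel_measurable_continuous_onI linear_continuous_on linear_conv_bounded_linear[THEN iffD1]
      orthogonal_transformation_linear unitary_map_orthogonal)

lemma nn_integral_unitary:
  assumes U: "unitary_map U" and [measurable]: "g \<in> borel_measurable borel"
  shows "(\<integral>\<^sup>+x. g (U x) \<partial>lborel) = (\<integral>\<^sup>+x. g x \<partial>lborel)"
proof -
  note [measurable] = borel_measurable_unitary[OF U]
  have "(\<integral>\<^sup>+x. g x \<partial>lborel) = (\<integral>\<^sup>+x. g x \<partial>distr lborel borel U)"
    using lborel_distr_orthogonal[OF unitary_map_orthogonal[OF U]] by simp
  then show ?thesis by (simp add: nn_integral_distr)
qed

lemma integral_unitary: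
  fixes g :: "complex ^ 'n \<Rightarrow> 'b::{banach, second_countable_topology}"
  assumes U: "unitary_map U" and [measurable]: "g \<in> borel_measurable borel"
  shows "(LINT x|lborel. g (U x)) = (LINT x|lborel. g x)"
proof -
  note [measurable] = borel_measurable_unitary[OF U]
  have "(LINT x|lborel. g x) = (LINT x|distr lborel borel U. g x)"
    using lborel_distr_orthogonal[OF unitary_map_orthogonal[OF U]] by simp
  then show ?thesis by (simp add: integral_distr)
qed

lemma unitary_map_scale: "cmod c = 1 \<Longrightarrow> unitary_map ((*s) c)"
  by (intro unitary_mapI)
     (auto simp: vector_add_ldistrib vector_smult_assoc mult.commute hinner_scale_left hinner_scale_right
        complex_norm_square[symmetric] mult.assoc[symmetric])

lemma unitary_map_compose: "unitary_map U \<Longrightarrow> unitary_map V \<Longrightarrow> unitary_map (\<lambda>v. U (V v))"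
  by (simp add: unitary_map_def)

text \<open>
  A complex Householder reflection maps a unit vector to a multiple of the \<open>k\<close>-th unit vector; the
  phase is chosen to make the inner product of the two vectors real.
\<close>

lemma exists_unitary_to_axis:
  fixes \<zeta> :: "complex ^ 'n"
  assumes \<zeta>: "norm \<zeta> = 1"
  obtains U where "unitary_map U" "\<And>w. U w $ k = hinner w \<zeta>"
proof -
  define u where "u = (if \<zeta> $ k = 0 then 1 else sgn (\<zeta> $ k))"
  have u: "cmod u = 1" by (simp add: u_def norm_sgn)
  have uu: "cnj u * u = 1" "u * cnj u = 1"
    using u by (simp_all add: complex_norm_square[symmetric] mult.commute[of "cnj u"])
  define \<eta> where "\<eta> = axis k u"
  have h\<eta>: "hinner v \<eta> = v $ k * cnj u" for v by (simp add: \<eta>_def hinner_axis_right)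
  have real: "hinner \<zeta> \<eta> = complex_of_real (cmod (\<zeta> $ k))"
    by (auto simp: h\<eta> u_def sgn_eq complex_norm_square[symmetric] power2_eq_square)
  have real': "hinner \<eta> \<zeta> = complex_of_real (cmod (\<zeta> $ k))"
    by (metis real cnj_hinner complex_cnj_complex_of_real)
  have \<zeta>\<zeta>: "hinner \<zeta> \<zeta> = 1" using \<zeta> by (simp add: hinner_self)
  have \<eta>\<eta>: "hinner \<eta> \<eta> = 1" unfolding h\<eta> by (simp add: \<eta>_def axis_nth uu)
  define p where "p = \<zeta> - \<eta>"
  define a where "a = hinner p p"
  have ca: "cnj a = a" by (simp add: a_def cnj_hinner)
  define H where "H v = v - (2 * hinner v p / a) *s p" for v
  have H\<zeta>: "H \<zeta> = \<eta>"
  proof (cases "\<zeta> = \<eta>")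
    case False
    have "a \<noteq> 0" using False by (simp add: a_def hinner_self p_def)
    moreover have "a = 2 * hinner \<zeta> p"
      by (simp add: a_def p_def hinner_diff_left hinner_diff_right \<zeta>\<zeta> \<eta>\<eta> real real')
    ultimately have "2 * hinner \<zeta> p / a = 1" by simp
    then show ?thesis by (simp add: H_def p_def)
  qed (simp add: H_def p_def)
  have "unitary_map H"
  proof (rule unitary_mapI)
    fix v w
    show "H (v + w) = H v + H w"
      by (simp add: H_def hinner_add_left algebra_simps add_divide_distrib vector_sadd_rdistrib)
    show "H (c *s v) = c *s H v" for c
      by (simp add: H_def hinner_scale_left vector_ssub_ldistrib vector_smult_assoc mult_ac)
    show "hinner (H v) (H w) = hinner v w"
    proof (cases "a = 0")
      case False
      have "cnj (hinner w p) = hinner p w" by (rule cnj_hinner)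
      then show ?thesis using False
        by (simp add: H_def hinner_diff_left hinner_diff_right hinner_scale_left hinner_scale_right
            a_def[symmetric] ca field_simps)
    qed (simp add: H_def)
  qed
  show thesis
  proof
    show "unitary_map (\<lambda>v. cnj u *s H v)"
      by (rule unitary_map_compose[OF unitary_map_scale \<open>unitary_map H\<close>]) (simp add: u)
    fix w
    have "hinner (H w) (H \<zeta>) = hinner w \<zeta>" using \<open>unitary_map H\<close> by (simp add: unitary_map_def)
    then show "(cnj u *s H w) $ k = hinner w \<zeta>" by (simp add: H\<zeta> h\<eta> mult.commute)
  qed
qed

text \<open>Hence integrals of functions of \<open>hinner w \<zeta>\<close> and \<open>norm w\<close> do not depend on the unit vector.\<close>

lemma nn_integral_rotate_to_axis:
  fixes F :: "complex \<Rightarrow> real \<Rightarrow> ennreal" and \<zeta> :: "complex ^ 'n"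
  assumes "norm \<zeta> = 1" and meas: "(\<lambda>w :: complex ^ 'n. F (w $ k) (norm w)) \<in> borel_measurable borel"
  shows "(\<integral>\<^sup>+w. F (hinner w \<zeta>) (norm w) \<partial>lborel) = (\<integral>\<^sup>+w. F (w $ k) (norm w) \<partial>(lborel :: (complex ^ 'n) measure))"
proof -
  obtain U where U: "unitary_map U" "\<And>w. U w $ k = hinner w \<zeta>"
    using exists_unitary_to_axis[OF assms(1)] by blast
  show ?thesis using nn_integral_unitary[OF U(1) meas] by (simp add: U unitary_map_norm)
qed

lemma lborel_coordinate_scaling:
  fixes c :: "'n::finite \<Rightarrow> real"
  assumes c: "\<And>j. c j > 0"
  shows "(lborel :: (complex ^ 'n) measure)
    = density (distr lborel borel (\<lambda>v. \<chi> j. c j *\<^sub>R v $ j)) (\<lambda>_. ennreal (\<Prod>j\<in>UNIV. (c j)\<^sup>2))"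
proof -
  define d :: "complex ^ 'n \<Rightarrow> real" where "d b = c (THE j. b $ j \<noteq> 0)" for b
  have d: "d (axis j u) = c j" if "u \<in> Basis" for j and u :: complex
  proof -
    have "u \<noteq> 0" using that nonzero_Basis by blast
    then have "(THE i. (axis j u :: complex ^ 'n) $ i \<noteq> 0) = j"
      by (intro the_equality) (auto simp: axis_def split: if_splits)
    then show ?thesis by (simp add: d_def)
  qed
  have Bas: "(Basis :: (complex ^ 'n) set) = (\<lambda>(j, u). axis j u) ` (UNIV \<times> Basis)"
    by (auto simp: Basis_vec_def)
  have inj: "inj_on (\<lambda>(j, u). axis j u :: complex ^ 'n) (UNIV \<times> Basis)"
    by (auto simp: inj_on_def axis_eq_axis nonzero_Basis)
  have prod: "(\<Prod>b\<in>(Basis :: (complex ^ 'n) set). \<bar>d b\<bar>) = (\<Prod>j\<in>UNIV. (c j)\<^sup>2)"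
  proof -
    have "(\<Prod>b\<in>(Basis :: (complex ^ 'n) set). \<bar>d b\<bar>) = (\<Prod>(j, u)\<in>UNIV \<times> (Basis :: complex set). \<bar>c j\<bar>)"
      unfolding Bas by (subst prod.reindex[OF inj]) (auto intro!: prod.cong simp: d)
    also have "\<dots> = (\<Prod>j\<in>UNIV. (c j)\<^sup>2)"
      by (simp add: prod.cartesian_product[symmetric])
    finally show ?thesis .
  qed
  define T :: "complex ^ 'n \<Rightarrow> complex ^ 'n"
    where "T x = 0 + (\<Sum>b\<in>Basis. (d b * (x \<bullet> b)) *\<^sub>R b)" for x
  have T: "T x = (\<chi> j. c j *\<^sub>R x $ j)" for x
  proof (rule euclidean_eqI)
    fix b :: "complex ^ 'n" assume b: "b \<in> Basis"
    then obtain j u where ju: "b = axis j u" "u \<in> Basis" by (auto simp: Bas)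
    have "T x \<bullet> b = d b * (x \<bullet> b)"
      using b by (simp add: T_def inner_sum_left inner_Basis if_distrib cong: if_cong)
    also have "\<dots> = (\<chi> j. c j *\<^sub>R x $ j) \<bullet> b"
      using ju by (simp add: d inner_axis)
    finally show "T x \<bullet> b = (\<chi> j. c j *\<^sub>R x $ j) \<bullet> b" .
  qed
  have [measurable]: "T \<in> borel_measurable borel" by (simp add: T_def[abs_def])
  have dn: "d b \<noteq> 0" if "b \<in> Basis" for b :: "complex ^ 'n"
    using c by (simp add: d_def order_less_imp_not_eq2)
  have "(lborel :: (complex ^ 'n) measure) = density (distr lborel borel T) (\<lambda>_. ennreal (\<Prod>b\<in>Basis. \<bar>d b\<bar>))"
    using lborel_affine_euclidean[of d 0, OF dn] by (simp add: T_def[abs_def] prod_ennreal)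
  then show ?thesis by (simp add: prod T[abs_def])
qed

lemma measurable_coordinate_scaling [measurable]:
  "(\<lambda>v :: complex ^ 'n. \<chi> j. c j *\<^sub>R v $ j) \<in> borel_measurable borel"
  by (intro borel_measurable_continuous_onI continuous_intros)

lemma nn_integral_coordinate_scaling:
  fixes f :: "complex ^ 'n \<Rightarrow> ennreal" and c :: "'n \<Rightarrow> real"
  assumes [measurable]: "f \<in> borel_measurable borel" and c: "\<And>j. c j > 0"
  shows "(\<integral>\<^sup>+v. f v \<partial>lborel) = ennreal (\<Prod>j\<in>UNIV. (c j)\<^sup>2) * (\<integral>\<^sup>+v. f (\<chi> j. c j *\<^sub>R v $ j) \<partial>lborel)"
  by (subst lborel_coordinate_scaling[OF c])
     (simp add: nn_integral_density nn_integral_cmult nn_integral_distr)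

lemma integral_coordinate_scaling:
  fixes f :: "complex ^ 'n \<Rightarrow> real" and c :: "'n \<Rightarrow> real"
  assumes [measurable]: "f \<in> borel_measurable borel" and c: "\<And>j. c j > 0"
  shows "(LINT v|lborel. f v) = (\<Prod>j\<in>UNIV. (c j)\<^sup>2) * (LINT v|lborel. f (\<chi> j. c j *\<^sub>R v $ j))"
  by (subst lborel_coordinate_scaling[OF c])
     (simp add: integral_density integral_distr prod_nonneg)

section \<open>Volumes of tubes\<close>

declare borel_open [OF open_ball, measurable]

definition rho :: "complex ^ 'n \<Rightarrow> real" where
  "rho w = 1 - (norm w)\<^sup>2"

text \<open>\<open>carleson_tube \<zeta> r\<close> is \<open>tube \<zeta> (r\<^sup>2)\<close>; interior centres are allowed as well.\<close>

definition tube :: "complex ^ 'n \<Rightarrow> real \<Rightarrow> (complex ^ 'n) set" where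
  "tube \<zeta> R = {w. norm w < 1 \<and> cmod (1 - hinner w \<zeta>) < R}"

text \<open>
  The shape of a Bergman cell: its extent is of order \<open>\<delta>\<close> in the complex direction of \<open>\<zeta>\<close> and of
  order \<open>sqrt \<delta>\<close> in the orthogonal directions. The factors \<open>1 / 6\<close> keep \<open>rho\<close> comparable to \<open>\<delta>\<close> on
  the cell around \<open>(1 - \<delta>) *\<^sub>R \<zeta>\<close>. Multiplication by complex numbers of modulus one preserves the
  cell, so that averages over circles can be taken in it.
\<close>

definition cell :: "complex ^ 'n \<Rightarrow> real \<Rightarrow> (complex ^ 'n) set" where
  "cell \<zeta> \<delta> = {v. cmod (hinner v \<zeta>) < \<delta> / 6 \<and> (norm v)\<^sup>2 < \<delta> / 6}"

lemma rho_pos: "norm w < 1 \<Longrightarrow> 0 < rho w"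
  by (simp add: rho_def abs_square_less_1)

lemma rho_le_1: "rho w \<le> 1"
  by (simp add: rho_def)

lemma borel_measurable_vec_component [measurable]:
  "(\<lambda>w :: complex ^ 'n. w $ k) \<in> borel_measurable borel"
  by (intro borel_measurable_continuous_onI continuous_intros)

lemma borel_measurable_rho [measurable]: "rho \<in> borel_measurable borel"
  by (simp add: rho_def[abs_def])

lemma sets_tube [measurable]: "tube \<zeta> R \<in> sets borel"
  unfolding tube_def by measurable

lemma sets_cell [measurable]: "cell \<zeta> \<delta> \<in> sets borel"
  unfolding cell_def by measurable

lemma tube_mono: "R \<le> S \<Longrightarrow> tube \<zeta> R \<subseteq> tube \<zeta> S"
  by (auto simp: tube_def)

lemma tube_subset_ball: "tube \<zeta> R \<subseteq> ball 0 1"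
  by (auto simp: tube_def)

lemma norm_vec_square: "(norm (v :: complex ^ 'n))\<^sup>2 = (\<Sum>j\<in>UNIV. (cmod (v $ j))\<^sup>2)"
  by (simp add: norm_vec_def L2_set_def sum_nonneg)

lemma norm_vec_square_remove:
  "(norm (v :: complex ^ 'n))\<^sup>2 = (cmod (v $ k))\<^sup>2 + (\<Sum>j\<in>UNIV - {k}. (cmod (v $ j))\<^sup>2)"
  unfolding norm_vec_square by (rule sum.remove) auto

lemma rho_less_tube:
  assumes "norm w < 1" "norm \<zeta> \<le> 1"
  shows "rho w \<le> 2 * cmod (1 - hinner w \<zeta>)"
proof -
  have "cmod (hinner w \<zeta>) \<le> norm w"
    using cmod_hinner_le[of w \<zeta>] assms mult_left_mono[of "norm \<zeta>" 1 "norm w"] by simp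
  then have 1: "1 - norm w \<le> cmod (1 - hinner w \<zeta>)"
    using norm_triangle_ineq2[of 1 "hinner w \<zeta>"] by simp
  have "rho w = (1 - norm w) * (1 + norm w)" by (simp add: rho_def power2_eq_square algebra_simps)
  also have "\<dots> \<le> (1 - norm w) * 2" using assms by (intro mult_left_mono) auto
  finally show ?thesis using 1 by simp
qed

lemma anisotropic_dilation:
  fixes f :: "complex ^ 'n \<Rightarrow> ennreal"
  assumes "f \<in> borel_measurable borel" and R: "R > 0"
  shows "(\<integral>\<^sup>+v. f v \<partial>lborel)
    = ennreal (R ^ (CARD('n) + 1)) * (\<integral>\<^sup>+v. f (\<chi> j. (if j = k then R else sqrt R) *\<^sub>R v $ j) \<partial>lborel)"
proof -
  have "(\<Prod>j\<in>(UNIV :: 'n set). (if j = k then R else sqrt R)\<^sup>2) = R\<^sup>2 * (\<Prod>j\<in>UNIV - {k}. R)"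
    using R by (subst prod.remove[of _ k]) (auto intro!: arg_cong2[of _ _ _ _ "(*)"] prod.cong)
  also have "\<dots> = R ^ (CARD('n) + 1)"
    by (simp add: card_Diff_singleton power2_eq_square mult.assoc flip: power_Suc)
  finally have *: "(\<Prod>j\<in>(UNIV :: 'n set). (if j = k then R else sqrt R)\<^sup>2) = R ^ (CARD('n) + 1)" .
  show ?thesis
    using nn_integral_coordinate_scaling[OF assms(1), of "\<lambda>j. if j = k then R else sqrt R"] R
    unfolding * by simp
qed

lemma norm_anisotropic_square:
  assumes "R > 0"
  shows "(norm (\<chi> j. (if j = k then R else sqrt R) *\<^sub>R (y :: complex ^ 'n) $ j))\<^sup>2
    = R\<^sup>2 * (cmod (y $ k))\<^sup>2 + R * (\<Sum>j\<in>UNIV - {k}. (cmod (y $ j))\<^sup>2)"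
  unfolding norm_vec_square_remove[of _ k] sum_distrib_left using assms
  by (auto intro!: arg_cong2[of _ _ _ _ "(+)"] sum.cong simp: power_mult_distrib)

text \<open>
  In coordinates centred at \<open>\<zeta>\<close>, a tube of size \<open>R\<close> fits into the image of a fixed ball under the
  anisotropic dilation with factors \<open>R\<close> in the direction of \<open>\<zeta>\<close> and \<open>sqrt R\<close> in the others.
\<close>

lemma emeasure_tube_le:
  fixes \<zeta> :: "complex ^ 'n"
  assumes \<zeta>: "norm \<zeta> = 1" and R: "R > 0"
  shows "emeasure lborel (tube \<zeta> R)
    \<le> ennreal (R ^ (CARD('n) + 1)) * emeasure lborel (ball (0 :: complex ^ 'n) 2)"
proof -
  obtain k :: 'n where True by simp
  define F :: "complex \<Rightarrow> real \<Rightarrow> ennreal"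
    where "F x r = of_bool (r < 1 \<and> cmod (1 - x) < R)" for x r
  define f :: "complex ^ 'n \<Rightarrow> ennreal" where "f w = F (w $ k) (norm w)" for w
  have [measurable]: "f \<in> borel_measurable borel" unfolding f_def F_def by measurable
  have "emeasure lborel (tube \<zeta> R) = (\<integral>\<^sup>+w. indicator (tube \<zeta> R) w \<partial>lborel)" by simp
  also have "\<dots> = (\<integral>\<^sup>+w. F (hinner w \<zeta>) (norm w) \<partial>lborel)"
    by (rule nn_integral_cong) (simp add: F_def tube_def indicator_def)
  also have "\<dots> = (\<integral>\<^sup>+w. f w \<partial>lborel)"
    unfolding f_def by (rule nn_integral_rotate_to_axis[OF \<zeta>]) (simp flip: f_def)
  also have "\<dots> = (\<integral>\<^sup>+w. f (axis k 1 + w) \<partial>lborel)"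
    by (rule nn_integral_lborel_translate[symmetric]) simp
  also have "\<dots> = ennreal (R ^ (CARD('n) + 1)) *
      (\<integral>\<^sup>+v. f (axis k 1 + (\<chi> j. (if j = k then R else sqrt R) *\<^sub>R v $ j)) \<partial>lborel)"
    by (rule anisotropic_dilation[OF _ R]) simp
  also have "\<dots> \<le> ennreal (R ^ (CARD('n) + 1)) * (\<integral>\<^sup>+v. indicator (ball (0 :: complex ^ 'n) 2) v \<partial>lborel)"
  proof (intro mult_left_mono nn_integral_mono)
    fix y :: "complex ^ 'n"
    let ?v = "\<chi> j. (if j = k then R else sqrt R) *\<^sub>R y $ j"
    show "f (axis k 1 + ?v) \<le> indicator (ball 0 2) y"
    proof (cases "norm (axis k 1 + ?v) < 1 \<and> cmod (1 - (axis k 1 + ?v) $ k) < R")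
      case True
      have yk: "cmod (y $ k) < 1" using True R by (simp add: norm_mult)
      let ?S = "\<Sum>j\<in>UNIV - {k}. (cmod (y $ j))\<^sup>2"
      have "(norm (axis k 1 + ?v))\<^sup>2 = (norm ?v)\<^sup>2 + 2 * R * Re (y $ k) + 1"
        by (simp add: power2_norm_eq_inner inner_add_left inner_add_right inner_axis inner_axis'
            inner_complex_def)
      moreover have "(norm (axis k 1 + ?v))\<^sup>2 < 1" using True by (simp add: abs_square_less_1)
      ultimately have "R\<^sup>2 * (cmod (y $ k))\<^sup>2 + R * ?S < - 2 * R * Re (y $ k)"
        using norm_anisotropic_square[OF R, of k y] by simp
      then have "R * ?S < - 2 * R * Re (y $ k)"
        using zero_le_power2[of "R * cmod (y $ k)"] unfolding power_mult_distrib by linarith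
      also have "\<dots> \<le> 2 * R * cmod (y $ k)"
        using mult_left_mono[of "- Re (y $ k)" "cmod (y $ k)" "2 * R"] abs_Re_le_cmod[of "y $ k"] R
        by (simp add: abs_le_iff)
      also have "\<dots> \<le> R * 2" using yk R by simp
      finally have "?S < 2" using R by simp
      moreover have "(cmod (y $ k))\<^sup>2 < 1" using yk by (simp add: abs_square_less_1)
      ultimately have "(norm y)\<^sup>2 < 2\<^sup>2" by (simp add: norm_vec_square_remove[of y k])
      then have "norm y < 2" using power_less_imp_less_base by fastforce
      then show ?thesis by (simp add: f_def F_def)
    next
      case False
      then show ?thesis by (auto simp: f_def F_def)
    qed
  qed simp
  finally show ?thesis by simp
qed

text \<open>
  The same dilation with parameter \<open>\<delta>\<close> maps the ball of radius \<open>1 / 6\<close> into the cell. The moments of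
  order \<open>m = 0\<close> and \<open>m = 2\<close> serve to normalise the indicator function and the linear weight.
\<close>

lemma cell_moment_ge:
  fixes \<zeta> :: "complex ^ 'n" and k :: 'n and m :: nat
  assumes \<zeta>: "norm \<zeta> = 1" and \<delta>: "0 < \<delta>" "\<delta> \<le> 1"
  shows "ennreal (\<delta> ^ (CARD('n) + 1 + m)) *
      (\<integral>\<^sup>+v. indicator (ball (0 :: complex ^ 'n) (1 / 6)) v * ennreal (cmod (v $ k) ^ m) \<partial>lborel)
    \<le> (\<integral>\<^sup>+v. indicator (cell \<zeta> \<delta>) v * ennreal (cmod (hinner v \<zeta>) ^ m) \<partial>lborel)"
proof -
  define F :: "complex \<Rightarrow> real \<Rightarrow> ennreal"
    where "F x r = of_bool (cmod x < \<delta> / 6 \<and> r\<^sup>2 < \<delta> / 6) * ennreal (cmod x ^ m)" for x r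
  define f :: "complex ^ 'n \<Rightarrow> ennreal" where "f w = F (w $ k) (norm w)" for w
  have [measurable]: "f \<in> borel_measurable borel" unfolding f_def F_def by measurable
  define g :: "complex ^ 'n \<Rightarrow> ennreal"
    where "g v = indicator (ball 0 (1 / 6)) v * ennreal (cmod (v $ k) ^ m)" for v
  have [measurable]: "g \<in> borel_measurable borel"
    unfolding g_def by measurable
  have "ennreal (\<delta> ^ (CARD('n) + 1 + m)) * (\<integral>\<^sup>+v. g v \<partial>lborel)
      = ennreal (\<delta> ^ (CARD('n) + 1)) * (\<integral>\<^sup>+v. ennreal (\<delta> ^ m) * g v \<partial>lborel)"
    using \<delta> by (simp add: nn_integral_cmult power_add ennreal_mult mult.assoc)
  also have "\<dots> \<le> ennreal (\<delta> ^ (CARD('n) + 1)) *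
      (\<integral>\<^sup>+v. f (\<chi> j. (if j = k then \<delta> else sqrt \<delta>) *\<^sub>R v $ j) \<partial>lborel)"
  proof (intro mult_left_mono nn_integral_mono)
    fix y :: "complex ^ 'n"
    let ?v = "\<chi> j. (if j = k then \<delta> else sqrt \<delta>) *\<^sub>R y $ j"
    show "ennreal (\<delta> ^ m) * g y \<le> f ?v"
    proof (cases "norm y < 1 / 6")
      case True
      then have "cmod (y $ k) < 1 / 6" using Finite_Cartesian_Product.norm_nth_le[of y k] by linarith
      then have 1: "cmod (?v $ k) < \<delta> / 6" using \<delta> by (simp add: norm_mult)
      have "(norm ?v)\<^sup>2 \<le> \<delta> * (cmod (y $ k))\<^sup>2 + \<delta> * (\<Sum>j\<in>UNIV - {k}. (cmod (y $ j))\<^sup>2)"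
        unfolding norm_anisotropic_square[OF \<delta>(1)] using \<delta>
        by (intro add_mono mult_right_mono sum_nonneg) (auto simp: power2_eq_square mult_left_le intro!: sum_nonneg)
      also have "\<dots> = \<delta> * (norm y)\<^sup>2"
        by (simp add: norm_vec_square_remove[of y k] algebra_simps)
      also have "(norm y)\<^sup>2 \<le> (1 / 6)\<^sup>2" using True by (intro power_mono) auto
      then have "\<delta> * (norm y)\<^sup>2 < \<delta> / 6" using \<delta> by (simp add: power2_eq_square field_simps)
      finally show ?thesis using 1 True \<delta>
        by (simp add: f_def F_def g_def norm_mult power_mult_distrib ennreal_mult[symmetric])
    qed (simp add: g_def)
  qed simp
  also have "\<dots> = (\<integral>\<^sup>+w. f w \<partial>lborel)"
    by (rule anisotropic_dilation[OF _ \<delta>(1), symmetric]) simp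
  also have "\<dots> = (\<integral>\<^sup>+w. F (hinner w \<zeta>) (norm w) \<partial>lborel)"
    unfolding f_def by (rule nn_integral_rotate_to_axis[OF \<zeta>, symmetric]) (simp flip: f_def)
  also have "\<dots> = (\<integral>\<^sup>+w. indicator (cell \<zeta> \<delta>) w * ennreal (cmod (hinner w \<zeta>) ^ m) \<partial>lborel)"
    by (rule nn_integral_cong) (simp add: F_def cell_def indicator_def)
  finally show ?thesis unfolding g_def .
qed

lemma emeasure_cell_ge:
  fixes \<zeta> :: "complex ^ 'n"
  assumes "norm \<zeta> = 1" and "0 < \<delta>" "\<delta> \<le> 1"
  shows "ennreal (\<delta> ^ (CARD('n) + 1)) * emeasure lborel (ball (0 :: complex ^ 'n) (1 / 6))
    \<le> emeasure lborel (cell \<zeta> \<delta>)"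
  using cell_moment_ge[OF assms, of 0 undefined] by simp

lemma tube_eq_ball:
  assumes "norm \<zeta> \<le> 1" "R \<ge> 2"
  shows "tube \<zeta> R = ball 0 1"
proof -
  have "cmod (1 - hinner w \<zeta>) < R" if "norm w < 1" for w
  proof -
    have "cmod (1 - hinner w \<zeta>) \<le> 1 + cmod (hinner w \<zeta>)"
      using norm_triangle_ineq4[of 1 "hinner w \<zeta>"] by simp
    also have "cmod (hinner w \<zeta>) \<le> norm w * 1"
      using cmod_hinner_le[of w \<zeta>] assms(1) mult_left_mono[of "norm \<zeta>" 1 "norm w"] by simp
    finally show ?thesis using that assms by simp
  qed
  then show ?thesis by (auto simp: tube_def)
qed

text \<open>
  The part of a tube of size \<open>R\<close> within distance \<open>t\<close> of the sphere occupies at most a fraction of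
  order \<open>t / R\<close> of the volume: about \<open>R / t\<close> of its dilates by factors \<open>1 - i * t\<close> are
  disjoint, because each of them passes to a new range of radii, and fit into a tube of size \<open>2 * R\<close>.
\<close>

lemma measure_tube_shell_le:
  obtains C where "C > 0" and
    "\<And>(\<zeta> :: complex ^ 'n) R t. norm \<zeta> = 1 \<Longrightarrow> 0 < R \<Longrightarrow> R \<le> 2 \<Longrightarrow> 0 < t \<Longrightarrow>
       emeasure lborel {w \<in> tube \<zeta> R. rho w < t} \<le> ennreal (C * R ^ CARD('n) * t)"
proof
  let ?n = "CARD('n)"
  define C0 where "C0 = measure lborel (ball (0 :: complex ^ 'n) 2)"
  have C0: "C0 > 0" "emeasure lborel (ball (0 :: complex ^ 'n) 2) = ennreal C0"
    by (simp_all add: C0_def content_ball emeasure_ball)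
  define C where "C = 8 * 4 ^ ?n * 2 ^ (?n + 1) * C0"
  show "C > 0" using C0 by (simp add: C_def)
  fix \<zeta> :: "complex ^ 'n" and R t :: real
  assume \<zeta>: "norm \<zeta> = 1" and R: "0 < R" "R \<le> 2" and t: "0 < t"
  have T: "emeasure lborel (tube \<zeta> S) \<le> ennreal (C0 * S ^ (?n + 1))" if "S > 0" for S
    using emeasure_tube_le[OF \<zeta> that] C0 that by (simp add: ennreal_mult[symmetric] mult.commute)
  define A where "A = {w \<in> tube \<zeta> R. rho w < t}"
  have [measurable]: "A \<in> sets borel" unfolding A_def by measurable
  have AT: "emeasure lborel A \<le> ennreal (C0 * R ^ (?n + 1))"
    by (rule order_trans[OF emeasure_mono T[OF R(1)]]) (auto simp: A_def)
  then have fin: "emeasure lborel A < \<infinity>" using ennreal_less_top le_less_trans by fastforce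
  define a where "a = measure lborel A"
  have a: "emeasure lborel A = ennreal a" using fin by (simp add: a_def emeasure_eq_ennreal_measure)
  have "a \<ge> 0" by (simp add: a_def)
  have aT: "a \<le> C0 * R ^ (?n + 1)" using AT C0 R by (simp add: a)
  have "a \<le> C * R ^ ?n * t"
  proof (cases "t \<le> R / 4")
    case False
    have "8 * 4 ^ ?n * 2 ^ (?n + 1) \<ge> (4 :: real)"
      using mult_mono[of 4 "8 * 4 ^ ?n" 1 "2 ^ (?n + 1) :: real"] one_le_power[of "4 :: real" ?n]
        one_le_power[of "2 :: real" "?n + 1"] by linarith
    then have "C0 * 4 \<le> C" using C0 unfolding C_def by (simp add: mult.commute)
    have "a \<le> C0 * R ^ ?n * R" using aT by (simp add: mult_ac)
    also have "\<dots> \<le> C0 * R ^ ?n * (4 * t)" using False C0 R by (intro mult_left_mono) auto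
    also have "\<dots> = C0 * 4 * (R ^ ?n * t)" by simp
    also have "\<dots> \<le> C * (R ^ ?n * t)" using \<open>C0 * 4 \<le> C\<close> R t by (intro mult_right_mono) auto
    finally show ?thesis by simp
  next
    case True
    define K where "K = nat \<lfloor>R / (4 * t)\<rfloor>"
    have K1: "real K * t \<le> R / 4"
    proof -
      have "real K \<le> R / (4 * t)" using R t unfolding K_def by (subst of_nat_nat) auto
      then show ?thesis using t by (simp add: field_simps)
    qed
    have K2: "real K \<ge> R / (8 * t)"
    proof -
      have "1 \<le> R / (4 * t)" using True t by (simp add: field_simps)
      then have "1 \<le> \<lfloor>R / (4 * t)\<rfloor>" by (simp add: le_floor_iff)
      then have "real K \<ge> 1" "real K > R / (4 * t) - 1" unfolding K_def by linarith+
      then have "R / (4 * t) \<le> 2 * real K" by linarith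
      then show ?thesis using t by (simp add: field_simps)
    qed
    \<comment> \<open>Since \<open>i * t \<le> R / 4 \<le> 1 / 2\<close>, all factors lie between one and two.\<close>
    define c where "c i = inverse (1 - real i * t)" for i :: nat
    have it: "real i * t \<le> R / 4" if "i < K" for i
      by (rule order_trans[OF mult_right_mono K1]) (use that t in auto)
    have c: "1 \<le> c i" "c i \<le> 2" if "i < K" for i
      using it[OF that] R t unfolding c_def by (auto simp: field_simps)
    define A' where "A' i = {u. c i *\<^sub>R u \<in> A}" for i
    have [measurable]: "A' i \<in> sets borel" for i
      unfolding A'_def by measurable
    have em: "ennreal (a / 4 ^ ?n) \<le> emeasure lborel (A' i)" if i: "i < K" for i
    proof -
      have "ennreal a = (\<integral>\<^sup>+v. indicator A v \<partial>lborel)" by (simp add: a)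
      also have "\<dots> = ennreal (\<Prod>j\<in>(UNIV :: 'n set). (c i)\<^sup>2) * (\<integral>\<^sup>+v. indicator A (\<chi> j. c i *\<^sub>R v $ j) \<partial>lborel)"
        using c(1)[OF i] by (intro nn_integral_coordinate_scaling) auto
      also have "(\<lambda>v. indicator A (\<chi> j. c i *\<^sub>R v $ j) :: ennreal) = indicator (A' i)"
      proof
        fix v :: "complex ^ 'n"
        have "(\<chi> j. c i *\<^sub>R v $ j) = c i *\<^sub>R v" by (simp add: vec_eq_iff)
        then show "indicator A (\<chi> j. c i *\<^sub>R v $ j) = (indicator (A' i) v :: ennreal)"
          by (simp add: A'_def indicator_def)
      qed
      also have "ennreal (\<Prod>j\<in>(UNIV :: 'n set). (c i)\<^sup>2) \<le> ennreal (4 ^ ?n)"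
      proof (rule ennreal_leI)
        have "(c i)\<^sup>2 \<le> 2\<^sup>2" using c[OF i] by (intro power_mono) auto
        then show "(\<Prod>j\<in>(UNIV :: 'n set). (c i)\<^sup>2) \<le> 4 ^ ?n"
          unfolding prod_constant by (intro power_mono) auto
      qed
      finally have le: "ennreal a \<le> ennreal (4 ^ ?n) * emeasure lborel (A' i)"
        by (simp add: mult_right_mono)
      have "ennreal (a / 4 ^ ?n) = ennreal (inverse (4 ^ ?n)) * ennreal a"
        using \<open>a \<ge> 0\<close> by (simp add: ennreal_mult[symmetric] field_simps)
      also have "\<dots> \<le> ennreal (inverse (4 ^ ?n)) * (ennreal (4 ^ ?n) * emeasure lborel (A' i))"
        by (rule mult_left_mono[OF le]) simp
      also have "\<dots> = emeasure lborel (A' i)"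
        by (simp add: mult.assoc[symmetric] ennreal_mult[symmetric])
      finally show ?thesis .
    qed
    have disj: "A' i \<inter> A' j = {}" if ij: "i < j" "j < K" for i j
    proof (rule ccontr)
      assume "A' i \<inter> A' j \<noteq> {}"
      then obtain u where u: "c i *\<^sub>R u \<in> A" "c j *\<^sub>R u \<in> A" by (auto simp: A'_def)
      have p: "0 < 1 - real i * t" "0 < 1 - real j * t" using it[of i] it[of j] ij R by auto
      have "t \<le> 1 / 2" using True R by simp
      have "real i + 1 \<le> real j" using ij by linarith
      then have "(real i + 1) * t \<le> real j * t" using t by (intro mult_right_mono) auto
      then have "(1 - real j * t) * (1 + t) \<le> 1 - real i * t"
        using t add_increasing2[of "t * (t * real j)" "t + t * real i" "t * real j"] by (simp add: algebra_simps)
      then have "(1 + t) * c i \<le> c j" using p unfolding c_def by (simp add: field_simps)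
      then have "(1 + t) * (c i * norm u) \<le> c j * norm u"
        using mult_right_mono[of "(1 + t) * c i" "c j" "norm u"] by (simp add: mult.assoc)
      then have "((1 + t) * (c i * norm u))\<^sup>2 \<le> (c j * norm u)\<^sup>2"
        using t c[of i] ij by (intro power_mono) auto
      moreover have "(c j * norm u)\<^sup>2 < 1" using u(2) c[of j] ij
        by (auto simp: A_def tube_def abs_square_less_1)
      moreover have "1 - t < (c i * norm u)\<^sup>2" using u(1) c[of i] ij
        by (auto simp: A_def rho_def)
      then have "(1 + t)\<^sup>2 * (1 - t) \<le> ((1 + t) * (c i * norm u))\<^sup>2"
        unfolding power_mult_distrib[of "1 + t"] by (intro mult_left_mono) auto
      moreover have "1 \<le> (1 + t)\<^sup>2 * (1 - t)"
      proof -
        have "(1 + t)\<^sup>2 * (1 - t) = 1 + t * (1 - t - t * t)" by (simp add: power2_eq_square algebra_simps)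
        moreover have "t * t \<le> 1 / 2 * (1 / 2)" using t \<open>t \<le> 1 / 2\<close> by (intro mult_mono) auto
        then have "0 \<le> t * (1 - t - t * t)" using t \<open>t \<le> 1 / 2\<close> by (intro mult_nonneg_nonneg) auto
        ultimately show ?thesis by simp
      qed
      ultimately show False by linarith
    qed
    have sub: "A' i \<subseteq> tube \<zeta> (2 * R)" if i: "i < K" for i
    proof
      fix u assume "u \<in> A' i"
      define w where "w = c i *\<^sub>R u"
      have w: "norm w < 1" "cmod (1 - hinner w \<zeta>) < R"
        using \<open>u \<in> A' i\<close> by (auto simp: A'_def A_def w_def tube_def)
      define \<tau> where "\<tau> = real i * t"
      have \<tau>: "0 \<le> \<tau>" "\<tau> < R" "\<tau> < 1" using it[OF i] R t by (auto simp: \<tau>_def)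
      have u: "u = (1 - \<tau>) *\<^sub>R w" using \<tau> by (simp add: w_def c_def \<tau>_def)
      have "norm u \<le> norm w" using \<tau> by (simp add: u mult_left_le_one_le)
      have "cmod (hinner w \<zeta>) \<le> 1" using cmod_hinner_le[of w \<zeta>] \<zeta> w by simp
      have *: "1 - hinner u \<zeta> = (1 - hinner w \<zeta>) + of_real \<tau> * hinner w \<zeta>"
        unfolding u hinner_scaleR_left by (simp add: algebra_simps)
      have "cmod (1 - hinner u \<zeta>) \<le> cmod (1 - hinner w \<zeta>) + \<tau> * cmod (hinner w \<zeta>)"
        using norm_triangle_ineq[of "1 - hinner w \<zeta>" "of_real \<tau> * hinner w \<zeta>"] \<tau>
        unfolding * by (simp add: norm_mult)
      also have "\<dots> < R + R * 1"
        using w \<tau> \<open>cmod (hinner w \<zeta>) \<le> 1\<close> mult_mono[of \<tau> R "cmod (hinner w \<zeta>)" 1] by simp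
      finally show "u \<in> tube \<zeta> (2 * R)" using w \<open>norm u \<le> norm w\<close> by (simp add: tube_def)
    qed
    have "ennreal (real K * (a / 4 ^ ?n)) = (\<Sum>i<K. ennreal (a / 4 ^ ?n))"
      using \<open>a \<ge> 0\<close> by (simp add: ennreal_mult[symmetric] ennreal_of_nat_eq_real_of_nat)
    also have "\<dots> \<le> (\<Sum>i<K. emeasure lborel (A' i))" by (intro sum_mono em) auto
    also have "\<dots> = emeasure lborel (\<Union>i<K. A' i)"
    proof (rule sum_emeasure)
      show "disjoint_family_on A' {..<K}"
        unfolding disjoint_family_on_def
      proof (intro ballI impI)
        fix i j assume "i \<in> {..<K}" "j \<in> {..<K}" "i \<noteq> j"
        then show "A' i \<inter> A' j = {}" using disj[of i j] disj[of j i] by (cases "i < j") auto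
      qed
    qed auto
    also have "\<dots> \<le> emeasure lborel (tube \<zeta> (2 * R))" by (rule emeasure_mono) (use sub in auto)
    also have "\<dots> \<le> ennreal (C0 * (2 * R) ^ (?n + 1))" using R by (intro T) auto
    finally have "real K * (a / 4 ^ ?n) \<le> C0 * (2 * R) ^ (?n + 1)"
      using C0 R by simp
    then have "R / (8 * t) * (a / 4 ^ ?n) \<le> C0 * (2 * R) ^ (?n + 1)"
      using mult_right_mono[OF K2, of "a / 4 ^ ?n"] \<open>a \<ge> 0\<close> by simp
    then have "R * a \<le> R * (C * R ^ ?n * t)"
      using t R by (simp add: C_def field_simps power_mult_distrib)
    then show ?thesis using R by simp
  qed
  then show "emeasure lborel {w \<in> tube \<zeta> R. rho w < t} \<le> ennreal (C * R ^ ?n * t)"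
    unfolding A_def[symmetric] a by (rule ennreal_leI)
qed

lemma dyadic_bracket_small:
  assumes "0 < x" "x < (T :: real)"
  obtains j :: nat where "T * (1 / 2) ^ Suc j \<le> x" "x < T * (1 / 2) ^ j"
proof -
  obtain m where m: "(1 / 2 :: real) ^ m < x / T"
    using real_arch_pow_inv[of "x / T" "1 / 2"] assms by auto
  have "\<exists>k<m. (\<forall>i\<le>k. \<not> T * (1 / 2) ^ i \<le> x) \<and> T * (1 / 2) ^ Suc k \<le> x"
    by (rule ex_least_nat_less) (use m assms in \<open>auto simp: field_simps\<close>)
  then show ?thesis using that by (meson not_le order_refl)
qed

lemma dyadic_bracket_large:
  assumes "0 < R" "R \<le> (x :: real)"
  obtains j :: nat where "2 ^ j * R \<le> x" "x < 2 ^ Suc j * R"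
proof -
  obtain m where m: "x / R < 2 ^ m"
    using real_arch_pow[of 2 "x / R"] by auto
  have "\<exists>k<m. (\<forall>i\<le>k. \<not> x < 2 ^ i * R) \<and> x < 2 ^ Suc k * R"
    by (rule ex_least_nat_less) (use m assms in \<open>auto simp: field_simps\<close>)
  then show ?thesis using that by (meson not_le order_refl)
qed

lemma suminf_ennreal_geometric:
  assumes "0 \<le> c" "0 \<le> r" "r < 1"
  shows "(\<Sum>j. ennreal (c * r ^ j)) = ennreal (c / (1 - r))"
proof -
  have "(\<lambda>j. c * r ^ j) sums (c * (1 / (1 - r)))"
    using assms by (intro sums_mult geometric_sums) auto
  then show ?thesis using assms by (subst suminf_ennreal_eq) auto
qed

lemma tube_interior_subset:
  assumes "norm \<zeta> = 1" "0 \<le> t" "t \<le> 1"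
  shows "tube (t *\<^sub>R \<zeta>) R \<subseteq> tube \<zeta> (2 * R)"
proof
  fix w assume "w \<in> tube (t *\<^sub>R \<zeta>) R"
  then have w: "norm w < 1" "cmod (1 - of_real t * hinner w \<zeta>) < R"
    by (auto simp: tube_def hinner_scaleR_right)
  have h: "cmod (hinner w \<zeta>) \<le> 1" using cmod_hinner_le[of w \<zeta>] assms w by simp
  have "t * cmod (hinner w \<zeta>) \<le> t * 1" using h assms by (intro mult_left_mono) auto
  then have t: "1 - t \<le> cmod (1 - of_real t * hinner w \<zeta>)"
    using norm_triangle_ineq2[of 1 "of_real t * hinner w \<zeta>"] assms by (simp add: norm_mult)
  have *: "1 - hinner w \<zeta> = (1 - of_real t * hinner w \<zeta>) - of_real (1 - t) * hinner w \<zeta>"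
    by (simp add: algebra_simps)
  have "cmod (1 - hinner w \<zeta>) \<le> cmod (1 - of_real t * hinner w \<zeta>) + (1 - t) * cmod (hinner w \<zeta>)"
    using norm_triangle_ineq4[of "1 - of_real t * hinner w \<zeta>" "of_real (1 - t) * hinner w \<zeta>"] assms
    unfolding *[symmetric] by (simp add: norm_mult del: of_real_diff)
  also have "(1 - t) * cmod (hinner w \<zeta>) \<le> (1 - t) * 1" using h assms by (intro mult_left_mono) auto
  finally show "w \<in> tube \<zeta> (2 * R)" using w t by (simp add: tube_def)
qed

lemma polar_vector:
  fixes \<eta> :: "complex ^ 'n"
  obtains \<zeta> where "norm \<zeta> = 1" "\<eta> = norm \<eta> *\<^sub>R \<zeta>"
proof (cases "\<eta> = 0")
  case True
  obtain k :: 'n where True by simp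
  have "norm (axis k 1 :: complex ^ 'n) = 1" by simp
  then show ?thesis using that True by (metis norm_zero scaleR_zero_left)
next
  case False
  then show ?thesis using that[of "sgn \<eta>"] by (simp add: norm_sgn sgn_div_norm)
qed

text \<open>Dyadic decomposition according to the distance to the sphere.\<close>

lemma weighted_volume_tube_le:
  fixes \<gamma> :: real
  assumes \<gamma>: "\<gamma> > -1"
  obtains C where "C > 0" and
    "\<And>(\<eta> :: complex ^ 'n) R. norm \<eta> \<le> 1 \<Longrightarrow> 0 < R \<Longrightarrow>
       (\<integral>\<^sup>+w. indicator (tube \<eta> R) w * ennreal (rho w powr \<gamma>) \<partial>lborel)
         \<le> ennreal (C * R powr (real CARD('n) + 1 + \<gamma>))"
proof -
  let ?n = "CARD('n)"
  obtain C1 where C1: "C1 > 0" and shell: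
    "\<And>(\<zeta> :: complex ^ 'n) R t. norm \<zeta> = 1 \<Longrightarrow> 0 < R \<Longrightarrow> R \<le> 2 \<Longrightarrow> 0 < t \<Longrightarrow>
       emeasure lborel {w \<in> tube \<zeta> R. rho w < t} \<le> ennreal (C1 * R ^ ?n * t)"
    using measure_tube_shell_le by blast
  \<comment> \<open>Within a dyadic shell \<open>rho\<close> varies by a factor two, which matters for negative \<open>\<gamma>\<close>.\<close>
  define B where "B = max 1 (2 powr (- \<gamma>))"
  define q where "q = 2 powr (- (\<gamma> + 1))"
  have q: "0 < q" "q < 1" using \<gamma> powr_less_mono[of "- (\<gamma> + 1)" 0 2] by (auto simp: q_def)
  define C where "C = B * C1 * 2 powr (\<gamma> + 1) / (1 - q)"
  have "B > 0" by (simp add: B_def)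
  have "C > 0" using q C1 \<open>B > 0\<close> by (simp add: C_def)
  have small: "(\<integral>\<^sup>+w. indicator (tube \<zeta> R) w * ennreal (rho w powr \<gamma>) \<partial>lborel)
         \<le> ennreal (C * R powr (real ?n + 1 + \<gamma>))"
    if \<zeta>: "norm \<zeta> = 1" and R: "0 < R" "R \<le> 2" for \<zeta> :: "complex ^ 'n" and R
  proof -
    define t where "t j = 2 * R * (1 / 2) ^ j" for j :: nat
    have t: "t j > 0" for j using R by (simp add: t_def)
    define S where "S j = {w \<in> tube \<zeta> R. rho w < t j}" for j
    have [measurable]: "S j \<in> sets borel" for j unfolding S_def by measurable
    have pt: "indicator (tube \<zeta> R) w * ennreal (rho w powr \<gamma>)
        \<le> (\<Sum>j. ennreal (B * t j powr \<gamma>) * indicator (S j) w)" for w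
    proof (cases "w \<in> tube \<zeta> R")
      case True
      then have w: "norm w < 1" "cmod (1 - hinner w \<zeta>) < R" by (auto simp: tube_def)
      have r: "0 < rho w" "rho w < 2 * R"
        using rho_pos[OF w(1)] rho_less_tube[OF w(1), of \<zeta>] w \<zeta> by auto
      obtain j where j: "2 * R * (1 / 2) ^ Suc j \<le> rho w" "rho w < 2 * R * (1 / 2) ^ j"
        using dyadic_bracket_small[OF r] by blast
      have "rho w powr \<gamma> \<le> B * t j powr \<gamma>"
      proof (cases "\<gamma> \<ge> 0")
        case True
        have "rho w powr \<gamma> \<le> 1 * t j powr \<gamma>" using True r j by (simp add: t_def powr_mono2)
        also have "\<dots> \<le> B * t j powr \<gamma>" by (intro mult_right_mono) (auto simp: B_def)
        finally show ?thesis .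
      next
        case False
        have "rho w powr \<gamma> \<le> (t j / 2) powr \<gamma>"
          using False r j R by (intro powr_mono2') (auto simp: t_def)
        also have "\<dots> = 2 powr (- \<gamma>) * t j powr \<gamma>"
          using t[of j] by (simp add: powr_divide powr_minus field_simps)
        also have "\<dots> \<le> B * t j powr \<gamma>" by (intro mult_right_mono) (auto simp: B_def)
        finally show ?thesis .
      qed
      then have "indicator (tube \<zeta> R) w * ennreal (rho w powr \<gamma>)
          \<le> ennreal (B * t j powr \<gamma>) * indicator (S j) w"
        using True j by (simp add: S_def t_def ennreal_leI)
      also have "\<dots> \<le> (\<Sum>j. ennreal (B * t j powr \<gamma>) * indicator (S j) w)"
        using sum_le_suminf[of "\<lambda>j. ennreal (B * t j powr \<gamma>) * indicator (S j) w" "{j}"]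
        by (simp del: sum_mult_indicator)
      finally show ?thesis .
    qed simp
    have "(\<integral>\<^sup>+w. indicator (tube \<zeta> R) w * ennreal (rho w powr \<gamma>) \<partial>lborel)
        \<le> (\<integral>\<^sup>+w. (\<Sum>j. ennreal (B * t j powr \<gamma>) * indicator (S j) w) \<partial>lborel)"
      by (rule nn_integral_mono) (rule pt)
    also have "\<dots> = (\<Sum>j. ennreal (B * t j powr \<gamma>) * emeasure lborel (S j))"
      by (subst nn_integral_suminf) (simp_all add: nn_integral_cmult)
    also have "\<dots> \<le> (\<Sum>j. ennreal ((B * C1 * 2 powr (\<gamma> + 1) * R powr (real ?n + 1 + \<gamma>)) * q ^ j))"
    proof (rule suminf_le)
      fix j
      have "ennreal (B * t j powr \<gamma>) * emeasure lborel (S j)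
          \<le> ennreal (B * t j powr \<gamma>) * ennreal (C1 * R ^ ?n * t j)"
        unfolding S_def by (rule mult_left_mono[OF shell[OF \<zeta> R t]]) simp
      also have "\<dots> = ennreal (B * C1 * R ^ ?n * (t j powr \<gamma> * t j))"
        using \<open>B > 0\<close> C1 R t[of j] by (simp add: ennreal_mult[symmetric] mult_ac)
      also have "t j powr \<gamma> * t j = t j powr (\<gamma> + 1)" using t[of j] by (simp add: powr_add)
      also have "\<dots> = 2 powr (\<gamma> + 1) * R powr (\<gamma> + 1) * q ^ j"
      proof -
        have "((1 / 2) ^ j) powr (\<gamma> + 1) = q ^ j"
          by (simp add: q_def powr_powr powr_realpow[symmetric] powr_divide powr_minus_divide[symmetric])
            (simp add: algebra_simps arg_cong[where f = "(powr) 2"])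
        then show ?thesis using R by (simp add: t_def powr_mult)
      qed
      also have "B * C1 * R ^ ?n * (2 powr (\<gamma> + 1) * R powr (\<gamma> + 1) * q ^ j)
          = (B * C1 * 2 powr (\<gamma> + 1) * R powr (real ?n + 1 + \<gamma>)) * q ^ j"
        using R by (simp add: powr_add powr_realpow[symmetric])
      finally show "ennreal (B * t j powr \<gamma>) * emeasure lborel (S j)
          \<le> ennreal ((B * C1 * 2 powr (\<gamma> + 1) * R powr (real ?n + 1 + \<gamma>)) * q ^ j)" .
    qed auto
    also have "\<dots> = ennreal (C * R powr (real ?n + 1 + \<gamma>))"
      using q C1 \<open>B > 0\<close> by (subst suminf_ennreal_geometric) (auto simp: C_def)
    finally show ?thesis .
  qed
  have unit: "(\<integral>\<^sup>+w. indicator (tube \<zeta> R) w * ennreal (rho w powr \<gamma>) \<partial>lborel)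
         \<le> ennreal (C * R powr (real ?n + 1 + \<gamma>))"
    if \<zeta>: "norm \<zeta> = 1" and R: "0 < R" for \<zeta> :: "complex ^ 'n" and R
  proof (cases "R \<le> 2")
    case False
    then have "tube \<zeta> R = tube \<zeta> 2" using \<zeta> by (simp add: tube_eq_ball)
    moreover have "C * 2 powr (real ?n + 1 + \<gamma>) \<le> C * R powr (real ?n + 1 + \<gamma>)"
      using False \<open>C > 0\<close> \<gamma> by (intro mult_left_mono powr_mono2) auto
    ultimately show ?thesis using small[OF \<zeta>, of 2] by (auto intro: order_trans ennreal_leI)
  qed (use small that in blast)
  show ?thesis
  proof (rule that[of "C * 2 powr (real ?n + 1 + \<gamma>)"])
    show "C * 2 powr (real ?n + 1 + \<gamma>) > 0" using \<open>C > 0\<close> by simp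
    fix \<eta> :: "complex ^ 'n" and R :: real
    assume \<eta>: "norm \<eta> \<le> 1" and R: "0 < R"
    obtain \<zeta> where \<zeta>: "norm \<zeta> = 1" "\<eta> = norm \<eta> *\<^sub>R \<zeta>" using polar_vector by blast
    have "tube \<eta> R \<subseteq> tube \<zeta> (2 * R)"
      using tube_interior_subset[OF \<zeta>(1) norm_ge_zero \<eta>, of R] \<zeta>(2) by simp
    then have "(\<integral>\<^sup>+w. indicator (tube \<eta> R) w * ennreal (rho w powr \<gamma>) \<partial>lborel)
        \<le> (\<integral>\<^sup>+w. indicator (tube \<zeta> (2 * R)) w * ennreal (rho w powr \<gamma>) \<partial>lborel)"
      by (intro nn_integral_mono mult_right_mono) (auto simp: indicator_def)
    also have "\<dots> \<le> ennreal (C * (2 * R) powr (real ?n + 1 + \<gamma>))"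
      using R by (intro unit \<zeta>) auto
    finally show "(\<integral>\<^sup>+w. indicator (tube \<eta> R) w * ennreal (rho w powr \<gamma>) \<partial>lborel)
        \<le> ennreal (C * 2 powr (real ?n + 1 + \<gamma>) * R powr (real ?n + 1 + \<gamma>))"
      using R by (simp add: powr_mult mult.assoc)
  qed
qed

text \<open>The Forelli--Rudin type estimate, by a dyadic decomposition into tubes.\<close>

lemma weighted_kernel_integral_le:
  fixes \<gamma> \<epsilon> :: real
  assumes \<gamma>: "\<gamma> > -1" and \<epsilon>: "\<epsilon> > 0"
  obtains C where "C > 0" and
    "\<And>(\<eta> :: complex ^ 'n) R. norm \<eta> \<le> 1 \<Longrightarrow> 0 < R \<Longrightarrow>
       (\<integral>\<^sup>+w. indicator (ball 0 1 - tube \<eta> R) w *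
          ennreal (rho w powr \<gamma> * cmod (1 - hinner w \<eta>) powr (- (real CARD('n) + 1 + \<gamma> + \<epsilon>))) \<partial>lborel)
         \<le> ennreal (C * R powr (- \<epsilon>))"
proof -
  let ?n = "CARD('n)"
  define p where "p = real ?n + 1 + \<gamma> + \<epsilon>"
  have p: "p > 0" using \<gamma> \<epsilon> by (simp add: p_def)
  obtain C1 where C1: "C1 > 0" and tube:
    "\<And>(\<eta> :: complex ^ 'n) R. norm \<eta> \<le> 1 \<Longrightarrow> 0 < R \<Longrightarrow>
       (\<integral>\<^sup>+w. indicator (tube \<eta> R) w * ennreal (rho w powr \<gamma>) \<partial>lborel)
         \<le> ennreal (C1 * R powr (real ?n + 1 + \<gamma>))"
    using weighted_volume_tube_le[OF \<gamma>] by blast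
  define q where "q = 2 powr (- \<epsilon>)"
  have q: "0 < q" "q < 1" using \<epsilon> powr_less_mono[of "- \<epsilon>" 0 2] by (auto simp: q_def)
  define C where "C = C1 * 2 powr (real ?n + 1 + \<gamma>) / (1 - q)"
  show ?thesis
  proof (rule that[of C])
    show "C > 0" using q C1 by (simp add: C_def)
    fix \<eta> :: "complex ^ 'n" and R :: real
    assume \<eta>: "norm \<eta> \<le> 1" and R: "0 < R"
    define T where "T j = tube \<eta> (2 ^ Suc j * R)" for j
    have [measurable]: "T j \<in> sets borel" for j by (simp add: T_def)
    have pt: "indicator (ball 0 1 - tube \<eta> R) w * ennreal (rho w powr \<gamma> * cmod (1 - hinner w \<eta>) powr (- p))
        \<le> (\<Sum>j. ennreal ((2 ^ j * R) powr (- p)) * (indicator (T j) w * ennreal (rho w powr \<gamma>)))" for w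
    proof (cases "w \<in> ball 0 1 - tube \<eta> R")
      case True
      then have w: "norm w < 1" "R \<le> cmod (1 - hinner w \<eta>)" by (auto simp: tube_def)
      obtain j where j: "2 ^ j * R \<le> cmod (1 - hinner w \<eta>)" "cmod (1 - hinner w \<eta>) < 2 ^ Suc j * R"
        using dyadic_bracket_large[OF R w(2)] by blast
      have "cmod (1 - hinner w \<eta>) powr (- p) \<le> (2 ^ j * R) powr (- p)"
        using j R p by (intro powr_mono2') auto
      then have "indicator (ball 0 1 - tube \<eta> R) w * ennreal (rho w powr \<gamma> * cmod (1 - hinner w \<eta>) powr (- p))
          \<le> ennreal ((2 ^ j * R) powr (- p)) * (indicator (T j) w * ennreal (rho w powr \<gamma>))"
        using True j w by (simp add: T_def tube_def ennreal_mult[symmetric] mult.commute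
            ennreal_leI mult_left_mono)
      also have "\<dots> \<le> (\<Sum>j. ennreal ((2 ^ j * R) powr (- p)) * (indicator (T j) w * ennreal (rho w powr \<gamma>)))"
        using sum_le_suminf[of "\<lambda>j. ennreal ((2 ^ j * R) powr (- p)) * (indicator (T j) w * ennreal (rho w powr \<gamma>))" "{j}"]
        by (simp del: sum_mult_indicator)
      finally show ?thesis .
    qed simp
    have "(\<integral>\<^sup>+w. indicator (ball 0 1 - tube \<eta> R) w * ennreal (rho w powr \<gamma> * cmod (1 - hinner w \<eta>) powr (- p)) \<partial>lborel)
        \<le> (\<integral>\<^sup>+w. (\<Sum>j. ennreal ((2 ^ j * R) powr (- p)) * (indicator (T j) w * ennreal (rho w powr \<gamma>))) \<partial>lborel)"
      by (rule nn_integral_mono) (rule pt)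
    also have "\<dots> = (\<Sum>j. ennreal ((2 ^ j * R) powr (- p)) * (\<integral>\<^sup>+w. indicator (T j) w * ennreal (rho w powr \<gamma>) \<partial>lborel))"
      by (subst nn_integral_suminf) (simp_all add: nn_integral_cmult)
    also have "\<dots> \<le> (\<Sum>j. ennreal ((C1 * 2 powr (real ?n + 1 + \<gamma>) * R powr (- \<epsilon>)) * q ^ j))"
    proof (rule suminf_le)
      fix j
      have "ennreal ((2 ^ j * R) powr (- p)) * (\<integral>\<^sup>+w. indicator (T j) w * ennreal (rho w powr \<gamma>) \<partial>lborel)
          \<le> ennreal ((2 ^ j * R) powr (- p)) * ennreal (C1 * (2 ^ Suc j * R) powr (real ?n + 1 + \<gamma>))"
        unfolding T_def using R by (intro mult_left_mono[OF tube[OF \<eta>]]) auto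
      also have "\<dots> = ennreal (C1 * ((2 ^ j * R) powr (- p) * (2 * (2 ^ j * R)) powr (real ?n + 1 + \<gamma>)))"
        using C1 by (simp add: ennreal_mult[symmetric] mult_ac)
      also have "(2 ^ j * R) powr (- p) * (2 * (2 ^ j * R)) powr (real ?n + 1 + \<gamma>)
          = 2 powr (real ?n + 1 + \<gamma>) * (2 ^ j * R) powr (- \<epsilon>)"
        unfolding powr_mult[of 2 "2 ^ j * R"] by (simp add: powr_add[symmetric] p_def mult.left_commute)
      also have "(2 ^ j * R) powr (- \<epsilon>) = R powr (- \<epsilon>) * q ^ j"
        using R by (simp add: q_def powr_mult powr_powr powr_realpow[symmetric] mult.commute)
      finally show "ennreal ((2 ^ j * R) powr (- p)) * (\<integral>\<^sup>+w. indicator (T j) w * ennreal (rho w powr \<gamma>) \<partial>lborel)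
          \<le> ennreal ((C1 * 2 powr (real ?n + 1 + \<gamma>) * R powr (- \<epsilon>)) * q ^ j)"
        by (simp add: mult.assoc)
    qed auto
    also have "\<dots> = ennreal (C * R powr (- \<epsilon>))"
      using q C1 by (subst suminf_ennreal_geometric) (auto simp: C_def)
    finally show "(\<integral>\<^sup>+w. indicator (ball 0 1 - tube \<eta> R) w *
          ennreal (rho w powr \<gamma> * cmod (1 - hinner w \<eta>) powr (- (real CARD('n) + 1 + \<gamma> + \<epsilon>))) \<partial>lborel)
         \<le> ennreal (C * R powr (- \<epsilon>))"
      unfolding p_def .
  qed
qed

section \<open>The weighted measure on the ball\<close>

definition weight_density :: "real \<Rightarrow> complex ^ 'n \<Rightarrow> real" where
  "weight_density \<alpha> w =
     weight_const CARD('n) \<alpha> * rho w powr \<alpha> / measure lborel (ball (0 :: complex ^ 'n) 1)"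

lemma borel_measurable_weight_density [measurable]: "weight_density \<alpha> \<in> borel_measurable borel"
  by (simp add: weight_density_def[abs_def])

lemma weight_const_pos: "\<alpha> > -1 \<Longrightarrow> weight_const n \<alpha> > 0"
  by (auto simp: weight_const_def intro!: divide_pos_pos mult_pos_pos Gamma_real_pos)

lemma weight_density_eq:
  "weight_density \<alpha> (w :: complex ^ 'n) = weight_density \<alpha> (0 :: complex ^ 'n) * rho w powr \<alpha>"
  by (simp add: weight_density_def rho_def)

lemma weight_density_0_pos: "\<alpha> > -1 \<Longrightarrow> weight_density \<alpha> (0 :: complex ^ 'n) > 0"
  using weight_const_pos[of \<alpha> "CARD('n)"] unit_ball_vol_pos[of "real DIM(complex ^ 'n)"]
  by (auto simp: weight_density_def rho_def content_ball intro!: divide_pos_pos)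

lemma weight_density_pos: "\<alpha> > -1 \<Longrightarrow> norm w < 1 \<Longrightarrow> weight_density \<alpha> w > 0"
  using weight_density_0_pos[of \<alpha>] rho_pos[of w] unfolding weight_density_eq[of \<alpha> w]
  by (intro mult_pos_pos) auto

lemma weight_density_nonneg: "\<alpha> > -1 \<Longrightarrow> weight_density \<alpha> w \<ge> 0"
  using weight_density_0_pos[of \<alpha>, where 'n = 'a] by (simp add: weight_density_eq[of \<alpha> w])

lemma weighted_measure_eq_density:
  assumes "\<alpha> > -1"
  shows "(weighted_measure \<alpha> :: (complex ^ 'n) measure)
    = density (lebesgue_on (ball 0 1)) (\<lambda>w. ennreal (weight_density \<alpha> w))"
proof -
  let ?B = "ball (0 :: complex ^ 'n) 1"
  let ?V = "measure lborel ?B"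
  have V: "?V > 0" by (simp add: content_ball)
  have em: "emeasure (lebesgue_on ?B) ?B = ennreal ?V"
    by (simp add: emeasure_restrict_space emeasure_ball content_ball)
  have meas: "(\<lambda>w. rho w) \<in> borel_measurable (lebesgue_on ?B)"
    by (intro measurable_restrict_space1 measurable_completion) simp
  have [measurable]: "(\<lambda>w. indicator ?B w / ennreal ?V :: ennreal) \<in> borel_measurable (lebesgue_on ?B)"
    unfolding divide_ennreal_def by (intro measurable_restrict_space1 measurable_completion) simp
  note [measurable] = meas
  have *: "(\<lambda>w :: complex ^ 'n. ennreal (weight_const CARD('n) \<alpha> * (1 - (norm w)\<^sup>2) powr \<alpha>))
      = (\<lambda>w. ennreal (weight_const CARD('n) \<alpha> * rho w powr \<alpha>))" by (simp add: rho_def)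
  show ?thesis
    unfolding weighted_measure_def ball_measure_def uniform_measure_def em *
  proof (subst density_density_eq)
    show "density (lebesgue_on ?B) (\<lambda>x. indicator ?B x / ennreal ?V * ennreal (weight_const CARD('n) \<alpha> * rho x powr \<alpha>))
        = density (lebesgue_on ?B) (\<lambda>w. ennreal (weight_density \<alpha> w))"
    proof (rule density_cong)
      show "(\<lambda>w :: complex ^ 'n. ennreal (weight_density \<alpha> w)) \<in> borel_measurable (lebesgue_on ?B)"
        unfolding weight_density_def by measurable
      show "AE x in lebesgue_on ?B. indicator ?B x / ennreal ?V * ennreal (weight_const CARD('n) \<alpha> * rho x powr \<alpha>)
          = ennreal (weight_density \<alpha> x)"
        using V weight_const_pos[OF assms, of "CARD('n)"]
        by (intro AE_I2) (auto simp: weight_density_def divide_ennreal_def inverse_ennreal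
            ennreal_mult[symmetric] field_simps)
    qed measurable
  qed measurable
qed

lemma space_weighted_measure [simp]: "space (weighted_measure \<alpha>) = ball 0 1"
  by (simp add: weighted_measure_def ball_measure_def)

lemma sets_weighted_measure:
  "sets (weighted_measure \<alpha>) = sets (lebesgue_on (ball 0 1))"
  by (simp add: weighted_measure_def ball_measure_def)

lemma measurable_weighted_measure:
  "f \<in> measurable borel N \<Longrightarrow> f \<in> measurable (weighted_measure \<alpha>) N"
  unfolding measurable_cong_sets[OF sets_weighted_measure refl]
  by (intro measurable_restrict_space1 measurable_completion) simp

lemma measurable_ident_weighted_measure:
  "(\<lambda>w. w) \<in> borel_measurable (weighted_measure \<alpha>)"
  by (rule measurable_weighted_measure) simp

lemma sets_weighted_measureI: "A \<in> sets borel \<Longrightarrow> A \<subseteq> ball 0 1 \<Longrightarrow> A \<in> sets (weighted_measure \<alpha>)"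
  unfolding sets_weighted_measure by (auto simp: sets_restrict_space_iff)

lemma continuous_measurable_weighted_measure:
  fixes f :: "complex ^ 'n \<Rightarrow> complex"
  assumes "continuous_on (ball 0 1) f"
  shows "f \<in> borel_measurable (weighted_measure \<alpha>)"
proof -
  have "f \<in> borel_measurable (lebesgue_on (ball 0 1))"
    by (rule continuous_imp_measurable_on_sets_lebesgue[OF assms]) simp
  then show ?thesis unfolding measurable_cong_sets[OF sets_weighted_measure refl] .
qed

lemma nn_integral_weighted_measure:
  fixes h :: "complex ^ 'n \<Rightarrow> ennreal"
  assumes \<alpha>: "\<alpha> > -1" and [measurable]: "h \<in> borel_measurable borel"
  shows "(\<integral>\<^sup>+w. h w \<partial>weighted_measure \<alpha>)
    = ennreal (weight_density \<alpha> (0 :: complex ^ 'n)) *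
        (\<integral>\<^sup>+w. indicator (ball 0 1) w * (ennreal (rho w powr \<alpha>) * h w) \<partial>lborel)"
proof -
  let ?c = "weight_density \<alpha> (0 :: complex ^ 'n)"
  have h: "h \<in> borel_measurable (lebesgue_on (ball 0 1))"
    and [measurable]: "(\<lambda>w :: complex ^ 'n. ennreal (weight_density \<alpha> w)) \<in> borel_measurable (lebesgue_on (ball 0 1))"
    by (intro measurable_restrict_space1 measurable_completion; simp)+
  note [measurable] = h
  have "(\<integral>\<^sup>+w. h w \<partial>weighted_measure \<alpha>)
      = (\<integral>\<^sup>+w. ennreal (weight_density \<alpha> w) * h w \<partial>lebesgue_on (ball 0 1))"
    unfolding weighted_measure_eq_density[OF \<alpha>] by (rule nn_integral_density) auto
  also have "\<dots> = (\<integral>\<^sup>+w. ennreal (weight_density \<alpha> w) * h w * indicator (ball 0 1) w \<partial>lborel)"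
    by (simp add: nn_integral_restrict_space nn_integral_completion)
  also have "\<dots> = (\<integral>\<^sup>+w. ennreal ?c * (indicator (ball 0 1) w * (ennreal (rho w powr \<alpha>) * h w)) \<partial>lborel)"
  proof (rule nn_integral_cong)
    fix w :: "complex ^ 'n"
    have "ennreal (weight_density \<alpha> w) = ennreal ?c * ennreal (rho w powr \<alpha>)"
      using weight_density_0_pos[OF \<alpha>, where 'n = 'n]
      unfolding weight_density_eq[of \<alpha> w] by (simp add: ennreal_mult)
    then show "ennreal (weight_density \<alpha> w) * h w * indicator (ball 0 1) w
        = ennreal ?c * (indicator (ball 0 1) w * (ennreal (rho w powr \<alpha>) * h w))"
      by (simp add: mult_ac)
  qed
  also have "\<dots> = ennreal ?c * (\<integral>\<^sup>+w. indicator (ball 0 1) w * (ennreal (rho w powr \<alpha>) * h w) \<partial>lborel)"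
    by (rule nn_integral_cmult) measurable
  finally show ?thesis .
qed

lemma integral_weighted_measure:
  fixes h :: "complex ^ 'n \<Rightarrow> 'b::{banach, second_countable_topology}"
  assumes \<alpha>: "\<alpha> > -1" and [measurable]: "h \<in> borel_measurable borel"
  shows "(LINT w|weighted_measure \<alpha>. h w)
    = (LINT w|lborel. indicator (ball 0 1) w *\<^sub>R (weight_density \<alpha> w *\<^sub>R h w))"
proof -
  have h: "h \<in> borel_measurable (lebesgue_on (ball 0 1))"
    and wd: "(\<lambda>w :: complex ^ 'n. weight_density \<alpha> w) \<in> borel_measurable (lebesgue_on (ball 0 1))"
    by (intro measurable_restrict_space1 measurable_completion; simp)+
  have "(LINT w|weighted_measure \<alpha>. h w)
      = (LINT w|lebesgue_on (ball 0 1). weight_density \<alpha> w *\<^sub>R h w)"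
    unfolding weighted_measure_eq_density[OF \<alpha>]
    by (rule integral_density) (use h wd weight_density_nonneg[OF \<alpha>] in auto)
  also have "\<dots> = (LINT w|lborel. indicator (ball 0 1) w *\<^sub>R (weight_density \<alpha> w *\<^sub>R h w))"
  proof -
    have "(LINT w|lebesgue_on (ball 0 1). weight_density \<alpha> w *\<^sub>R h w)
        = (LINT w|lebesgue. indicator (ball 0 1) w *\<^sub>R (weight_density \<alpha> w *\<^sub>R h w))"
      by (rule integral_restrict_space) simp
    also have "\<dots> = (LINT w|lborel. indicator (ball 0 1) w *\<^sub>R (weight_density \<alpha> w *\<^sub>R h w))"
      by (rule integral_completion) measurable
    finally show ?thesis .
  qed
  finally show ?thesis .
qed

lemma weighted_tube_integral_le:
  fixes \<sigma> :: real
  assumes \<alpha>: "\<alpha> > -1" and \<sigma>: "\<alpha> - \<sigma> > -1"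
  obtains C where "C > 0" and
    "\<And>(\<eta> :: complex ^ 'n) R. norm \<eta> \<le> 1 \<Longrightarrow> 0 < R \<Longrightarrow>
       (\<integral>\<^sup>+w. indicator (tube \<eta> R) w * ennreal (rho w powr (- \<sigma>)) \<partial>weighted_measure \<alpha>)
         \<le> ennreal (C * R powr (real CARD('n) + 1 + \<alpha> - \<sigma>))"
proof -
  let ?c = "weight_density \<alpha> (0 :: complex ^ 'n)"
  have c: "?c > 0" by (rule weight_density_0_pos[OF \<alpha>])
  obtain C where C: "C > 0" and le: "\<And>(\<eta> :: complex ^ 'n) R. norm \<eta> \<le> 1 \<Longrightarrow> 0 < R \<Longrightarrow>
       (\<integral>\<^sup>+w. indicator (tube \<eta> R) w * ennreal (rho w powr (\<alpha> - \<sigma>)) \<partial>lborel)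
         \<le> ennreal (C * R powr (real CARD('n) + 1 + (\<alpha> - \<sigma>)))"
    using weighted_volume_tube_le[OF \<sigma>, where 'n = 'n] by blast
  show ?thesis
  proof (rule that[of "?c * C"])
    show "?c * C > 0" using c C by simp
    fix \<eta> :: "complex ^ 'n" and R :: real assume \<eta>: "norm \<eta> \<le> 1" and R: "0 < R"
    have "(\<integral>\<^sup>+w. indicator (tube \<eta> R) w * ennreal (rho w powr (- \<sigma>)) \<partial>weighted_measure \<alpha>)
        = ennreal ?c * (\<integral>\<^sup>+w. indicator (ball 0 1) w *
            (ennreal (rho w powr \<alpha>) * (indicator (tube \<eta> R) w * ennreal (rho w powr (- \<sigma>)))) \<partial>lborel)"
      by (rule nn_integral_weighted_measure[OF \<alpha>]) simp
    also have "(\<lambda>w. indicator (ball 0 1) w * (ennreal (rho w powr \<alpha>) * (indicator (tube \<eta> R) w * ennreal (rho w powr (- \<sigma>)))))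
        = (\<lambda>w. indicator (tube \<eta> R) w * ennreal (rho w powr (\<alpha> - \<sigma>)))"
      by (auto simp: fun_eq_iff indicator_def tube_def ennreal_mult[symmetric] powr_add[symmetric])
    also have "ennreal ?c * (\<integral>\<^sup>+w. indicator (tube \<eta> R) w * ennreal (rho w powr (\<alpha> - \<sigma>)) \<partial>lborel)
        \<le> ennreal ?c * ennreal (C * R powr (real CARD('n) + 1 + (\<alpha> - \<sigma>)))"
      by (rule mult_left_mono[OF le[OF \<eta> R]]) simp
    also have "\<dots> = ennreal (?c * C * R powr (real CARD('n) + 1 + \<alpha> - \<sigma>))"
      using c C by (simp add: ennreal_mult[symmetric] algebra_simps)
    finally show "(\<integral>\<^sup>+w. indicator (tube \<eta> R) w * ennreal (rho w powr (- \<sigma>)) \<partial>weighted_measure \<alpha>)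
         \<le> ennreal (?c * C * R powr (real CARD('n) + 1 + \<alpha> - \<sigma>))" .
  qed
qed

lemma weighted_outer_integral_le:
  fixes \<epsilon> :: real
  assumes \<alpha>: "\<alpha> > -1" and \<epsilon>: "\<epsilon> > 0"
  obtains C where "C > 0" and
    "\<And>(\<eta> :: complex ^ 'n) R. norm \<eta> \<le> 1 \<Longrightarrow> 0 < R \<Longrightarrow>
       (\<integral>\<^sup>+w. indicator (ball 0 1 - tube \<eta> R) w *
          ennreal (cmod (1 - hinner w \<eta>) powr (- (real CARD('n) + 1 + \<alpha> + \<epsilon>))) \<partial>weighted_measure \<alpha>)
         \<le> ennreal (C * R powr (- \<epsilon>))"
proof -
  let ?c = "weight_density \<alpha> (0 :: complex ^ 'n)"
  let ?p = "real CARD('n) + 1 + \<alpha> + \<epsilon>"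
  have c: "?c > 0" by (rule weight_density_0_pos[OF \<alpha>])
  obtain C where C: "C > 0" and le: "\<And>(\<eta> :: complex ^ 'n) R. norm \<eta> \<le> 1 \<Longrightarrow> 0 < R \<Longrightarrow>
       (\<integral>\<^sup>+w. indicator (ball 0 1 - tube \<eta> R) w *
          ennreal (rho w powr \<alpha> * cmod (1 - hinner w \<eta>) powr (- ?p)) \<partial>lborel)
         \<le> ennreal (C * R powr (- \<epsilon>))"
    using weighted_kernel_integral_le[OF \<alpha> \<epsilon>, where 'n = 'n] by blast
  show ?thesis
  proof (rule that[of "?c * C"])
    show "?c * C > 0" using c C by simp
    fix \<eta> :: "complex ^ 'n" and R :: real assume \<eta>: "norm \<eta> \<le> 1" and R: "0 < R"
    let ?I = "indicator (ball 0 1 - tube \<eta> R) :: complex ^ 'n \<Rightarrow> ennreal"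
    have "(\<integral>\<^sup>+w. ?I w * ennreal (cmod (1 - hinner w \<eta>) powr (- ?p)) \<partial>weighted_measure \<alpha>)
        = ennreal ?c * (\<integral>\<^sup>+w. indicator (ball 0 1) w *
            (ennreal (rho w powr \<alpha>) * (?I w * ennreal (cmod (1 - hinner w \<eta>) powr (- ?p)))) \<partial>lborel)"
      by (rule nn_integral_weighted_measure[OF \<alpha>]) simp
    also have "(\<lambda>w. indicator (ball 0 1) w * (ennreal (rho w powr \<alpha>) * (?I w * ennreal (cmod (1 - hinner w \<eta>) powr (- ?p)))))
        = (\<lambda>w. ?I w * ennreal (rho w powr \<alpha> * cmod (1 - hinner w \<eta>) powr (- ?p)))"
      by (auto simp: fun_eq_iff indicator_def ennreal_mult[symmetric])
    also have "ennreal ?c * (\<integral>\<^sup>+w. ?I w * ennreal (rho w powr \<alpha> * cmod (1 - hinner w \<eta>) powr (- ?p)) \<partial>lborel)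
        \<le> ennreal ?c * ennreal (C * R powr (- \<epsilon>))"
      by (rule mult_left_mono[OF le[OF \<eta> R]]) simp
    also have "\<dots> = ennreal (?c * C * R powr (- \<epsilon>))"
      using c C by (simp add: ennreal_mult[symmetric] algebra_simps)
    finally show "(\<integral>\<^sup>+w. ?I w * ennreal (cmod (1 - hinner w \<eta>) powr (- ?p)) \<partial>weighted_measure \<alpha>)
         \<le> ennreal (?c * C * R powr (- \<epsilon>))" .
  qed
qed

lemma finite_weighted_measure:
  assumes \<alpha>: "\<alpha> > -1"
  shows "finite_measure (weighted_measure \<alpha> :: (complex ^ 'n) measure)"
proof
  let ?M = "weighted_measure \<alpha> :: (complex ^ 'n) measure"
  obtain C where C: "C > 0" and le: "\<And>(\<eta> :: complex ^ 'n) R. norm \<eta> \<le> 1 \<Longrightarrow> 0 < R \<Longrightarrow>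
       (\<integral>\<^sup>+w. indicator (tube \<eta> R) w * ennreal (rho w powr (- 0)) \<partial>weighted_measure \<alpha>)
         \<le> ennreal (C * R powr (real CARD('n) + 1 + \<alpha> - 0))"
    using weighted_tube_integral_le[OF \<alpha>, of 0, where 'n = 'n] \<alpha> by auto
  have "emeasure ?M (space ?M) = (\<integral>\<^sup>+w. 1 \<partial>?M)" by simp
  also have "\<dots> = (\<integral>\<^sup>+w. indicator (tube 0 2) w * ennreal (rho w powr (- 0)) \<partial>?M)"
  proof (rule nn_integral_cong)
    fix w assume "w \<in> space ?M"
    then show "1 = indicator (tube 0 2) w * ennreal (rho w powr (- 0))"
      using rho_pos[of w] by (auto simp: tube_def)
  qed
  also have "\<dots> \<le> ennreal (C * 2 powr (real CARD('n) + 1 + \<alpha> - 0))" by (rule le) auto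
  finally show "emeasure ?M (space ?M) \<noteq> \<infinity>" by (auto simp: top_unique)
qed

text \<open>
  To first order the change of \<open>rho\<close> is twice the component of \<open>v\<close> along \<open>\<zeta>\<close>, and the remainder is
  the square of the norm of \<open>v\<close>; both are small compared to \<open>\<delta>\<close>.
\<close>

lemma cell_bounds:
  fixes \<zeta> :: "complex ^ 'n"
  assumes \<zeta>: "norm \<zeta> = 1" and \<delta>: "0 < \<delta>" "\<delta> \<le> 1" and v: "v \<in> cell \<zeta> \<delta>"
  defines "u \<equiv> (1 - \<delta>) *\<^sub>R \<zeta> + v"
  shows "\<delta> / 2 \<le> rho u" "rho u \<le> 3 * \<delta>" "norm u < 1" "u \<in> tube \<zeta> (2 * \<delta>)"
proof -
  have v1: "cmod (hinner v \<zeta>) < \<delta> / 6" "(norm v)\<^sup>2 < \<delta> / 6" using v by (auto simp: cell_def)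
  have re: "\<bar>Re (hinner v \<zeta>)\<bar> < \<delta> / 6" using abs_Re_le_cmod[of "hinner v \<zeta>"] v1 by linarith
  have \<zeta>1: "\<zeta> \<bullet> \<zeta> = 1" using \<zeta> by (simp add: dot_square_norm)
  have "(norm u)\<^sup>2 = (1 - \<delta>)\<^sup>2 + 2 * (1 - \<delta>) * Re (hinner v \<zeta>) + (norm v)\<^sup>2"
    using \<zeta>1 inner_eq_Re_hinner[of v \<zeta>] unfolding u_def power2_norm_eq_inner
    by (simp add: inner_add_left inner_add_right inner_commute[of \<zeta> v] power2_eq_square algebra_simps
        del: scaleR_left_diff_distrib)
  then have r: "rho u = \<delta> * (2 - \<delta>) - 2 * (1 - \<delta>) * Re (hinner v \<zeta>) - (norm v)\<^sup>2"
    by (simp add: rho_def power2_eq_square algebra_simps)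
  have "\<bar>2 * (1 - \<delta>) * Re (hinner v \<zeta>)\<bar> \<le> 2 * (\<delta> / 6)"
    unfolding abs_mult using re \<delta> by (intro mult_mono) auto
  moreover have "\<delta> * 1 \<le> \<delta> * (2 - \<delta>)" "\<delta> * (2 - \<delta>) \<le> \<delta> * 2" using \<delta> by (intro mult_left_mono; simp)+
  ultimately show r1: "\<delta> / 2 \<le> rho u" and "rho u \<le> 3 * \<delta>"
    using v1 r zero_le_power2[of "norm v"] \<delta> unfolding abs_le_iff by linarith+
  show nu: "norm u < 1" using r1 \<delta> abs_square_less_1[of "norm u"] by (simp add: rho_def)
  have "hinner \<zeta> \<zeta> = 1" using \<zeta> by (simp add: hinner_self)
  then have *: "1 - hinner u \<zeta> = of_real \<delta> - hinner v \<zeta>"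
    by (simp add: u_def hinner_add_left hinner_scaleR_left del: scaleR_left_diff_distrib)
  have "cmod (1 - hinner u \<zeta>) \<le> \<delta> + cmod (hinner v \<zeta>)"
    using norm_triangle_ineq4[of "of_real \<delta>" "hinner v \<zeta>"] \<delta> unfolding * by simp
  then show "u \<in> tube \<zeta> (2 * \<delta>)" using v1 nu \<delta> by (simp add: tube_def)
qed

lemma sets_tube_weighted_measure: "tube \<zeta> R \<in> sets (weighted_measure \<alpha>)"
  by (intro sets_weighted_measureI tube_subset_ball) simp

text \<open>
  The tube contains a Bergman cell of comparable size, on which the density is comparable to
  \<open>R powr \<alpha>\<close>.
\<close>

lemma measure_tube_ge:
  assumes \<alpha>: "\<alpha> > -1"
  obtains c where "c > 0" and
    "\<And>(\<zeta> :: complex ^ 'n) R. norm \<zeta> = 1 \<Longrightarrow> 0 < R \<Longrightarrow> R \<le> 4 \<Longrightarrow>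
       c * R powr (real CARD('n) + 1 + \<alpha>) \<le> measure (weighted_measure \<alpha>) (tube \<zeta> R)"
proof -
  let ?M = "weighted_measure \<alpha> :: (complex ^ 'n) measure"
  let ?c = "weight_density \<alpha> (0 :: complex ^ 'n)"
  have c: "?c > 0" by (rule weight_density_0_pos[OF \<alpha>])
  define V where "V = measure lborel (ball (0 :: complex ^ 'n) (1 / 6))"
  have V: "V > 0" "emeasure lborel (ball (0 :: complex ^ 'n) (1 / 6)) = ennreal V"
    by (simp_all add: V_def content_ball emeasure_ball)
  define b where "b = min ((1 / 2) powr \<alpha>) (3 powr \<alpha>)"
  have b: "b > 0" by (simp add: b_def)
  define c' where "c' = ?c * b * V * (1 / 4) powr (real CARD('n) + 1 + \<alpha>)"
  show ?thesis
  proof (rule that[of c'])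
    show "c' > 0" using c b V by (simp add: c'_def)
    fix \<zeta> :: "complex ^ 'n" and R :: real
    assume \<zeta>: "norm \<zeta> = 1" and R: "0 < R" "R \<le> 4"
    define \<delta> where "\<delta> = R / 4"
    have \<delta>: "0 < \<delta>" "\<delta> \<le> 1" using R by (auto simp: \<delta>_def)
    let ?p = "(1 - \<delta>) *\<^sub>R \<zeta>"
    have powr: "b * \<delta> powr \<alpha> \<le> rho (?p + v) powr \<alpha>" if "v \<in> cell \<zeta> \<delta>" for v
    proof -
      note cb = cell_bounds[OF \<zeta> \<delta> that]
      show ?thesis
      proof (cases "\<alpha> \<ge> 0")
        case True
        have "b * \<delta> powr \<alpha> \<le> (1 / 2) powr \<alpha> * \<delta> powr \<alpha>" by (intro mult_right_mono) (auto simp: b_def)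
        also have "\<dots> = (\<delta> / 2) powr \<alpha>" using \<delta> by (simp add: powr_mult[symmetric] mult.commute)
        also have "\<dots> \<le> rho (?p + v) powr \<alpha>" using cb \<delta> True by (intro powr_mono2) auto
        finally show ?thesis .
      next
        case False
        have "b * \<delta> powr \<alpha> \<le> 3 powr \<alpha> * \<delta> powr \<alpha>" by (intro mult_right_mono) (auto simp: b_def)
        also have "\<dots> = (3 * \<delta>) powr \<alpha>" using \<delta> by (simp add: powr_mult)
        also have "\<dots> \<le> rho (?p + v) powr \<alpha>" using cb \<delta> False by (intro powr_mono2') auto
        finally show ?thesis .
      qed
    qed
    have "ennreal (c' * R powr (real CARD('n) + 1 + \<alpha>))
        = ennreal ?c * (ennreal (b * \<delta> powr \<alpha>) * (ennreal (\<delta> ^ (CARD('n) + 1)) * ennreal V))"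
    proof -
      have "R = 4 * \<delta>" by (simp add: \<delta>_def)
      have "(1 / 4) powr (real CARD('n) + 1 + \<alpha>) * R powr (real CARD('n) + 1 + \<alpha>) = \<delta> powr (real CARD('n) + 1 + \<alpha>)"
        using R by (simp add: powr_mult[symmetric] \<delta>_def)
      also have "\<dots> = \<delta> powr \<alpha> * \<delta> ^ (CARD('n) + 1)"
        using \<delta> by (simp add: powr_add powr_realpow[symmetric])
      finally have "c' * R powr (real CARD('n) + 1 + \<alpha>) = ?c * (b * \<delta> powr \<alpha> * (\<delta> ^ (CARD('n) + 1) * V))"
        unfolding c'_def by (simp add: mult_ac)
      then show ?thesis using c b \<delta> V by (simp add: ennreal_mult)
    qed
    also have "\<dots> \<le> ennreal ?c * (ennreal (b * \<delta> powr \<alpha>) * emeasure lborel (cell \<zeta> \<delta>))"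
      using emeasure_cell_ge[OF \<zeta> \<delta>] by (intro mult_left_mono) (simp_all add: V(2))
    also have "\<dots> = ennreal ?c * (\<integral>\<^sup>+v. ennreal (b * \<delta> powr \<alpha>) * indicator (cell \<zeta> \<delta>) v \<partial>lborel)"
      by (simp add: nn_integral_cmult)
    also have "\<dots> \<le> ennreal ?c * (\<integral>\<^sup>+v. indicator (ball 0 1) (?p + v) *
        (ennreal (rho (?p + v) powr \<alpha>) * indicator (tube \<zeta> R) (?p + v)) \<partial>lborel)"
    proof (intro mult_left_mono nn_integral_mono)
      fix v :: "complex ^ 'n"
      show "ennreal (b * \<delta> powr \<alpha>) * indicator (cell \<zeta> \<delta>) v
        \<le> indicator (ball 0 1) (?p + v) * (ennreal (rho (?p + v) powr \<alpha>) * indicator (tube \<zeta> R) (?p + v))"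
      proof (cases "v \<in> cell \<zeta> \<delta>")
        case True
        have "2 * \<delta> \<le> R" using R by (simp add: \<delta>_def)
        then have "?p + v \<in> tube \<zeta> R" using cell_bounds(4)[OF \<zeta> \<delta> True] tube_mono by blast
        then show ?thesis using True powr[OF True] cell_bounds(3)[OF \<zeta> \<delta> True]
          by (simp add: ennreal_leI)
      qed simp
    qed simp
    also have "\<dots> = ennreal ?c * (\<integral>\<^sup>+u. indicator (ball 0 1) u *
        (ennreal (rho u powr \<alpha>) * indicator (tube \<zeta> R) u) \<partial>lborel)"
      by (subst nn_integral_lborel_translate) simp_all
    also have "\<dots> = (\<integral>\<^sup>+u. indicator (tube \<zeta> R) u \<partial>?M)"
      by (rule nn_integral_weighted_measure[OF \<alpha>, symmetric]) simp
    also have "\<dots> = ennreal (measure ?M (tube \<zeta> R))"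
      using finite_measure.emeasure_eq_measure[OF finite_weighted_measure[OF \<alpha>], of "tube \<zeta> R"]
        sets_tube_weighted_measure[of \<zeta> R \<alpha>] by (simp only: nn_integral_indicator)
    finally show "c' * R powr (real CARD('n) + 1 + \<alpha>) \<le> measure ?M (tube \<zeta> R)"
      by (simp add: ennreal_le_iff)
  qed
qed

section \<open>The kernel\<close>

definition bker :: "real \<Rightarrow> complex ^ 'n \<Rightarrow> complex ^ 'n \<Rightarrow> complex" where
  "bker s z w = (1 - hinner z w) powr complex_of_real (- s)"

lemma bergman_proj_eq:
  "bergman_proj \<alpha> f (z :: complex ^ 'n) =
     (LINT w|weighted_measure \<alpha>. f w * bker (real CARD('n) + 1 + \<alpha>) z w)"
  unfolding bergman_proj_def bker_def of_real_minus powr_minus divide_inverse ..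

lemma cmod_bker: "cmod (bker s z w) = cmod (1 - hinner z w) powr (- s)"
  by (simp add: bker_def norm_powr_real_powr')

lemma measurable_bker [measurable (raw)]:
  fixes f g :: "'a \<Rightarrow> complex ^ 'n"
  assumes [measurable]: "f \<in> borel_measurable M" "g \<in> borel_measurable M"
  shows "(\<lambda>x. bker s (f x) (g x)) \<in> borel_measurable M"
  unfolding bker_def by measurable

lemma cmod_hinner_less_1:
  assumes "norm z < 1" "norm w \<le> 1"
  shows "cmod (hinner z w) < 1"
  using cmod_hinner_le[of z w] mult_left_mono[OF assms(2), of "norm z"] assms(1) by simp

lemma Re_one_minus_pos: "cmod x < 1 \<Longrightarrow> 0 < Re (1 - x)"
  using complex_Re_le_cmod[of x] by simp

lemma Re_pos_not_nonpos_Reals: "0 < Re x \<Longrightarrow> x \<notin> \<real>\<^sub>\<le>\<^sub>0"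
  by (auto simp: complex_nonpos_Reals_iff)

lemma has_field_derivative_one_minus_powr:
  assumes "cmod x < 1"
  shows "((\<lambda>x. (1 - x) powr complex_of_real (- s)) has_field_derivative
           of_real s * (1 - x) powr complex_of_real (- (s + 1))) (at x within S)"
proof -
  have "1 - x \<notin> \<real>\<^sub>\<le>\<^sub>0" using assms by (intro Re_pos_not_nonpos_Reals Re_one_minus_pos)
  then have "((\<lambda>x. (1 - x) powr complex_of_real (- s)) has_field_derivative
      complex_of_real (- s) * (1 - x) powr (complex_of_real (- s) - 1) * (0 - 1)) (at x)"
    by (auto intro!: derivative_eq_intros)
  moreover have "complex_of_real (- s) - 1 = complex_of_real (- (s + 1))" by simp
  ultimately show ?thesis by (auto intro: has_field_derivative_at_within)
qed

text \<open>The mean value inequality on the convex set where \<open>Re x > 0\<close> and \<open>x\<close> is close to \<open>y\<close>.\<close>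

lemma powr_difference_le:
  assumes x: "0 < Re x" and y: "0 < Re y" and xy: "cmod (x - y) \<le> cmod y / 2" and s: "s > 0"
  shows "cmod (x powr complex_of_real (- s) - y powr complex_of_real (- s))
    \<le> s * 2 powr (s + 1) * cmod (x - y) * cmod y powr (- (s + 1))"
proof -
  define S where "S = {u. 0 < Re u} \<inter> cball y (cmod y / 2)"
  have "convex S" unfolding S_def
    using convex_halfspace_gt[of 0 "1 :: complex"] by (intro convex_Int) (auto simp: inner_complex_def)
  have "y \<noteq> 0" using y by auto
  have "cmod (x powr complex_of_real (- s) - y powr complex_of_real (- s))
      \<le> s * (cmod y / 2) powr (- (s + 1)) * cmod (x - y)"
  proof (rule field_differentiable_bound[OF \<open>convex S\<close>])
    fix u assume u: "u \<in> S"
    have "u \<notin> \<real>\<^sub>\<le>\<^sub>0" using u by (intro Re_pos_not_nonpos_Reals) (auto simp: S_def)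
    then show "((\<lambda>u. u powr complex_of_real (- s)) has_field_derivative
        complex_of_real (- s) * u powr (complex_of_real (- s) - 1)) (at u within S)"
      by (rule has_field_derivative_at_within[OF has_field_derivative_powr])
    have "cmod y - cmod u \<le> cmod (y - u)" by (rule norm_triangle_ineq2)
    also have "\<dots> \<le> cmod y / 2" using u by (simp add: S_def dist_norm)
    finally have u2: "cmod y / 2 \<le> cmod u" by simp
    have e: "complex_of_real (- s) - 1 = complex_of_real (- (s + 1))" by simp
    have "cmod (complex_of_real (- s) * u powr (complex_of_real (- s) - 1)) = s * cmod u powr (- (s + 1))"
      unfolding e norm_mult using s by (simp add: norm_powr_real_powr' del: of_real_minus of_real_add)
    also have "\<dots> \<le> s * (cmod y / 2) powr (- (s + 1))"
      using s u2 \<open>y \<noteq> 0\<close> by (intro mult_left_mono powr_mono2') auto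
    finally show "cmod (complex_of_real (- s) * u powr (complex_of_real (- s) - 1))
        \<le> s * (cmod y / 2) powr (- (s + 1))" .
  qed (use x y xy in \<open>auto simp: S_def dist_norm norm_minus_commute\<close>)
  also have "(cmod y / 2) powr (- (s + 1)) = 2 powr (s + 1) * cmod y powr (- (s + 1))"
    unfolding powr_divide powr_minus[of 2 "s + 1"] by (simp add: divide_inverse)
  finally show ?thesis by (simp add: mult_ac)
qed

text \<open>
  If \<open>w\<close> is close to \<open>\<zeta>\<close>, then so are \<open>hinner z w\<close> and \<open>hinner z \<zeta>\<close>: split off the components
  along \<open>\<zeta>\<close> and estimate the orthogonal parts by Pythagoras.
\<close>

lemma hinner_difference_le:
  assumes \<zeta>: "norm \<zeta> = 1" and z: "norm z \<le> 1" and w: "norm w \<le> 1"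
  shows "cmod (hinner z \<zeta> - hinner z w)
    \<le> cmod (1 - hinner w \<zeta>) + 2 * sqrt (cmod (1 - hinner z \<zeta>)) * sqrt (cmod (1 - hinner w \<zeta>))"
proof -
  let ?P = "\<lambda>v. v - hinner v \<zeta> *s \<zeta>"
  have P: "norm (?P v) \<le> sqrt (2 * cmod (1 - hinner v \<zeta>))" if v: "norm v \<le> 1" for v
  proof (rule real_le_rsqrt)
    have le1: "cmod (hinner v \<zeta>) \<le> 1" using cmod_hinner_le[of v \<zeta>] v \<zeta> by simp
    have "(norm (?P v))\<^sup>2 = (norm v)\<^sup>2 - (cmod (hinner v \<zeta>))\<^sup>2" by (rule norm_orthogonal_part[OF \<zeta>])
    also have "\<dots> \<le> 1 - (cmod (hinner v \<zeta>))\<^sup>2" using v by (simp add: power_le_one)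
    also have "\<dots> = (1 - cmod (hinner v \<zeta>)) * (1 + cmod (hinner v \<zeta>))"
      by (simp add: power2_eq_square algebra_simps)
    also have "\<dots> \<le> cmod (1 - hinner v \<zeta>) * 2"
      using le1 norm_triangle_ineq2[of 1 "hinner v \<zeta>"] by (intro mult_mono) auto
    finally show "(norm (?P v))\<^sup>2 \<le> 2 * cmod (1 - hinner v \<zeta>)" by simp
  qed
  have "hinner z w = hinner z \<zeta> * hinner \<zeta> w + hinner (?P z) (?P w)" by (rule hinner_split[OF \<zeta>])
  then have "hinner z \<zeta> - hinner z w = hinner z \<zeta> * (1 - hinner \<zeta> w) - hinner (?P z) (?P w)"
    by (simp add: algebra_simps)
  then have "cmod (hinner z \<zeta> - hinner z w)
      \<le> cmod (hinner z \<zeta>) * cmod (1 - hinner \<zeta> w) + cmod (hinner (?P z) (?P w))"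
    using norm_triangle_ineq4[of "hinner z \<zeta> * (1 - hinner \<zeta> w)" "hinner (?P z) (?P w)"] by (simp add: norm_mult)
  also have "\<dots> \<le> 1 * cmod (1 - hinner w \<zeta>) + norm (?P z) * norm (?P w)"
    using cmod_hinner_le[of z \<zeta>] \<zeta> z cmod_one_minus_hinner_commute[of \<zeta> w]
    by (intro add_mono mult_mono cmod_hinner_le) auto
  also have "norm (?P z) * norm (?P w) \<le> sqrt (2 * cmod (1 - hinner z \<zeta>)) * sqrt (2 * cmod (1 - hinner w \<zeta>))"
    by (intro mult_mono P z w) auto
  also have "\<dots> = 2 * sqrt (cmod (1 - hinner z \<zeta>)) * sqrt (cmod (1 - hinner w \<zeta>))"
    by (simp add: real_sqrt_mult)
  finally show ?thesis by simp
qed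

text \<open>
  The constant \<open>36\<close> places \<open>z\<close> so far from the tube that the difference of the two inner products is
  at most half of the distance to the singularity, as the mean value estimate requires.
\<close>

lemma kernel_difference_le:
  assumes \<zeta>: "norm \<zeta> = 1" and z: "norm z < 1" and w: "w \<in> tube \<zeta> R" and R: "R > 0"
    and far: "36 * R \<le> cmod (1 - hinner z \<zeta>)" and s: "s > 0"
  shows "cmod (bker s z w - bker s z \<zeta>)
    \<le> 3 * s * 2 powr (s + 1) * sqrt R * cmod (1 - hinner z \<zeta>) powr (- (s + 1 / 2))"
proof -
  define Y where "Y = cmod (1 - hinner z \<zeta>)"
  have Y: "36 * R \<le> Y" "Y > 0" using far R by (auto simp: Y_def)
  have w1: "norm w < 1" "cmod (1 - hinner w \<zeta>) < R" using w by (auto simp: tube_def)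
  have sR: "sqrt R \<le> sqrt Y / 6"
  proof -
    have "sqrt (36 * R) \<le> sqrt Y" using Y by simp
    moreover have "sqrt (36 * R) = 6 * sqrt R" using real_sqrt_abs[of 6] by (simp add: real_sqrt_mult)
    ultimately show ?thesis by simp
  qed
  have RR: "R = sqrt R * sqrt R" "Y = sqrt Y * sqrt Y" using R Y by simp_all
  have "cmod (hinner z \<zeta> - hinner z w) \<le> R + 2 * sqrt Y * sqrt R"
  proof -
    have "2 * sqrt Y * sqrt (cmod (1 - hinner w \<zeta>)) \<le> 2 * sqrt Y * sqrt R"
      using w1 Y by (intro mult_left_mono) auto
    then show ?thesis using hinner_difference_le[OF \<zeta>, of z w] z w1 unfolding Y_def by linarith
  qed
  moreover have "R \<le> sqrt R * sqrt Y"
  proof -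
    have "sqrt R * sqrt R \<le> sqrt R * sqrt Y" using Y R by (intro mult_left_mono) auto
    then show ?thesis using RR(1) by simp
  qed
  ultimately have d: "cmod (hinner z \<zeta> - hinner z w) \<le> 3 * sqrt R * sqrt Y"
    by (simp add: algebra_simps)
  also have "\<dots> \<le> Y / 2"
  proof -
    have "3 * sqrt R * sqrt Y \<le> 3 * (sqrt Y / 6) * sqrt Y" using sR Y by (intro mult_right_mono) auto
    then show ?thesis using RR(2) by simp
  qed
  finally have d2: "cmod ((1 - hinner z w) - (1 - hinner z \<zeta>)) \<le> cmod (1 - hinner z \<zeta>) / 2"
    by (simp add: Y_def)
  have "cmod (bker s z w - bker s z \<zeta>)
      \<le> s * 2 powr (s + 1) * cmod ((1 - hinner z w) - (1 - hinner z \<zeta>)) * cmod (1 - hinner z \<zeta>) powr (- (s + 1))"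
    unfolding bker_def
    by (rule powr_difference_le[OF _ _ d2 s]; intro Re_one_minus_pos cmod_hinner_less_1 z)
       (use w1 \<zeta> in auto)
  also have "\<dots> = s * 2 powr (s + 1) * cmod (hinner z \<zeta> - hinner z w) * Y powr (- (s + 1))"
    by (simp add: Y_def)
  also have "\<dots> \<le> s * 2 powr (s + 1) * (3 * sqrt R * sqrt Y) * Y powr (- (s + 1))"
    using d s by (intro mult_right_mono mult_left_mono) auto
  also have "sqrt Y = Y powr (1 / 2)" using Y by (simp add: powr_half_sqrt)
  also have "s * 2 powr (s + 1) * (3 * sqrt R * Y powr (1 / 2)) * Y powr (- (s + 1))
      = 3 * s * 2 powr (s + 1) * sqrt R * Y powr (1 / 2 + - (s + 1))"
    unfolding powr_add by (simp add: mult_ac)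
  also have "1 / 2 + - (s + 1) = - (s + 1 / 2)" by (simp add: field_simps)
  finally show ?thesis by (simp add: Y_def)
qed

section \<open>Projections of integrable functions are holomorphic\<close>

lemma integrable_mult_bounded_kernel:
  fixes a g :: "'a \<Rightarrow> complex"
  assumes "integrable M a" and [measurable]: "g \<in> borel_measurable M"
    and "\<And>w. w \<in> space M \<Longrightarrow> cmod (g w) \<le> B"
  shows "integrable M (\<lambda>w. a w * g w)"
proof (rule Bochner_Integration.integrable_bound)
  show "integrable M (\<lambda>w. B * cmod (a w))" using assms(1) by auto
  show "(\<lambda>w. a w * g w) \<in> borel_measurable M" using borel_measurable_integrable[OF assms(1)] by measurable
  show "AE w in M. norm (a w * g w) \<le> norm (B * cmod (a w))"
  proof (rule AE_I2)
    fix w assume "w \<in> space M"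
    then have "0 \<le> B" using assms(3) norm_ge_zero order_trans by blast
    then show "norm (a w * g w) \<le> norm (B * cmod (a w))"
      using assms(3)[OF \<open>w \<in> space M\<close>] mult_right_mono[of "cmod (g w)" B "cmod (a w)"]
      by (simp add: norm_mult mult.commute)
  qed
qed

lemma bker_bound:
  assumes "s > 0" "norm z \<le> r" "r < 1" "norm w < 1"
  shows "cmod (bker s z w) \<le> (1 - r) powr (- s)"
proof -
  have "norm w * norm z \<le> 1 * r" using assms by (intro mult_mono) auto
  then have "1 - r \<le> cmod (1 - hinner z w)"
    using cmod_hinner_le[of z w] norm_triangle_ineq2[of 1 "hinner z w"] by (simp add: mult.commute)
  then show ?thesis unfolding cmod_bker using assms by (intro powr_mono2') auto
qed

lemma measurable_bker_weighted_measure: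
  "(\<lambda>w. bker s z w) \<in> borel_measurable (weighted_measure \<alpha>)"
  by (rule measurable_weighted_measure) simp

lemma bergman_proj_integrable:
  assumes "integrable (weighted_measure \<alpha>) a" "norm z < 1" "s > 0"
  shows "integrable (weighted_measure \<alpha>) (\<lambda>w. a w * bker s z w)"
  using bker_bound[OF assms(3) order_refl assms(2)]
  by (intro integrable_mult_bounded_kernel[OF assms(1) measurable_bker_weighted_measure]) auto

text \<open>
  A second order Taylor estimate of the kernel, uniform in \<open>w\<close>, allows differentiation under the
  integral sign.
\<close>

lemma bker_taylor:
  assumes s: "s > 0" and r: "norm z \<le> r" "norm (z + h) \<le> r" "r < 1" and w: "norm w < 1"
  shows "cmod (bker s (z + h) w - bker s z w - of_real s * (hinner h w * bker (s + 1) z w))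
    \<le> s * (s + 1) * (1 - r) powr (- (s + 2)) * (norm h)\<^sup>2"
proof -
  define x y where "x = hinner z w" and "y = hinner (z + h) w"
  have le: "cmod (hinner v w) \<le> r" if "norm v \<le> r" for v
    using cmod_hinner_le[of v w] mult_left_mono[of "norm w" 1 "norm v"] that w by simp
  define f :: "nat \<Rightarrow> complex \<Rightarrow> complex" where
    "f i u = (if i = 0 then 1 else if i = 1 then of_real s else of_real (s * (s + 1)))
       * (1 - u) powr complex_of_real (- (s + real i))" for i u
  have "0 \<le> r" using r by (meson norm_ge_zero order_trans)
  have "cmod (f 0 y - (\<Sum>i\<le>1. f i x * (y - x) ^ i / fact i))
      \<le> (s * (s + 1) * (1 - r) powr (- (s + 2))) * cmod (y - x) ^ Suc 1 / fact 1"
  proof (rule complex_Taylor[of "cball 0 r" 1 f])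
    show "(f i has_field_derivative f (Suc i) u) (at u within cball 0 r)" if u: "u \<in> cball 0 r" and "i \<le> 1" for i u
    proof -
      have u1: "cmod u < 1" using u r by simp
      have e: "s + real i + 1 = s + real (Suc i)" by simp
      show ?thesis
        unfolding f_def
        by (rule DERIV_cong[OF DERIV_cmult[OF has_field_derivative_one_minus_powr[OF u1, of "s + real i"]]])
           (use \<open>i \<le> 1\<close> in \<open>auto simp: le_Suc_eq e add.assoc\<close>)
    qed
    show "cmod (f (Suc 1) u) \<le> s * (s + 1) * (1 - r) powr (- (s + 2))" if u: "u \<in> cball 0 r" for u
    proof -
      have "1 - r \<le> cmod (1 - u)" using u norm_triangle_ineq2[of 1 u] by simp
      then have "cmod (1 - u) powr (- (s + 2)) \<le> (1 - r) powr (- (s + 2))"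
        using r s by (intro powr_mono2') auto
      moreover have "cmod (f (Suc 1) u) = s * (s + 1) * cmod (1 - u) powr (- (s + 2))"
        using s norm_of_real[of "s * (s + 1)", where 'a = complex]
        by (simp add: f_def norm_mult norm_powr_real_powr' abs_mult del: of_real_mult of_real_add)
      ultimately show ?thesis using s by (simp add: mult_left_mono)
    qed
    show "x \<in> cball 0 r" "y \<in> cball 0 r" using le r by (auto simp: x_def y_def)
  qed simp
  moreover have "y - x = hinner h w" by (simp add: x_def y_def hinner_add_left)
  moreover have "cmod (hinner h w) \<le> norm h"
    using cmod_hinner_le[of h w] mult_left_mono[of "norm w" 1 "norm h"] w by simp
  then have "(s * (s + 1) * (1 - r) powr (- (s + 2))) * cmod (hinner h w) ^ 2
      \<le> (s * (s + 1) * (1 - r) powr (- (s + 2))) * (norm h)\<^sup>2"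
    using s by (intro mult_left_mono power_mono) auto
  moreover have "f 0 y - (\<Sum>i\<le>1. f i x * (y - x) ^ i / fact i)
      = bker s (z + h) w - bker s z w - of_real s * ((y - x) * bker (s + 1) z w)"
  proof -
    have "f 1 x = of_real s * bker (s + 1) z w" "f 0 x = bker s z w" "f 0 y = bker s (z + h) w"
      by (simp_all add: f_def bker_def x_def y_def del: of_real_add of_real_minus)
    then show ?thesis by (simp add: mult_ac)
  qed
  ultimately show ?thesis by (simp add: power2_eq_square)
qed

lemma holomorphic_bergman_proj:
  fixes a :: "complex ^ 'n \<Rightarrow> complex"
  assumes \<alpha>: "\<alpha> > -1" and a: "integrable (weighted_measure \<alpha>) a"
  shows "holomorphic_sv (bergman_proj \<alpha> a) (ball 0 1)"
  unfolding holomorphic_sv_def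
proof
  let ?M = "weighted_measure \<alpha> :: (complex ^ 'n) measure"
  define s where "s = real CARD('n) + 1 + \<alpha>"
  have s: "s > 0" using \<alpha> by (simp add: s_def)
  fix z :: "complex ^ 'n" assume "z \<in> ball 0 1"
  then have z: "norm z < 1" by simp
  define r where "r = (1 + norm z) / 2"
  have r: "norm z < r" "r < 1" using z by (auto simp: r_def)
  define k where "k h w = of_real s * (hinner h w * bker (s + 1) z w)" for h w
  have kint: "integrable ?M (\<lambda>w. a w * k h w)" for h
  proof (rule integrable_mult_bounded_kernel[OF a])
    show "k h \<in> borel_measurable ?M"
      unfolding k_def by (rule measurable_weighted_measure) simp
    fix w assume "w \<in> space ?M"
    then have w: "norm w < 1" by simp
    have "cmod (k h w) = s * (cmod (hinner h w) * cmod (bker (s + 1) z w))"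
      using s by (simp add: k_def norm_mult)
    also have "\<dots> \<le> s * (norm h * 1 * (1 - r) powr (- (s + 1)))"
      using cmod_hinner_le[of h w] mult_left_mono[of "norm w" 1 "norm h"] w s r
        bker_bound[of "s + 1" z r w]
      by (intro mult_left_mono mult_mono) auto
    finally show "cmod (k h w) \<le> s * (norm h * 1 * (1 - r) powr (- (s + 1)))" .
  qed
  define D where "D h = (LINT w|?M. a w * k h w)" for h
  define C where "C = s * (s + 1) * (1 - r) powr (- (s + 2)) * (LINT w|?M. cmod (a w))"
  have D1: "D (h1 + h2) = D h1 + D h2" for h1 h2
    unfolding D_def by (subst Bochner_Integration.integral_add[OF kint kint, symmetric])
      (simp add: k_def hinner_add_left algebra_simps)
  have D2: "D (c *s h) = c * D h" for c h
    unfolding D_def by (subst integral_mult_right_zero[symmetric])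
      (simp add: k_def hinner_scale_left mult_ac)
  have "linear D"
    by (intro linearI) (simp_all add: D1 D2 scaleR_eq_scale scaleR_conv_of_real)
  have est: "cmod (bergman_proj \<alpha> a (z + h) - bergman_proj \<alpha> a z - D h) \<le> C * (norm h)\<^sup>2"
    if h: "norm h < r - norm z" for h
  proof -
    have zh: "norm (z + h) \<le> r" using norm_triangle_ineq[of z h] h by simp
    note i1 = bergman_proj_integrable[OF a, of "z + h" s] and i2 = bergman_proj_integrable[OF a z s]
    have zh1: "norm (z + h) < 1" using zh r by simp
    have "bergman_proj \<alpha> a (z + h) - bergman_proj \<alpha> a z - D h
        = (LINT w|?M. a w * bker s (z + h) w - a w * bker s z w - a w * k h w)"
      unfolding bergman_proj_eq D_def s_def[symmetric]
      using i1[OF zh1 s] i2 kint by simp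
    also have "cmod \<dots> \<le> (LINT w|?M. s * (s + 1) * (1 - r) powr (- (s + 2)) * (norm h)\<^sup>2 * cmod (a w))"
    proof (rule order_trans[OF integral_norm_bound Bochner_Integration.integral_mono])
      show "integrable ?M (\<lambda>w. cmod (a w * bker s (z + h) w - a w * bker s z w - a w * k h w))"
        using i1[OF zh1 s] i2 kint by simp
      show "integrable ?M (\<lambda>w. s * (s + 1) * (1 - r) powr (- (s + 2)) * (norm h)\<^sup>2 * cmod (a w))"
        using a by auto
      fix w assume "w \<in> space ?M"
      then have w: "norm w < 1" by simp
      have "a w * bker s (z + h) w - a w * bker s z w - a w * k h w
          = a w * (bker s (z + h) w - bker s z w - k h w)" by (simp add: algebra_simps)
      then show "cmod (a w * bker s (z + h) w - a w * bker s z w - a w * k h w)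
          \<le> s * (s + 1) * (1 - r) powr (- (s + 2)) * (norm h)\<^sup>2 * cmod (a w)"
        using mult_left_mono[OF bker_taylor[OF s _ zh r(2) w], of "cmod (a w)"] r
        by (simp add: norm_mult k_def mult.commute)
    qed
    also have "\<dots> = C * (norm h)\<^sup>2" by (simp add: C_def mult_ac)
    finally show ?thesis .
  qed
  have "(bergman_proj \<alpha> a has_derivative D) (at z)"
    unfolding has_derivative_at
  proof
    show "bounded_linear D" using \<open>linear D\<close> by (simp add: linear_conv_bounded_linear)
    show "(\<lambda>h. norm (bergman_proj \<alpha> a (z + h) - bergman_proj \<alpha> a z - D h) / norm h) \<midarrow>0\<rightarrow> 0"
    proof (rule Lim_null_comparison)
      have "eventually (\<lambda>h :: complex ^ 'n. norm h < r - norm z) (at 0)"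
        using r by (auto simp: eventually_at intro!: exI[of _ "r - norm z"])
      then show "\<forall>\<^sub>F h in at 0. norm (norm (bergman_proj \<alpha> a (z + h) - bergman_proj \<alpha> a z - D h) / norm h) \<le> C * norm h"
      proof eventually_elim
        case (elim h)
        show ?case
        proof (cases "h = 0")
          case False
          then show ?thesis using est[OF elim] by (simp add: divide_le_eq power2_eq_square mult.assoc)
        qed simp
      qed
      show "(\<lambda>h :: complex ^ 'n. C * norm h) \<midarrow>0\<rightarrow> 0"
        by (auto intro!: tendsto_eq_intros)
    qed
  qed
  then show "\<exists>D. (bergman_proj \<alpha> a has_derivative D) (at z) \<and> (\<forall>c v. D (c *s v) = c * D v)"
    using D2 by blast
qed

lemma holomorphic_sv_continuous:
  "holomorphic_sv f U \<Longrightarrow> continuous_on U f"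
  unfolding holomorphic_sv_def
  by (meson continuous_at_imp_continuous_on has_derivative_continuous)

section \<open>Projections of atoms are bounded in norm\<close>

lemma Lq_fun_integrable:
  fixes a :: "complex ^ 'n \<Rightarrow> complex"
  assumes \<alpha>: "\<alpha> > -1" and q: "q > 1" and a: "a \<in> Lq_fun (weighted_measure \<alpha>) q"
  shows "integrable (weighted_measure \<alpha>) a"
proof -
  interpret finite_measure "weighted_measure \<alpha> :: (complex ^ 'n) measure"
    by (rule finite_weighted_measure[OF \<alpha>])
  show ?thesis
  proof (rule Bochner_Integration.integrable_bound)
    show "integrable (weighted_measure \<alpha>) (\<lambda>w. 1 + cmod (a w) powr q)"
      using a by (auto simp: Lq_fun_def)
    show "a \<in> borel_measurable (weighted_measure \<alpha>)" using a by (simp add: Lq_fun_def)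
    show "AE w in weighted_measure \<alpha>. norm (a w) \<le> norm (1 + cmod (a w) powr q)"
    proof (rule AE_I2)
      fix w
      have "cmod (a w) \<le> 1 + cmod (a w) powr q"
      proof (cases "cmod (a w) \<le> 1")
        case False
        then have "cmod (a w) powr 1 \<le> cmod (a w) powr q" using q by (intro powr_mono) auto
        then show ?thesis by simp
      qed (simp add: add_increasing2)
      then show "norm (a w) \<le> norm (1 + cmod (a w) powr q)" by simp
    qed
  qed
qed

text \<open>
  Without the sharp constants of Young's inequality, it suffices to compare \<open>b\<close> with \<open>a powr (q - 1)\<close>.
\<close>

lemma weak_Young:
  assumes "q > 1" "0 \<le> a" "0 \<le> (b :: real)"
  shows "a * b \<le> a powr q + b powr (q / (q - 1))"
proof (cases "b \<le> a powr (q - 1)")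
  case True
  have "a * b \<le> a * a powr (q - 1)" using True assms by (intro mult_left_mono) auto
  also have "\<dots> = a powr q" using assms powr_add[of a 1 "q - 1"] by (cases "a = 0") auto
  finally show ?thesis by (simp add: add_increasing2)
next
  case False
  have b: "b > 0" using False powr_ge_zero[of a "q - 1"] by linarith
  have "a = (a powr (q - 1)) powr (1 / (q - 1))" using assms by (simp add: powr_powr)
  also have "\<dots> \<le> b powr (1 / (q - 1))" using False assms by (intro powr_mono2) auto
  finally have "a * b \<le> b powr (1 / (q - 1)) * b" using b by (intro mult_right_mono) auto
  also have "\<dots> = b powr (1 / (q - 1) + 1)" using b by (simp add: powr_add)
  also have "1 / (q - 1) + 1 = q / (q - 1)" using assms by (simp add: field_simps)
  finally show ?thesis by (simp add: add_increasing)
qed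

lemma carleson_tube_eq: "r > 0 \<Longrightarrow> carleson_tube \<zeta> r = tube \<zeta> (r\<^sup>2)"
  by (auto simp: carleson_tube_def tube_def qdist_def real_less_lsqrt real_sqrt_less_iff
      intro: real_less_rsqrt) (metis abs_of_pos real_sqrt_abs real_sqrt_less_iff)

lemma is_carleson_tubeE:
  assumes "is_carleson_tube (Q :: (complex ^ 'n) set)"
  obtains \<zeta> R where "norm \<zeta> = 1" "0 < R" "R \<le> 4" "Q = tube \<zeta> R"
proof -
  obtain \<zeta> r where *: "norm \<zeta> = 1" "r > 0" "Q = carleson_tube \<zeta> r"
    using assms by (auto simp: is_carleson_tube_def)
  have "Q = tube \<zeta> (min (r\<^sup>2) 4)"
  proof (cases "r\<^sup>2 \<le> 4")
    case False
    then show ?thesis using * tube_eq_ball[of \<zeta> "r\<^sup>2"] tube_eq_ball[of \<zeta> 4] by (simp add: carleson_tube_eq)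
  qed (use * in \<open>simp add: carleson_tube_eq min_def\<close>)
  then show ?thesis using that[of \<zeta> "min (r\<^sup>2) 4"] * by auto
qed

lemma is_carleson_tubeI:
  assumes "norm \<zeta> = 1" "R > 0"
  shows "is_carleson_tube (tube \<zeta> R)"
proof -
  have "tube \<zeta> R = carleson_tube \<zeta> (sqrt R)" using assms by (simp add: carleson_tube_eq)
  then show ?thesis using assms unfolding is_carleson_tube_def by (metis dist_0_norm mem_sphere real_sqrt_gt_zero)
qed

text \<open>
  Up to constants this is Hoelder's inequality: the weight has a bounded mean of order
  \<open>q / (q - 1)\<close> over the tube as long as \<open>\<epsilon>\<close> is small. It is here that atoms with \<open>q > 1\<close> are better
  than integrable functions.
\<close>

lemma atom_weighted_integral_le:
  fixes q \<alpha> :: real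
  assumes \<alpha>: "\<alpha> > -1" and q: "q > 1"
  obtains C \<epsilon> where "C > 0" "\<epsilon> > 0" and
    "\<And>(a :: complex ^ 'n \<Rightarrow> complex) \<zeta> R. norm \<zeta> = 1 \<Longrightarrow> 0 < R \<Longrightarrow> R \<le> 4 \<Longrightarrow>
       a \<in> Lq_fun (weighted_measure \<alpha>) q \<Longrightarrow>
       (AE w in weighted_measure \<alpha>. w \<notin> tube \<zeta> R \<longrightarrow> a w = 0) \<Longrightarrow>
       Lq_norm (weighted_measure \<alpha>) q a \<le> measure (weighted_measure \<alpha>) (tube \<zeta> R) powr (1 / q - 1) \<Longrightarrow>
       (\<integral>\<^sup>+w. ennreal (cmod (a w) * (R / rho w) powr \<epsilon>) \<partial>weighted_measure \<alpha>) \<le> ennreal C"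
proof -
  let ?M = "weighted_measure \<alpha> :: (complex ^ 'n) measure"
  define s where "s = real CARD('n) + 1 + \<alpha>"
  define q' where "q' = q / (q - 1)"
  have q': "q' > 0" using q by (simp add: q'_def)
  \<comment> \<open>With this choice \<open>rho powr (\<alpha> - \<epsilon> * q')\<close> is still integrable.\<close>
  define \<epsilon> where "\<epsilon> = (\<alpha> + 1) / (2 * q')"
  have \<epsilon>: "\<epsilon> > 0" using \<alpha> q' by (simp add: \<epsilon>_def)
  have "\<epsilon> * q' = (\<alpha> + 1) / 2" using q' by (simp add: \<epsilon>_def)
  then have \<sigma>: "\<alpha> - \<epsilon> * q' > -1" using \<alpha> by simp
  obtain C1 where C1: "C1 > 0" and le: "\<And>(\<eta> :: complex ^ 'n) R. norm \<eta> \<le> 1 \<Longrightarrow> 0 < R \<Longrightarrow>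
       (\<integral>\<^sup>+w. indicator (tube \<eta> R) w * ennreal (rho w powr (- (\<epsilon> * q'))) \<partial>?M)
         \<le> ennreal (C1 * R powr (real CARD('n) + 1 + \<alpha> - \<epsilon> * q'))"
    using weighted_tube_integral_le[OF \<alpha> \<sigma>, where 'n = 'n] by blast
  obtain c where c: "c > 0" and ge: "\<And>(\<zeta> :: complex ^ 'n) R. norm \<zeta> = 1 \<Longrightarrow> 0 < R \<Longrightarrow> R \<le> 4 \<Longrightarrow>
       c * R powr (real CARD('n) + 1 + \<alpha>) \<le> measure ?M (tube \<zeta> R)"
    using measure_tube_ge[OF \<alpha>, where 'n = 'n] by blast
  show ?thesis
  proof (rule that[of "1 + C1 / c" \<epsilon>])
    show "1 + C1 / c > 0" using C1 c by (simp add: add_pos_pos)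
    show "\<epsilon> > 0" by (rule \<epsilon>)
    fix a :: "complex ^ 'n \<Rightarrow> complex" and \<zeta> :: "complex ^ 'n" and R :: real
    assume \<zeta>: "norm \<zeta> = 1" and R: "0 < R" "R \<le> 4" and a: "a \<in> Lq_fun ?M q"
      and supp: "AE w in ?M. w \<notin> tube \<zeta> R \<longrightarrow> a w = 0"
      and nrm: "Lq_norm ?M q a \<le> measure ?M (tube \<zeta> R) powr (1 / q - 1)"
    define V where "V = measure ?M (tube \<zeta> R)"
    have VR: "c * R powr s \<le> V" unfolding V_def s_def by (rule ge[OF \<zeta> R])
    have V: "V > 0" using VR c R less_le_trans[of 0 "c * R powr s" V] by simp
    define I where "I = (LINT w|?M. cmod (a w) powr q)"
    have I0: "I \<ge> 0" by (simp add: I_def)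
    have [measurable]: "a \<in> borel_measurable ?M" and int: "integrable ?M (\<lambda>w. cmod (a w) powr q)"
      using a by (auto simp: Lq_fun_def)
    have [measurable]: "rho \<in> borel_measurable ?M" "tube \<zeta> R \<in> sets ?M"
      using measurable_weighted_measure[OF borel_measurable_rho] sets_tube_weighted_measure by auto
    have "I = (I powr (1 / q)) powr q" using I0 q by (simp add: powr_powr)
    also have "\<dots> \<le> (V powr (1 / q - 1)) powr q"
      using nrm q unfolding Lq_norm_def I_def[symmetric] V_def[symmetric] by (intro powr_mono2) auto
    also have "\<dots> = V powr (1 - q)"
    proof -
      have "(1 / q - 1) * q = 1 - q" using q by (simp add: field_simps)
      then show ?thesis by (simp only: powr_powr)
    qed
    finally have IV: "I \<le> V powr (1 - q)" .
    have "(\<integral>\<^sup>+w. ennreal (cmod (a w) * (R / rho w) powr \<epsilon>) \<partial>?M)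
        \<le> (\<integral>\<^sup>+w. ennreal (V powr (q - 1)) * ennreal (cmod (a w) powr q)
            + ennreal (R powr (\<epsilon> * q') / V) * (indicator (tube \<zeta> R) w * ennreal (rho w powr (- (\<epsilon> * q')))) \<partial>?M)"
    proof (rule nn_integral_mono_AE)
      show "AE w in ?M. ennreal (cmod (a w) * (R / rho w) powr \<epsilon>)
        \<le> ennreal (V powr (q - 1)) * ennreal (cmod (a w) powr q)
            + ennreal (R powr (\<epsilon> * q') / V) * (indicator (tube \<zeta> R) w * ennreal (rho w powr (- (\<epsilon> * q'))))"
        using supp
      proof eventually_elim
        case (elim w)
        show ?case
        proof (cases "w \<in> tube \<zeta> R")
          case True
          then have w: "0 < rho w" by (auto simp: tube_def intro: rho_pos)
          have "cmod (a w) * (R / rho w) powr \<epsilon> = (cmod (a w) * V) * (R / rho w) powr \<epsilon> / V"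
            using V by simp
          also have "\<dots> \<le> ((cmod (a w) * V) powr q + ((R / rho w) powr \<epsilon>) powr q') / V"
            unfolding q'_def using V q by (intro divide_right_mono weak_Young) auto
          also have "\<dots> = V powr (q - 1) * cmod (a w) powr q + R powr (\<epsilon> * q') / V * rho w powr (- (\<epsilon> * q'))"
            using V R w by (simp add: powr_mult powr_powr powr_divide powr_diff powr_minus field_simps)
          finally show ?thesis using True V
            by (simp add: ennreal_mult[symmetric] ennreal_plus[symmetric] ennreal_leI del: ennreal_plus)
        next
          case False
          then show ?thesis using elim by simp
        qed
      qed
    qed
    also have "\<dots> = ennreal (V powr (q - 1)) * (\<integral>\<^sup>+w. ennreal (cmod (a w) powr q) \<partial>?M)
          + ennreal (R powr (\<epsilon> * q') / V) * (\<integral>\<^sup>+w. indicator (tube \<zeta> R) w * ennreal (rho w powr (- (\<epsilon> * q'))) \<partial>?M)"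
      by (subst nn_integral_add) (simp_all add: nn_integral_cmult)
    also have "(\<integral>\<^sup>+w. ennreal (cmod (a w) powr q) \<partial>?M) = ennreal I"
      unfolding I_def by (rule nn_integral_eq_integral[OF int]) simp
    also have "ennreal (V powr (q - 1)) * ennreal I \<le> ennreal 1"
    proof -
      have "V powr (q - 1) * I \<le> V powr (q - 1) * V powr (1 - q)" using IV by (intro mult_left_mono) auto
      also have "\<dots> = 1" using V by (simp add: powr_add[symmetric])
      finally show ?thesis using I0 by (simp add: ennreal_mult[symmetric])
    qed
    also have "ennreal (R powr (\<epsilon> * q') / V) * (\<integral>\<^sup>+w. indicator (tube \<zeta> R) w * ennreal (rho w powr (- (\<epsilon> * q'))) \<partial>?M)
        \<le> ennreal (C1 / c)"
    proof -
      have "ennreal (R powr (\<epsilon> * q') / V) * (\<integral>\<^sup>+w. indicator (tube \<zeta> R) w * ennreal (rho w powr (- (\<epsilon> * q'))) \<partial>?M)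
          \<le> ennreal (R powr (\<epsilon> * q') / V) * ennreal (C1 * R powr (s - \<epsilon> * q'))"
        unfolding s_def using \<zeta> R by (intro mult_left_mono le) auto
      also have "\<dots> = ennreal (C1 * R powr s / V)"
        using V C1 R by (simp add: ennreal_mult[symmetric] powr_diff)
      also have "\<dots> \<le> ennreal (C1 / c)"
      proof (rule ennreal_leI)
        have "C1 * (c * R powr s) \<le> C1 * V" using VR C1 by (intro mult_left_mono) auto
        then show "C1 * R powr s / V \<le> C1 / c" using V c by (simp add: field_simps)
      qed
      finally show ?thesis .
    qed
    finally show "(\<integral>\<^sup>+w. ennreal (cmod (a w) * (R / rho w) powr \<epsilon>) \<partial>?M) \<le> ennreal (1 + C1 / c)"
      using C1 c by (simp add: add_mono)
  qed
qed

text \<open>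
  The integral of the kernel just fails to be bounded. For points of the tube,
  \<open>cmod (1 - hinner z w)\<close> lies between \<open>rho w / 2\<close> and \<open>49 * R\<close>, so inserting a small power of
  \<open>49 * R / cmod (1 - hinner z w)\<close> only increases the integrand and makes it decay faster; the
  integral outside the tube of size \<open>rho w / 2\<close> around \<open>w\<close> is then controlled.
\<close>

lemma kernel_tube_integral_le:
  fixes \<epsilon> :: real
  assumes \<alpha>: "\<alpha> > -1" and \<epsilon>: "\<epsilon> > 0"
  obtains C where "C > 0" and
    "\<And>(\<zeta> :: complex ^ 'n) R w. norm \<zeta> = 1 \<Longrightarrow> 0 < R \<Longrightarrow> w \<in> tube \<zeta> R \<Longrightarrow>
       (\<integral>\<^sup>+z. indicator (tube \<zeta> (36 * R)) z * ennreal (cmod (bker (real CARD('n) + 1 + \<alpha>) z w)) \<partial>weighted_measure \<alpha>)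
         \<le> ennreal (C * (R / rho w) powr \<epsilon>)"
proof -
  let ?M = "weighted_measure \<alpha> :: (complex ^ 'n) measure"
  define s where "s = real CARD('n) + 1 + \<alpha>"
  obtain C1 where C1: "C1 > 0" and le: "\<And>(\<eta> :: complex ^ 'n) R. norm \<eta> \<le> 1 \<Longrightarrow> 0 < R \<Longrightarrow>
       (\<integral>\<^sup>+w. indicator (ball 0 1 - tube \<eta> R) w *
          ennreal (cmod (1 - hinner w \<eta>) powr (- (real CARD('n) + 1 + \<alpha> + \<epsilon>))) \<partial>?M)
         \<le> ennreal (C1 * R powr (- \<epsilon>))"
    using weighted_outer_integral_le[OF \<alpha> \<epsilon>, where 'n = 'n] by blast
  show ?thesis
  proof (rule that[of "C1 * 98 powr \<epsilon>"])
    show "C1 * 98 powr \<epsilon> > 0" using C1 by simp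
    fix \<zeta> w :: "complex ^ 'n" and R :: real
    assume \<zeta>: "norm \<zeta> = 1" and R: "0 < R" and w: "w \<in> tube \<zeta> R"
    have w1: "norm w < 1" "cmod (1 - hinner w \<zeta>) < R" using w by (auto simp: tube_def)
    have rho: "rho w > 0" by (rule rho_pos[OF w1(1)])
    have [measurable]: "tube w (rho w / 2) \<in> sets ?M" "ball 0 1 \<in> sets ?M"
      "(\<lambda>z. cmod (1 - hinner z w)) \<in> borel_measurable ?M"
      by (auto intro: sets_tube_weighted_measure sets_weighted_measureI measurable_weighted_measure)
    have "(\<integral>\<^sup>+z. indicator (tube \<zeta> (36 * R)) z * ennreal (cmod (bker s z w)) \<partial>?M)
        \<le> (\<integral>\<^sup>+z. ennreal ((49 * R) powr \<epsilon>) * (indicator (ball 0 1 - tube w (rho w / 2)) z *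
             ennreal (cmod (1 - hinner z w) powr (- (s + \<epsilon>)))) \<partial>?M)"
    proof (rule nn_integral_mono)
      fix z assume "z \<in> space ?M"
      then have z: "norm z < 1" by simp
      show "indicator (tube \<zeta> (36 * R)) z * ennreal (cmod (bker s z w))
        \<le> ennreal ((49 * R) powr \<epsilon>) * (indicator (ball 0 1 - tube w (rho w / 2)) z *
             ennreal (cmod (1 - hinner z w) powr (- (s + \<epsilon>))))"
      proof (cases "z \<in> tube \<zeta> (36 * R)")
        case True
        then have z2: "cmod (1 - hinner z \<zeta>) < 36 * R" by (simp add: tube_def)
        define Y where "Y = cmod (1 - hinner z w)"
        have "rho w \<le> 2 * cmod (1 - hinner w z)" using rho_less_tube[OF w1(1)] z by simp
        then have Y: "rho w / 2 \<le> Y" by (simp add: Y_def cmod_one_minus_hinner_commute[of z w])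
        then have Y0: "Y > 0" using rho by linarith
        have "Y \<le> cmod (1 - hinner z \<zeta>) + cmod (hinner z \<zeta> - hinner z w)"
          using norm_triangle_ineq[of "1 - hinner z \<zeta>" "hinner z \<zeta> - hinner z w"] by (simp add: Y_def)
        also have "\<dots> \<le> 36 * R + (R + 2 * sqrt (36 * R) * sqrt R)"
        proof (intro add_mono)
          have "2 * sqrt (cmod (1 - hinner z \<zeta>)) * sqrt (cmod (1 - hinner w \<zeta>)) \<le> 2 * sqrt (36 * R) * sqrt R"
            using z2 w1 R by (intro mult_mono) auto
          then show "cmod (hinner z \<zeta> - hinner z w) \<le> R + 2 * sqrt (36 * R) * sqrt R"
            using hinner_difference_le[OF \<zeta>, of z w] z w1 by linarith
        qed (use z2 in simp)
        also have "sqrt (36 * R) = 6 * sqrt R" using real_sqrt_abs[of 6] by (simp add: real_sqrt_mult)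
        also have "36 * R + (R + 2 * (6 * sqrt R) * sqrt R) = 37 * R + 12 * (sqrt R * sqrt R)"
          by (simp add: algebra_simps)
        finally have "Y \<le> 49 * R" using R by simp
        then have "1 \<le> (49 * R / Y) powr \<epsilon>" using Y0 \<epsilon> by (intro ge_one_powr_ge_zero) auto
        then have "Y powr (- s) * 1 \<le> Y powr (- s) * (49 * R / Y) powr \<epsilon>" by (intro mult_left_mono) auto
        also have "\<dots> = (49 * R) powr \<epsilon> * Y powr (- (s + \<epsilon>))"
        proof -
          have "Y powr (- (s + \<epsilon>)) = Y powr (- s) * Y powr (- \<epsilon>)" by (simp flip: powr_add)
          moreover have "(49 * R / Y) powr \<epsilon> = (49 * R) powr \<epsilon> * Y powr (- \<epsilon>)"
            unfolding powr_divide powr_minus by (simp add: divide_inverse)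
          ultimately show ?thesis by simp
        qed
        finally have "Y powr (- s) \<le> (49 * R) powr \<epsilon> * Y powr (- (s + \<epsilon>))" by simp
        moreover have "z \<notin> tube w (rho w / 2)" using Y by (simp add: tube_def Y_def)
        ultimately show ?thesis using True z
          by (simp add: cmod_bker Y_def ennreal_mult[symmetric] ennreal_leI)
      qed simp
    qed
    also have "\<dots> = ennreal ((49 * R) powr \<epsilon>) * (\<integral>\<^sup>+z. indicator (ball 0 1 - tube w (rho w / 2)) z *
             ennreal (cmod (1 - hinner z w) powr (- (s + \<epsilon>))) \<partial>?M)"
      by (rule nn_integral_cmult) measurable
    also have "\<dots> \<le> ennreal ((49 * R) powr \<epsilon>) * ennreal (C1 * (rho w / 2) powr (- \<epsilon>))"
      unfolding s_def using w1 rho by (intro mult_left_mono le) auto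
    also have "\<dots> = ennreal (C1 * 98 powr \<epsilon> * (R / rho w) powr \<epsilon>)"
    proof -
      have "(49 * R) powr \<epsilon> * (rho w / 2) powr (- \<epsilon>) = (49 * R) powr \<epsilon> * (2 / rho w) powr \<epsilon>"
        using rho by (simp add: powr_minus powr_divide)
      also have "\<dots> = 98 powr \<epsilon> * (R / rho w) powr \<epsilon>"
        using R rho by (simp add: powr_mult[symmetric] del: powr_numeral)
      finally show ?thesis using C1 by (simp add: ennreal_mult[symmetric] mult_ac)
    qed
    finally show "(\<integral>\<^sup>+z. indicator (tube \<zeta> (36 * R)) z * ennreal (cmod (bker (real CARD('n) + 1 + \<alpha>) z w)) \<partial>?M)
         \<le> ennreal (C1 * 98 powr \<epsilon> * (R / rho w) powr \<epsilon>)"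
      unfolding s_def .
  qed
qed

text \<open>
  Near the tube the kernel is integrated in absolute value; away from it the vanishing mean of the
  atom replaces the kernel by its difference from the kernel at the centre of the tube.
\<close>

lemma proj_tube_atom_bound:
  fixes q \<alpha> :: real
  assumes \<alpha>: "\<alpha> > -1" and q: "q > 1"
  obtains C where "C > 0" and
    "\<And>(a :: complex ^ 'n \<Rightarrow> complex) \<zeta> R. norm \<zeta> = 1 \<Longrightarrow> 0 < R \<Longrightarrow> R \<le> 4 \<Longrightarrow>
       a \<in> Lq_fun (weighted_measure \<alpha>) q \<Longrightarrow>
       (AE w in weighted_measure \<alpha>. w \<notin> tube \<zeta> R \<longrightarrow> a w = 0) \<Longrightarrow>
       Lq_norm (weighted_measure \<alpha>) q a \<le> measure (weighted_measure \<alpha>) (tube \<zeta> R) powr (1 / q - 1) \<Longrightarrow>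
       (LINT w|weighted_measure \<alpha>. a w) = 0 \<Longrightarrow>
       (\<integral>\<^sup>+z. ennreal (cmod (bergman_proj \<alpha> a z)) \<partial>weighted_measure \<alpha>) \<le> ennreal C"
proof -
  let ?M = "weighted_measure \<alpha> :: (complex ^ 'n) measure"
  define s where "s = real CARD('n) + 1 + \<alpha>"
  have s: "s > 0" using \<alpha> by (simp add: s_def)
  obtain C1 \<epsilon> where C1: "C1 > 0" and \<epsilon>: "\<epsilon> > 0" and atom:
    "\<And>(a :: complex ^ 'n \<Rightarrow> complex) \<zeta> R. norm \<zeta> = 1 \<Longrightarrow> 0 < R \<Longrightarrow> R \<le> 4 \<Longrightarrow>
       a \<in> Lq_fun ?M q \<Longrightarrow>
       (AE w in ?M. w \<notin> tube \<zeta> R \<longrightarrow> a w = 0) \<Longrightarrow>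
       Lq_norm ?M q a \<le> measure ?M (tube \<zeta> R) powr (1 / q - 1) \<Longrightarrow>
       (\<integral>\<^sup>+w. ennreal (cmod (a w) * (R / rho w) powr \<epsilon>) \<partial>?M) \<le> ennreal C1"
    using atom_weighted_integral_le[OF \<alpha> q, where 'n = 'n] by blast
  obtain C2 where C2: "C2 > 0" and near: "\<And>(\<zeta> :: complex ^ 'n) R w. norm \<zeta> = 1 \<Longrightarrow> 0 < R \<Longrightarrow> w \<in> tube \<zeta> R \<Longrightarrow>
       (\<integral>\<^sup>+z. indicator (tube \<zeta> (36 * R)) z * ennreal (cmod (bker (real CARD('n) + 1 + \<alpha>) z w)) \<partial>?M)
         \<le> ennreal (C2 * (R / rho w) powr \<epsilon>)"
    using kernel_tube_integral_le[OF \<alpha> \<epsilon>, where 'n = 'n] by blast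
  obtain C3 where C3: "C3 > 0" and far: "\<And>(\<eta> :: complex ^ 'n) R. norm \<eta> \<le> 1 \<Longrightarrow> 0 < R \<Longrightarrow>
       (\<integral>\<^sup>+w. indicator (ball 0 1 - tube \<eta> R) w *
          ennreal (cmod (1 - hinner w \<eta>) powr (- (real CARD('n) + 1 + \<alpha> + 1 / 2))) \<partial>?M)
         \<le> ennreal (C3 * R powr (- (1 / 2)))"
    using weighted_outer_integral_le[OF \<alpha>, of "1 / 2", where 'n = 'n] by auto
  define B where "B = 3 * s * 2 powr (s + 1)"
  have B: "B > 0" using s by (simp add: B_def)
  define C where "C = C2 * C1 + B * (2 powr \<epsilon> * C1) * C3"
  show ?thesis
  proof (rule that[of C])
    show "C > 0" using B C1 C2 C3 unfolding C_def by (intro add_pos_pos mult_pos_pos) auto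
    fix a :: "complex ^ 'n \<Rightarrow> complex" and \<zeta> :: "complex ^ 'n" and R :: real
    assume \<zeta>: "norm \<zeta> = 1" and R: "0 < R" "R \<le> 4" and a: "a \<in> Lq_fun ?M q"
      and supp: "AE w in ?M. w \<notin> tube \<zeta> R \<longrightarrow> a w = 0"
      and nrm: "Lq_norm ?M q a \<le> measure ?M (tube \<zeta> R) powr (1 / q - 1)"
      and mean: "(LINT w|?M. a w) = 0"
    have int: "integrable ?M a" by (rule Lq_fun_integrable[OF \<alpha> q a])
    interpret finite_measure ?M by (rule finite_weighted_measure[OF \<alpha>])
    interpret pair_sigma_finite ?M ?M ..
    have [measurable]: "a \<in> borel_measurable ?M" "rho \<in> borel_measurable ?M"
      "tube \<zeta> S \<in> sets ?M" "(\<lambda>w. w) \<in> borel_measurable ?M" "ball 0 1 \<in> sets ?M"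
      "(\<lambda>z. bker s z u) \<in> borel_measurable ?M" "(\<lambda>z. bker s u z) \<in> borel_measurable ?M"
      "(\<lambda>z. cmod (1 - hinner z \<zeta>)) \<in> borel_measurable ?M" for S u
      using int by (auto intro: sets_tube_weighted_measure sets_weighted_measureI measurable_weighted_measure)
    note aw = atom[OF \<zeta> R a supp nrm]
    let ?T = "tube \<zeta> (36 * R)"
    have P: "bergman_proj \<alpha> a z = (LINT w|?M. a w * bker s z w)" for z
      by (simp add: bergman_proj_eq s_def)
    have ai: "integrable ?M (\<lambda>w. a w * bker s z w)" if "norm z < 1" for z
      by (rule bergman_proj_integrable[OF int that s])
    have L1: "ennreal (LINT w|?M. cmod (a w)) \<le> ennreal (2 powr \<epsilon> * C1)"
    proof -
      have "ennreal (LINT w|?M. cmod (a w)) = (\<integral>\<^sup>+w. ennreal (cmod (a w)) \<partial>?M)"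
        using int by (intro nn_integral_eq_integral[symmetric]) auto
      also have "\<dots> \<le> (\<integral>\<^sup>+w. ennreal (2 powr \<epsilon>) * ennreal (cmod (a w) * (R / rho w) powr \<epsilon>) \<partial>?M)"
      proof (rule nn_integral_mono_AE)
        show "AE w in ?M. ennreal (cmod (a w)) \<le> ennreal (2 powr \<epsilon>) * ennreal (cmod (a w) * (R / rho w) powr \<epsilon>)"
          using supp
        proof eventually_elim
          case (elim w)
          show ?case
          proof (cases "w \<in> tube \<zeta> R")
            case True
            then have w: "norm w < 1" "cmod (1 - hinner w \<zeta>) < R" by (auto simp: tube_def)
            have "rho w > 0" "rho w \<le> 2 * R" using rho_pos[OF w(1)] rho_less_tube[OF w(1), of \<zeta>] w \<zeta> by auto
            then have "1 \<le> (2 * (R / rho w)) powr \<epsilon>" using \<epsilon> by (intro ge_one_powr_ge_zero) auto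
            also have "\<dots> = 2 powr \<epsilon> * (R / rho w) powr \<epsilon>"
              by (rule powr_mult)
            finally have "cmod (a w) * 1 \<le> cmod (a w) * (2 powr \<epsilon> * (R / rho w) powr \<epsilon>)"
              by (intro mult_left_mono) auto
            then show ?thesis by (simp add: ennreal_mult[symmetric] ennreal_leI mult_ac)
          qed (use elim in simp)
        qed
      qed
      also have "\<dots> = ennreal (2 powr \<epsilon>) * (\<integral>\<^sup>+w. ennreal (cmod (a w) * (R / rho w) powr \<epsilon>) \<partial>?M)"
        by (rule nn_integral_cmult) measurable
      also have "\<dots> \<le> ennreal (2 powr \<epsilon>) * ennreal C1" by (intro mult_left_mono aw) auto
      finally show ?thesis using C1 by (simp add: ennreal_mult[symmetric])
    qed
    have part1: "(\<integral>\<^sup>+z. indicator ?T z * ennreal (cmod (bergman_proj \<alpha> a z)) \<partial>?M) \<le> ennreal (C2 * C1)"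
    proof -
      have "(\<integral>\<^sup>+z. indicator ?T z * ennreal (cmod (bergman_proj \<alpha> a z)) \<partial>?M)
          \<le> (\<integral>\<^sup>+z. (\<integral>\<^sup>+w. indicator ?T z * ennreal (cmod (a w) * cmod (bker s z w)) \<partial>?M) \<partial>?M)"
      proof (rule nn_integral_mono)
        fix z assume "z \<in> space ?M"
        then have z: "norm z < 1" by simp
        have "ennreal (cmod (bergman_proj \<alpha> a z)) \<le> (\<integral>\<^sup>+w. ennreal (norm (a w * bker s z w)) \<partial>?M)"
          unfolding P by (rule integral_norm_bound_ennreal[OF ai[OF z]])
        then show "indicator ?T z * ennreal (cmod (bergman_proj \<alpha> a z))
            \<le> (\<integral>\<^sup>+w. indicator ?T z * ennreal (cmod (a w) * cmod (bker s z w)) \<partial>?M)"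
          by (simp add: nn_integral_cmult norm_mult mult_left_mono)
      qed
      also have "\<dots> = (\<integral>\<^sup>+w. (\<integral>\<^sup>+z. indicator ?T z * ennreal (cmod (a w) * cmod (bker s z w)) \<partial>?M) \<partial>?M)"
        by (rule Fubini'[symmetric]) measurable
      also have "\<dots> \<le> (\<integral>\<^sup>+w. ennreal C2 * ennreal (cmod (a w) * (R / rho w) powr \<epsilon>) \<partial>?M)"
      proof (rule nn_integral_mono_AE)
        show "AE w in ?M. (\<integral>\<^sup>+z. indicator ?T z * ennreal (cmod (a w) * cmod (bker s z w)) \<partial>?M)
            \<le> ennreal C2 * ennreal (cmod (a w) * (R / rho w) powr \<epsilon>)"
          using supp
        proof eventually_elim
          case (elim w)
          show ?case
          proof (cases "w \<in> tube \<zeta> R")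
            case True
            have "(\<integral>\<^sup>+z. indicator ?T z * ennreal (cmod (a w) * cmod (bker s z w)) \<partial>?M)
                = (\<integral>\<^sup>+z. ennreal (cmod (a w)) * (indicator ?T z * ennreal (cmod (bker s z w))) \<partial>?M)"
              by (rule nn_integral_cong) (simp add: ennreal_mult mult_ac)
            also have "\<dots> = ennreal (cmod (a w)) * (\<integral>\<^sup>+z. indicator ?T z * ennreal (cmod (bker s z w)) \<partial>?M)"
              by (rule nn_integral_cmult) measurable
            also have "\<dots> \<le> ennreal (cmod (a w)) * ennreal (C2 * (R / rho w) powr \<epsilon>)"
              unfolding s_def by (intro mult_left_mono near \<zeta> R True) auto
            finally show ?thesis using C2 by (simp add: ennreal_mult[symmetric] mult_ac)
          qed (use elim in simp)
        qed
      qed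
      also have "\<dots> = ennreal C2 * (\<integral>\<^sup>+w. ennreal (cmod (a w) * (R / rho w) powr \<epsilon>) \<partial>?M)"
        by (rule nn_integral_cmult) measurable
      also have "\<dots> \<le> ennreal C2 * ennreal C1" by (intro mult_left_mono aw) auto
      finally show ?thesis using C1 C2 by (simp add: ennreal_mult[symmetric])
    qed
    have part2: "(\<integral>\<^sup>+z. indicator (ball 0 1 - ?T) z * ennreal (cmod (bergman_proj \<alpha> a z)) \<partial>?M)
        \<le> ennreal (B * (2 powr \<epsilon> * C1) * C3)"
    proof -
      have "(\<integral>\<^sup>+z. indicator (ball 0 1 - ?T) z * ennreal (cmod (bergman_proj \<alpha> a z)) \<partial>?M)
          \<le> (\<integral>\<^sup>+z. ennreal (B * sqrt R * (2 powr \<epsilon> * C1)) *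
              (indicator (ball 0 1 - ?T) z * ennreal (cmod (1 - hinner z \<zeta>) powr (- (s + 1 / 2)))) \<partial>?M)"
      proof (rule nn_integral_mono)
        fix z assume "z \<in> space ?M"
        then have z: "norm z < 1" by simp
        show "indicator (ball 0 1 - ?T) z * ennreal (cmod (bergman_proj \<alpha> a z))
          \<le> ennreal (B * sqrt R * (2 powr \<epsilon> * C1)) *
              (indicator (ball 0 1 - ?T) z * ennreal (cmod (1 - hinner z \<zeta>) powr (- (s + 1 / 2))))"
        proof (cases "z \<in> ?T")
          case False
          then have out: "36 * R \<le> cmod (1 - hinner z \<zeta>)" using z by (simp add: tube_def)
          define Y where "Y = cmod (1 - hinner z \<zeta>) powr (- (s + 1 / 2))"
          have "bergman_proj \<alpha> a z = (LINT w|?M. a w * bker s z w) - (LINT w|?M. a w) * bker s z \<zeta>"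
            by (simp add: P mean)
          also have "\<dots> = (LINT w|?M. a w * bker s z w - a w * bker s z \<zeta>)"
            using ai[OF z] int by simp
          also have "cmod \<dots> \<le> (LINT w|?M. B * sqrt R * Y * cmod (a w))"
          proof (rule order_trans[OF integral_norm_bound integral_mono_AE])
            show "integrable ?M (\<lambda>w. cmod (a w * bker s z w - a w * bker s z \<zeta>))" using ai[OF z] int by simp
            show "integrable ?M (\<lambda>w. B * sqrt R * Y * cmod (a w))" using int by auto
            show "AE w in ?M. cmod (a w * bker s z w - a w * bker s z \<zeta>) \<le> B * sqrt R * Y * cmod (a w)"
              using supp
            proof eventually_elim
              case (elim w)
              show ?case
              proof (cases "w \<in> tube \<zeta> R")
                case True
                have "cmod (a w * bker s z w - a w * bker s z \<zeta>) = cmod (a w) * cmod (bker s z w - bker s z \<zeta>)"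
                  by (simp add: norm_mult[symmetric] algebra_simps)
                also have "\<dots> \<le> cmod (a w) * (3 * s * 2 powr (s + 1) * sqrt R * Y)"
                  unfolding Y_def by (intro mult_left_mono kernel_difference_le[OF \<zeta> z True R(1) out s]) auto
                finally show ?thesis by (simp add: B_def mult_ac)
              qed (use elim in simp)
            qed
          qed
          also have "\<dots> = B * sqrt R * Y * (LINT w|?M. cmod (a w))" by simp
          also have "\<dots> \<le> B * sqrt R * Y * (2 powr \<epsilon> * C1)"
            using L1 C1 B R by (intro mult_left_mono) (auto simp: ennreal_le_iff Y_def)
          finally have "cmod (bergman_proj \<alpha> a z) \<le> B * sqrt R * (2 powr \<epsilon> * C1) * Y" by (simp add: mult_ac)
          then show ?thesis using False z B R C1
            by (simp add: Y_def ennreal_mult[symmetric] ennreal_leI)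
        qed simp
      qed
      also have "\<dots> = ennreal (B * sqrt R * (2 powr \<epsilon> * C1)) *
          (\<integral>\<^sup>+z. indicator (ball 0 1 - ?T) z * ennreal (cmod (1 - hinner z \<zeta>) powr (- (s + 1 / 2))) \<partial>?M)"
        by (rule nn_integral_cmult) measurable
      also have "\<dots> \<le> ennreal (B * sqrt R * (2 powr \<epsilon> * C1)) * ennreal (C3 * (36 * R) powr (- (1 / 2)))"
        unfolding s_def using \<zeta> R by (intro mult_left_mono far) auto
      also have "\<dots> \<le> ennreal (B * (2 powr \<epsilon> * C1) * C3)"
      proof -
        have "(36 * R) powr (- (1 / 2)) \<le> R powr (- (1 / 2))" using R by (intro powr_mono2') auto
        then have "sqrt R * (36 * R) powr (- (1 / 2)) \<le> sqrt R * R powr (- (1 / 2))"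
          using R by (intro mult_left_mono) auto
        also have "\<dots> = 1" using R by (simp add: powr_half_sqrt[symmetric] powr_add[symmetric])
        finally have "B * (2 powr \<epsilon> * C1) * C3 * (sqrt R * (36 * R) powr (- (1 / 2))) \<le> B * (2 powr \<epsilon> * C1) * C3 * 1"
          using B C1 C3 by (intro mult_left_mono) auto
        then show ?thesis using B C1 C3 R by (simp add: ennreal_mult[symmetric] ennreal_leI mult_ac)
      qed
      finally show ?thesis .
    qed
    have hol: "holomorphic_sv (bergman_proj \<alpha> a) (ball 0 1)" by (rule holomorphic_bergman_proj[OF \<alpha> int])
    have [measurable]: "bergman_proj \<alpha> a \<in> borel_measurable ?M"
      by (intro continuous_measurable_weighted_measure holomorphic_sv_continuous hol)
    have "(\<integral>\<^sup>+z. ennreal (cmod (bergman_proj \<alpha> a z)) \<partial>?M)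
        = (\<integral>\<^sup>+z. indicator ?T z * ennreal (cmod (bergman_proj \<alpha> a z)) +
             indicator (ball 0 1 - ?T) z * ennreal (cmod (bergman_proj \<alpha> a z)) \<partial>?M)"
      by (rule nn_integral_cong) (auto simp: indicator_def)
    also have "\<dots> = (\<integral>\<^sup>+z. indicator ?T z * ennreal (cmod (bergman_proj \<alpha> a z)) \<partial>?M) +
        (\<integral>\<^sup>+z. indicator (ball 0 1 - ?T) z * ennreal (cmod (bergman_proj \<alpha> a z)) \<partial>?M)"
      by (rule nn_integral_add) measurable
    also have "\<dots> \<le> ennreal (C2 * C1) + ennreal (B * (2 powr \<epsilon> * C1) * C3)"
      by (rule add_mono[OF part1 part2])
    also have "\<dots> = ennreal C" using B C1 C2 C3 by (simp add: C_def ennreal_plus[symmetric] del: ennreal_plus)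
    finally show "(\<integral>\<^sup>+z. ennreal (cmod (bergman_proj \<alpha> a z)) \<partial>?M) \<le> ennreal C" .
  qed
qed

section \<open>Averages over circles\<close>

lemma root_of_unity_average:
  assumes "m \<noteq> j" "m < K" "j < K"
  shows "(\<Sum>p<K. cis (2 * pi * real p / real K) ^ m * cnj (cis (2 * pi * real p / real K)) ^ j) = 0"
proof -
  define x where "x = cis (2 * pi * (real m - real j) / real K)"
  have K: "K > 0" using assms by simp
  have power_eq: "cis (2 * pi * real p / real K) ^ m * cnj (cis (2 * pi * real p / real K)) ^ j = x ^ p" for p
    unfolding x_def cis_cnj Complex.DeMoivre cis_mult
    by (rule arg_cong[where f = cis]) (simp add: diff_divide_distrib right_diff_distrib mult_ac)
  have "x \<noteq> 1"
  proof
    assume "x = 1"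
    then have "cos (2 * pi * (real m - real j) / real K) = 1"
      unfolding x_def by (metis cis.sel(1) one_complex.sel(1))
    then obtain i :: int where "2 * pi * (real m - real j) / real K = of_int i * 2 * pi"
      using cos_one_2pi_int by blast
    then have "2 * pi * (real m - real j) = 2 * pi * (of_int i * real K)" using K by (simp add: field_simps)
    then have "real m - real j = of_int i * real K" unfolding mult_cancel_left by simp
    then have "real_of_int (int m - int j) = real_of_int (i * int K)" by simp
    then have "int m - int j = i * int K" by (simp only: of_int_eq_iff)
    moreover have "\<bar>int m - int j\<bar> < int K" "int m - int j \<noteq> 0" using assms by auto
    ultimately show False
      using zdvd_imp_le[of "int K" "\<bar>int m - int j\<bar>"] by (metis abs_of_nonneg abs_0_eq dvd_abs_iff dvd_triv_right
          linorder_not_le zero_less_abs_iff)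
  qed
  moreover have "x ^ K = 1"
  proof -
    have "x ^ K = cis (2 * pi * (real m - real j))"
      using K by (simp add: x_def Complex.DeMoivre)
    also have "\<dots> = cis (2 * pi * of_int (int m - int j))" by simp
    also have "\<dots> = 1" by (rule cis_multiple_2pi) simp
    finally show ?thesis .
  qed
  ultimately show ?thesis
    unfolding power_eq by (simp add: geometric_sum)
qed

lemma tendsto_root_of_unity_average:
  fixes A :: "nat \<Rightarrow> complex" and f :: "complex \<Rightarrow> complex"
  assumes A: "summable (\<lambda>m. cmod (A m))"
    and f: "\<And>\<xi>. cmod \<xi> = 1 \<Longrightarrow> (\<lambda>m. A m * \<xi> ^ m) sums (\<xi> ^ j * f \<xi>)"
  shows "(\<lambda>K. (\<Sum>p<K. f (cis (2 * pi * real p / real K))) / of_nat K) \<longlonglongrightarrow> A j"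
proof -
  define \<omega> where "\<omega> K p = cis (2 * pi * real p / real K)" for K p :: nat
  have \<omega>: "cmod (\<omega> K p) = 1" for K p by (simp add: \<omega>_def)
  have \<omega>j: "cnj (\<omega> K p) ^ j * \<omega> K p ^ j = 1" for K p
    using \<omega>[of K p] by (simp add: power_mult_distrib[symmetric] complex_norm_square[symmetric] mult.commute)
  define b where "b m K = A m * ((\<Sum>p<K. \<omega> K p ^ m * cnj (\<omega> K p) ^ j) / of_nat K)" for m K
  have S: "(\<Sum>m. b m K) = (\<Sum>p<K. f (\<omega> K p)) / of_nat K" for K
  proof -
    have "(\<lambda>m. cnj (\<omega> K p) ^ j * (A m * \<omega> K p ^ m)) sums (cnj (\<omega> K p) ^ j * (\<omega> K p ^ j * f (\<omega> K p)))" for p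
      by (intro sums_mult f \<omega>)
    then have "(\<lambda>m. cnj (\<omega> K p) ^ j * (A m * \<omega> K p ^ m)) sums f (\<omega> K p)" for p
      using \<omega>j by (simp add: mult.assoc[symmetric])
    then have "(\<lambda>m. (\<Sum>p<K. cnj (\<omega> K p) ^ j * (A m * \<omega> K p ^ m)) / of_nat K) sums ((\<Sum>p<K. f (\<omega> K p)) / of_nat K)"
      by (intro sums_divide sums_sum) auto
    moreover have "(\<Sum>p<K. cnj (\<omega> K p) ^ j * (A m * \<omega> K p ^ m)) / of_nat K = b m K" for m
      by (simp add: b_def sum_distrib_left mult_ac)
    ultimately show ?thesis by (simp add: sums_iff)
  qed
  have "(\<lambda>K. \<Sum>m. b m K) \<longlonglongrightarrow> (\<Sum>m. if m = j then A j else 0)"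
  proof (rule tannerys_theorem[THEN conjunct2, THEN conjunct2])
    fix m
    show "(\<lambda>K. b m K) \<longlonglongrightarrow> (if m = j then A j else 0)"
    proof (rule tendsto_eventually)
      show "\<forall>\<^sub>F K in sequentially. b m K = (if m = j then A j else 0)"
        using eventually_gt_at_top[of "max m j"]
      proof eventually_elim
        case (elim K)
        show ?case
        proof (cases "m = j")
          case True
          then show ?thesis using elim \<omega>j by (simp add: b_def mult.commute)
        next
          case False
          then show ?thesis using root_of_unity_average[of m j K] elim by (simp add: b_def \<omega>_def)
        qed
      qed
    qed
  next
    have "norm (b m K) \<le> cmod (A m)" for m K
    proof -
      have "cmod (\<Sum>p<K. \<omega> K p ^ m * cnj (\<omega> K p) ^ j) \<le> (\<Sum>p<K. 1)"
        by (rule order_trans[OF norm_sum]) (simp add: norm_mult norm_power \<omega>)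
      then have "cmod ((\<Sum>p<K. \<omega> K p ^ m * cnj (\<omega> K p) ^ j) / of_nat K) \<le> 1"
        by (cases "K = 0") (simp_all add: norm_divide divide_le_eq_1)
      then show ?thesis unfolding b_def norm_mult by (simp add: mult_left_le)
    qed
    then show "\<forall>\<^sub>F (m, K) in at_top \<times>\<^sub>F sequentially. norm (b m K) \<le> cmod (A m)"
      by (intro always_eventually) auto
  qed (use A in auto)
  moreover have "(\<Sum>m. if m = j then A j else 0) = A j"
    using suminf_finite[of "{j}" "\<lambda>m. if m = j then A j else 0"] by simp
  ultimately show ?thesis by (simp add: S \<omega>_def)
qed

text \<open>
  A function and its average over a circle of unitary maps have the same integral. Along the
  circle the function is a Laurent series, so the average picks out one coefficient. Averages over
  roots of unity are used, for which integration is a finite sum.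
\<close>

lemma integral_eq_circle_coefficient:
  fixes F L :: "complex ^ 'n \<Rightarrow> complex" and D :: "complex ^ 'n \<Rightarrow> real"
  assumes F[measurable]: "F \<in> borel_measurable borel" and L[measurable]: "L \<in> borel_measurable borel"
    and R: "\<And>\<xi>. cmod \<xi> = 1 \<Longrightarrow> unitary_map (R \<xi>)"
    and D: "integrable lborel D" and bound: "\<And>x \<xi>. cmod \<xi> = 1 \<Longrightarrow> cmod (F (R \<xi> x)) \<le> D x"
    and exp: "\<And>x. \<exists>A. summable (\<lambda>m. cmod (A m)) \<and> A j = L x \<and>
                 (\<forall>\<xi>. cmod \<xi> = 1 \<longrightarrow> (\<lambda>m. A m * \<xi> ^ m) sums (\<xi> ^ j * F (R \<xi> x)))"
  shows "(LINT x|lborel. F x) = (LINT x|lborel. L x)"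
proof -
  define \<omega> where "\<omega> K p = cis (2 * pi * real p / real K)" for K p :: nat
  have \<omega>: "cmod (\<omega> K p) = 1" for K p by (simp add: \<omega>_def)
  have meas: "(\<lambda>x. F (R (\<omega> K p) x)) \<in> borel_measurable borel" for K p
    using measurable_compose[OF borel_measurable_unitary[OF R[OF \<omega>]] F] .
  have int: "integrable lborel (\<lambda>x. F (R (\<omega> K p) x))" for K p
    by (rule Bochner_Integration.integrable_bound[OF D])
       (use meas bound[OF \<omega>] in \<open>auto intro!: AE_I2 order_trans[OF bound[OF \<omega>] abs_ge_self]\<close>)
  define G where "G K x = (\<Sum>p<K. F (R (\<omega> K p) x)) / of_nat K" for K x
  have "(\<lambda>K. LINT x|lborel. G K x) \<longlonglongrightarrow> (LINT x|lborel. L x)"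
  proof (rule integral_dominated_convergence[where w = D])
    show "G K \<in> borel_measurable lborel" for K
      unfolding G_def using meas by (intro borel_measurable_divide borel_measurable_sum) auto
    show "AE x in lborel. (\<lambda>K. G K x) \<longlonglongrightarrow> L x"
    proof (rule AE_I2)
      fix x :: "complex ^ 'n"
      obtain A where A: "summable (\<lambda>m. cmod (A m))" "A j = L x"
        "\<And>\<xi>. cmod \<xi> = 1 \<Longrightarrow> (\<lambda>m. A m * \<xi> ^ m) sums (\<xi> ^ j * F (R \<xi> x))" using exp[of x] by blast
      show "(\<lambda>K. G K x) \<longlonglongrightarrow> L x"
        using tendsto_root_of_unity_average[OF A(1,3)] A(2) by (simp add: G_def \<omega>_def)
    qed
    show "AE x in lborel. norm (G K x) \<le> D x" for K
    proof (rule AE_I2)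
      fix x :: "complex ^ 'n"
      have "cmod (F (R 1 x)) \<le> D x" by (rule bound) simp
      then have "0 \<le> D x" using norm_ge_zero[of "F (R 1 x)"] by linarith
      have "cmod (\<Sum>p<K. F (R (\<omega> K p) x)) \<le> (\<Sum>p<K. D x)"
        by (rule order_trans[OF norm_sum]) (intro sum_mono bound \<omega>)
      then show "norm (G K x) \<le> D x"
        using \<open>0 \<le> D x\<close> by (cases "K = 0") (simp_all add: G_def norm_divide divide_le_eq mult.commute)
    qed
  qed (use D in auto)
  moreover have "\<forall>\<^sub>F K in sequentially. (LINT x|lborel. G K x) = (LINT x|lborel. F x)"
    using eventually_gt_at_top[of 0]
  proof eventually_elim
    case (elim K)
    have "(LINT x|lborel. G K x) = (\<Sum>p<K. (LINT x|lborel. F (R (\<omega> K p) x))) / of_nat K"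
      unfolding G_def using int by simp
    also have "\<dots> = (LINT x|lborel. F x)"
      using elim integral_unitary[OF R[OF \<omega>] F] by simp
    finally show ?case .
  qed
  then have "(\<lambda>K. LINT x|lborel. G K x) \<longlonglongrightarrow> (LINT x|lborel. F x)" by (rule tendsto_eventually)
  ultimately show ?thesis using LIMSEQ_unique by blast
qed

text \<open>
  Along the circle the base stays in the right half plane, and so it does on a slightly larger disc;
  this gives absolute convergence of the power series on the circle itself.
\<close>

lemma powr_circle_expansion:
  assumes "cmod Y < Re X"
  obtains A where "summable (\<lambda>m. cmod (A m))" "A 0 = X powr complex_of_real (- s)"
    "A 1 = of_real s * (Y * X powr complex_of_real (- (s + 1)))"
    "\<And>\<xi>. cmod \<xi> = 1 \<Longrightarrow> (\<lambda>m. A m * \<xi> ^ m) sums ((X - \<xi> * Y) powr complex_of_real (- s))"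
proof -
  obtain r where r: "1 < r" "r * cmod Y < Re X"
  proof (cases "Y = 0")
    case True
    then show ?thesis using that[of 2] assms by simp
  next
    case False
    then have "1 < Re X / cmod Y" using assms by simp
    then obtain r where "1 < r" "r < Re X / cmod Y" using dense by blast
    then show ?thesis using that[of r] False by (simp add: field_simps)
  qed
  define g where "g \<xi> = (X - \<xi> * Y) powr complex_of_real (- s)" for \<xi>
  have pos: "X - \<xi> * Y \<notin> \<real>\<^sub>\<le>\<^sub>0" if "cmod \<xi> < r" for \<xi>
  proof (rule Re_pos_not_nonpos_Reals)
    have "Re (\<xi> * Y) \<le> cmod (\<xi> * Y)" by (rule complex_Re_le_cmod)
    also have "\<dots> \<le> r * cmod Y" unfolding norm_mult using that by (intro mult_right_mono) auto
    finally show "0 < Re (X - \<xi> * Y)" using r by simp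
  qed
  have der: "(g has_field_derivative of_real s * (Y * (X - \<xi> * Y) powr complex_of_real (- (s + 1)))) (at \<xi>)"
    if "cmod \<xi> < r" for \<xi>
  proof -
    have "(g has_field_derivative complex_of_real (- s) * (X - \<xi> * Y) powr (complex_of_real (- s) - 1) * (0 - Y)) (at \<xi>)"
      unfolding g_def using pos[OF that] by (auto intro!: derivative_eq_intros)
    moreover have "complex_of_real (- s) - 1 = complex_of_real (- (s + 1))" by simp
    ultimately show ?thesis by (auto simp: mult_ac)
  qed
  have hol: "g holomorphic_on ball 0 r"
  proof (rule holomorphic_onI)
    fix \<xi> :: complex assume "\<xi> \<in> ball 0 r"
    then have "cmod \<xi> < r" by simp
    from der[OF this] show "g field_differentiable (at \<xi> within ball 0 r)"
      using field_differentiable_at_within field_differentiable_def by blast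
  qed
  define A where "A m = (deriv ^^ m) g 0 / fact m" for m
  have sums: "(\<lambda>m. A m * \<xi> ^ m) sums g \<xi>" if "cmod \<xi> < r" for \<xi>
    using holomorphic_power_series[OF hol, of \<xi>] that by (simp add: A_def)
  show ?thesis
  proof (rule that[of A])
    define t where "t = (1 + r) / 2"
    have t: "1 < t" "t < r" using r by (auto simp: t_def)
    have "summable (\<lambda>m. A m * of_real t ^ m)" using sums[of "of_real t"] t by (auto simp: sums_iff)
    then show "summable (\<lambda>m. cmod (A m))"
      using powser_insidea[of A "of_real t" 1] t by simp
    show "A 0 = X powr complex_of_real (- s)" by (simp add: A_def g_def)
    have "deriv g 0 = of_real s * (Y * X powr complex_of_real (- (s + 1)))"
      using DERIV_imp_deriv[OF der[of 0]] r by simp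
    then show "A 1 = of_real s * (Y * X powr complex_of_real (- (s + 1)))" by (simp add: A_def)
    show "(\<lambda>m. A m * \<xi> ^ m) sums ((X - \<xi> * Y) powr complex_of_real (- s))" if "cmod \<xi> = 1" for \<xi>
      using sums[of \<xi>] that r by (simp add: g_def)
  qed
qed

lemma integral_lborel_translate:
  fixes g :: "'a::euclidean_space \<Rightarrow> 'b::{banach, second_countable_topology}"
  assumes [measurable]: "g \<in> borel_measurable borel"
  shows "(LINT x|lborel. g (a + x)) = (LINT x|lborel. g x)"
proof -
  have "(LINT x|lborel. g x) = (LINT x|distr lborel borel ((+) a). g x)"
    by (simp add: lborel_distr_plus)
  then show ?thesis by (simp add: integral_distr)
qed

section \<open>Kernels as projections of functions living on cells\<close>

lemma cell_scale: "cmod \<xi> = 1 \<Longrightarrow> \<xi> *s v \<in> cell \<zeta> \<delta> \<longleftrightarrow> v \<in> cell \<zeta> \<delta>"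
  by (simp add: cell_def hinner_scale_left norm_mult norm_scale)

lemma cell_subset_ball: "cell \<zeta> \<delta> \<subseteq> cball 0 (sqrt (\<delta> / 6))"
  by (auto simp: cell_def intro!: real_le_rsqrt)

lemma emeasure_cell_finite: "emeasure lborel (cell \<zeta> \<delta>) < \<infinity>"
  by (rule le_less_trans[OF emeasure_mono[OF cell_subset_ball] emeasure_bounded_finite[OF bounded_cball]]) simp

lemma integrable_cell:
  fixes h :: "complex ^ 'n \<Rightarrow> 'b::{banach, second_countable_topology}"
  assumes [measurable]: "h \<in> borel_measurable borel" and "\<And>v. v \<in> cell \<zeta> \<delta> \<Longrightarrow> norm (h v) \<le> B"
  shows "integrable lborel (\<lambda>v. indicator (cell \<zeta> \<delta>) v *\<^sub>R h v)"
proof (rule integrableI_bounded_set_indicator)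
  show "emeasure lborel (cell \<zeta> \<delta>) < \<infinity>" by (rule emeasure_cell_finite)
  show "AE x in lborel. x \<in> cell \<zeta> \<delta> \<longrightarrow> norm (h x) \<le> B" using assms(2) by auto
qed auto

text \<open>
  The Bergman kernel is antiholomorphic in its second variable, so that its mean over a cell is
  its value at the centre, and its mean against a linear weight is a derivative at the centre.
\<close>

context
  fixes \<zeta> p z :: "complex ^ 'n" and \<delta> s :: real
  assumes \<zeta>: "norm \<zeta> = 1" and \<delta>: "0 < \<delta>" "\<delta> \<le> 1" and z: "norm z < 1" and s: "s > 0"
  defines "p \<equiv> (1 - \<delta>) *\<^sub>R \<zeta>"
begin

lemma cell_expansion:
  assumes v: "v \<in> cell \<zeta> \<delta>"
  obtains A where "summable (\<lambda>m. cmod (A m))" "A 0 = bker s z p"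
    "A 1 = of_real s * (hinner z v * bker (s + 1) z p)"
    "\<And>\<xi>. cmod \<xi> = 1 \<Longrightarrow> (\<lambda>m. A m * \<xi> ^ m) sums (bker s z (p + cnj \<xi> *s v))"
proof -
  have *: "cmod (hinner z v) < Re (1 - hinner z p)"
  proof -
    \<comment> \<open>The phase \<open>u\<close> makes \<open>u * hinner z v\<close> nonnegative; \<open>p + cnj u *s v\<close> still lies in the ball.\<close>
    define u where "u = (if hinner z v = 0 then 1 else cnj (sgn (hinner z v)))"
    have u: "cmod u = 1" by (simp add: u_def norm_sgn)
    have "u * hinner z v = complex_of_real (cmod (hinner z v))"
      by (auto simp: u_def sgn_eq complex_norm_square[symmetric] power2_eq_square field_simps
          mult.commute[of "cnj _"])
    then have "hinner z (p + cnj u *s v) = hinner z p + complex_of_real (cmod (hinner z v))"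
      by (simp add: hinner_add_right hinner_scale_right)
    moreover have "norm (p + cnj u *s v) < 1"
      unfolding p_def by (rule cell_bounds(3)[OF \<zeta> \<delta>]) (use v u in \<open>simp add: cell_scale\<close>)
    then have "0 < Re (1 - hinner z (p + cnj u *s v))"
      using cmod_hinner_less_1[OF z] by (intro Re_one_minus_pos) auto
    ultimately show ?thesis by simp
  qed
  obtain A where A: "summable (\<lambda>m. cmod (A m))" "A 0 = (1 - hinner z p) powr complex_of_real (- s)"
    "A 1 = of_real s * (hinner z v * (1 - hinner z p) powr complex_of_real (- (s + 1)))"
    "\<And>\<xi>. cmod \<xi> = 1 \<Longrightarrow> (\<lambda>m. A m * \<xi> ^ m) sums ((1 - hinner z p - \<xi> * hinner z v) powr complex_of_real (- s))"
    using powr_circle_expansion[OF *, of s] by blast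
  show ?thesis
  proof (rule that[of A])
    show "(\<lambda>m. A m * \<xi> ^ m) sums (bker s z (p + cnj \<xi> *s v))" if "cmod \<xi> = 1" for \<xi>
      using A(4)[OF that] by (simp add: bker_def hinner_add_right hinner_scale_right algebra_simps)
  qed (use A in \<open>auto simp: bker_def\<close>)
qed

lemma bker_cell_bound: "v \<in> cell \<zeta> \<delta> \<Longrightarrow> cmod (bker s z (p + v)) \<le> (1 - norm z) powr (- s)"
  using bker_bound[OF s order_refl z] cell_bounds(3)[OF \<zeta> \<delta>] unfolding p_def by blast

lemma integral_cell_bker:
  "(LINT v|lborel. indicator (cell \<zeta> \<delta>) v *\<^sub>R bker s z (p + v))
     = of_real (measure lborel (cell \<zeta> \<delta>)) * bker s z p"
proof -
  have "(LINT v|lborel. indicator (cell \<zeta> \<delta>) v *\<^sub>R bker s z (p + v))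
      = (LINT v|lborel. indicator (cell \<zeta> \<delta>) v *\<^sub>R bker s z p)"
  proof (rule integral_eq_circle_coefficient[where R = "\<lambda>\<xi>. (*s) (cnj \<xi>)" and j = 0
        and D = "\<lambda>v. indicator (cell \<zeta> \<delta>) v *\<^sub>R (1 - norm z) powr (- s)"])
    show "integrable lborel (\<lambda>v. indicator (cell \<zeta> \<delta>) v *\<^sub>R (1 - norm z) powr (- s))"
      by (rule integrable_cell[where B = "(1 - norm z) powr (- s)"]) auto
    fix v :: "complex ^ 'n"
    show "cmod (indicator (cell \<zeta> \<delta>) (cnj \<xi> *s v) *\<^sub>R bker s z (p + cnj \<xi> *s v))
        \<le> indicator (cell \<zeta> \<delta>) v *\<^sub>R (1 - norm z) powr (- s)" if "cmod \<xi> = 1" for \<xi>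
      using that bker_cell_bound[of "cnj \<xi> *s v"] by (auto simp: indicator_def cell_scale)
    show "\<exists>A. summable (\<lambda>m. cmod (A m)) \<and> A 0 = indicator (cell \<zeta> \<delta>) v *\<^sub>R bker s z p \<and>
        (\<forall>\<xi>. cmod \<xi> = 1 \<longrightarrow> (\<lambda>m. A m * \<xi> ^ m) sums
          (\<xi> ^ 0 * (indicator (cell \<zeta> \<delta>) (cnj \<xi> *s v) *\<^sub>R bker s z (p + cnj \<xi> *s v))))"
    proof (cases "v \<in> cell \<zeta> \<delta>")
      case True
      obtain A where A: "summable (\<lambda>m. cmod (A m))" "A 0 = bker s z p"
        "\<And>\<xi>. cmod \<xi> = 1 \<Longrightarrow> (\<lambda>m. A m * \<xi> ^ m) sums (bker s z (p + cnj \<xi> *s v))"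
        using cell_expansion[OF True] by metis
      then show ?thesis using True by (intro exI[of _ A]) (simp add: cell_scale)
    next
      case False
      then show ?thesis by (intro exI[of _ "\<lambda>_. 0"]) (simp add: cell_scale)
    qed
  qed (auto intro!: unitary_map_scale)
  also have "\<dots> = of_real (measure lborel (cell \<zeta> \<delta>)) * bker s z p"
    using emeasure_cell_finite[of \<zeta> \<delta>] by (simp add: scaleR_conv_of_real)
  finally show ?thesis .
qed

lemma integral_cell_linear_bker:
  "(LINT v|lborel. indicator (cell \<zeta> \<delta>) v *\<^sub>R (hinner v \<zeta> * bker s z (p + v)))
     = of_real (LINT v|lborel. indicator (cell \<zeta> \<delta>) v *\<^sub>R (cmod (hinner v \<zeta>))\<^sup>2)
         * (of_real s * (hinner z \<zeta> * bker (s + 1) z p))"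
proof -
  let ?E = "cell \<zeta> \<delta>"
  let ?B = "(1 - norm z) powr (- s)"
  have hv: "cmod (hinner v \<zeta>) \<le> 1" if "v \<in> ?E" for v
    using that \<delta> by (simp add: cell_def)
  have "(LINT v|lborel. indicator ?E v *\<^sub>R (hinner v \<zeta> * bker s z (p + v)))
      = (LINT v|lborel. indicator ?E v *\<^sub>R (hinner v \<zeta> * (of_real s * (hinner z v * bker (s + 1) z p))))"
  proof (rule integral_eq_circle_coefficient[where R = "\<lambda>\<xi>. (*s) (cnj \<xi>)" and j = 1
        and D = "\<lambda>v. indicator ?E v *\<^sub>R ?B"])
    show "integrable lborel (\<lambda>v. indicator ?E v *\<^sub>R ?B)"
      by (rule integrable_cell[where B = ?B]) auto
    fix v :: "complex ^ 'n"
    show "cmod (indicator ?E (cnj \<xi> *s v) *\<^sub>R (hinner (cnj \<xi> *s v) \<zeta> * bker s z (p + cnj \<xi> *s v)))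
        \<le> indicator ?E v *\<^sub>R ?B" if "cmod \<xi> = 1" for \<xi>
      using that mult_mono[OF hv[of "cnj \<xi> *s v"] bker_cell_bound[of "cnj \<xi> *s v"]]
      by (auto simp: indicator_def cell_scale norm_mult)
    show "\<exists>A. summable (\<lambda>m. cmod (A m)) \<and>
        A 1 = indicator ?E v *\<^sub>R (hinner v \<zeta> * (of_real s * (hinner z v * bker (s + 1) z p))) \<and>
        (\<forall>\<xi>. cmod \<xi> = 1 \<longrightarrow> (\<lambda>m. A m * \<xi> ^ m) sums
          (\<xi> ^ 1 * (indicator ?E (cnj \<xi> *s v) *\<^sub>R (hinner (cnj \<xi> *s v) \<zeta> * bker s z (p + cnj \<xi> *s v)))))"
    proof (cases "v \<in> ?E")
      case True
      obtain A where A: "summable (\<lambda>m. cmod (A m))" "A 0 = bker s z p"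
        "A 1 = of_real s * (hinner z v * bker (s + 1) z p)"
        "\<And>\<xi>. cmod \<xi> = 1 \<Longrightarrow> (\<lambda>m. A m * \<xi> ^ m) sums (bker s z (p + cnj \<xi> *s v))"
        using cell_expansion[OF True] by blast
      have "(\<lambda>m. hinner v \<zeta> * A m * \<xi> ^ m) sums
          (\<xi> * (hinner (cnj \<xi> *s v) \<zeta> * bker s z (p + cnj \<xi> *s v)))" if "cmod \<xi> = 1" for \<xi>
      proof -
        have "\<xi> * cnj \<xi> = 1" using that by (simp add: complex_norm_square[symmetric])
        then have eq: "\<xi> * (hinner (cnj \<xi> *s v) \<zeta> * bker s z (p + cnj \<xi> *s v)) = hinner v \<zeta> * bker s z (p + cnj \<xi> *s v)"
          by (simp add: hinner_scale_left mult.assoc[symmetric])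
        show ?thesis unfolding eq using sums_mult[OF A(4)[OF that], of "hinner v \<zeta>"] by (simp only: mult.assoc)
      qed
      moreover have "summable (\<lambda>m. cmod (hinner v \<zeta> * A m))"
        using A(1) by (simp add: norm_mult)
      ultimately show ?thesis using True A(3)
        by (intro exI[of _ "\<lambda>m. hinner v \<zeta> * A m"]) (simp add: cell_scale)
    next
      case False
      then show ?thesis by (intro exI[of _ "\<lambda>_. 0"]) (simp add: cell_scale)
    qed
  qed (auto intro!: unitary_map_scale)
  also have "\<dots> = (LINT v|lborel. indicator ?E v *\<^sub>R (hinner v \<zeta> * hinner z v)) * (of_real s * bker (s + 1) z p)"
    by (subst integral_mult_left_zero[symmetric]) (simp add: scaleR_conv_of_real mult_ac)
  also have "(LINT v|lborel. indicator ?E v *\<^sub>R (hinner v \<zeta> * hinner z v))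
      = of_real (LINT v|lborel. indicator ?E v *\<^sub>R (cmod (hinner v \<zeta>))\<^sup>2) * hinner z \<zeta>"
  proof -
    define z' where "z' = z - hinner z \<zeta> *s \<zeta>"
    have \<zeta>\<zeta>: "hinner \<zeta> \<zeta> = 1" using \<zeta> by (simp add: hinner_self)
    have z'\<zeta>: "hinner z' \<zeta> = 0" by (simp add: z'_def hinner_diff_left hinner_scale_left \<zeta>\<zeta>)
    \<comment> \<open>The reflection that changes the sign of the component along \<open>\<zeta>\<close> removes the mixed term.\<close>
    define S where "S v = v - (2 * hinner v \<zeta>) *s \<zeta>" for v
    have S: "unitary_map S"
    proof (rule unitary_mapI)
      fix v w c
      show "S (v + w) = S v + S w"
        by (simp add: S_def hinner_add_left vector_sadd_rdistrib algebra_simps)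
      show "S (c *s v) = c *s S v"
        by (simp add: S_def hinner_scale_left vector_ssub_ldistrib vector_smult_assoc mult_ac)
      show "hinner (S v) (S w) = hinner v w"
        by (simp add: S_def hinner_diff_left hinner_diff_right hinner_scale_left hinner_scale_right
            \<zeta>\<zeta> cnj_hinner algebra_simps)
    qed
    have S\<zeta>: "hinner (S v) \<zeta> = - hinner v \<zeta>" for v
      by (simp add: S_def hinner_diff_left hinner_scale_left \<zeta>\<zeta>)
    have Sz': "hinner z' (S v) = hinner z' v" for v
      by (simp add: S_def hinner_diff_right hinner_scale_right z'\<zeta>)
    have SE: "S v \<in> ?E \<longleftrightarrow> v \<in> ?E" for v
      by (simp add: cell_def S\<zeta> unitary_map_norm[OF S])
    define T where "T v = indicator ?E v *\<^sub>R (hinner v \<zeta> * hinner z' v)" for v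
    have [measurable]: "T \<in> borel_measurable borel" unfolding T_def by measurable
    have "(LINT v|lborel. T v) = (LINT v|lborel. T (S v))"
      by (rule integral_unitary[OF S, symmetric]) measurable
    also have "(\<lambda>v. T (S v)) = (\<lambda>v. - T v)"
      by (auto simp: T_def fun_eq_iff indicator_def SE S\<zeta> Sz')
    finally have T0: "(LINT v|lborel. T v) = 0" by (simp add: equation_minus_iff)
    define f where "f v = indicator ?E v *\<^sub>R (cmod (hinner v \<zeta>))\<^sup>2" for v
    have split: "indicator ?E v *\<^sub>R (hinner v \<zeta> * hinner z v) = of_real (f v) * hinner z \<zeta> + T v" for v
    proof -
      have "hinner z v = hinner z \<zeta> * hinner \<zeta> v + hinner z' v"
        by (simp add: z'_def hinner_diff_left hinner_scale_left)
      moreover have "hinner v \<zeta> * hinner \<zeta> v = of_real ((cmod (hinner v \<zeta>))\<^sup>2)"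
        by (simp only: complex_norm_square cnj_hinner)
      ultimately have "hinner v \<zeta> * hinner z v = of_real ((cmod (hinner v \<zeta>))\<^sup>2) * hinner z \<zeta> + hinner v \<zeta> * hinner z' v"
        by (simp add: algebra_simps)
      then show ?thesis by (simp add: T_def f_def indicator_def)
    qed
    have T: "integrable lborel T"
      unfolding T_def
    proof (rule integrable_cell[where B = "norm z'"])
      fix v assume v: "v \<in> ?E"
      have "(norm v)\<^sup>2 \<le> 1\<^sup>2" using v \<delta> by (simp add: cell_def)
      then have "norm v \<le> 1" by (rule power2_le_imp_le) simp
      then have "cmod (hinner z' v) \<le> norm z'"
        using cmod_hinner_le[of z' v] mult_left_mono[of "norm v" 1 "norm z'"] by simp
      then have "cmod (hinner v \<zeta>) * cmod (hinner z' v) \<le> 1 * norm z'"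
        using hv[OF v] by (intro mult_mono) auto
      then show "norm (hinner v \<zeta> * hinner z' v) \<le> norm z'" by (simp add: norm_mult)
    qed simp
    have f: "integrable lborel f"
      unfolding f_def
    proof (rule integrable_cell[where B = 1])
      fix v assume "v \<in> ?E"
      then show "norm ((cmod (hinner v \<zeta>))\<^sup>2) \<le> 1" using hv[of v] by (simp add: power_le_one)
    qed simp
    have "(LINT v|lborel. of_real (f v) * hinner z \<zeta> + T v)
        = (LINT v|lborel. of_real (f v) * hinner z \<zeta>) + (LINT v|lborel. T v)"
      by (rule Bochner_Integration.integral_add) (use f T in auto)
    then show ?thesis unfolding split f_def[symmetric] by (simp add: T0)
  qed
  finally show ?thesis by (simp add: mult_ac)
qed

end

text \<open>
  A function on the cell, transported to the centre \<open>(1 - \<delta>) *\<^sub>R \<zeta>\<close>. Division by the density turns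
  weighted integrals into Lebesgue integrals over the cell, which is symmetric.
\<close>

definition cell_fun :: "real \<Rightarrow> complex ^ 'n \<Rightarrow> real \<Rightarrow> (complex ^ 'n \<Rightarrow> complex) \<Rightarrow> complex ^ 'n \<Rightarrow> complex" where
  "cell_fun \<alpha> \<zeta> \<delta> G u =
     (let v = u - (1 - \<delta>) *\<^sub>R \<zeta> in indicator (cell \<zeta> \<delta>) v *\<^sub>R (G v / of_real (weight_density \<alpha> u)))"

lemma measurable_cell_fun [measurable]:
  assumes [measurable]: "G \<in> borel_measurable borel"
  shows "cell_fun \<alpha> \<zeta> \<delta> G \<in> borel_measurable borel"
  unfolding cell_fun_def Let_def by measurable

lemma integral_cell_fun:
  fixes \<zeta> :: "complex ^ 'n"
  assumes \<alpha>: "\<alpha> > -1" and \<zeta>: "norm \<zeta> = 1" and \<delta>: "0 < \<delta>" "\<delta> \<le> 1"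
    and [measurable]: "G \<in> borel_measurable borel" "h \<in> borel_measurable borel"
  shows "(LINT u|weighted_measure \<alpha>. cell_fun \<alpha> \<zeta> \<delta> G u * h u)
    = (LINT v|lborel. indicator (cell \<zeta> \<delta>) v *\<^sub>R (G v * h ((1 - \<delta>) *\<^sub>R \<zeta> + v)))"
proof -
  let ?p = "(1 - \<delta>) *\<^sub>R \<zeta>"
  have [measurable]: "cell_fun \<alpha> \<zeta> \<delta> G \<in> borel_measurable borel" by simp
  define H where "H u = indicator (ball 0 1) u *\<^sub>R (weight_density \<alpha> u *\<^sub>R (cell_fun \<alpha> \<zeta> \<delta> G u * h u))" for u
  have [measurable]: "H \<in> borel_measurable borel" unfolding H_def by measurable
  have "(LINT u|weighted_measure \<alpha>. cell_fun \<alpha> \<zeta> \<delta> G u * h u) = (LINT u|lborel. H u)"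
    unfolding H_def by (rule integral_weighted_measure[OF \<alpha>]) simp
  also have "\<dots> = (LINT v|lborel. H (?p + v))" by (rule integral_lborel_translate[symmetric]) simp
  also have "(\<lambda>v. H (?p + v)) = (\<lambda>v. indicator (cell \<zeta> \<delta>) v *\<^sub>R (G v * h (?p + v)))"
  proof
    fix v
    show "H (?p + v) = indicator (cell \<zeta> \<delta>) v *\<^sub>R (G v * h (?p + v))"
    proof (cases "v \<in> cell \<zeta> \<delta>")
      case True
      note n = cell_bounds(3)[OF \<zeta> \<delta> True]
      have "weight_density \<alpha> (?p + v) > 0" by (rule weight_density_pos[OF \<alpha> n])
      then show ?thesis using True n by (simp add: H_def cell_fun_def scaleR_conv_of_real)
    qed (simp add: H_def cell_fun_def)
  qed
  finally show ?thesis .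
qed

lemma cell_fun_bound:
  fixes \<alpha> :: real
  assumes \<alpha>: "\<alpha> > -1"
  obtains C where "C > 0" and
    "\<And>(\<zeta> :: complex ^ 'n) \<delta> G B u. norm \<zeta> = 1 \<Longrightarrow> 0 < \<delta> \<Longrightarrow> \<delta> \<le> 1 \<Longrightarrow>
       (\<And>v. v \<in> cell \<zeta> \<delta> \<Longrightarrow> cmod (G v) \<le> B) \<Longrightarrow> B \<ge> 0 \<Longrightarrow> cmod (cell_fun \<alpha> \<zeta> \<delta> G u) \<le> C * B * \<delta> powr (- \<alpha>)"
proof -
  let ?c = "weight_density \<alpha> (0 :: complex ^ 'n)"
  have c: "?c > 0" by (rule weight_density_0_pos[OF \<alpha>])
  define b where "b = max (2 powr \<alpha>) (3 powr (- \<alpha>))"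
  have b: "b > 0" by (simp add: b_def less_max_iff_disj)
  show ?thesis
  proof (rule that[of "b / ?c"])
    show "b / ?c > 0" using b c by simp
    fix \<zeta> :: "complex ^ 'n" and \<delta> G B u
    assume \<zeta>: "norm \<zeta> = 1" and \<delta>: "0 < \<delta>" "\<delta> \<le> 1"
      and G: "\<And>v. v \<in> cell \<zeta> \<delta> \<Longrightarrow> cmod (G v) \<le> B" and B: "B \<ge> 0"
    define v where "v = u - (1 - \<delta>) *\<^sub>R \<zeta>"
    show "cmod (cell_fun \<alpha> \<zeta> \<delta> G u) \<le> b / ?c * B * \<delta> powr (- \<alpha>)"
    proof (cases "v \<in> cell \<zeta> \<delta>")
      case True
      have u: "u = (1 - \<delta>) *\<^sub>R \<zeta> + v" by (simp add: v_def)
      note cb = cell_bounds[OF \<zeta> \<delta> True, folded u]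
      have r: "rho u > 0" using cb \<delta> by linarith
      have "rho u powr (- \<alpha>) \<le> b * \<delta> powr (- \<alpha>)"
      proof (cases "\<alpha> \<ge> 0")
        case True
        have "rho u powr (- \<alpha>) \<le> (\<delta> / 2) powr (- \<alpha>)" using cb \<delta> True by (intro powr_mono2') auto
        also have "\<dots> = 2 powr \<alpha> * \<delta> powr (- \<alpha>)"
          unfolding powr_divide powr_minus by (simp add: divide_inverse)
        also have "\<dots> \<le> b * \<delta> powr (- \<alpha>)" by (intro mult_right_mono) (auto simp: b_def)
        finally show ?thesis .
      next
        case False
        have "rho u powr (- \<alpha>) \<le> (3 * \<delta>) powr (- \<alpha>)" using cb \<delta> False r by (intro powr_mono2) auto
        also have "\<dots> = 3 powr (- \<alpha>) * \<delta> powr (- \<alpha>)" by (rule powr_mult)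
        also have "\<dots> \<le> b * \<delta> powr (- \<alpha>)" by (intro mult_right_mono) (auto simp: b_def)
        finally show ?thesis .
      qed
      then have "B * rho u powr (- \<alpha>) \<le> B * (b * \<delta> powr (- \<alpha>))" using B by (intro mult_left_mono)
      moreover have "cmod (cell_fun \<alpha> \<zeta> \<delta> G u) = cmod (G v) * rho u powr (- \<alpha>) / ?c"
        using True c r unfolding cell_fun_def Let_def v_def[symmetric] weight_density_eq[of \<alpha> u]
        by (simp add: norm_divide norm_mult powr_minus divide_inverse norm_inverse mult_ac)
      moreover have "cmod (G v) * rho u powr (- \<alpha>) \<le> B * rho u powr (- \<alpha>)"
        using G[OF True] by (intro mult_right_mono) auto
      ultimately show ?thesis using c by (simp add: field_simps)
    next
      case False
      then show ?thesis using b c B by (simp add: cell_fun_def Let_def v_def)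
    qed
  qed
qed

lemma cell_fun_support:
  assumes "norm \<zeta> = 1" "0 < \<delta>" "\<delta> \<le> 1" "u \<notin> tube \<zeta> (2 * \<delta>)"
  shows "cell_fun \<alpha> \<zeta> \<delta> G u = 0"
proof -
  have "u - (1 - \<delta>) *\<^sub>R \<zeta> \<notin> cell \<zeta> \<delta>"
  proof
    assume "u - (1 - \<delta>) *\<^sub>R \<zeta> \<in> cell \<zeta> \<delta>"
    from cell_bounds(4)[OF assms(1-3) this] have "u \<in> tube \<zeta> (2 * \<delta>)"
      by (subst (asm) add.commute) (simp only: diff_add_cancel)
    then show False using assms(4) by simp
  qed
  then show ?thesis by (simp add: cell_fun_def)
qed

text \<open>
  The kernel is antiholomorphic in its second variable, so its mean over any circle around the
  origin is its value \<open>1\<close> there.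
\<close>

lemma bergman_proj_one:
  fixes z :: "complex ^ 'n"
  assumes \<alpha>: "\<alpha> > -1" and z: "norm z < 1" and a: "AE w in weighted_measure \<alpha>. a w = 1"
    and am: "a \<in> borel_measurable (weighted_measure \<alpha>)"
  shows "bergman_proj \<alpha> a z = of_real (measure (weighted_measure \<alpha> :: (complex ^ 'n) measure) (ball 0 1))"
proof -
  let ?M = "weighted_measure \<alpha> :: (complex ^ 'n) measure"
  interpret finite_measure ?M by (rule finite_weighted_measure[OF \<alpha>])
  define s where "s = real CARD('n) + 1 + \<alpha>"
  have s: "s > 0" using \<alpha> by (simp add: s_def)
  let ?w = "\<lambda>w :: complex ^ 'n. indicator (ball 0 1) w *\<^sub>R weight_density \<alpha> w"
  have wd: "integrable lborel ?w"
  proof -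
    have "(\<integral>\<^sup>+w. 1 \<partial>?M) = emeasure ?M (space ?M)" by (simp only: nn_integral_const mult_1)
    then have "(\<integral>\<^sup>+w. 1 \<partial>?M) < \<infinity>"
      by (metis emeasure_finite infinity_ennreal_def top.not_eq_extremum)
    also have "(\<integral>\<^sup>+w. 1 \<partial>?M) = ennreal (weight_density \<alpha> (0 :: complex ^ 'n)) *
        (\<integral>\<^sup>+w. indicator (ball (0 :: complex ^ 'n) 1) w * (ennreal (rho w powr \<alpha>) * 1) \<partial>lborel)"
      by (rule nn_integral_weighted_measure[OF \<alpha>, where h = "\<lambda>_. 1"]) simp
    also have "\<dots> = (\<integral>\<^sup>+w. ennreal (norm (?w w)) \<partial>lborel)"
    proof -
      have pt: "ennreal (norm (?w w)) = ennreal (weight_density \<alpha> (0 :: complex ^ 'n)) *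
          (indicator (ball 0 1) w * (ennreal (rho w powr \<alpha>) * 1))" for w :: "complex ^ 'n"
      proof (cases "w \<in> ball 0 1")
        case True
        then show ?thesis
          using weight_density_0_pos[OF \<alpha>, where 'n = 'n] unfolding weight_density_eq[of \<alpha> w]
          by (simp add: ennreal_mult abs_mult)
      qed simp
      show ?thesis unfolding pt by (rule nn_integral_cmult[symmetric]) measurable
    qed
    finally show ?thesis by (intro integrableI_bounded) auto
  qed
  have "bergman_proj \<alpha> a z = (LINT w|?M. a w * bker s z w)" by (simp add: bergman_proj_eq s_def)
  also have "\<dots> = (LINT w|?M. bker s z w)"
    using a by (intro integral_cong_AE borel_measurable_times am measurable_bker_weighted_measure) auto
  also have "\<dots> = (LINT w|lborel. indicator (ball 0 1) w *\<^sub>R (weight_density \<alpha> w *\<^sub>R bker s z w))"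
    by (rule integral_weighted_measure[OF \<alpha>]) simp
  also have "\<dots> = (LINT w|lborel. indicator (ball (0 :: complex ^ 'n) 1) w *\<^sub>R (weight_density \<alpha> w *\<^sub>R (1 :: complex)))"
  proof (rule integral_eq_circle_coefficient[where R = "\<lambda>\<xi>. (*s) (cnj \<xi>)" and j = 0
        and D = "\<lambda>w. ?w w * (1 - norm z) powr (- s)"])
    show "integrable lborel (\<lambda>w. ?w w * (1 - norm z) powr (- s))" using wd by simp
    fix w :: "complex ^ 'n"
    have inv: "cnj \<xi> *s w \<in> ball 0 1 \<longleftrightarrow> w \<in> ball 0 1"
      "weight_density \<alpha> (cnj \<xi> *s w) = weight_density \<alpha> w" if "cmod \<xi> = 1" for \<xi>
      using that by (simp_all add: norm_scale weight_density_def rho_def)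
    show "cmod (indicator (ball 0 1) (cnj \<xi> *s w) *\<^sub>R (weight_density \<alpha> (cnj \<xi> *s w) *\<^sub>R bker s z (cnj \<xi> *s w)))
        \<le> ?w w * (1 - norm z) powr (- s)" if \<xi>: "cmod \<xi> = 1" for \<xi>
    proof (cases "w \<in> ball 0 1")
      case True
      then have "cmod (bker s z (cnj \<xi> *s w)) \<le> (1 - norm z) powr (- s)"
        using \<xi> by (intro bker_bound[OF s order_refl z]) (simp add: norm_scale)
      then show ?thesis using True inv[OF \<xi>] weight_density_nonneg[OF \<alpha>, of w]
        by (simp add: mult_left_mono)
    next
      case False
      then show ?thesis using inv[OF \<xi>] by (simp add: indicator_def)
    qed
    show "\<exists>A. summable (\<lambda>m. cmod (A m)) \<and> A 0 = indicator (ball 0 1) w *\<^sub>R (weight_density \<alpha> w *\<^sub>R (1 :: complex)) \<and>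
        (\<forall>\<xi>. cmod \<xi> = 1 \<longrightarrow> (\<lambda>m. A m * \<xi> ^ m) sums
          (\<xi> ^ 0 * (indicator (ball 0 1) (cnj \<xi> *s w) *\<^sub>R (weight_density \<alpha> (cnj \<xi> *s w) *\<^sub>R bker s z (cnj \<xi> *s w)))))"
    proof (cases "w \<in> ball 0 1")
      case True
      then have less: "cmod (hinner z w) < Re 1" using cmod_hinner_less_1[OF z, of w] by simp
      obtain A where A: "summable (\<lambda>m. cmod (A m))" "A 0 = 1 powr complex_of_real (- s)"
        "A 1 = of_real s * (hinner z w * 1 powr complex_of_real (- (s + 1)))"
        "\<And>\<xi>. cmod \<xi> = 1 \<Longrightarrow> (\<lambda>m. A m * \<xi> ^ m) sums ((1 - \<xi> * hinner z w) powr complex_of_real (- s))"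
        using powr_circle_expansion[OF less, of s] by blast
      let ?A = "\<lambda>m. of_real (weight_density \<alpha> w) * A m"
      have "(\<lambda>m. ?A m * \<xi> ^ m) sums (of_real (weight_density \<alpha> w) * bker s z (cnj \<xi> *s w))" if "cmod \<xi> = 1" for \<xi>
        using sums_mult[OF A(4)[OF that], of "of_real (weight_density \<alpha> w)"]
        by (simp add: bker_def hinner_scale_right mult.assoc)
      moreover have "summable (\<lambda>m. cmod (?A m))" using A(1) by (simp add: norm_mult)
      ultimately show ?thesis using True A(2) inv
        by (intro exI[of _ ?A]) (simp add: scaleR_conv_of_real)
    next
      case False
      then show ?thesis using inv by (intro exI[of _ "\<lambda>_. 0"]) (simp add: indicator_def)
    qed
  qed (auto intro!: unitary_map_scale)
  also have "\<dots> = (LINT w|?M. 1)"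
    by (rule integral_weighted_measure[OF \<alpha>, symmetric]) simp
  also have "\<dots> = of_real (measure ?M (ball 0 1))" by (simp add: scaleR_conv_of_real)
  finally show ?thesis .
qed

section \<open>The closed convex hull of the projected atoms\<close>

lemma bergman_space_integrable:
  "f \<in> bergman_space \<alpha> \<Longrightarrow> integrable (weighted_measure \<alpha>) f"
  unfolding bergman_space_def
  by (auto intro: integrable_norm_cancel continuous_measurable_weighted_measure holomorphic_sv_continuous)

lemma bergman_norm_nonneg: "0 \<le> bergman_norm \<alpha> f"
  by (simp add: bergman_norm_def)

lemma bergman_norm_cong: "(\<And>z. norm z < 1 \<Longrightarrow> f z = g z) \<Longrightarrow> bergman_norm \<alpha> f = bergman_norm \<alpha> g"
  unfolding bergman_norm_def by (rule Bochner_Integration.integral_cong) auto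

lemma bergman_norm_mult: "bergman_norm \<alpha> (\<lambda>z. c * f z) = cmod c * bergman_norm \<alpha> f"
  by (simp add: bergman_norm_def norm_mult)

lemma bergman_norm_add_le:
  assumes "integrable (weighted_measure \<alpha>) f" "integrable (weighted_measure \<alpha>) g"
  shows "bergman_norm \<alpha> (\<lambda>z. f z + g z) \<le> bergman_norm \<alpha> f + bergman_norm \<alpha> g"
proof -
  have "bergman_norm \<alpha> (\<lambda>z. f z + g z) \<le> (LINT z|weighted_measure \<alpha>. cmod (f z) + cmod (g z))"
    unfolding bergman_norm_def
    by (rule Bochner_Integration.integral_mono) (use assms norm_triangle_ineq in auto)
  also have "\<dots> = bergman_norm \<alpha> f + bergman_norm \<alpha> g"
    unfolding bergman_norm_def using assms by simp
  finally show ?thesis .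
qed

lemma bergman_norm_sum_le:
  assumes "finite I" "\<And>i. i \<in> I \<Longrightarrow> integrable (weighted_measure \<alpha>) (f i)"
  shows "bergman_norm \<alpha> (\<lambda>z. \<Sum>i\<in>I. f i z) \<le> (\<Sum>i\<in>I. bergman_norm \<alpha> (f i))"
  using assms
proof (induction I rule: finite_induct)
  case (insert i I)
  have "bergman_norm \<alpha> (\<lambda>z. f i z + (\<Sum>i\<in>I. f i z)) \<le> bergman_norm \<alpha> (f i) + bergman_norm \<alpha> (\<lambda>z. \<Sum>i\<in>I. f i z)"
    using insert.prems by (intro bergman_norm_add_le) auto
  then show ?case using insert by simp
qed (simp add: bergman_norm_def)

lemma proj_atom_bound:
  fixes q \<alpha> :: real
  assumes \<alpha>: "\<alpha> > -1" and q: "q > 1"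
  obtains A where "A > 0" and
    "\<And>a :: complex ^ 'n \<Rightarrow> complex. is_atom q \<alpha> a \<Longrightarrow>
       bergman_proj \<alpha> a \<in> bergman_space \<alpha> \<and> bergman_norm \<alpha> (bergman_proj \<alpha> a) \<le> A"
proof -
  let ?M = "weighted_measure \<alpha> :: (complex ^ 'n) measure"
  interpret finite_measure ?M by (rule finite_weighted_measure[OF \<alpha>])
  obtain C where C: "C > 0" and le:
    "\<And>(a :: complex ^ 'n \<Rightarrow> complex) \<zeta> R. norm \<zeta> = 1 \<Longrightarrow> 0 < R \<Longrightarrow> R \<le> 4 \<Longrightarrow>
       a \<in> Lq_fun ?M q \<Longrightarrow> (AE w in ?M. w \<notin> tube \<zeta> R \<longrightarrow> a w = 0) \<Longrightarrow>
       Lq_norm ?M q a \<le> measure ?M (tube \<zeta> R) powr (1 / q - 1) \<Longrightarrow>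
       (LINT w|?M. a w) = 0 \<Longrightarrow>
       (\<integral>\<^sup>+z. ennreal (cmod (bergman_proj \<alpha> a z)) \<partial>?M) \<le> ennreal C"
    using proj_tube_atom_bound[OF \<alpha> q, where 'n = 'n] by blast
  let ?m = "measure ?M (ball 0 1)"
  show ?thesis
  proof (rule that[of "C + ?m * ?m"])
    show "C + ?m * ?m > 0" using C by (simp add: add_pos_nonneg)
    fix a :: "complex ^ 'n \<Rightarrow> complex" assume at: "is_atom q \<alpha> a"
    then have aq: "a \<in> Lq_fun ?M q" by (simp add: is_atom_def)
    have int: "integrable ?M a" by (rule Lq_fun_integrable[OF \<alpha> q aq])
    have hol: "holomorphic_sv (bergman_proj \<alpha> a) (ball 0 1)" by (rule holomorphic_bergman_proj[OF \<alpha> int])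
    have meas: "bergman_proj \<alpha> a \<in> borel_measurable ?M"
      by (intro continuous_measurable_weighted_measure holomorphic_sv_continuous hol)
    have bd: "(\<integral>\<^sup>+z. ennreal (cmod (bergman_proj \<alpha> a z)) \<partial>?M) \<le> ennreal (C + ?m * ?m)"
    proof (cases "AE z in ?M. a z = 1")
      case True
      have "(\<integral>\<^sup>+z. ennreal (cmod (bergman_proj \<alpha> a z)) \<partial>?M) = (\<integral>\<^sup>+z. ennreal ?m \<partial>?M)"
        by (rule nn_integral_cong)
           (use bergman_proj_one[OF \<alpha> _ True borel_measurable_integrable[OF int]] in simp)
      also have "\<dots> = ennreal (?m * ?m)"
        by (simp add: emeasure_eq_measure ennreal_mult)
      also have "\<dots> \<le> ennreal (C + ?m * ?m)" using C by (intro ennreal_leI) simp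
      finally show ?thesis .
    next
      case False
      then obtain Q where Q: "is_carleson_tube Q" "AE z in ?M. z \<notin> Q \<longrightarrow> a z = 0"
        "Lq_norm ?M q a \<le> measure ?M Q powr (1 / q - 1)" "(LINT z|?M. a z) = 0"
        using at unfolding is_atom_def by blast
      obtain \<zeta> R where R: "norm \<zeta> = 1" "0 < R" "R \<le> 4" "Q = tube \<zeta> R"
        using is_carleson_tubeE[OF Q(1)] by blast
      have "(\<integral>\<^sup>+z. ennreal (cmod (bergman_proj \<alpha> a z)) \<partial>?M) \<le> ennreal C"
        using le[OF R(1-3) aq] Q(2-4) unfolding R(4) by blast
      also have "\<dots> \<le> ennreal (C + ?m * ?m)" by (intro ennreal_leI) simp
      finally show ?thesis .
    qed
    have int2: "integrable ?M (bergman_proj \<alpha> a)"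
      by (rule integrableI_bounded[OF meas], rule le_less_trans[OF bd]) simp
    have "ennreal (bergman_norm \<alpha> (bergman_proj \<alpha> a)) = (\<integral>\<^sup>+z. ennreal (cmod (bergman_proj \<alpha> a z)) \<partial>?M)"
      unfolding bergman_norm_def using int2 by (intro nn_integral_eq_integral[symmetric]) auto
    then have "ennreal (bergman_norm \<alpha> (bergman_proj \<alpha> a)) \<le> ennreal (C + ?m * ?m)" using bd by simp
    then have "bergman_norm \<alpha> (bergman_proj \<alpha> a) \<le> C + ?m * ?m"
      using C by (subst (asm) ennreal_le_iff) (auto simp: add_nonneg_nonneg)
    then show "bergman_proj \<alpha> a \<in> bergman_space \<alpha> \<and> bergman_norm \<alpha> (bergman_proj \<alpha> a) \<le> C + ?m * ?m"
      using hol int2 by (auto simp: bergman_space_def)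
  qed
qed

definition atom_list :: "real \<Rightarrow> real \<Rightarrow> (complex \<times> (complex ^ 'n \<Rightarrow> complex)) list \<Rightarrow> bool" where
  "atom_list q \<alpha> xs \<longleftrightarrow> (\<forall>(l, a) \<in> set xs. is_atom q \<alpha> a)"

definition atom_cost :: "(complex \<times> (complex ^ 'n \<Rightarrow> complex)) list \<Rightarrow> real" where
  "atom_cost xs = (\<Sum>(l, a)\<leftarrow>xs. cmod l)"

definition atom_sum :: "real \<Rightarrow> (complex \<times> (complex ^ 'n \<Rightarrow> complex)) list \<Rightarrow> complex ^ 'n \<Rightarrow> complex" where
  "atom_sum \<alpha> xs z = (\<Sum>(l, a)\<leftarrow>xs. l * bergman_proj \<alpha> a z)"

text \<open>
  \<open>C\<close> times the closed absolutely convex hull of the projected atoms. Membership is stable under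
  integration, which is the reason to work with the hull before constructing any series.
\<close>

definition atomic_hull :: "real \<Rightarrow> real \<Rightarrow> real \<Rightarrow> (complex ^ 'n \<Rightarrow> complex) \<Rightarrow> bool" where
  "atomic_hull q \<alpha> C g \<longleftrightarrow> integrable (weighted_measure \<alpha>) g \<and>
     (\<forall>\<epsilon>>0. \<exists>xs. atom_list q \<alpha> xs \<and> atom_cost xs \<le> C \<and>
        bergman_norm \<alpha> (\<lambda>z. g z - atom_sum \<alpha> xs z) \<le> \<epsilon>)"

context
  fixes q \<alpha> :: real
  assumes \<alpha>: "\<alpha> > -1" and q: "q > 1"
begin

lemma atom_proj_integrable:
  fixes a :: "complex ^ 'n \<Rightarrow> complex"
  assumes "is_atom q \<alpha> a"
  shows "integrable (weighted_measure \<alpha>) (bergman_proj \<alpha> a)"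
  using proj_atom_bound[OF \<alpha> q, where 'n = 'n] assms bergman_space_integrable by metis

lemma atom_sum_integrable:
  "atom_list q \<alpha> xs \<Longrightarrow> integrable (weighted_measure \<alpha>) (atom_sum \<alpha> xs)"
  by (induction xs) (auto simp: atom_list_def atom_sum_def[abs_def] intro!: atom_proj_integrable)

lemma atomic_hull_atom:
  assumes "is_atom q \<alpha> a"
  shows "atomic_hull q \<alpha> (cmod l) (\<lambda>z. l * bergman_proj \<alpha> a z)"
  unfolding atomic_hull_def
proof (intro conjI allI impI)
  show "integrable (weighted_measure \<alpha>) (\<lambda>z. l * bergman_proj \<alpha> a z)"
    using atom_proj_integrable[OF assms] by simp
  fix \<epsilon> :: real assume "\<epsilon> > 0"
  then show "\<exists>xs. atom_list q \<alpha> xs \<and> atom_cost xs \<le> cmod l \<and>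
      bergman_norm \<alpha> (\<lambda>z. l * bergman_proj \<alpha> a z - atom_sum \<alpha> xs z) \<le> \<epsilon>"
    using assms by (intro exI[of _ "[(l, a)]"])
      (simp add: atom_list_def atom_cost_def atom_sum_def bergman_norm_def)
qed

lemma atomic_hull_cong:
  assumes "atomic_hull q \<alpha> C f" "\<And>z. norm z < 1 \<Longrightarrow> f z = g z"
  shows "atomic_hull q \<alpha> C g"
proof -
  have "integrable (weighted_measure \<alpha>) g \<longleftrightarrow> integrable (weighted_measure \<alpha>) f"
    by (rule Bochner_Integration.integrable_cong) (use assms(2) in auto)
  moreover have "bergman_norm \<alpha> (\<lambda>z. g z - atom_sum \<alpha> xs z) = bergman_norm \<alpha> (\<lambda>z. f z - atom_sum \<alpha> xs z)" for xs
    by (rule bergman_norm_cong) (simp add: assms(2))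
  ultimately show ?thesis using assms(1) by (simp add: atomic_hull_def)
qed

lemma atomic_hull_mono: "atomic_hull q \<alpha> C g \<Longrightarrow> C \<le> D \<Longrightarrow> atomic_hull q \<alpha> D g"
  unfolding atomic_hull_def by (meson order_trans)

lemma atomic_hull_zero: "0 \<le> C \<Longrightarrow> atomic_hull q \<alpha> C (\<lambda>z. 0)"
  unfolding atomic_hull_def
  by (auto intro!: exI[of _ "[]"] simp: atom_list_def atom_cost_def atom_sum_def bergman_norm_def)

lemma atomic_hull_add:
  assumes f: "atomic_hull q \<alpha> C f" and g: "atomic_hull q \<alpha> D g"
  shows "atomic_hull q \<alpha> (C + D) (\<lambda>z. f z + g z)"
  unfolding atomic_hull_def
proof (intro conjI allI impI)
  show "integrable (weighted_measure \<alpha>) (\<lambda>z. f z + g z)"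
    using f g by (simp add: atomic_hull_def)
  fix \<epsilon> :: real assume "\<epsilon> > 0"
  then have "\<epsilon> / 2 > 0" by simp
  then obtain xs ys where x: "atom_list q \<alpha> xs" "atom_cost xs \<le> C" "bergman_norm \<alpha> (\<lambda>z. f z - atom_sum \<alpha> xs z) \<le> \<epsilon> / 2"
    and y: "atom_list q \<alpha> ys" "atom_cost ys \<le> D" "bergman_norm \<alpha> (\<lambda>z. g z - atom_sum \<alpha> ys z) \<le> \<epsilon> / 2"
    using f g unfolding atomic_hull_def by meson
  have "bergman_norm \<alpha> (\<lambda>z. f z + g z - atom_sum \<alpha> (xs @ ys) z)
      = bergman_norm \<alpha> (\<lambda>z. (f z - atom_sum \<alpha> xs z) + (g z - atom_sum \<alpha> ys z))"
    by (rule bergman_norm_cong) (simp add: atom_sum_def)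
  also have "\<dots> \<le> bergman_norm \<alpha> (\<lambda>z. f z - atom_sum \<alpha> xs z) + bergman_norm \<alpha> (\<lambda>z. g z - atom_sum \<alpha> ys z)"
    using f g x y by (intro bergman_norm_add_le) (auto simp: atomic_hull_def atom_sum_integrable)
  also have "\<dots> \<le> \<epsilon>" using x y by simp
  finally show "\<exists>xs. atom_list q \<alpha> xs \<and> atom_cost xs \<le> C + D \<and>
      bergman_norm \<alpha> (\<lambda>z. f z + g z - atom_sum \<alpha> xs z) \<le> \<epsilon>"
    using x y by (intro exI[of _ "xs @ ys"]) (auto simp: atom_list_def atom_cost_def)
qed

lemma atomic_hull_scale:
  assumes g: "atomic_hull q \<alpha> C g"
  shows "atomic_hull q \<alpha> (cmod c * C) (\<lambda>z. c * g z)"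
  unfolding atomic_hull_def
proof (intro conjI allI impI)
  show "integrable (weighted_measure \<alpha>) (\<lambda>z. c * g z)"
    using g by (simp add: atomic_hull_def)
  fix \<epsilon> :: real assume "\<epsilon> > 0"
  then have "\<epsilon> / (cmod c + 1) > 0" by (simp add: add_nonneg_pos)
  then obtain xs where x: "atom_list q \<alpha> xs" "atom_cost xs \<le> C"
      "bergman_norm \<alpha> (\<lambda>z. g z - atom_sum \<alpha> xs z) \<le> \<epsilon> / (cmod c + 1)"
    using g unfolding atomic_hull_def by meson
  let ?ys = "map (\<lambda>(l, a). (c * l, a)) xs"
  have s: "atom_sum \<alpha> ?ys z = c * atom_sum \<alpha> xs z" for z
    by (induction xs) (auto simp: atom_sum_def algebra_simps)
  have c: "atom_cost ?ys = cmod c * atom_cost xs"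
    by (induction xs) (auto simp: atom_cost_def norm_mult algebra_simps)
  have "bergman_norm \<alpha> (\<lambda>z. c * g z - atom_sum \<alpha> ?ys z) = cmod c * bergman_norm \<alpha> (\<lambda>z. g z - atom_sum \<alpha> xs z)"
    unfolding s bergman_norm_mult[symmetric] by (simp add: right_diff_distrib)
  also have "\<dots> \<le> (cmod c + 1) * (\<epsilon> / (cmod c + 1))"
    using x(3) by (intro mult_mono) (auto simp: bergman_norm_nonneg)
  also have "\<dots> = \<epsilon>" by (simp add: add_nonneg_pos order_less_imp_not_eq2)
  finally show "\<exists>xs. atom_list q \<alpha> xs \<and> atom_cost xs \<le> cmod c * C \<and>
      bergman_norm \<alpha> (\<lambda>z. c * g z - atom_sum \<alpha> xs z) \<le> \<epsilon>"
    using x c by (intro exI[of _ ?ys]) (auto simp: atom_list_def mult_left_mono)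
qed

lemma atomic_hull_sum:
  assumes "finite I" "\<And>i. i \<in> I \<Longrightarrow> atomic_hull q \<alpha> (C i) (g i)"
  shows "atomic_hull q \<alpha> (\<Sum>i\<in>I. C i) (\<lambda>z. \<Sum>i\<in>I. g i z)"
  using assms
proof (induction I rule: finite_induct)
  case (insert i I)
  then show ?case using atomic_hull_add[of "C i" "g i" "sum C I" "\<lambda>z. \<Sum>i\<in>I. g i z"] by simp
qed (simp add: atomic_hull_zero)

lemma atomic_hull_closed:
  assumes g: "integrable (weighted_measure \<alpha>) g"
    and h: "\<And>\<epsilon>. \<epsilon> > 0 \<Longrightarrow> \<exists>h. atomic_hull q \<alpha> C h \<and> bergman_norm \<alpha> (\<lambda>z. g z - h z) \<le> \<epsilon>"
  shows "atomic_hull q \<alpha> C g"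
  unfolding atomic_hull_def
proof (intro conjI allI impI)
  fix \<epsilon> :: real assume "\<epsilon> > 0"
  then have e: "\<epsilon> / 2 > 0" by simp
  obtain h where h: "atomic_hull q \<alpha> C h" "bergman_norm \<alpha> (\<lambda>z. g z - h z) \<le> \<epsilon> / 2"
    using h[OF e] by blast
  obtain xs where x: "atom_list q \<alpha> xs" "atom_cost xs \<le> C" "bergman_norm \<alpha> (\<lambda>z. h z - atom_sum \<alpha> xs z) \<le> \<epsilon> / 2"
    using h(1) e unfolding atomic_hull_def by meson
  have "bergman_norm \<alpha> (\<lambda>z. g z - atom_sum \<alpha> xs z)
      = bergman_norm \<alpha> (\<lambda>z. (g z - h z) + (h z - atom_sum \<alpha> xs z))" by simp
  also have "\<dots> \<le> bergman_norm \<alpha> (\<lambda>z. g z - h z) + bergman_norm \<alpha> (\<lambda>z. h z - atom_sum \<alpha> xs z)"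
    using g h x by (intro bergman_norm_add_le) (auto simp: atomic_hull_def atom_sum_integrable)
  also have "\<dots> \<le> \<epsilon>" using h x by simp
  finally show "\<exists>xs. atom_list q \<alpha> xs \<and> atom_cost xs \<le> C \<and>
      bergman_norm \<alpha> (\<lambda>z. g z - atom_sum \<alpha> xs z) \<le> \<epsilon>" using x by blast
qed (rule g)

lemma atom_sum_norm_le:
  fixes xs :: "(complex \<times> (complex ^ 'n \<Rightarrow> complex)) list"
  assumes "atom_list q \<alpha> xs" and "\<And>a :: complex ^ 'n \<Rightarrow> complex. is_atom q \<alpha> a \<Longrightarrow> bergman_norm \<alpha> (bergman_proj \<alpha> a) \<le> A"
  shows "bergman_norm \<alpha> (atom_sum \<alpha> xs) \<le> A * atom_cost xs"
  using assms(1)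
proof (induction xs)
  case (Cons x xs)
  obtain l a where x: "x = (l, a)" by (cases x)
  have at: "is_atom q \<alpha> a" "atom_list q \<alpha> xs" using Cons.prems by (auto simp: atom_list_def x)
  have "bergman_norm \<alpha> (atom_sum \<alpha> (x # xs)) = bergman_norm \<alpha> (\<lambda>z. l * bergman_proj \<alpha> a z + atom_sum \<alpha> xs z)"
    by (simp add: atom_sum_def[abs_def] x)
  also have "\<dots> \<le> bergman_norm \<alpha> (\<lambda>z. l * bergman_proj \<alpha> a z) + bergman_norm \<alpha> (atom_sum \<alpha> xs)"
    using atom_proj_integrable[OF at(1)] atom_sum_integrable[OF at(2)] by (intro bergman_norm_add_le) auto
  also have "\<dots> \<le> cmod l * A + A * atom_cost xs"
    unfolding bergman_norm_mult using Cons.IH[OF at(2)] assms(2)[OF at(1)]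
    by (intro add_mono mult_left_mono) auto
  also have "\<dots> = A * atom_cost (x # xs)" by (simp add: atom_cost_def x algebra_simps)
  finally show ?case .
qed (simp add: atom_sum_def[abs_def] atom_cost_def bergman_norm_def)

lemma atomic_hull_norm_le:
  fixes g :: "complex ^ 'n \<Rightarrow> complex"
  assumes g: "atomic_hull q \<alpha> C g" and A: "A > 0"
    and le: "\<And>a :: complex ^ 'n \<Rightarrow> complex. is_atom q \<alpha> a \<Longrightarrow> bergman_norm \<alpha> (bergman_proj \<alpha> a) \<le> A"
  shows "bergman_norm \<alpha> g \<le> A * C"
proof (rule field_le_epsilon)
  fix \<epsilon> :: real assume "\<epsilon> > 0"
  then obtain xs where x: "atom_list q \<alpha> xs" "atom_cost xs \<le> C" "bergman_norm \<alpha> (\<lambda>z. g z - atom_sum \<alpha> xs z) \<le> \<epsilon>"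
    using g unfolding atomic_hull_def by meson
  have "bergman_norm \<alpha> g = bergman_norm \<alpha> (\<lambda>z. atom_sum \<alpha> xs z + (g z - atom_sum \<alpha> xs z))" by simp
  also have "\<dots> \<le> bergman_norm \<alpha> (atom_sum \<alpha> xs) + bergman_norm \<alpha> (\<lambda>z. g z - atom_sum \<alpha> xs z)"
    using g x by (intro bergman_norm_add_le) (auto simp: atomic_hull_def atom_sum_integrable)
  also have "\<dots> \<le> A * atom_cost xs + \<epsilon>" using atom_sum_norm_le[OF x(1) le] x(3) by (intro add_mono) auto
  also have "\<dots> \<le> A * C + \<epsilon>" using x(2) A by simp
  finally show "bergman_norm \<alpha> g \<le> A * C + \<epsilon>" .
qed

lemma bergman_proj_mult: "bergman_proj \<alpha> (\<lambda>w. c * a w) z = c * bergman_proj \<alpha> a z"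
  unfolding bergman_proj_eq by (simp add: mult.assoc)

text \<open>A bounded function of mean zero that lives on a tube is a multiple of an atom.\<close>

lemma atomic_hull_tube_function:
  obtains C where "C > 0" and
    "\<And>(a :: complex ^ 'n \<Rightarrow> complex) \<zeta> \<delta> A. norm \<zeta> = 1 \<Longrightarrow> 0 < \<delta> \<Longrightarrow> \<delta> \<le> 1 \<Longrightarrow>
       a \<in> borel_measurable borel \<Longrightarrow> A > 0 \<Longrightarrow>
       (\<And>u. cmod (a u) \<le> A * \<delta> powr (- (real CARD('n) + 1 + \<alpha>))) \<Longrightarrow>
       (\<And>u. norm u < 1 \<Longrightarrow> u \<notin> tube \<zeta> (4 * \<delta>) \<Longrightarrow> a u = 0) \<Longrightarrow>
       (LINT u|weighted_measure \<alpha>. a u) = 0 \<Longrightarrow> atomic_hull q \<alpha> (C * A) (bergman_proj \<alpha> a)"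
proof -
  let ?M = "weighted_measure \<alpha> :: (complex ^ 'n) measure"
  define s where "s = real CARD('n) + 1 + \<alpha>"
  interpret finite_measure ?M by (rule finite_weighted_measure[OF \<alpha>])
  obtain C0 where C0: "C0 > 0" and le: "\<And>(\<eta> :: complex ^ 'n) R. norm \<eta> \<le> 1 \<Longrightarrow> 0 < R \<Longrightarrow>
       (\<integral>\<^sup>+w. indicator (tube \<eta> R) w * ennreal (rho w powr (- 0)) \<partial>?M)
         \<le> ennreal (C0 * R powr (real CARD('n) + 1 + \<alpha> - 0))"
    using weighted_tube_integral_le[OF \<alpha>, of 0, where 'n = 'n] \<alpha> by auto
  obtain c where c: "c > 0" and ge: "\<And>(\<zeta> :: complex ^ 'n) R. norm \<zeta> = 1 \<Longrightarrow> 0 < R \<Longrightarrow> R \<le> 4 \<Longrightarrow>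
       c * R powr (real CARD('n) + 1 + \<alpha>) \<le> measure ?M (tube \<zeta> R)"
    using measure_tube_ge[OF \<alpha>, where 'n = 'n] by blast
  define C where "C = C0 * 4 powr s"
  have C: "C > 0" using C0 by (simp add: C_def)
  show ?thesis
  proof (rule that[of C, OF C])
    fix a :: "complex ^ 'n \<Rightarrow> complex" and \<zeta> :: "complex ^ 'n" and \<delta> A :: real
    assume \<zeta>: "norm \<zeta> = 1" and \<delta>: "0 < \<delta>" "\<delta> \<le> 1" and a: "a \<in> borel_measurable borel" and A: "A > 0"
      and bd: "\<And>u. cmod (a u) \<le> A * \<delta> powr (- (real CARD('n) + 1 + \<alpha>))"
      and supp: "\<And>u. norm u < 1 \<Longrightarrow> u \<notin> tube \<zeta> (4 * \<delta>) \<Longrightarrow> a u = 0"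
      and mean: "(LINT u|?M. a u) = 0"
    let ?Q = "tube \<zeta> (4 * \<delta>)"
    have Qs: "?Q \<in> sets ?M" by (rule sets_tube_weighted_measure)
    define V where "V = measure ?M ?Q"
    have "c * (4 * \<delta>) powr s \<le> V" unfolding V_def s_def using \<delta> by (intro ge \<zeta>) auto
    moreover have "0 < c * (4 * \<delta>) powr s" using c \<delta> by simp
    ultimately have V0: "V > 0" by linarith
    have "ennreal V = (\<integral>\<^sup>+w. indicator ?Q w \<partial>?M)" using Qs by (simp add: V_def emeasure_eq_measure)
    also have "\<dots> = (\<integral>\<^sup>+w. indicator ?Q w * ennreal (rho w powr (- 0)) \<partial>?M)"
    proof (rule nn_integral_cong)
      fix w assume "w \<in> space ?M"
      then have "rho w \<noteq> 0" using rho_pos[of w] by simp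
      then show "indicator ?Q w = indicator ?Q w * ennreal (rho w powr (- 0))" by simp
    qed
    also have "\<dots> \<le> ennreal (C0 * (4 * \<delta>) powr (s - 0))"
      unfolding s_def using \<delta> \<zeta> by (intro le) auto
    finally have "V \<le> C0 * (4 * \<delta>) powr s" using C0 by (simp add: ennreal_le_iff)
    also have "\<dots> = C * \<delta> powr s" unfolding C_def using powr_mult[of 4 \<delta> s] by simp
    finally have V: "V \<le> C * \<delta> powr s" .
    define l where "l = C * A"
    have l: "l > 0" using C A by (simp add: l_def)
    define b where "b w = a w / of_real l" for w
    have [measurable]: "b \<in> borel_measurable borel" unfolding b_def using a by measurable
    have bM: "b \<in> borel_measurable ?M" by (rule measurable_weighted_measure) simp
    have bb: "cmod (b u) \<le> 1 / V" for u
    proof -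
      have "cmod (b u) = cmod (a u) / l" using l by (simp add: b_def norm_divide)
      also have "\<dots> \<le> A * \<delta> powr (- s) / l"
        using bd[of u] l unfolding s_def by (intro divide_right_mono) auto
      also have "\<dots> = 1 / (C * \<delta> powr s)" using A C \<delta> by (simp add: l_def powr_minus field_simps)
      also have "\<dots> \<le> 1 / V" using V V0 C \<delta> by (intro divide_left_mono) auto
      finally show ?thesis .
    qed
    have bsupp: "b u = 0" if "norm u < 1" "u \<notin> ?Q" for u using supp[OF that] by (simp add: b_def)
    have pw: "cmod (b w) powr q \<le> indicator ?Q w * (1 / V) powr q" if "norm w < 1" for w
    proof (cases "w \<in> ?Q")
      case True
      then show ?thesis using bb[of w] q by (auto intro!: powr_mono2)
    qed (use bsupp[OF that] in simp)
    have iQ: "integrable ?M (\<lambda>w. indicator ?Q w * (1 / V) powr q :: real)"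
      using Qs by (intro integrable_mult_left) (simp add: emeasure_eq_measure)
    have bint: "integrable ?M (\<lambda>w. cmod (b w) powr q)"
    proof (rule Bochner_Integration.integrable_bound[OF iQ])
      show "(\<lambda>w. cmod (b w) powr q) \<in> borel_measurable ?M" using bM by measurable
      show "AE w in ?M. norm (cmod (b w) powr q) \<le> norm (indicator ?Q w * (1 / V) powr q :: real)"
        by (rule AE_I2) (use pw in auto)
    qed
    have "(LINT w|?M. cmod (b w) powr q) \<le> (LINT w|?M. indicator ?Q w * (1 / V) powr q)"
      by (rule Bochner_Integration.integral_mono[OF bint iQ]) (use pw in auto)
    also have "\<dots> = V * (1 / V) powr q" by (simp add: V_def Int_absorb2[OF tube_subset_ball])
    also have "\<dots> = V powr (1 - q)" using V0 by (simp add: powr_divide powr_diff)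
    finally have "Lq_norm ?M q b \<le> (V powr (1 - q)) powr (1 / q)"
      unfolding Lq_norm_def using q by (intro powr_mono2) auto
    also have "\<dots> = V powr (1 / q - 1)"
    proof -
      have "(1 - q) * (1 / q) = 1 / q - 1" using q by (simp add: field_simps)
      then show ?thesis by (simp only: powr_powr)
    qed
    finally have nb: "Lq_norm ?M q b \<le> V powr (1 / q - 1)" .
    have "is_atom q \<alpha> b"
      unfolding is_atom_def
    proof (intro conjI disjI2 exI[of _ ?Q])
      show "b \<in> Lq_fun ?M q" using bint bM by (simp add: Lq_fun_def)
      show "is_carleson_tube ?Q" using \<delta> by (intro is_carleson_tubeI \<zeta>) auto
      show "AE z in ?M. z \<notin> ?Q \<longrightarrow> b z = 0" by (rule AE_I2) (use bsupp in auto)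
      show "Lq_norm ?M q b \<le> measure ?M ?Q powr (1 / q - 1)" using nb by (simp add: V_def)
      show "(LINT z|?M. b z) = 0" using mean by (simp add: b_def)
    qed
    then have "atomic_hull q \<alpha> (cmod (of_real l)) (\<lambda>z. of_real l * bergman_proj \<alpha> b z)"
      by (rule atomic_hull_atom)
    moreover have "(\<lambda>z. of_real l * bergman_proj \<alpha> b z) = bergman_proj \<alpha> a"
      using l unfolding bergman_proj_mult[symmetric] b_def by simp
    moreover have "cmod (of_real l) = C * A" using l by (subst norm_of_real) (simp add: l_def)
    ultimately show "atomic_hull q \<alpha> (C * A) (bergman_proj \<alpha> a)" by (simp only:)
  qed
qed

lemma integrable_bounded_weighted:
  fixes h :: "complex ^ 'n \<Rightarrow> complex"
  assumes "h \<in> borel_measurable borel" "\<And>u. cmod (h u) \<le> B"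
  shows "integrable (weighted_measure \<alpha>) h"
proof -
  interpret finite_measure "weighted_measure \<alpha> :: (complex ^ 'n) measure"
    by (rule finite_weighted_measure[OF \<alpha>])
  show ?thesis
    by (rule integrable_const_bound[of _ B]) (use assms measurable_weighted_measure in auto)
qed

text \<open>The normalised indicator function of a cell reproduces the kernel at its centre.\<close>

definition cell_bump :: "complex ^ 'n \<Rightarrow> real \<Rightarrow> complex ^ 'n \<Rightarrow> complex" where
  "cell_bump \<zeta> \<delta> = cell_fun \<alpha> \<zeta> \<delta> (\<lambda>_. 1 / of_real (measure lborel (cell \<zeta> \<delta>)))"

lemma measurable_cell_bump [measurable]: "cell_bump \<zeta> \<delta> \<in> borel_measurable borel"
  by (simp add: cell_bump_def)

lemma measure_cell_ge:
  obtains c where "c > 0" and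
    "\<And>(\<zeta> :: complex ^ 'n) \<delta>. norm \<zeta> = 1 \<Longrightarrow> 0 < \<delta> \<Longrightarrow> \<delta> \<le> 1 \<Longrightarrow>
       c * \<delta> ^ (CARD('n) + 1) \<le> measure lborel (cell \<zeta> \<delta>)"
proof (rule that)
  define c where "c = measure lborel (ball (0 :: complex ^ 'n) (1 / 6))"
  have c: "c > 0" "emeasure lborel (ball (0 :: complex ^ 'n) (1 / 6)) = ennreal c"
    by (simp_all add: c_def content_ball emeasure_ball)
  show "c > 0" by (rule c(1))
  fix \<zeta> :: "complex ^ 'n" and \<delta> :: real
  assume *: "norm \<zeta> = 1" "0 < \<delta>" "\<delta> \<le> 1"
  have "ennreal (c * \<delta> ^ (CARD('n) + 1)) \<le> emeasure lborel (cell \<zeta> \<delta>)"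
    using emeasure_cell_ge[OF *] c * by (simp add: ennreal_mult[symmetric] mult.commute)
  also have "\<dots> = ennreal (measure lborel (cell \<zeta> \<delta>))"
    using emeasure_cell_finite[of \<zeta> \<delta>] by (intro emeasure_eq_ennreal_measure) auto
  finally show "c * \<delta> ^ (CARD('n) + 1) \<le> measure lborel (cell \<zeta> \<delta>)" by simp
qed

lemma cell_bump_bound:
  obtains C where "C > 0" and
    "\<And>(\<zeta> :: complex ^ 'n) \<delta> u. norm \<zeta> = 1 \<Longrightarrow> 0 < \<delta> \<Longrightarrow> \<delta> \<le> 1 \<Longrightarrow>
       cmod (cell_bump \<zeta> \<delta> u) \<le> C * \<delta> powr (- (real CARD('n) + 1 + \<alpha>))"
proof -
  obtain c where c: "c > 0" and ge: "\<And>(\<zeta> :: complex ^ 'n) \<delta>. norm \<zeta> = 1 \<Longrightarrow> 0 < \<delta> \<Longrightarrow> \<delta> \<le> 1 \<Longrightarrow>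
       c * \<delta> ^ (CARD('n) + 1) \<le> measure lborel (cell \<zeta> \<delta>)"
    using measure_cell_ge[where 'n = 'n] by blast
  obtain C where C: "C > 0" and le: "\<And>(\<zeta> :: complex ^ 'n) \<delta> G B u. norm \<zeta> = 1 \<Longrightarrow> 0 < \<delta> \<Longrightarrow> \<delta> \<le> 1 \<Longrightarrow>
       (\<And>v. v \<in> cell \<zeta> \<delta> \<Longrightarrow> cmod (G v) \<le> B) \<Longrightarrow> B \<ge> 0 \<Longrightarrow> cmod (cell_fun \<alpha> \<zeta> \<delta> G u) \<le> C * B * \<delta> powr (- \<alpha>)"
    using cell_fun_bound[OF \<alpha>, where 'n = 'n] by blast
  show ?thesis
  proof (rule that[of "C / c"])
    show "C / c > 0" using C c by simp
    fix \<zeta> u :: "complex ^ 'n" and \<delta> :: real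
    assume \<zeta>: "norm \<zeta> = 1" and \<delta>: "0 < \<delta>" "\<delta> \<le> 1"
    let ?m = "measure lborel (cell \<zeta> \<delta>)"
    have p: "0 < c * \<delta> ^ (CARD('n) + 1)" using c \<delta> by simp
    have m: "c * \<delta> ^ (CARD('n) + 1) \<le> ?m" by (rule ge[OF \<zeta> \<delta>])
    have "1 / ?m \<le> 1 / (c * \<delta> ^ (CARD('n) + 1))" using m p by (intro divide_left_mono) auto
    then have "cmod (cell_bump \<zeta> \<delta> u) \<le> C * (1 / (c * \<delta> ^ (CARD('n) + 1))) * \<delta> powr (- \<alpha>)"
      unfolding cell_bump_def using \<zeta> \<delta> p m by (intro le) (auto simp: norm_divide)
    also have "\<dots> = C / c * \<delta> powr (- (real CARD('n) + 1 + \<alpha>))"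
    proof -
      have "- (real CARD('n) + 1 + \<alpha>) = - real (CARD('n) + 1) + - \<alpha>" by simp
      then have "\<delta> powr (- (real CARD('n) + 1 + \<alpha>)) = \<delta> powr (- real (CARD('n) + 1)) * \<delta> powr (- \<alpha>)"
        by (simp only: powr_add)
      also have "\<delta> powr (- real (CARD('n) + 1)) = 1 / \<delta> ^ (CARD('n) + 1)"
        unfolding powr_minus powr_realpow[OF \<delta>(1)] by (simp add: divide_inverse)
      finally show ?thesis by simp
    qed
    finally show "cmod (cell_bump \<zeta> \<delta> u) \<le> C / c * \<delta> powr (- (real CARD('n) + 1 + \<alpha>))" .
  qed
qed

lemma cell_bump_integral:
  fixes \<zeta> :: "complex ^ 'n"
  assumes \<zeta>: "norm \<zeta> = 1" and \<delta>: "0 < \<delta>" "\<delta> \<le> 1"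
  shows "(LINT u|weighted_measure \<alpha>. cell_bump \<zeta> \<delta> u) = 1"
    and "norm z < 1 \<Longrightarrow> bergman_proj \<alpha> (cell_bump \<zeta> \<delta>) z
           = bker (real CARD('n) + 1 + \<alpha>) z ((1 - \<delta>) *\<^sub>R \<zeta>)"
proof -
  let ?m = "measure lborel (cell \<zeta> \<delta>)"
  obtain c where c: "c > 0" and ge: "\<And>(\<zeta> :: complex ^ 'n) \<delta>. norm \<zeta> = 1 \<Longrightarrow> 0 < \<delta> \<Longrightarrow> \<delta> \<le> 1 \<Longrightarrow>
       c * \<delta> ^ (CARD('n) + 1) \<le> measure lborel (cell \<zeta> \<delta>)"
    using measure_cell_ge[where 'n = 'n] by blast
  have "0 < c * \<delta> ^ (CARD('n) + 1)" using c \<delta> by simp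
  then have m: "?m > 0" using ge[OF \<zeta> \<delta>] by linarith
  have fin: "emeasure lborel (cell \<zeta> \<delta>) < \<infinity>" by (rule emeasure_cell_finite)
  have gen: "(LINT u|weighted_measure \<alpha>. cell_bump \<zeta> \<delta> u * h u)
      = (LINT v|lborel. indicator (cell \<zeta> \<delta>) v *\<^sub>R h ((1 - \<delta>) *\<^sub>R \<zeta> + v)) / of_real ?m"
    if [measurable]: "h \<in> borel_measurable borel" for h
  proof -
    let ?p = "(1 - \<delta>) *\<^sub>R \<zeta>"
    have "(LINT u|weighted_measure \<alpha>. cell_bump \<zeta> \<delta> u * h u)
        = (LINT v|lborel. indicator (cell \<zeta> \<delta>) v *\<^sub>R (1 / of_real ?m * h (?p + v)))"
      unfolding cell_bump_def by (rule integral_cell_fun[OF \<alpha> \<zeta> \<delta>]) simp_all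
    also have "\<dots> = (LINT v|lborel. indicator (cell \<zeta> \<delta>) v *\<^sub>R h (?p + v) / of_real ?m)"
      by (simp add: scaleR_conv_of_real)
    also have "\<dots> = (LINT v|lborel. indicator (cell \<zeta> \<delta>) v *\<^sub>R h (?p + v)) / of_real ?m"
      by (rule integral_divide_zero)
    finally show ?thesis .
  qed
  show "(LINT u|weighted_measure \<alpha>. cell_bump \<zeta> \<delta> u) = 1"
    using gen[of "\<lambda>_. 1"] m fin by (simp add: scaleR_conv_of_real)
  assume z: "norm z < 1"
  have s: "real CARD('n) + 1 + \<alpha> > 0" using \<alpha> by simp
  show "bergman_proj \<alpha> (cell_bump \<zeta> \<delta>) z = bker (real CARD('n) + 1 + \<alpha>) z ((1 - \<delta>) *\<^sub>R \<zeta>)"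
    unfolding bergman_proj_eq using m
    by (subst gen) (simp_all add: integral_cell_bker[OF \<zeta> \<delta> z s])
qed

text \<open>
  The kernel at \<open>(1 - \<delta>) *\<^sub>R \<zeta>\<close>. Passing from \<open>\<delta>\<close> to \<open>2 * \<delta>\<close> costs a bounded multiple of an atom.
  About \<open>log (1 / \<delta>)\<close> such steps lead to the constant function; a bound by \<open>1 / \<delta>\<close> suffices.
\<close>

lemma atomic_hull_kernel:
  obtains C where "C > 0" and
    "\<And>(\<zeta> :: complex ^ 'n) \<delta>. norm \<zeta> = 1 \<Longrightarrow> 0 < \<delta> \<Longrightarrow> \<delta> \<le> 1 \<Longrightarrow>
       atomic_hull q \<alpha> (C / \<delta>) (\<lambda>z. bker (real CARD('n) + 1 + \<alpha>) z ((1 - \<delta>) *\<^sub>R \<zeta>))"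
proof -
  let ?M = "weighted_measure \<alpha> :: (complex ^ 'n) measure"
  interpret finite_measure ?M by (rule finite_weighted_measure[OF \<alpha>])
  define s where "s = real CARD('n) + 1 + \<alpha>"
  have s: "s > 0" using \<alpha> by (simp add: s_def)
  define K where "K \<zeta> \<delta> z = bker s z ((1 - \<delta>) *\<^sub>R \<zeta>)" for \<zeta> :: "complex ^ 'n" and \<delta> z
  obtain C1 where C1: "C1 > 0" and hull:
    "\<And>(a :: complex ^ 'n \<Rightarrow> complex) \<zeta> \<delta> A. norm \<zeta> = 1 \<Longrightarrow> 0 < \<delta> \<Longrightarrow> \<delta> \<le> 1 \<Longrightarrow>
       a \<in> borel_measurable borel \<Longrightarrow> A > 0 \<Longrightarrow>
       (\<And>u. cmod (a u) \<le> A * \<delta> powr (- (real CARD('n) + 1 + \<alpha>))) \<Longrightarrow>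
       (\<And>u. norm u < 1 \<Longrightarrow> u \<notin> tube \<zeta> (4 * \<delta>) \<Longrightarrow> a u = 0) \<Longrightarrow>
       (LINT u|?M. a u) = 0 \<Longrightarrow> atomic_hull q \<alpha> (C1 * A) (bergman_proj \<alpha> a)"
    using atomic_hull_tube_function[where 'n = 'n] by blast
  obtain C2 where C2: "C2 > 0" and bump:
    "\<And>(\<zeta> :: complex ^ 'n) \<delta> u. norm \<zeta> = 1 \<Longrightarrow> 0 < \<delta> \<Longrightarrow> \<delta> \<le> 1 \<Longrightarrow>
       cmod (cell_bump \<zeta> \<delta> u) \<le> C2 * \<delta> powr (- (real CARD('n) + 1 + \<alpha>))"
    using cell_bump_bound[where 'n = 'n] by blast
  have step: "atomic_hull q \<alpha> (C1 * (2 * C2)) (\<lambda>z. K \<zeta> \<delta> z - K \<zeta> \<delta>' z)"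
    if \<zeta>: "norm \<zeta> = 1" and \<delta>: "0 < \<delta>" "\<delta> \<le> 1" and \<delta>': "\<delta> \<le> \<delta>'" "\<delta>' \<le> 2 * \<delta>" "\<delta>' \<le> 1"
    for \<zeta> :: "complex ^ 'n" and \<delta> \<delta>'
  proof -
    have \<delta>'0: "0 < \<delta>'" using \<delta> \<delta>' by simp
    define a where "a u = cell_bump \<zeta> \<delta> u - cell_bump \<zeta> \<delta>' u" for u
    have i: "integrable ?M (cell_bump \<zeta> \<delta>)" "integrable ?M (cell_bump \<zeta> \<delta>')"
      using bump[OF \<zeta> \<delta>] bump[OF \<zeta> \<delta>'0 \<delta>'(3)] by (auto intro!: integrable_bounded_weighted)
    have "atomic_hull q \<alpha> (C1 * (2 * C2)) (bergman_proj \<alpha> a)"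
    proof (rule hull[OF \<zeta> \<delta>])
      show "a \<in> borel_measurable borel" unfolding a_def by measurable
      show "2 * C2 > 0" using C2 by simp
      have "(LINT u|?M. a u) = (LINT u|?M. cell_bump \<zeta> \<delta> u) - (LINT u|?M. cell_bump \<zeta> \<delta>' u)"
        unfolding a_def by (rule Bochner_Integration.integral_diff[OF i])
      then show "(LINT u|?M. a u) = 0" by (simp add: cell_bump_integral[OF \<zeta>] \<delta> \<delta>' \<delta>'0)
      fix u
      have "\<delta>' powr (- s) \<le> \<delta> powr (- s)" using \<delta> \<delta>' s by (intro powr_mono2') auto
      then have "C2 * \<delta>' powr (- s) \<le> C2 * \<delta> powr (- s)" using C2 by (intro mult_left_mono) auto
      then show "cmod (a u) \<le> 2 * C2 * \<delta> powr (- (real CARD('n) + 1 + \<alpha>))"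
        using bump[OF \<zeta> \<delta>, of u] bump[OF \<zeta> \<delta>'0 \<delta>'(3), of u]
          norm_triangle_ineq4[of "cell_bump \<zeta> \<delta> u" "cell_bump \<zeta> \<delta>' u"]
        unfolding a_def s_def[symmetric] by linarith
      assume "u \<notin> tube \<zeta> (4 * \<delta>)"
      then have "u \<notin> tube \<zeta> (2 * \<delta>)" "u \<notin> tube \<zeta> (2 * \<delta>')"
        using tube_mono[of "2 * \<delta>" "4 * \<delta>" \<zeta>] tube_mono[of "2 * \<delta>'" "4 * \<delta>" \<zeta>] \<delta> \<delta>' by auto
      then show "a u = 0"
        unfolding a_def cell_bump_def using \<zeta> \<delta> \<delta>' \<delta>'0 by (simp add: cell_fun_support)
    qed
    moreover have "bergman_proj \<alpha> a z = K \<zeta> \<delta> z - K \<zeta> \<delta>' z" if z: "norm z < 1" for z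
    proof -
      have "bergman_proj \<alpha> a z = (LINT w|?M. cell_bump \<zeta> \<delta> w * bker s z w - cell_bump \<zeta> \<delta>' w * bker s z w)"
        by (simp add: bergman_proj_eq a_def s_def left_diff_distrib)
      also have "\<dots> = bergman_proj \<alpha> (cell_bump \<zeta> \<delta>) z - bergman_proj \<alpha> (cell_bump \<zeta> \<delta>') z"
        unfolding bergman_proj_eq s_def[symmetric]
        by (intro Bochner_Integration.integral_diff bergman_proj_integrable i z s)
      also have "\<dots> = K \<zeta> \<delta> z - K \<zeta> \<delta>' z"
        using \<delta> \<delta>' \<delta>'0 z by (simp add: cell_bump_integral[OF \<zeta>] K_def s_def)
      finally show ?thesis .
    qed
    ultimately show ?thesis by (rule atomic_hull_cong)
  qed
  define m where "m = measure ?M (ball 0 1)"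
  have m: "m > 0"
  proof -
    obtain \<zeta> :: "complex ^ 'n" where \<zeta>: "norm \<zeta> = 1" using polar_vector by blast
    obtain c where c: "c > 0" and ge: "\<And>(\<zeta> :: complex ^ 'n) R. norm \<zeta> = 1 \<Longrightarrow> 0 < R \<Longrightarrow> R \<le> 4 \<Longrightarrow>
         c * R powr (real CARD('n) + 1 + \<alpha>) \<le> measure ?M (tube \<zeta> R)"
      using measure_tube_ge[OF \<alpha>, where 'n = 'n] by blast
    have "c * 2 powr (real CARD('n) + 1 + \<alpha>) \<le> m"
      using ge[OF \<zeta>, of 2] tube_eq_ball[of \<zeta> 2] \<zeta> by (simp add: m_def)
    moreover have "0 < c * 2 powr (real CARD('n) + 1 + \<alpha>)" using c by simp
    ultimately show ?thesis by linarith
  qed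
  have one: "atomic_hull q \<alpha> (1 / m) (\<lambda>z :: complex ^ 'n. 1)"
  proof -
    have "is_atom q \<alpha> (\<lambda>_ :: complex ^ 'n. 1)" by (simp add: is_atom_def Lq_fun_def)
    then have "atomic_hull q \<alpha> (cmod (of_real (1 / m))) (\<lambda>z. of_real (1 / m) * bergman_proj \<alpha> (\<lambda>_ :: complex ^ 'n. 1) z)"
      by (rule atomic_hull_atom)
    moreover have "of_real (1 / m) * bergman_proj \<alpha> (\<lambda>_ :: complex ^ 'n. 1) z = 1" if "norm z < 1" for z :: "complex ^ 'n"
      using bergman_proj_one[OF \<alpha> that, of "\<lambda>_. 1"] m by (simp add: m_def)
    ultimately have "atomic_hull q \<alpha> (cmod (of_real (1 / m))) (\<lambda>z :: complex ^ 'n. 1)"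
      by (rule atomic_hull_cong)
    then show ?thesis using m by (simp add: norm_divide)
  qed
  define C where "C = C1 * (2 * C2) + 1 / m"
  have C: "C > 0" using C1 C2 m unfolding C_def by (intro add_pos_pos) auto
  have main: "atomic_hull q \<alpha> (C / \<delta>) (K \<zeta> \<delta>)"
    if \<zeta>: "norm \<zeta> = 1" and "(1 / 2) ^ N \<le> \<delta>" "\<delta> \<le> 1" for \<zeta> :: "complex ^ 'n" and \<delta> N
    using that(2,3)
  proof (induction N arbitrary: \<delta>)
    case 0
    then have "\<delta> = 1" by simp
    have "atomic_hull q \<alpha> (C / \<delta>) (\<lambda>z :: complex ^ 'n. 1)"
      by (rule atomic_hull_mono[OF one]) (use C1 C2 \<open>\<delta> = 1\<close> in \<open>simp add: C_def\<close>)
    moreover have "K \<zeta> \<delta> = (\<lambda>z. 1)" by (simp add: K_def bker_def \<open>\<delta> = 1\<close> fun_eq_iff)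
    ultimately show ?case by simp
  next
    case (Suc N)
    have \<delta>: "0 < \<delta>" using Suc.prems(1) less_le_trans[of 0 "(1 / 2 :: real) ^ Suc N" \<delta>] by simp
    show ?case
    proof (cases "\<delta> \<le> 1 / 2")
      case True
      have "atomic_hull q \<alpha> (C / (2 * \<delta>)) (K \<zeta> (2 * \<delta>))"
        using True Suc.prems by (intro Suc.IH) auto
      then have "atomic_hull q \<alpha> (C1 * (2 * C2) + C / (2 * \<delta>)) (\<lambda>z. (K \<zeta> \<delta> z - K \<zeta> (2 * \<delta>) z) + K \<zeta> (2 * \<delta>) z)"
        using True \<delta> by (intro atomic_hull_add step \<zeta>) auto
      moreover have "C1 * (2 * C2) + C / (2 * \<delta>) \<le> C / \<delta>"
      proof -
        have "C1 * (2 * C2) \<le> C" using m by (simp add: C_def)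
        also have "\<dots> \<le> C / (2 * \<delta>)" using True \<delta> C by (simp add: field_simps)
        finally show ?thesis using \<delta> by (simp add: field_simps)
      qed
      ultimately show ?thesis using atomic_hull_mono by fastforce
    next
      case False
      have "K \<zeta> 1 = (\<lambda>z. 1)" by (simp add: K_def bker_def fun_eq_iff)
      then have "atomic_hull q \<alpha> (1 / m) (K \<zeta> 1)" using one by simp
      then have "atomic_hull q \<alpha> (C1 * (2 * C2) + 1 / m) (\<lambda>z. (K \<zeta> \<delta> z - K \<zeta> 1 z) + K \<zeta> 1 z)"
        using False \<delta> Suc.prems by (intro atomic_hull_add step \<zeta>) auto
      moreover have "C \<le> C / \<delta>" using \<delta> Suc.prems C by (simp add: field_simps)
      ultimately show ?thesis using atomic_hull_mono unfolding C_def[symmetric] by fastforce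
    qed
  qed
  show ?thesis
  proof (rule that[of C, OF C])
    fix \<zeta> :: "complex ^ 'n" and \<delta> :: real
    assume \<zeta>: "norm \<zeta> = 1" and \<delta>: "0 < \<delta>" "\<delta> \<le> 1"
    obtain N where "(1 / 2) ^ N < \<delta>" using real_arch_pow_inv[of \<delta> "1 / 2"] \<delta> by auto
    then have "atomic_hull q \<alpha> (C / \<delta>) (K \<zeta> \<delta>)" using main[OF \<zeta>, of N \<delta>] \<delta> by simp
    then show "atomic_hull q \<alpha> (C / \<delta>) (\<lambda>z. bker (real CARD('n) + 1 + \<alpha>) z ((1 - \<delta>) *\<^sub>R \<zeta>))"
      by (simp add: K_def[abs_def] s_def)
  qed
qed

lemma cell_second_moment_ge:
  obtains c where "c > 0" and
    "\<And>(\<zeta> :: complex ^ 'n) \<delta>. norm \<zeta> = 1 \<Longrightarrow> 0 < \<delta> \<Longrightarrow> \<delta> \<le> 1 \<Longrightarrow>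
       c * \<delta> ^ (CARD('n) + 3) \<le> (LINT v|lborel. indicator (cell \<zeta> \<delta>) v *\<^sub>R (cmod (hinner v \<zeta>))\<^sup>2)"
proof -
  obtain k :: 'n where True by simp
  define J where "J = (\<integral>\<^sup>+v. indicator (ball (0 :: complex ^ 'n) (1 / 6)) v * ennreal (cmod (v $ k) ^ 2) \<partial>lborel)"
  define p :: "complex ^ 'n" where "p = (1 / 12) *\<^sub>R axis k 1"
  have np: "norm p = 1 / 12" by (simp add: p_def)
  define V where "V = measure lborel (ball p (1 / 24))"
  have V: "V > 0" "emeasure lborel (ball p (1 / 24)) = ennreal V"
    by (simp_all add: V_def content_ball emeasure_ball)
  define c where "c = (1 / 24)\<^sup>2 * V"
  have "ennreal c = (\<integral>\<^sup>+v. ennreal ((1 / 24)\<^sup>2) * indicator (ball p (1 / 24)) v \<partial>lborel)"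
    using V by (simp add: nn_integral_cmult c_def ennreal_mult)
  also have "\<dots> \<le> J"
    unfolding J_def
  proof (rule nn_integral_mono)
    fix v :: "complex ^ 'n"
    show "ennreal ((1 / 24)\<^sup>2) * indicator (ball p (1 / 24)) v
      \<le> indicator (ball (0 :: complex ^ 'n) (1 / 6)) v * ennreal (cmod (v $ k) ^ 2)"
    proof (cases "v \<in> ball p (1 / 24)")
      case True
      then have d: "norm (p - v) < 1 / 24" by (simp add: dist_norm)
      have "norm v \<le> norm p + norm (p - v)" using norm_triangle_ineq4[of p "p - v"] by simp
      then have "norm v < 1 / 6" using d np by simp
      have "cmod (p $ k) - cmod (v $ k) \<le> cmod ((p - v) $ k)" by (simp add: norm_triangle_ineq2)
      also have "\<dots> \<le> norm (p - v)" by (rule Finite_Cartesian_Product.norm_nth_le)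
      finally have "1 / 24 \<le> cmod (v $ k)" using d by (simp add: p_def)
      then have "(1 / 24)\<^sup>2 \<le> (cmod (v $ k))\<^sup>2" by (intro power_mono) auto
      then show ?thesis using True \<open>norm v < 1 / 6\<close> by (simp add: ennreal_leI)
    qed simp
  qed
  finally have J: "ennreal c \<le> J" .
  have c: "c > 0" using V by (simp add: c_def)
  show ?thesis
  proof (rule that[of c, OF c])
    fix \<zeta> :: "complex ^ 'n" and \<delta> :: real
    assume \<zeta>: "norm \<zeta> = 1" and \<delta>: "0 < \<delta>" "\<delta> \<le> 1"
    let ?f = "\<lambda>v. indicator (cell \<zeta> \<delta>) v *\<^sub>R (cmod (hinner v \<zeta>))\<^sup>2"
    have int: "integrable lborel ?f"
    proof (rule integrable_cell[where B = 1])
      fix v assume "v \<in> cell \<zeta> \<delta>"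
      then have "cmod (hinner v \<zeta>) \<le> 1" using \<delta> by (simp add: cell_def)
      then show "norm ((cmod (hinner v \<zeta>))\<^sup>2) \<le> 1" by (simp add: power_le_one)
    qed simp
    have "ennreal (c * \<delta> ^ (CARD('n) + 3)) = ennreal (\<delta> ^ (CARD('n) + 3)) * ennreal c"
      using c \<delta> by (simp add: ennreal_mult mult.commute)
    also have "\<dots> \<le> ennreal (\<delta> ^ (CARD('n) + 3)) * J" using J by (intro mult_left_mono) auto
    also have "\<dots> = ennreal (\<delta> ^ (CARD('n) + 1 + 2)) * J"
      by (rule arg_cong[where f = "\<lambda>m. ennreal (\<delta> ^ m) * J"]) simp
    also have "\<dots> \<le> (\<integral>\<^sup>+v. indicator (cell \<zeta> \<delta>) v * ennreal (cmod (hinner v \<zeta>) ^ 2) \<partial>lborel)"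
      unfolding J_def by (rule cell_moment_ge[OF \<zeta> \<delta>])
    also have "\<dots> = (\<integral>\<^sup>+v. ennreal (?f v) \<partial>lborel)"
      by (rule nn_integral_cong) (simp add: indicator_def)
    also have "\<dots> = ennreal (LINT v|lborel. ?f v)"
      using int by (intro nn_integral_eq_integral) auto
    finally show "c * \<delta> ^ (CARD('n) + 3) \<le> (LINT v|lborel. ?f v)"
      by (simp add: ennreal_le_iff)
  qed
qed

text \<open>
  The radial derivative of the kernel is the projection of a linear function on a cell, which has
  mean zero by symmetry. This function is of order \<open>\<delta>\<close> on the cell, while its pairing with the
  kernel yields the second moment, smaller than the volume by a factor of order \<open>\<delta>\<^sup>2\<close>; the quotient
  is the bound of order \<open>1 / \<delta>\<close>.
\<close>

lemma atomic_hull_kernel_derivative: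
  obtains C where "C > 0" and
    "\<And>(\<zeta> :: complex ^ 'n) \<delta>. norm \<zeta> = 1 \<Longrightarrow> 0 < \<delta> \<Longrightarrow> \<delta> \<le> 1 \<Longrightarrow>
       atomic_hull q \<alpha> (C / \<delta>) (\<lambda>z. hinner z \<zeta> * bker (real CARD('n) + 1 + \<alpha> + 1) z ((1 - \<delta>) *\<^sub>R \<zeta>))"
proof -
  let ?M = "weighted_measure \<alpha> :: (complex ^ 'n) measure"
  let ?n = "CARD('n)"
  define s where "s = real ?n + 1 + \<alpha>"
  have s: "s > 0" using \<alpha> by (simp add: s_def)
  obtain C1 where C1: "C1 > 0" and hull:
    "\<And>(a :: complex ^ 'n \<Rightarrow> complex) \<zeta> \<delta> A. norm \<zeta> = 1 \<Longrightarrow> 0 < \<delta> \<Longrightarrow> \<delta> \<le> 1 \<Longrightarrow>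
       a \<in> borel_measurable borel \<Longrightarrow> A > 0 \<Longrightarrow>
       (\<And>u. cmod (a u) \<le> A * \<delta> powr (- (real CARD('n) + 1 + \<alpha>))) \<Longrightarrow>
       (\<And>u. norm u < 1 \<Longrightarrow> u \<notin> tube \<zeta> (4 * \<delta>) \<Longrightarrow> a u = 0) \<Longrightarrow>
       (LINT u|?M. a u) = 0 \<Longrightarrow> atomic_hull q \<alpha> (C1 * A) (bergman_proj \<alpha> a)"
    using atomic_hull_tube_function[where 'n = 'n] by blast
  obtain C2 where C2: "C2 > 0" and le: "\<And>(\<zeta> :: complex ^ 'n) \<delta> G B u. norm \<zeta> = 1 \<Longrightarrow> 0 < \<delta> \<Longrightarrow> \<delta> \<le> 1 \<Longrightarrow>
       (\<And>v. v \<in> cell \<zeta> \<delta> \<Longrightarrow> cmod (G v) \<le> B) \<Longrightarrow> B \<ge> 0 \<Longrightarrow> cmod (cell_fun \<alpha> \<zeta> \<delta> G u) \<le> C2 * B * \<delta> powr (- \<alpha>)"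
    using cell_fun_bound[OF \<alpha>, where 'n = 'n] by blast
  obtain c where c: "c > 0" and ge: "\<And>(\<zeta> :: complex ^ 'n) \<delta>. norm \<zeta> = 1 \<Longrightarrow> 0 < \<delta> \<Longrightarrow> \<delta> \<le> 1 \<Longrightarrow>
       c * \<delta> ^ (?n + 3) \<le> (LINT v|lborel. indicator (cell \<zeta> \<delta>) v *\<^sub>R (cmod (hinner v \<zeta>))\<^sup>2)"
    using cell_second_moment_ge[where 'n = 'n] by blast
  show ?thesis
  proof (rule that[of "C1 * C2 / (c * s)"])
    show "C1 * C2 / (c * s) > 0" using C1 C2 c s by simp
    fix \<zeta> :: "complex ^ 'n" and \<delta> :: real
    assume \<zeta>: "norm \<zeta> = 1" and \<delta>: "0 < \<delta>" "\<delta> \<le> 1"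
    let ?p = "(1 - \<delta>) *\<^sub>R \<zeta>"
    \<comment> \<open>Dividing by \<open>d\<close> makes the linear weight comparable to a normalised indicator function.\<close>
    define d where "d = \<delta> ^ (?n + 2)"
    have d: "d > 0" using \<delta> by (simp add: d_def)
    define G where "G v = hinner v \<zeta> / of_real d" for v
    have [measurable]: "G \<in> borel_measurable borel" unfolding G_def by measurable
    define a where "a = cell_fun \<alpha> \<zeta> \<delta> G"
    define \<kappa> where "\<kappa> = (LINT v|lborel. indicator (cell \<zeta> \<delta>) v *\<^sub>R (cmod (hinner v \<zeta>))\<^sup>2)"
    have \<kappa>: "c * \<delta> ^ (?n + 3) \<le> \<kappa>" unfolding \<kappa>_def by (rule ge[OF \<zeta> \<delta>])
    have "0 < c * \<delta> ^ (?n + 3)" using c \<delta> by simp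
    then have \<kappa>0: "\<kappa> > 0" using \<kappa> by linarith
    have bd: "cmod (a u) \<le> C2 * \<delta> powr (- s)" for u
    proof -
      have "cmod (G v) \<le> 1 / \<delta> ^ (?n + 1)" if "v \<in> cell \<zeta> \<delta>" for v
      proof -
        have "cmod (hinner v \<zeta>) \<le> \<delta>" using that \<delta> by (simp add: cell_def)
        then have "cmod (G v) \<le> \<delta> / d" using d by (simp add: G_def norm_divide divide_right_mono)
        also have "\<dots> = 1 / \<delta> ^ (?n + 1)" using \<delta> by (simp add: d_def)
        finally show ?thesis .
      qed
      then have "cmod (a u) \<le> C2 * (1 / \<delta> ^ (?n + 1)) * \<delta> powr (- \<alpha>)"
        unfolding a_def using \<zeta> \<delta> by (intro le) auto
      also have "\<dots> = C2 * \<delta> powr (- s)"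
      proof -
        have "- s = - real (?n + 1) + - \<alpha>" by (simp add: s_def)
        then have "\<delta> powr (- s) = \<delta> powr (- real (?n + 1)) * \<delta> powr (- \<alpha>)"
          by (simp only: powr_add)
        also have "\<delta> powr (- real (?n + 1)) = 1 / \<delta> ^ (?n + 1)"
          unfolding powr_minus powr_realpow[OF \<delta>(1)] by (simp add: divide_inverse)
        finally show ?thesis by simp
      qed
      finally show ?thesis .
    qed
    have "atomic_hull q \<alpha> (C1 * C2) (bergman_proj \<alpha> a)"
    proof (rule hull[OF \<zeta> \<delta> _ C2])
      show "a \<in> borel_measurable borel" unfolding a_def by measurable
      show "cmod (a u) \<le> C2 * \<delta> powr (- (real CARD('n) + 1 + \<alpha>))" for u
        using bd by (simp add: s_def)
      show "a u = 0" if "u \<notin> tube \<zeta> (4 * \<delta>)" for u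
      proof -
        have "u \<notin> tube \<zeta> (2 * \<delta>)" using that tube_mono[of "2 * \<delta>" "4 * \<delta>" \<zeta>] \<delta> by auto
        then show ?thesis unfolding a_def using \<zeta> \<delta> by (simp add: cell_fun_support)
      qed
      define T where "T v = indicator (cell \<zeta> \<delta>) v *\<^sub>R G v" for v
      have [measurable]: "T \<in> borel_measurable borel" unfolding T_def by measurable
      have "(LINT u|?M. a u) = (LINT u|?M. cell_fun \<alpha> \<zeta> \<delta> G u * 1)" by (simp add: a_def)
      also have "\<dots> = (LINT v|lborel. T v)"
        by (subst integral_cell_fun[OF \<alpha> \<zeta> \<delta>]) (simp_all add: T_def[abs_def])
      finally have aT: "(LINT u|?M. a u) = (LINT v|lborel. T v)" .
      have "(LINT v|lborel. T v) = (LINT v|lborel. T ((-1) *s v))"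
        by (rule integral_unitary[OF unitary_map_scale, symmetric]) simp_all
      also have "(\<lambda>v. T ((-1) *s v)) = (\<lambda>v. - T v)"
        by (auto simp: T_def G_def fun_eq_iff indicator_def cell_def hinner_scale_left hinner_minus_left)
      finally show "(LINT u|?M. a u) = 0" unfolding aT by (simp add: equation_minus_iff)
    qed
    then have h: "atomic_hull q \<alpha> (cmod (of_real (d / (\<kappa> * s))) * (C1 * C2)) (\<lambda>z. of_real (d / (\<kappa> * s)) * bergman_proj \<alpha> a z)"
      by (rule atomic_hull_scale)
    have eq: "of_real (d / (\<kappa> * s)) * bergman_proj \<alpha> a z = hinner z \<zeta> * bker (s + 1) z ?p" if z: "norm z < 1" for z
    proof -
      have "bergman_proj \<alpha> a z = (LINT v|lborel. indicator (cell \<zeta> \<delta>) v *\<^sub>R (G v * bker s z (?p + v)))"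
        unfolding bergman_proj_eq s_def[symmetric] a_def by (rule integral_cell_fun[OF \<alpha> \<zeta> \<delta>]) simp_all
      also have "\<dots> = (LINT v|lborel. indicator (cell \<zeta> \<delta>) v *\<^sub>R (hinner v \<zeta> * bker s z (?p + v)) / of_real d)"
        by (simp add: G_def scaleR_conv_of_real)
      also have "\<dots> = (LINT v|lborel. indicator (cell \<zeta> \<delta>) v *\<^sub>R (hinner v \<zeta> * bker s z (?p + v))) / of_real d"
        by (rule integral_divide_zero)
      also have "\<dots> = of_real \<kappa> * (of_real s * (hinner z \<zeta> * bker (s + 1) z ?p)) / of_real d"
        unfolding \<kappa>_def by (simp only: integral_cell_linear_bker[OF \<zeta> \<delta> z s])
      finally show ?thesis using d \<kappa>0 s by (simp add: field_simps)
    qed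
    have "atomic_hull q \<alpha> (cmod (of_real (d / (\<kappa> * s))) * (C1 * C2)) (\<lambda>z. hinner z \<zeta> * bker (s + 1) z ?p)"
      by (rule atomic_hull_cong[OF h eq])
    moreover have "cmod (of_real (d / (\<kappa> * s))) * (C1 * C2) \<le> C1 * C2 / (c * s) / \<delta>"
    proof -
      have "d / \<kappa> \<le> d / (c * \<delta> ^ (?n + 3))" using \<kappa> \<kappa>0 c \<delta> d by (intro divide_left_mono) auto
      also have "\<dots> = 1 / (c * \<delta>)" using \<delta> c by (simp add: d_def power_add power3_eq_cube power2_eq_square)
      finally have "d / \<kappa> * (C1 * C2 / s) \<le> 1 / (c * \<delta>) * (C1 * C2 / s)"
        using C1 C2 s by (intro mult_right_mono) auto
      moreover have "cmod (of_real (d / (\<kappa> * s))) = d / (\<kappa> * s)" using d \<kappa>0 s by (subst norm_of_real) simp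
      ultimately show ?thesis by (simp add: mult_ac)
    qed
    ultimately show "atomic_hull q \<alpha> (C1 * C2 / (c * s) / \<delta>)
        (\<lambda>z. hinner z \<zeta> * bker (real CARD('n) + 1 + \<alpha> + 1) z ?p)"
      unfolding s_def[symmetric] by (rule atomic_hull_mono)
  qed
qed

text \<open>
  Writing \<open>1 = (1 - hinner z w) + hinner z w\<close> reduces the normalised kernel of order one higher to
  the two cases above.
\<close>

lemma atomic_hull_normalised_kernel:
  obtains C where "C > 0" and
    "\<And>w :: complex ^ 'n. norm w < 1 \<Longrightarrow>
       atomic_hull q \<alpha> C (\<lambda>z. of_real (rho w) * bker (real CARD('n) + 2 + \<alpha>) z w)"
proof -
  define s where "s = real CARD('n) + 1 + \<alpha>"
  obtain C1 where C1: "C1 > 0" and h1: "\<And>(\<zeta> :: complex ^ 'n) \<delta>. norm \<zeta> = 1 \<Longrightarrow> 0 < \<delta> \<Longrightarrow> \<delta> \<le> 1 \<Longrightarrow>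
       atomic_hull q \<alpha> (C1 / \<delta>) (\<lambda>z. bker (real CARD('n) + 1 + \<alpha>) z ((1 - \<delta>) *\<^sub>R \<zeta>))"
    using atomic_hull_kernel[where 'n = 'n] by blast
  obtain C2 where C2: "C2 > 0" and h2: "\<And>(\<zeta> :: complex ^ 'n) \<delta>. norm \<zeta> = 1 \<Longrightarrow> 0 < \<delta> \<Longrightarrow> \<delta> \<le> 1 \<Longrightarrow>
       atomic_hull q \<alpha> (C2 / \<delta>) (\<lambda>z. hinner z \<zeta> * bker (real CARD('n) + 1 + \<alpha> + 1) z ((1 - \<delta>) *\<^sub>R \<zeta>))"
    using atomic_hull_kernel_derivative[where 'n = 'n] by blast
  show ?thesis
  proof (rule that[of "2 * C1 + 2 * C2"])
    show "2 * C1 + 2 * C2 > 0" using C1 C2 by simp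
    fix w :: "complex ^ 'n" assume w: "norm w < 1"
    obtain \<zeta> where \<zeta>: "norm \<zeta> = 1" "w = norm w *\<^sub>R \<zeta>" using polar_vector by blast
    define \<delta> where "\<delta> = 1 - norm w"
    have \<delta>: "0 < \<delta>" "\<delta> \<le> 1" using w by (auto simp: \<delta>_def)
    have w\<delta>: "(1 - \<delta>) *\<^sub>R \<zeta> = w" using \<zeta>(2) by (simp add: \<delta>_def)
    have r: "0 \<le> rho w" "rho w \<le> 2 * \<delta>"
      using w zero_le_power2[of "1 - norm w"] rho_pos[OF w]
      by (auto simp: rho_def \<delta>_def power2_eq_square algebra_simps)
    let ?c1 = "of_real (rho w) :: complex" and ?c2 = "of_real (rho w * (1 - \<delta>)) :: complex"
    have "atomic_hull q \<alpha> (cmod ?c1 * (C1 / \<delta>) + cmod ?c2 * (C2 / \<delta>))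
        (\<lambda>z. ?c1 * bker s z w + ?c2 * (hinner z \<zeta> * bker (s + 1) z w))"
      using h1[OF \<zeta>(1) \<delta>] h2[OF \<zeta>(1) \<delta>] unfolding w\<delta> s_def
      by (intro atomic_hull_add atomic_hull_scale)
    moreover have "?c1 * bker s z w + ?c2 * (hinner z \<zeta> * bker (s + 1) z w)
        = of_real (rho w) * bker (real CARD('n) + 2 + \<alpha>) z w" if z: "norm z < 1" for z
    proof -
      have "hinner z w = of_real (1 - \<delta>) * hinner z \<zeta>"
        by (subst w\<delta>[symmetric]) (rule hinner_scaleR_right)
      then have e: "?c2 * (hinner z \<zeta> * bker (s + 1) z w) = ?c1 * (hinner z w * bker (s + 1) z w)"
        by (simp add: mult_ac)
      have "1 - hinner z w \<noteq> 0" using cmod_hinner_less_1[OF z, of w] w by auto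
      then have "bker s z w = (1 - hinner z w) * bker (s + 1) z w"
        using powr_add[of "1 - hinner z w" 1 "complex_of_real (- (s + 1))"] by (simp add: bker_def)
      then have "bker s z w + hinner z w * bker (s + 1) z w = bker (s + 1) z w"
        by (simp add: algebra_simps)
      moreover have s1: "real CARD('n) + 2 + \<alpha> = s + 1" by (simp add: s_def)
      ultimately show ?thesis unfolding e s1 by (simp only: distrib_left[symmetric])
    qed
    ultimately have h: "atomic_hull q \<alpha> (cmod ?c1 * (C1 / \<delta>) + cmod ?c2 * (C2 / \<delta>))
        (\<lambda>z. of_real (rho w) * bker (real CARD('n) + 2 + \<alpha>) z w)"
      by (rule atomic_hull_cong)
    have "cmod ?c1 * (C1 / \<delta>) \<le> 2 * \<delta> * (C1 / \<delta>)" using r C1 \<delta> by (intro mult_right_mono) auto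
    moreover have "cmod ?c2 \<le> 2 * \<delta> * 1" unfolding norm_of_real abs_mult using r \<delta> by (intro mult_mono) auto
    then have "cmod ?c2 * (C2 / \<delta>) \<le> 2 * \<delta> * (C2 / \<delta>)" using C2 \<delta> by (intro mult_right_mono) auto
    ultimately show "atomic_hull q \<alpha> (2 * C1 + 2 * C2) (\<lambda>z. of_real (rho w) * bker (real CARD('n) + 2 + \<alpha>) z w)"
      using \<delta> by (intro atomic_hull_mono[OF h]) simp
  qed
qed

end

section \<open>Moments of the weight\<close>

lemma powr_difference_le_mult:
  assumes b: "b > 1" and xy: "0 \<le> x" "x \<le> y" "y \<le> (1 :: real)"
  shows "y powr b - x powr b \<le> b * (y - x)"
proof (cases "x = y")
  case False
  then have "x < y" using xy by simp
  have "continuous_on {x..y} (\<lambda>u. u powr b)"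
    using b xy by (intro continuous_on_powr') (auto intro: continuous_intros)
  moreover have "(\<lambda>u. u powr b) differentiable (at u)" if "x < u" "u < y" for u
    using that xy has_real_derivative_powr[of u b] real_differentiable_def by auto
  ultimately obtain l u where u: "x < u" "u < y" "DERIV (\<lambda>u. u powr b) u :> l" "y powr b - x powr b = (y - x) * l"
    using MVT[OF \<open>x < y\<close>, of "\<lambda>u. u powr b"] by blast
  have "l = b * u powr (b - 1)"
    using DERIV_unique[OF u(3) has_real_derivative_powr] u xy by auto
  moreover have "u powr (b - 1) \<le> 1"
    using powr_mono2[of "b - 1" u 1] b u xy by auto
  ultimately have "l \<le> b * 1" using b by (simp add: mult_left_mono)
  then show ?thesis using u(4) \<open>x < y\<close> by (simp add: mult.commute)
qed simp

lemma max_powr_difference_le: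
  assumes b: "b > 1" and xy: "x \<le> y" "y \<le> (1 :: real)"
  shows "\<bar>max 0 x powr b - max 0 y powr b\<bar> \<le> b * (y - x)"
proof -
  have "max 0 x powr b \<le> max 0 y powr b" using b xy by (intro powr_mono2) auto
  moreover have "max 0 y powr b - max 0 x powr b \<le> b * (max 0 y - max 0 x)"
    using xy by (intro powr_difference_le_mult[OF b]) auto
  moreover have "b * (max 0 y - max 0 x) \<le> b * (y - x)" using b xy by (intro mult_left_mono) auto
  ultimately show ?thesis by linarith
qed

lemma tendsto_difference_quotient_sequence:
  assumes "(g has_real_derivative D) (at a)"
  shows "(\<lambda>i. (g (a + 1 / real (Suc i)) - g a) / (1 / real (Suc i))) \<longlonglongrightarrow> D"
proof -
  have "((\<lambda>h. (g (a + h) - g a) / h) \<longlongrightarrow> D) (at 0)" using assms by (simp add: DERIV_def)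
  moreover have "filterlim (\<lambda>i. 1 / real (Suc i)) (at 0) sequentially"
    unfolding filterlim_at using LIMSEQ_inverse_real_of_nat by (auto simp: inverse_eq_divide)
  ultimately show ?thesis by (rule filterlim_compose)
qed

text \<open>
  The integrand is extended by zero to the whole space, so that scaling the coordinates does not
  change the domain of integration.
\<close>

definition moment :: "'n::finite \<Rightarrow> nat \<Rightarrow> real \<Rightarrow> real" where
  "moment k m b = (LINT w|lborel. cmod ((w :: complex ^ 'n) $ k) ^ (2 * m) * max 0 (rho w) powr b)"

lemma norm_less_1_iff_rho: "norm w < 1 \<longleftrightarrow> 0 < rho w"
  by (simp add: rho_def abs_square_less_1)

lemma integrable_ball_bounded:
  fixes h :: "complex ^ 'n \<Rightarrow> 'b::{banach, second_countable_topology}"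
  assumes [measurable]: "h \<in> borel_measurable borel" and "\<And>w. norm (h w) \<le> B * indicator (ball 0 1) w"
  shows "integrable lborel h"
proof (rule Bochner_Integration.integrable_bound)
  show "integrable lborel (\<lambda>w :: complex ^ 'n. B * indicator (ball 0 1) w)"
    by (simp add: emeasure_ball)
  show "AE w in lborel. norm (h w) \<le> norm (B * indicator (ball (0 :: complex ^ 'n) 1) w)"
    by (rule AE_I2) (use assms(2) in \<open>auto intro: order_trans[OF _ abs_ge_self]\<close>)
qed simp

lemma moment_integrand_bound:
  assumes "b > 0" "\<bar>g\<bar> \<le> 1"
  shows "\<bar>cmod ((w :: complex ^ 'n) $ k) ^ (2 * m) * (g * max 0 (rho w) powr b)\<bar> \<le> 1 * indicator (ball 0 1) w"
proof (cases "norm w < 1")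
  case True
  then have "cmod (w $ k) \<le> 1" using Finite_Cartesian_Product.norm_nth_le[of w k] by simp
  then have "cmod (w $ k) ^ (2 * m) \<le> 1" by (simp add: power_le_one)
  moreover have "max 0 (rho w) powr b \<le> 1 powr b" using assms rho_le_1[of w] by (intro powr_mono2) auto
  ultimately have "cmod (w $ k) ^ (2 * m) * (\<bar>g\<bar> * max 0 (rho w) powr b) \<le> 1 * (1 * 1)"
    using assms by (intro mult_mono) auto
  then show ?thesis using True by (simp add: abs_mult)
next
  case False
  then have "max 0 (rho w) = 0" using norm_less_1_iff_rho[of w] by simp
  then show ?thesis by simp
qed

text \<open>
  Scaling the coordinates in \<open>S\<close> by \<open>sqrt t\<close> multiplies the \<open>m\<close>-th moment by a power of \<open>t\<close>, if the
  weight is scaled accordingly. Differentiation at \<open>t = 1\<close> yields a relation between moments; this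
  replaces integration by parts.
\<close>

lemma moment_scaling_derivative:
  fixes k :: "'n::finite" and S :: "'n set"
  assumes b: "b > 1" and k: "k \<in> S"
  shows "(real m + real (card S)) * moment k m b
    = b * (LINT w|lborel. cmod ((w :: complex ^ 'n) $ k) ^ (2 * m) *
        ((\<Sum>j\<in>S. (cmod (w $ j))\<^sup>2) * max 0 (rho w) powr (b - 1)))"
proof -
  define p :: "complex ^ 'n \<Rightarrow> real" where "p w = (\<Sum>j\<in>S. (cmod (w $ j))\<^sup>2)" for w
  have p0: "0 \<le> p w" for w by (simp add: p_def sum_nonneg)
  have p1: "p w \<le> (norm w)\<^sup>2" for w
    unfolding p_def norm_vec_square by (rule sum_mono2) auto
  have [measurable]: "p \<in> borel_measurable borel" unfolding p_def by measurable
  define f :: "complex ^ 'n \<Rightarrow> real" where "f w = cmod (w $ k) ^ (2 * m) * max 0 (rho w) powr b" for w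
  define g :: "real \<Rightarrow> complex ^ 'n \<Rightarrow> real"
    where "g h w = cmod (w $ k) ^ (2 * m) * max 0 (rho w - h * p w) powr b" for h w
  have [measurable]: "f \<in> borel_measurable borel" "g h \<in> borel_measurable borel" for h
    unfolding f_def g_def by measurable
  have fint: "integrable lborel f"
    by (rule integrable_ball_bounded[where B = 1])
       (use moment_integrand_bound[of b 1] b in \<open>auto simp: f_def abs_mult\<close>)
  have gle: "\<bar>g h w - f w\<bar> \<le> h * b * indicator (ball 0 1) w" if h: "h \<ge> 0" for h w
  proof (cases "norm w < 1")
    case True
    have "cmod (w $ k) \<le> 1" using Finite_Cartesian_Product.norm_nth_le[of w k] True by simp
    then have "cmod (w $ k) ^ (2 * m) \<le> 1" by (simp add: power_le_one)
    moreover have "\<bar>max 0 (rho w - h * p w) powr b - max 0 (rho w) powr b\<bar> \<le> b * (rho w - (rho w - h * p w))"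
      using h p0[of w] rho_le_1[of w] by (intro max_powr_difference_le[OF b]) auto
    moreover have "(norm w)\<^sup>2 < 1" using True by (simp add: abs_square_less_1)
    then have "h * p w \<le> h * 1" using h p1[of w] by (intro mult_left_mono) linarith+
    then have "b * (h * p w) \<le> b * h" using b by simp
    ultimately have "cmod (w $ k) ^ (2 * m) * \<bar>max 0 (rho w - h * p w) powr b - max 0 (rho w) powr b\<bar> \<le> 1 * (b * h)"
      by (intro mult_mono) auto
    moreover have "g h w - f w
        = cmod (w $ k) ^ (2 * m) * (max 0 (rho w - h * p w) powr b - max 0 (rho w) powr b)"
      by (simp add: f_def g_def right_diff_distrib)
    ultimately show ?thesis using True by (simp add: abs_mult mult.commute)
  next
    case False
    then have "rho w \<le> 0" using norm_less_1_iff_rho[of w] by simp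
    moreover have "rho w - h * p w \<le> 0" using h p0[of w] \<open>rho w \<le> 0\<close> mult_nonneg_nonneg[OF h p0[of w]] by linarith
    ultimately show ?thesis using False by (simp add: f_def g_def max_def)
  qed
  have gint: "integrable lborel (g h)" if h: "h \<ge> 0" for h
  proof -
    have "integrable lborel (\<lambda>w. g h w - f w)"
      by (rule integrable_ball_bounded[where B = "h * b"]) (use gle[OF h] in auto)
    then have "integrable lborel (\<lambda>w. (g h w - f w) + f w)" using fint by (rule Bochner_Integration.integrable_add)
    then show ?thesis by simp
  qed
  have scale: "(LINT w|lborel. g h w) = (1 + h) powr (- (real m + real (card S))) * moment k m b" if h: "h \<ge> 0" for h
  proof -
    define c where "c j = (if j \<in> S then sqrt (1 + h) else 1)" for j :: 'n
    have c: "c j > 0" for j using h by (simp add: c_def)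
    have c2: "(c j)\<^sup>2 = (if j \<in> S then 1 + h else 1)" for j using h by (simp add: c_def)
    have prod: "(\<Prod>j\<in>UNIV. (c j)\<^sup>2) = (1 + h) ^ card S"
      unfolding c2 by (subst prod.If_cases) auto
    have f: "f (\<chi> j. c j *\<^sub>R w $ j) = (1 + h) ^ m * g h w" for w :: "complex ^ 'n"
    proof -
      have "(norm (\<chi> j. c j *\<^sub>R w $ j))\<^sup>2 = (\<Sum>j\<in>UNIV. (c j)\<^sup>2 * (cmod (w $ j))\<^sup>2)"
        by (simp add: norm_vec_square power_mult_distrib)
      also have "\<dots> = (\<Sum>j\<in>UNIV. (cmod (w $ j))\<^sup>2 + (if j \<in> S then h * (cmod (w $ j))\<^sup>2 else 0))"
        by (rule sum.cong) (auto simp: c2 algebra_simps)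
      also have "\<dots> = (norm w)\<^sup>2 + h * p w"
        by (simp add: sum.distrib norm_vec_square p_def sum_distrib_left sum.If_cases)
      finally have "rho (\<chi> j. c j *\<^sub>R w $ j) = rho w - h * p w" by (simp add: rho_def)
      moreover have "cmod ((\<chi> j. c j *\<^sub>R w $ j) $ k) ^ (2 * m) = (1 + h) ^ m * cmod (w $ k) ^ (2 * m)"
        using k c2[of k] c[of k] by (simp add: norm_mult power_mult_distrib power_mult)
      ultimately show ?thesis by (simp add: f_def g_def)
    qed
    have "moment k m b = (1 + h) ^ card S * (LINT w|lborel. (1 + h) ^ m * g h w)"
      unfolding moment_def f_def[symmetric]
      by (subst integral_coordinate_scaling[of f c]) (simp_all add: prod f c)
    also have "\<dots> = (1 + h) powr (real m + real (card S)) * (LINT w|lborel. g h w)"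
      using h by (simp add: powr_add powr_realpow)
    finally have "(1 + h) powr (- (real m + real (card S))) * moment k m b
        = ((1 + h) powr (- (real m + real (card S))) * (1 + h) powr (real m + real (card S))) * (LINT w|lborel. g h w)"
      by simp
    also have "(1 + h) powr (- (real m + real (card S))) * (1 + h) powr (real m + real (card S)) = 1"
      using h unfolding powr_add[symmetric] by simp
    finally show ?thesis by simp
  qed
  define r where "r i = 1 / real (Suc i)" for i
  have r: "r i > 0" for i by (simp add: r_def)
  define L :: "complex ^ 'n \<Rightarrow> real"
    where "L w = cmod (w $ k) ^ (2 * m) * (- (b * (p w * max 0 (rho w) powr (b - 1))))" for w
  have [measurable]: "L \<in> borel_measurable borel" unfolding L_def by measurable
  have lim1: "(\<lambda>i. LINT w|lborel. (g (r i) w - f w) / r i) \<longlonglongrightarrow> (LINT w|lborel. L w)"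
  proof (rule integral_dominated_convergence[where w = "\<lambda>w. b * indicator (ball 0 1) w"])
    show "integrable lborel (\<lambda>w :: complex ^ 'n. b * indicator (ball 0 1) w)"
      by (simp add: emeasure_ball)
    show "AE w in lborel. (\<lambda>i. (g (r i) w - f w) / r i) \<longlonglongrightarrow> L w"
    proof (rule AE_I2)
      fix w :: "complex ^ 'n"
      define x where "x = rho w"
      define \<psi> where "\<psi> h = max 0 (x - h * p w) powr b" for h
      have "(\<lambda>i. (\<psi> (r i) - \<psi> 0) / r i) \<longlonglongrightarrow> - (b * (p w * max 0 x powr (b - 1)))"
      proof (cases "x > 0")
        case True
        have d: "((\<lambda>h. (x - h * p w) powr b) has_real_derivative b * (x - 0 * p w) powr (b - 1) * (0 - 1 * p w)) (at 0)"
          using True by (auto intro!: derivative_eq_intros)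
        have ev: "\<forall>\<^sub>F h in nhds 0. (x - h * p w) powr b = \<psi> h"
        proof -
          have "((\<lambda>h. x - h * p w) \<longlongrightarrow> x - 0 * p w) (nhds 0)"
            by (intro tendsto_intros filterlim_ident)
          then have "\<forall>\<^sub>F h in nhds 0. 0 < x - h * p w" using True by (intro order_tendstoD) auto
          then show ?thesis by eventually_elim (simp add: \<psi>_def)
        qed
        have "(\<psi> has_real_derivative b * (x - 0 * p w) powr (b - 1) * (0 - 1 * p w)) (at 0)"
          by (rule DERIV_cong_ev[OF refl ev refl, THEN iffD1, OF d])
        then show ?thesis
          using tendsto_difference_quotient_sequence[of \<psi> _ 0] True by (simp add: r_def mult_ac)
      next
        case False
        have "\<psi> (r i) = 0" for i
          using False mult_nonneg_nonneg[OF less_imp_le[OF r] p0, of i w] by (simp add: \<psi>_def max_def)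
        moreover have "\<psi> 0 = 0" using False by (simp add: \<psi>_def max_def)
        ultimately show ?thesis using False by (simp add: max_def)
      qed
      then have "(\<lambda>i. cmod (w $ k) ^ (2 * m) * ((\<psi> (r i) - \<psi> 0) / r i))
          \<longlonglongrightarrow> cmod (w $ k) ^ (2 * m) * - (b * (p w * max 0 x powr (b - 1)))"
        by (rule tendsto_mult_left)
      then show "(\<lambda>i. (g (r i) w - f w) / r i) \<longlonglongrightarrow> L w"
        by (simp add: g_def f_def L_def \<psi>_def x_def right_diff_distrib)
    qed
    show "AE w in lborel. norm ((g (r i) w - f w) / r i) \<le> b * indicator (ball 0 1) w" for i
    proof (rule AE_I2)
      fix w :: "complex ^ 'n"
      have "\<bar>g (r i) w - f w\<bar> \<le> r i * b * indicator (ball 0 1) w" by (rule gle) (use r[of i] in simp)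
      then show "norm ((g (r i) w - f w) / r i) \<le> b * indicator (ball 0 1) w"
        using r[of i] by (simp add: abs_divide divide_le_eq mult_ac)
    qed
  qed measurable
  have eq: "(LINT w|lborel. (g (r i) w - f w) / r i)
      = ((1 + r i) powr (- (real m + real (card S))) - 1) / r i * moment k m b" for i
  proof -
    have "(LINT w|lborel. (g (r i) w - f w) / r i) = ((LINT w|lborel. g (r i) w) - (LINT w|lborel. f w)) / r i"
      using gint[OF less_imp_le[OF r]] fint by simp
    also have "(LINT w|lborel. f w) = moment k m b" by (simp add: moment_def f_def)
    also have "(LINT w|lborel. g (r i) w) = (1 + r i) powr (- (real m + real (card S))) * moment k m b"
      by (rule scale) (use r[of i] in simp)
    finally show ?thesis by (simp add: diff_divide_distrib left_diff_distrib)
  qed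
  have lim2: "(\<lambda>i. ((1 + r i) powr (- (real m + real (card S))) - 1) / r i * moment k m b)
      \<longlonglongrightarrow> - (real m + real (card S)) * moment k m b"
  proof (rule tendsto_mult_right)
    have "((\<lambda>t. t powr (- (real m + real (card S)))) has_real_derivative
        - (real m + real (card S)) * 1 powr (- (real m + real (card S)) - 1)) (at 1)"
      by (rule has_real_derivative_powr) simp
    from tendsto_difference_quotient_sequence[OF this]
    show "(\<lambda>i. ((1 + r i) powr (- (real m + real (card S))) - 1) / r i) \<longlonglongrightarrow> - (real m + real (card S))"
      by (simp add: r_def)
  qed
  have "- (real m + real (card S)) * moment k m b = (LINT w|lborel. L w)"
    by (rule LIMSEQ_unique[OF lim2 lim1[unfolded eq]])
  also have "\<dots> = - (b * (LINT w|lborel. cmod ((w :: complex ^ 'n) $ k) ^ (2 * m) * (p w * max 0 (rho w) powr (b - 1))))"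
    unfolding integral_minus[symmetric] integral_mult_right_zero[symmetric]
    by (rule Bochner_Integration.integral_cong) (simp_all add: L_def)
  finally show ?thesis unfolding p_def mult_minus_left neg_equal_iff_equal .
qed

text \<open>
  Scaling one coordinate and scaling all coordinates give two expressions for the same moment of the
  weight with exponent \<open>\<beta> + 1\<close>.
\<close>

lemma moment_Suc:
  fixes k :: "'n::finite"
  assumes \<beta>: "\<beta> > 0"
  shows "(real m + real CARD('n) + \<beta> + 1) * moment k (Suc m) \<beta> = (real m + 1) * moment k m \<beta>"
proof -
  define b where "b = \<beta> + 1"
  have b: "b > 1" "b - 1 = \<beta>" using \<beta> by (auto simp: b_def)
  have int: "integrable lborel (\<lambda>w :: complex ^ 'n. cmod (w $ k) ^ (2 * m) * (g w * max 0 (rho w) powr c))"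
    if "c > 0" "\<And>w. \<bar>g w\<bar> \<le> 1" "g \<in> borel_measurable borel" for c and g :: "complex ^ 'n \<Rightarrow> real"
  proof (rule integrable_ball_bounded[where B = 1])
    show "(\<lambda>w. cmod (w $ k) ^ (2 * m) * (g w * max 0 (rho w) powr c)) \<in> borel_measurable borel"
      using that(3) by measurable
    show "norm (cmod (w $ k) ^ (2 * m) * (g w * max 0 (rho w) powr c)) \<le> 1 * indicator (ball 0 1) w" for w
      using moment_integrand_bound[OF that(1,2), of w k m w] by simp
  qed
  have i1: "integrable lborel (\<lambda>w :: complex ^ 'n. cmod (w $ k) ^ (2 * m) * max 0 (rho w) powr c)" if "c > 0" for c
    using int[OF that, of "\<lambda>_. 1"] by simp
  have "(real m + real (card {k})) * moment k m b
      = b * (LINT w|lborel. cmod ((w :: complex ^ 'n) $ k) ^ (2 * m) *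
          ((\<Sum>j\<in>{k}. (cmod (w $ j))\<^sup>2) * max 0 (rho w) powr (b - 1)))"
    by (rule moment_scaling_derivative[OF b(1)]) simp
  then have one: "(real m + 1) * moment k m b = b * moment k (Suc m) \<beta>"
    by (simp add: moment_def b power2_eq_square mult_ac)
  have "(real m + real CARD('n)) * moment k m b
      = b * (LINT w|lborel. cmod ((w :: complex ^ 'n) $ k) ^ (2 * m) *
          ((\<Sum>j\<in>UNIV. (cmod (w $ j))\<^sup>2) * max 0 (rho w) powr (b - 1)))"
    by (rule moment_scaling_derivative[OF b(1)]) simp
  also have "(LINT w|lborel. cmod ((w :: complex ^ 'n) $ k) ^ (2 * m) *
          ((\<Sum>j\<in>UNIV. (cmod (w $ j))\<^sup>2) * max 0 (rho w) powr (b - 1)))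
      = (LINT w|lborel. cmod ((w :: complex ^ 'n) $ k) ^ (2 * m) * max 0 (rho w) powr \<beta>
          - cmod (w $ k) ^ (2 * m) * max 0 (rho w) powr b)"
  proof (rule Bochner_Integration.integral_cong)
    fix w :: "complex ^ 'n"
    have s1: "(\<Sum>j\<in>UNIV. (cmod (w $ j))\<^sup>2) = 1 - rho w" by (simp add: norm_vec_square[symmetric] rho_def)
    have s2: "rho w * max 0 (rho w) powr \<beta> = max 0 (rho w) powr b"
      using \<beta> by (cases "rho w > 0") (auto simp: b_def powr_add max_def)
    show "cmod (w $ k) ^ (2 * m) * ((\<Sum>j\<in>UNIV. (cmod (w $ j))\<^sup>2) * max 0 (rho w) powr (b - 1))
        = cmod (w $ k) ^ (2 * m) * max 0 (rho w) powr \<beta> - cmod (w $ k) ^ (2 * m) * max 0 (rho w) powr b"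
      unfolding s1 b(2) left_diff_distrib s2 by (simp add: right_diff_distrib)
  qed simp
  also have "\<dots> = moment k m \<beta> - moment k m b"
    unfolding moment_def using i1[of \<beta>] i1[of b] \<beta> b by (intro Bochner_Integration.integral_diff) auto
  finally have two: "(real m + real CARD('n) + b) * moment k m b = b * moment k m \<beta>"
    by (simp add: algebra_simps)
  have "b * ((real m + real CARD('n) + b) * moment k (Suc m) \<beta>) = (real m + real CARD('n) + b) * ((real m + 1) * moment k m b)"
    by (simp add: one)
  also have "\<dots> = (real m + 1) * (b * moment k m \<beta>)" by (simp add: two[symmetric])
  also have "\<dots> = b * ((real m + 1) * moment k m \<beta>)" by simp
  finally have "(real m + real CARD('n) + b) * moment k (Suc m) \<beta> = (real m + 1) * moment k m \<beta>"
    using b(1) by simp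
  then show ?thesis by (simp add: b_def add.assoc)
qed

lemma moment_0_pos:
  fixes k :: "'n::finite"
  assumes "\<beta> > 0"
  shows "moment k 0 \<beta> > 0"
proof -
  have "0 < (3 / 4) powr \<beta> * measure lborel (ball (0 :: complex ^ 'n) (1 / 2))"
    by (simp add: content_ball)
  also have "\<dots> = (LINT w|lborel. (3 / 4) powr \<beta> * indicator (ball (0 :: complex ^ 'n) (1 / 2)) w)"
    by simp
  also have "\<dots> \<le> (LINT w|lborel. max 0 (rho (w :: complex ^ 'n)) powr \<beta>)"
  proof (rule Bochner_Integration.integral_mono)
    show "integrable lborel (\<lambda>w. (3 / 4) powr \<beta> * indicator (ball (0 :: complex ^ 'n) (1 / 2)) w)"
      by (simp add: emeasure_ball)
    show "integrable lborel (\<lambda>w :: complex ^ 'n. max 0 (rho w) powr \<beta>)"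
      using moment_integrand_bound[of \<beta> 1 _ k 0] assms by (intro integrable_ball_bounded[where B = 1]) auto
    fix w :: "complex ^ 'n"
    show "(3 / 4) powr \<beta> * indicator (ball 0 (1 / 2)) w \<le> max 0 (rho w) powr \<beta>"
    proof (cases "norm w < 1 / 2")
      case True
      then have "(norm w)\<^sup>2 \<le> (1 / 2)\<^sup>2" by (intro power_mono) auto
      then have "3 / 4 \<le> rho w" by (simp add: rho_def power2_eq_square)
      then show ?thesis using True assms by (auto intro!: powr_mono2)
    qed simp
  qed
  also have "\<dots> = moment k 0 \<beta>" by (simp add: moment_def)
  finally show ?thesis .
qed

text \<open>The moments are the reciprocals of the Taylor coefficients of \<open>(1 - x) powr - N\<close>, up to a constant.\<close>

lemma pochhammer_moment:
  fixes k :: "'n::finite"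
  assumes \<beta>: "\<beta> > 0"
  shows "pochhammer (real CARD('n) + 1 + \<beta>) m / fact m * moment k m \<beta> = moment k 0 \<beta>"
proof (induction m)
  case (Suc m)
  let ?N = "real CARD('n) + 1 + \<beta>"
  have "pochhammer ?N (Suc m) / fact (Suc m) * moment k (Suc m) \<beta>
      = pochhammer ?N m / fact m * ((real m + real CARD('n) + \<beta> + 1) * moment k (Suc m) \<beta>) / (real m + 1)"
    by (simp add: pochhammer_Suc field_simps)
  also have "\<dots> = pochhammer ?N m / fact m * ((real m + 1) * moment k m \<beta>) / (real m + 1)"
    by (simp only: moment_Suc[OF \<beta>])
  also have "\<dots> = pochhammer ?N m / fact m * moment k m \<beta>" by simp
  finally show ?case using Suc.IH by simp
qed simp

lemma one_minus_powr_sums: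
  assumes "cmod x < 1"
  shows "(\<lambda>m. of_real (pochhammer N m / fact m) * x ^ m) sums ((1 - x) powr complex_of_real (- N))"
proof -
  have "(\<lambda>m. (complex_of_real (- N) gchoose m) * (- x) ^ m) sums (1 + - x) powr complex_of_real (- N)"
    using assms by (intro gen_binomial_complex) simp
  moreover have "(complex_of_real (- N) gchoose m) * (- x) ^ m = of_real (pochhammer N m / fact m) * x ^ m" for m
  proof -
    have e: "- complex_of_real (- N) = complex_of_real N" by simp
    have s: "(- 1 :: complex) ^ m * (- 1) ^ m = 1" by (simp flip: power_mult_distrib)
    have "(complex_of_real (- N) gchoose m) * (- x) ^ m
        = ((- 1) ^ m * (- 1) ^ m) * (of_real (pochhammer N m) / fact m * x ^ m)"
      unfolding gbinomial_pochhammer e pochhammer_of_real power_minus[of x] by (simp only: divide_inverse mult_ac)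
    then show ?thesis unfolding s by simp
  qed
  ultimately show ?thesis by simp
qed

lemma summable_pochhammer:
  assumes "0 < N" "0 \<le> x" "x < (1 :: real)"
  shows "summable (\<lambda>m. pochhammer N m / fact m * x ^ m)"
proof -
  have "summable (\<lambda>m. complex_of_real (pochhammer N m / fact m) * complex_of_real x ^ m)"
    using one_minus_powr_sums[of "of_real x" N] assms by (auto simp: sums_iff)
  then have "summable (\<lambda>m. Re (complex_of_real (pochhammer N m / fact m) * complex_of_real x ^ m))"
    by (rule summable_Re)
  then show ?thesis by (simp only: of_real_mult[symmetric] of_real_power[symmetric] Re_complex_of_real)
qed

lemma pochhammer_real_nonneg: "0 \<le> (N :: real) \<Longrightarrow> 0 \<le> pochhammer N m"
  by (simp add: pochhammer_prod prod_nonneg)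

section \<open>The reproducing formula\<close>

lemma slice_holomorphic:
  fixes f :: "complex ^ 'n \<Rightarrow> complex"
  assumes f: "holomorphic_sv f (ball 0 1)" and sub: "\<And>\<xi>. \<xi> \<in> S \<Longrightarrow> norm (a + \<xi> *s b) < 1"
  shows "(\<lambda>\<xi>. f (a + \<xi> *s b)) holomorphic_on S"
proof (rule holomorphic_onI)
  fix \<xi> assume "\<xi> \<in> S"
  then have "a + \<xi> *s b \<in> ball 0 1" using sub by simp
  then obtain D where D: "(f has_derivative D) (at (a + \<xi> *s b))" "\<And>c v. D (c *s v) = c * D v"
    using f unfolding holomorphic_sv_def by blast
  have "linear (\<lambda>h. h *s b)"
    by (intro linearI) (simp_all add: vector_sadd_rdistrib scaleR_eq_scale vector_smult_assoc scaleR_conv_of_real)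
  then have "((\<lambda>h. h *s b) has_derivative (\<lambda>h. h *s b)) (at \<xi>)"
    by (intro bounded_linear_imp_has_derivative) (simp add: linear_conv_bounded_linear)
  then have "((\<lambda>h. a + h *s b) has_derivative (\<lambda>h. h *s b)) (at \<xi>)"
    using has_derivative_add[OF has_derivative_const[of a]] by fastforce
  from has_derivative_compose[OF this D(1)]
  have "((\<lambda>\<xi>. f (a + \<xi> *s b)) has_derivative (\<lambda>h. D b * h)) (at \<xi>)"
    by (simp add: D(2) mult.commute)
  then have "((\<lambda>\<xi>. f (a + \<xi> *s b)) has_field_derivative D b) (at \<xi>)"
    by (simp add: has_field_derivative_def)
  then show "(\<lambda>\<xi>. f (a + \<xi> *s b)) field_differentiable (at \<xi> within S)"
    using field_differentiable_at_within field_differentiable_def by blast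
qed

lemma integrable_indicator_ball [simp]:
  "integrable lborel (indicator (ball c r) :: 'a::euclidean_space \<Rightarrow> real)"
  by (rule integrable_real_indicator) (simp, rule emeasure_bounded_finite[OF bounded_ball])

lemma integral_rotate_to_axis:
  fixes F :: "complex \<Rightarrow> real \<Rightarrow> real" and \<zeta> :: "complex ^ 'n" and k :: 'n
  assumes "norm \<zeta> = 1" and meas: "(\<lambda>w :: complex ^ 'n. F (w $ k) (norm w)) \<in> borel_measurable borel"
  shows "(LINT w|lborel. F (hinner w \<zeta>) (norm w)) = (LINT w|lborel. F ((w :: complex ^ 'n) $ k) (norm w))"
proof -
  obtain U where U: "unitary_map U" "\<And>w. U w $ k = hinner w \<zeta>"
    using exists_unitary_to_axis[OF assms(1)] by blast
  show ?thesis using integral_unitary[OF U(1) meas] by (simp add: U unitary_map_norm)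
qed

text \<open>Unitary maps that fix \<open>\<zeta>\<close> and rotate its orthogonal complement.\<close>

definition rotate_complement :: "complex ^ 'n \<Rightarrow> complex \<Rightarrow> complex ^ 'n \<Rightarrow> complex ^ 'n" where
  "rotate_complement \<zeta> \<xi> w = hinner w \<zeta> *s \<zeta> + \<xi> *s (w - hinner w \<zeta> *s \<zeta>)"

lemma unitary_rotate_complement:
  assumes \<zeta>: "norm \<zeta> = 1" and \<xi>: "cmod \<xi> = 1"
  shows "unitary_map (rotate_complement \<zeta> \<xi>)"
proof (rule unitary_mapI)
  fix v w c
  show "rotate_complement \<zeta> \<xi> (v + w) = rotate_complement \<zeta> \<xi> v + rotate_complement \<zeta> \<xi> w"
    by (simp add: rotate_complement_def hinner_add_left vec_eq_iff algebra_simps)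
  show "rotate_complement \<zeta> \<xi> (c *s v) = c *s rotate_complement \<zeta> \<xi> v"
    by (simp add: rotate_complement_def hinner_scale_left vec_eq_iff algebra_simps)
  have \<zeta>\<zeta>: "hinner \<zeta> \<zeta> = 1" using \<zeta> by (simp add: hinner_self)
  have \<xi>\<xi>: "\<xi> * cnj \<xi> = 1" using \<xi> by (simp add: complex_norm_square[symmetric])
  define v' w' where "v' = v - hinner v \<zeta> *s \<zeta>" and "w' = w - hinner w \<zeta> *s \<zeta>"
  have v': "hinner v' \<zeta> = 0" by (simp add: v'_def hinner_diff_left hinner_scale_left \<zeta>\<zeta>)
  have "hinner \<zeta> w' = 0"
    by (simp add: w'_def hinner_diff_right hinner_scale_right \<zeta>\<zeta> cnj_hinner)
  then have "hinner (rotate_complement \<zeta> \<xi> v) (rotate_complement \<zeta> \<xi> w)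
      = hinner v \<zeta> * cnj (hinner w \<zeta>) + (\<xi> * cnj \<xi>) * hinner v' w'"
    using v' unfolding rotate_complement_def v'_def[symmetric] w'_def[symmetric]
    by (simp add: hinner_add_left hinner_add_right hinner_scale_left hinner_scale_right \<zeta>\<zeta>)
  also have "\<dots> = hinner v w"
    using hinner_split[OF \<zeta>, of v w] by (simp add: \<xi>\<xi> v'_def w'_def cnj_hinner)
  finally show "hinner (rotate_complement \<zeta> \<xi> v) (rotate_complement \<zeta> \<xi> w) = hinner v w" .
qed

lemma hinner_rotate_complement:
  assumes "norm \<zeta> = 1"
  shows "hinner (rotate_complement \<zeta> \<xi> w) \<zeta> = hinner w \<zeta>"
  using assms by (simp add: rotate_complement_def hinner_add_left hinner_diff_left hinner_scale_left hinner_self)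

context
  fixes f :: "complex ^ 'n \<Rightarrow> complex" and \<zeta> :: "complex ^ 'n" and x \<beta> N :: real
  assumes f: "holomorphic_sv f (ball 0 1)" and \<zeta>: "norm \<zeta> = 1" and x: "0 \<le> x" "x < 1" and \<beta>: "\<beta> > 0"
    and N_eq: "N = real CARD('n) + 1 + \<beta>"
begin

lemma N_pos: "N > 0"
  using \<beta> by (simp add: N_eq)

abbreviation wk :: "complex ^ 'n \<Rightarrow> complex" where
  "wk w \<equiv> of_real (rho w powr \<beta>) * bker N (x *\<^sub>R \<zeta>) w"

lemma hinner_line: "hinner (x *\<^sub>R \<zeta>) w = of_real x * cnj (hinner w \<zeta>)"
  by (simp add: hinner_scaleR_left cnj_hinner)

lemma wk_bound: "norm w < 1 \<Longrightarrow> cmod (wk w) \<le> (1 - x) powr (- N)"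
proof -
  assume w: "norm w < 1"
  have "rho w powr \<beta> \<le> 1 powr \<beta>" using rho_pos[OF w] rho_le_1[of w] \<beta> by (intro powr_mono2) auto
  then have "rho w powr \<beta> * cmod (bker N (x *\<^sub>R \<zeta>) w) \<le> 1 * (1 - x) powr (- N)"
    using N_pos x \<zeta> w by (intro mult_mono bker_bound) auto
  then show ?thesis by (simp add: norm_mult)
qed

lemma cmod_hinner_le_norm: "cmod (hinner w \<zeta>) \<le> norm w"
  using cmod_hinner_le[of w \<zeta>] \<zeta> by simp

text \<open>
  On a smaller ball everything is bounded. Rotating the complement of \<open>\<zeta>\<close> replaces \<open>f\<close> by its
  restriction to the complex line through \<open>\<zeta>\<close>.
\<close>

lemma integral_restrict_to_line:
  assumes r: "0 < r" "r < 1"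
  shows "(LINT w|lborel. indicator (ball 0 r) w *\<^sub>R (f w * wk w))
    = (LINT w|lborel. indicator (ball 0 r) w *\<^sub>R (f (hinner w \<zeta> *s \<zeta>) * wk w))"
proof -
  have cont: "continuous_on (ball 0 1) f" by (rule holomorphic_sv_continuous[OF f])
  have "compact (f ` cball 0 r)"
    by (intro compact_continuous_image continuous_on_subset[OF cont]) (use r in auto)
  then obtain B where B: "\<And>w. w \<in> cball 0 r \<Longrightarrow> cmod (f w) \<le> B"
    using compact_imp_bounded bounded_iff by (metis imageI)
  have "cmod (f 0) \<le> B" by (rule B) (use r in simp)
  then have B0: "0 \<le> B" using norm_ge_zero[of "f 0"] by linarith
  have m1: "(\<lambda>w. indicator (ball 0 r) w *\<^sub>R f w) \<in> borel_measurable borel"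
    by (intro borel_measurable_continuous_on_indicator continuous_on_subset[OF cont]) (use r in auto)
  have m2: "(\<lambda>w. indicator (ball 0 r) w *\<^sub>R f (hinner w \<zeta> *s \<zeta>)) \<in> borel_measurable borel"
  proof (intro borel_measurable_continuous_on_indicator)
    have "continuous_on (ball 0 r) (\<lambda>w :: complex ^ 'n. hinner w \<zeta> *s \<zeta>)"
      unfolding vector_scalar_mult_def by (intro continuous_intros)
    then show "continuous_on (ball 0 r) (\<lambda>w. f (hinner w \<zeta> *s \<zeta>))"
    proof (rule continuous_on_compose2[OF cont])
      show "(\<lambda>w. hinner w \<zeta> *s \<zeta>) ` ball 0 r \<subseteq> ball 0 1"
      proof (rule image_subsetI)
        fix w :: "complex ^ 'n" assume "w \<in> ball 0 r"
        then show "hinner w \<zeta> *s \<zeta> \<in> ball 0 1"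
          using cmod_hinner_le_norm[of w] r \<zeta> by (simp add: norm_scale)
      qed
    qed
  qed simp
  show ?thesis
  proof (rule integral_eq_circle_coefficient[where R = "rotate_complement \<zeta>" and j = 0
        and D = "\<lambda>w. indicator (ball 0 r) w * (B * (1 - x) powr (- N))"])
    have "(\<lambda>w. (indicator (ball 0 r) w *\<^sub>R f w) * wk w) \<in> borel_measurable borel"
      using m1 by (intro borel_measurable_times) auto
    then show "(\<lambda>w. indicator (ball 0 r) w *\<^sub>R (f w * wk w)) \<in> borel_measurable borel" by simp
    have "(\<lambda>w. (indicator (ball 0 r) w *\<^sub>R f (hinner w \<zeta> *s \<zeta>)) * wk w) \<in> borel_measurable borel"
      using m2 by (intro borel_measurable_times) auto
    then show "(\<lambda>w. indicator (ball 0 r) w *\<^sub>R (f (hinner w \<zeta> *s \<zeta>) * wk w)) \<in> borel_measurable borel" by simp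
    show "unitary_map (rotate_complement \<zeta> \<xi>)" if "cmod \<xi> = 1" for \<xi>
      by (rule unitary_rotate_complement[OF \<zeta> that])
    show "integrable lborel (\<lambda>w :: complex ^ 'n. indicator (ball 0 r) w * (B * (1 - x) powr (- N)))"
      by simp
    fix w :: "complex ^ 'n"
    have nR: "norm (rotate_complement \<zeta> \<xi> w) = norm w" if "cmod \<xi> = 1" for \<xi>
      by (rule unitary_map_norm[OF unitary_rotate_complement[OF \<zeta> that]])
    have wkR: "wk (rotate_complement \<zeta> \<xi> w) = wk w" if "cmod \<xi> = 1" for \<xi>
      by (simp add: rho_def nR[OF that] bker_def hinner_line hinner_rotate_complement[OF \<zeta>])
    show "cmod (indicator (ball 0 r) (rotate_complement \<zeta> \<xi> w) *\<^sub>R (f (rotate_complement \<zeta> \<xi> w) * wk (rotate_complement \<zeta> \<xi> w)))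
        \<le> indicator (ball 0 r) w * (B * (1 - x) powr (- N))" if \<xi>: "cmod \<xi> = 1" for \<xi>
    proof (cases "norm w < r")
      case True
      have "cmod (f (rotate_complement \<zeta> \<xi> w)) * cmod (wk w) \<le> B * (1 - x) powr (- N)"
        using True r nR[OF \<xi>] B0 by (intro mult_mono B wk_bound) auto
      then show ?thesis using True nR[OF \<xi>] wkR[OF \<xi>] by (simp add: norm_mult)
    next
      case False
      then show ?thesis using nR[OF \<xi>] by simp
    qed
    show "\<exists>A. summable (\<lambda>m. cmod (A m)) \<and> A 0 = indicator (ball 0 r) w *\<^sub>R (f (hinner w \<zeta> *s \<zeta>) * wk w) \<and>
        (\<forall>\<xi>. cmod \<xi> = 1 \<longrightarrow> (\<lambda>m. A m * \<xi> ^ m) sums (\<xi> ^ 0 *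
          (indicator (ball 0 r) (rotate_complement \<zeta> \<xi> w) *\<^sub>R (f (rotate_complement \<zeta> \<xi> w) * wk (rotate_complement \<zeta> \<xi> w)))))"
    proof (cases "norm w < r")
      case True
      define a b where "a = hinner w \<zeta> *s \<zeta>" and "b = w - hinner w \<zeta> *s \<zeta>"
      define g where "g \<xi> = f (a + \<xi> *s b)" for \<xi>
      have nab: "(norm (a + \<xi> *s b))\<^sup>2 = (cmod (hinner w \<zeta>))\<^sup>2 + (cmod \<xi>)\<^sup>2 * (norm b)\<^sup>2" for \<xi>
      proof -
        have "hinner (a + \<xi> *s b) \<zeta> = hinner w \<zeta>"
          using hinner_rotate_complement[OF \<zeta>, of \<xi> w] by (simp add: rotate_complement_def a_def b_def)
        then have "(norm (\<xi> *s b))\<^sup>2 = (norm (a + \<xi> *s b))\<^sup>2 - (cmod (hinner w \<zeta>))\<^sup>2"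
          using norm_orthogonal_part[OF \<zeta>, of "a + \<xi> *s b"] by (simp add: a_def)
        then show ?thesis by (simp add: norm_scale power_mult_distrib)
      qed
      have nb: "(norm b)\<^sup>2 = (norm w)\<^sup>2 - (cmod (hinner w \<zeta>))\<^sup>2"
        unfolding b_def by (rule norm_orthogonal_part[OF \<zeta>])
      have "g holomorphic_on ball 0 (1 / r)"
        unfolding g_def
      proof (rule slice_holomorphic[OF f])
        fix \<xi> :: complex assume "\<xi> \<in> ball 0 (1 / r)"
        then have "r * cmod \<xi> < 1" using r by (simp add: field_simps)
        then have "(r * cmod \<xi>)\<^sup>2 \<le> 1" by (intro power_le_one) (use r in auto)
        have "r\<^sup>2 * (norm (a + \<xi> *s b))\<^sup>2 = r\<^sup>2 * (cmod (hinner w \<zeta>))\<^sup>2 + (r * cmod \<xi>)\<^sup>2 * (norm b)\<^sup>2"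
          unfolding nab by (simp add: algebra_simps power_mult_distrib)
        also have "\<dots> \<le> 1 * (cmod (hinner w \<zeta>))\<^sup>2 + 1 * (norm b)\<^sup>2"
          using r \<open>(r * cmod \<xi>)\<^sup>2 \<le> 1\<close> by (intro add_mono mult_right_mono) (auto simp: power_le_one)
        also have "\<dots> = (norm w)\<^sup>2" by (simp add: nb)
        also have "\<dots> < r\<^sup>2" using True by (intro power_strict_mono) auto
        finally have "(norm (a + \<xi> *s b))\<^sup>2 < 1" using r by simp
        then show "norm (a + \<xi> *s b) < 1" by (simp add: abs_square_less_1)
      qed
      then have sums: "(\<lambda>m. (deriv ^^ m) g 0 / fact m * \<xi> ^ m) sums g \<xi>" if "cmod \<xi> < 1 / r" for \<xi>
        using holomorphic_power_series[of g 0 "1 / r" \<xi>] that by simp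
      define A where "A m = (deriv ^^ m) g 0 / fact m * wk w" for m
      have "1 < 1 / r" using r by simp
      then obtain t where t: "1 < t" "t < 1 / r" using dense by blast
      have "summable (\<lambda>m. (deriv ^^ m) g 0 / fact m * of_real t ^ m)"
        using sums[of "of_real t"] t by (auto simp: sums_iff)
      then have "summable (\<lambda>m. cmod ((deriv ^^ m) g 0 / fact m * 1 ^ m))"
        using powser_insidea[of "\<lambda>m. (deriv ^^ m) g 0 / fact m" "of_real t" 1] t by simp
      then have "summable (\<lambda>m. cmod (A m))"
        unfolding A_def norm_mult[of _ "wk w"] by (intro summable_mult2) simp
      moreover have "A 0 = indicator (ball 0 r) w *\<^sub>R (f (hinner w \<zeta> *s \<zeta>) * wk w)"
        using True by (simp add: A_def g_def a_def)
      moreover have "(\<lambda>m. A m * \<xi> ^ m) sums (\<xi> ^ 0 * (indicator (ball 0 r) (rotate_complement \<zeta> \<xi> w) *\<^sub>R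
          (f (rotate_complement \<zeta> \<xi> w) * wk (rotate_complement \<zeta> \<xi> w))))" if \<xi>: "cmod \<xi> = 1" for \<xi>
      proof -
        have "(\<lambda>m. ((deriv ^^ m) g 0 / fact m * \<xi> ^ m) * wk w) sums (g \<xi> * wk w)"
          using \<xi> \<open>1 < 1 / r\<close> by (intro sums_mult2 sums) auto
        moreover have "g \<xi> = f (rotate_complement \<zeta> \<xi> w)" by (simp add: g_def a_def b_def rotate_complement_def)
        moreover have "((deriv ^^ m) g 0 / fact m * \<xi> ^ m) * wk w = A m * \<xi> ^ m" for m
          by (simp add: A_def mult_ac)
        ultimately show ?thesis using True nR[OF \<xi>] wkR[OF \<xi>] by (simp only:) simp
      qed
      ultimately show ?thesis by blast
    next
      case False
      then show ?thesis using nR by (intro exI[of _ "\<lambda>_. 0"]) simp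
    qed
  qed
qed

definition trunc_moment :: "real \<Rightarrow> nat \<Rightarrow> real" where
  "trunc_moment r m = (LINT w|lborel. indicator (ball 0 r) w * (cmod (hinner w \<zeta>) ^ (2 * m) * rho w powr \<beta>))"

text \<open>Of the expansion of the kernel, only one term is not orthogonal to a given monomial.\<close>

lemma integral_monomial:
  assumes r: "0 < r" "r \<le> 1"
  shows "(LINT w|lborel. indicator (ball 0 r) w *\<^sub>R (hinner w \<zeta> ^ m * wk w))
    = of_real (pochhammer N m / fact m * x ^ m * trunc_moment r m)"
proof -
  let ?c = "\<lambda>l. pochhammer N l / fact l"
  let ?L = "\<lambda>w. indicator (ball 0 r) w * (?c m * x ^ m * (cmod (hinner w \<zeta>) ^ (2 * m) * rho w powr \<beta>))"
  have "(LINT w|lborel. indicator (ball 0 r) w *\<^sub>R (hinner w \<zeta> ^ m * wk w))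
      = (LINT w|lborel. complex_of_real (?L w))"
  proof (rule integral_eq_circle_coefficient[where R = "\<lambda>\<xi>. (*s) (cnj \<xi>)" and j = m
        and D = "\<lambda>w. indicator (ball 0 r) w * (1 - x) powr (- N)"])
    show "integrable lborel (\<lambda>w :: complex ^ 'n. indicator (ball 0 r) w * (1 - x) powr (- N))"
      by simp
    fix w :: "complex ^ 'n"
    have h: "cmod (hinner w \<zeta>) < 1" if "norm w < r" using cmod_hinner_le_norm[of w] that r by linarith
    show "cmod (indicator (ball 0 r) (cnj \<xi> *s w) *\<^sub>R (hinner (cnj \<xi> *s w) \<zeta> ^ m * wk (cnj \<xi> *s w)))
        \<le> indicator (ball 0 r) w * (1 - x) powr (- N)" if \<xi>: "cmod \<xi> = 1" for \<xi>
    proof (cases "norm w < r")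
      case True
      have "cmod (hinner (cnj \<xi> *s w) \<zeta>) = cmod (hinner w \<zeta>)" using \<xi> by (simp add: hinner_scale_left norm_mult)
      then have "cmod (hinner (cnj \<xi> *s w) \<zeta>) ^ m \<le> 1" using h[OF True] by (simp add: power_le_one)
      then have "cmod (hinner (cnj \<xi> *s w) \<zeta>) ^ m * cmod (wk (cnj \<xi> *s w)) \<le> 1 * (1 - x) powr (- N)"
        using True r \<xi> by (intro mult_mono wk_bound) (auto simp: norm_scale)
      then show ?thesis using True \<xi> by (simp add: norm_mult norm_power norm_scale)
    next
      case False
      then show ?thesis using \<xi> by (simp add: norm_scale)
    qed
    show "\<exists>A. summable (\<lambda>l. cmod (A l)) \<and> A m = complex_of_real (?L w) \<and>
        (\<forall>\<xi>. cmod \<xi> = 1 \<longrightarrow> (\<lambda>l. A l * \<xi> ^ l) sums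
          (\<xi> ^ m * (indicator (ball 0 r) (cnj \<xi> *s w) *\<^sub>R (hinner (cnj \<xi> *s w) \<zeta> ^ m * wk (cnj \<xi> *s w)))))"
    proof (cases "norm w < r")
      case True
      define y where "y = of_real x * cnj (hinner w \<zeta>)"
      have y: "cmod y < 1"
        using h[OF True] x mult_left_le[of "cmod (hinner w \<zeta>)" x] by (simp add: y_def norm_mult)
      define d where "d = hinner w \<zeta> ^ m * of_real (rho w powr \<beta>)"
      define A where "A l = d * (of_real (?c l) * y ^ l)" for l
      have "summable (\<lambda>l. ?c l * cmod y ^ l)" using N_pos y by (intro summable_pochhammer) auto
      then have "summable (\<lambda>l. cmod d * (?c l * cmod y ^ l))" by (rule summable_mult)
      moreover have "cmod (A l) = cmod d * (?c l * cmod y ^ l)" for l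
        using pochhammer_real_nonneg[OF less_imp_le[OF N_pos], of l]
        by (simp add: A_def norm_mult norm_power norm_divide)
      ultimately have "summable (\<lambda>l. cmod (A l))" by simp
      moreover have "A m = complex_of_real (?L w)"
      proof -
        have "hinner w \<zeta> ^ m * cnj (hinner w \<zeta>) ^ m = of_real (cmod (hinner w \<zeta>) ^ (2 * m))"
          by (simp add: power_mult_distrib[symmetric] complex_norm_square[symmetric] power_mult)
        then show ?thesis using True
          by (simp add: A_def d_def y_def power_mult_distrib mult_ac)
      qed
      moreover have "(\<lambda>l. A l * \<xi> ^ l) sums
          (\<xi> ^ m * (indicator (ball 0 r) (cnj \<xi> *s w) *\<^sub>R (hinner (cnj \<xi> *s w) \<zeta> ^ m * wk (cnj \<xi> *s w))))"
        if \<xi>: "cmod \<xi> = 1" for \<xi>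
      proof -
        have "cmod (y * \<xi>) < 1" using y \<xi> by (simp add: norm_mult)
        then have "(\<lambda>l. d * (of_real (?c l) * (y * \<xi>) ^ l)) sums (d * (1 - y * \<xi>) powr complex_of_real (- N))"
          by (intro sums_mult one_minus_powr_sums)
        moreover have "d * (of_real (?c l) * (y * \<xi>) ^ l) = A l * \<xi> ^ l" for l
          by (simp add: A_def power_mult_distrib mult_ac)
        moreover have "\<xi> ^ m * (indicator (ball 0 r) (cnj \<xi> *s w) *\<^sub>R (hinner (cnj \<xi> *s w) \<zeta> ^ m * wk (cnj \<xi> *s w)))
            = d * (1 - y * \<xi>) powr complex_of_real (- N)"
        proof -
          have "\<xi> ^ m * cnj \<xi> ^ m = 1"
            using \<xi> by (simp add: power_mult_distrib[symmetric] complex_norm_square[symmetric])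
          then have e: "\<xi> ^ m * hinner (cnj \<xi> *s w) \<zeta> ^ m = hinner w \<zeta> ^ m"
            by (simp add: hinner_scale_left power_mult_distrib mult.assoc[symmetric])
          have "bker N (x *\<^sub>R \<zeta>) (cnj \<xi> *s w) = (1 - y * \<xi>) powr complex_of_real (- N)"
            by (simp add: bker_def hinner_line hinner_scale_left y_def mult_ac)
          moreover have "rho (cnj \<xi> *s w) = rho w" using \<xi> by (simp add: rho_def norm_scale)
          moreover have "indicator (ball 0 r) (cnj \<xi> *s w) = (1 :: real)" using True \<xi> by (simp add: norm_scale)
          ultimately show ?thesis by (simp add: d_def e[symmetric] mult_ac)
        qed
        ultimately show ?thesis by simp
      qed
      ultimately show ?thesis by blast
    next
      case False
      then show ?thesis by (intro exI[of _ "\<lambda>_. 0"]) (simp add: norm_scale)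
    qed
  qed (auto intro!: unitary_map_scale)
  also have "\<dots> = of_real (LINT w|lborel. ?L w)" by (rule integral_complex_of_real)
  also have "(LINT w|lborel. ?L w) = ?c m * x ^ m * trunc_moment r m"
    unfolding trunc_moment_def integral_mult_right_zero[symmetric]
    by (rule Bochner_Integration.integral_cong) (simp_all add: mult_ac)
  finally show ?thesis .
qed

lemma line_power_series:
  assumes "cmod y < 1"
  shows "(\<lambda>m. (deriv ^^ m) (\<lambda>y. f (y *s \<zeta>)) 0 / fact m * y ^ m) sums f (y *s \<zeta>)"
proof -
  have "(\<lambda>y. f (0 + y *s \<zeta>)) holomorphic_on ball 0 1"
    by (rule slice_holomorphic[OF f]) (simp add: norm_scale \<zeta>)
  then show ?thesis using holomorphic_power_series[of "\<lambda>y. f (y *s \<zeta>)" 0 1 y] assms by simp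
qed

lemma summable_line_coefficients:
  assumes "0 \<le> t" "t < 1"
  shows "summable (\<lambda>m. cmod ((deriv ^^ m) (\<lambda>y. f (y *s \<zeta>)) 0 / fact m) * t ^ m)"
proof -
  obtain u where u: "t < u" "u < 1" using assms dense by blast
  have "summable (\<lambda>m. (deriv ^^ m) (\<lambda>y. f (y *s \<zeta>)) 0 / fact m * of_real u ^ m)"
    using line_power_series[of "of_real u"] u assms by (auto simp: sums_iff)
  then have "summable (\<lambda>m. cmod ((deriv ^^ m) (\<lambda>y. f (y *s \<zeta>)) 0 / fact m * of_real t ^ m))"
    by (rule powser_insidea) (use u assms in auto)
  then show ?thesis using assms by (simp add: norm_mult norm_power norm_divide)
qed

text \<open>
  Inside a smaller ball the Taylor series of \<open>f\<close> along the line converges uniformly and can be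
  integrated term by term; \<open>f\<close> itself may be unbounded on the unit ball.
\<close>

lemma integral_truncated_sums:
  assumes r: "0 < r" "r < 1"
  shows "(\<lambda>m. (deriv ^^ m) (\<lambda>y. f (y *s \<zeta>)) 0 / fact m * of_real (pochhammer N m / fact m * x ^ m * trunc_moment r m))
    sums (LINT w|lborel. indicator (ball 0 r) w *\<^sub>R (f w * wk w))"
proof -
  define g where "g m = (deriv ^^ m) (\<lambda>y. f (y *s \<zeta>)) 0 / fact m" for m
  define h where "h m w = indicator (ball 0 r) w *\<^sub>R (g m * (hinner w \<zeta> ^ m * wk w))" for m and w :: "complex ^ 'n"
  let ?B = "(1 - x) powr (- N)"
  have hb: "cmod (h m w) \<le> cmod (g m) * r ^ m * ?B * indicator (ball 0 r) w" for m w
  proof (cases "norm w < r")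
    case True
    have "cmod (hinner w \<zeta>) ^ m \<le> r ^ m" using cmod_hinner_le_norm[of w] True by (intro power_mono) auto
    then have "cmod (hinner w \<zeta>) ^ m * cmod (wk w) \<le> r ^ m * ?B"
      using True r by (intro mult_mono wk_bound) auto
    then have "cmod (g m) * (cmod (hinner w \<zeta>) ^ m * cmod (wk w)) \<le> cmod (g m) * (r ^ m * ?B)"
      by (intro mult_left_mono) auto
    then show ?thesis using True by (simp add: h_def norm_mult norm_power mult_ac)
  qed (simp add: h_def)
  have [measurable]: "h m \<in> borel_measurable borel" for m
    unfolding h_def by measurable
  have gs: "summable (\<lambda>m. cmod (g m) * r ^ m)"
    unfolding g_def using r by (intro summable_line_coefficients) auto
  have hint: "integrable lborel (h m)" for m
  proof (rule integrable_ball_bounded[where B = "cmod (g m) * r ^ m * ?B"])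
    show "norm (h m w) \<le> cmod (g m) * r ^ m * ?B * indicator (ball 0 1) w" for w
      by (rule order_trans[OF hb]) (use r in \<open>auto simp: indicator_def\<close>)
  qed simp
  have bint: "integrable lborel (\<lambda>w :: complex ^ 'n. c * indicator (ball 0 r) w :: real)" for c
    by simp
  define V where "V = measure lborel (ball (0 :: complex ^ 'n) r)"
  have "(\<lambda>m. LINT w|lborel. h m w) sums (LINT w|lborel. (\<Sum>m. h m w))"
  proof (rule sums_integral[OF hint])
    show "AE w in lborel. summable (\<lambda>m. norm (h m w))"
    proof (rule AE_I2)
      fix w :: "complex ^ 'n"
      have "summable (\<lambda>m. cmod (g m) * r ^ m * (?B * indicator (ball 0 r) w))" by (rule summable_mult2[OF gs])
      then show "summable (\<lambda>m. norm (h m w))"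
        by (rule summable_comparison_test') (use hb in \<open>simp add: mult_ac\<close>)
    qed
    have "summable (\<lambda>m. cmod (g m) * r ^ m * (?B * V))" by (rule summable_mult2[OF gs])
    then show "summable (\<lambda>m. LINT w|lborel. norm (h m w))"
    proof (rule summable_comparison_test')
      fix m
      have "(LINT w|lborel. norm (h m w)) \<le> (LINT w|lborel. cmod (g m) * r ^ m * ?B * indicator (ball (0 :: complex ^ 'n) r) w)"
        by (rule Bochner_Integration.integral_mono) (use hint bint hb in auto)
      also have "\<dots> = cmod (g m) * r ^ m * (?B * V)" by (simp add: V_def)
      finally show "norm (LINT w|lborel. norm (h m w)) \<le> cmod (g m) * r ^ m * (?B * V)" by simp
    qed
  qed
  moreover have "(\<Sum>m. h m w) = indicator (ball 0 r) w *\<^sub>R (f (hinner w \<zeta> *s \<zeta>) * wk w)" for w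
  proof (cases "norm w < r")
    case True
    then have "cmod (hinner w \<zeta>) < 1" using cmod_hinner_le_norm[of w] r by linarith
    then have "(\<lambda>m. (g m * hinner w \<zeta> ^ m) * wk w) sums (f (hinner w \<zeta> *s \<zeta>) * wk w)"
      unfolding g_def by (intro sums_mult2 line_power_series)
    then show ?thesis using True by (simp add: h_def sums_iff mult.assoc)
  qed (simp add: h_def)
  moreover have "(LINT w|lborel. h m w) = g m * of_real (pochhammer N m / fact m * x ^ m * trunc_moment r m)" for m
  proof -
    have "(LINT w|lborel. h m w) = (LINT w|lborel. g m * (indicator (ball 0 r) w *\<^sub>R (hinner w \<zeta> ^ m * wk w)))"
      by (simp add: h_def)
    also have "\<dots> = g m * (LINT w|lborel. indicator (ball 0 r) w *\<^sub>R (hinner w \<zeta> ^ m * wk w))"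
      by (rule integral_mult_right_zero)
    also have "\<dots> = g m * of_real (pochhammer N m / fact m * x ^ m * trunc_moment r m)"
      using r by (subst integral_monomial) auto
    finally show ?thesis .
  qed
  ultimately show ?thesis unfolding integral_restrict_to_line[OF r] g_def by simp
qed

lemma trunc_moment_1:
  fixes k :: 'n
  shows "trunc_moment 1 m = moment k m \<beta>"
proof -
  define F where "F x t = cmod x ^ (2 * m) * max 0 (1 - t\<^sup>2) powr \<beta>" for x :: complex and t :: real
  have "(LINT w|lborel. F (hinner w \<zeta>) (norm w)) = (LINT w|lborel. F ((w :: complex ^ 'n) $ k) (norm w))"
    by (rule integral_rotate_to_axis[OF \<zeta>]) (simp add: F_def)
  moreover have pt: "indicator (ball 0 1) w * (cmod (hinner w \<zeta>) ^ (2 * m) * rho w powr \<beta>) = F (hinner w \<zeta>) (norm w)" for w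
  proof (cases "norm w < 1")
    case True
    then show ?thesis using rho_pos[OF True] by (simp add: F_def rho_def)
  next
    case False
    then have "max 0 (1 - (norm w)\<^sup>2) = 0" using norm_less_1_iff_rho[of w] by (simp add: rho_def)
    then show ?thesis using False by (simp add: F_def)
  qed
  moreover have "(LINT w|lborel. F ((w :: complex ^ 'n) $ k) (norm w)) = moment k m \<beta>"
    by (simp add: moment_def F_def rho_def)
  ultimately show ?thesis unfolding trunc_moment_def pt by simp
qed

lemma trunc_integrand_integrable:
  "integrable lborel (\<lambda>w. indicator (ball 0 1) w * (cmod (hinner w \<zeta>) ^ (2 * m) * rho w powr \<beta>))"
proof (rule integrable_ball_bounded[where B = 1])
  fix w :: "complex ^ 'n"
  show "norm (indicator (ball 0 1) w * (cmod (hinner w \<zeta>) ^ (2 * m) * rho w powr \<beta>)) \<le> 1 * indicator (ball 0 1) w"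
  proof (cases "norm w < 1")
    case True
    have "cmod (hinner w \<zeta>) \<le> 1" using cmod_hinner_le_norm[of w] True by linarith
    then have "cmod (hinner w \<zeta>) ^ (2 * m) \<le> 1" by (simp add: power_le_one)
    moreover have "rho w powr \<beta> \<le> 1 powr \<beta>" using rho_pos[OF True] rho_le_1[of w] \<beta> by (intro powr_mono2) auto
    ultimately have "cmod (hinner w \<zeta>) ^ (2 * m) * rho w powr \<beta> \<le> 1 * 1" by (intro mult_mono) auto
    then show ?thesis using True by simp
  qed simp
qed measurable

text \<open>Exhausting the ball, and using the value of the moments, yields the reproducing formula.\<close>

lemma reproducing_on_line:
  fixes k :: 'n
  assumes int: "integrable lborel (\<lambda>w. indicator (ball 0 1) w *\<^sub>R (f w * wk w))"
  shows "(LINT w|lborel. indicator (ball 0 1) w *\<^sub>R (f w * wk w)) = of_real (moment k 0 \<beta>) * f (x *\<^sub>R \<zeta>)"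
proof -
  define g where "g m = (deriv ^^ m) (\<lambda>y. f (y *s \<zeta>)) 0 / fact m" for m
  define c where "c m = pochhammer N m / fact m" for m
  have c0: "0 \<le> c m" for m using pochhammer_real_nonneg[OF less_imp_le[OF N_pos]] by (simp add: c_def)
  define r where "r i = 1 - 1 / real (i + 2)" for i :: nat
  have r: "0 < r i" "r i < 1" for i by (auto simp: r_def field_simps)
  have r1: "r \<longlonglongrightarrow> 1"
  proof -
    have "(\<lambda>i. 1 - 1 / real (i + 2)) \<longlonglongrightarrow> 1 - 0"
      by (intro tendsto_intros LIMSEQ_ignore_initial_segment[OF lim_1_over_n])
    then show ?thesis by (simp add: r_def[abs_def])
  qed
  have ind: "\<forall>\<^sub>F i in sequentially. indicator (ball 0 (r i)) w = (indicator (ball 0 1) w :: real)" for w :: "complex ^ 'n"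
  proof (cases "norm w < 1")
    case True
    then have "\<forall>\<^sub>F i in sequentially. norm w < r i" using r1 by (rule order_tendstoD(1)[rotated])
    then show ?thesis by eventually_elim (use True in simp)
  next
    case False
    have "norm w \<ge> r i" for i using r(2)[of i] False by linarith
    then show ?thesis using False by (intro always_eventually) (auto simp: indicator_def not_less)
  qed
  have lim1: "(\<lambda>i. LINT w|lborel. indicator (ball 0 (r i)) w *\<^sub>R (f w * wk w))
      \<longlonglongrightarrow> (LINT w|lborel. indicator (ball 0 1) w *\<^sub>R (f w * wk w))"
  proof (rule integral_dominated_convergence[where w = "\<lambda>w. norm (indicator (ball 0 1) w *\<^sub>R (f w * wk w))"])
    show m: "(\<lambda>w. indicator (ball 0 1) w *\<^sub>R (f w * wk w)) \<in> borel_measurable lborel"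
      using int by (rule borel_measurable_integrable)
    show "(\<lambda>w. indicator (ball 0 (r i)) w *\<^sub>R (f w * wk w)) \<in> borel_measurable lborel" for i
    proof -
      have "(\<lambda>w. indicator (ball 0 (r i)) w *\<^sub>R (indicator (ball 0 1) w *\<^sub>R (f w * wk w))) \<in> borel_measurable lborel"
        by (rule borel_measurable_scaleR[OF _ m]) simp
      moreover have eq: "indicator (ball 0 (r i)) w *\<^sub>R (indicator (ball 0 1) w *\<^sub>R (f w * wk w))
          = indicator (ball 0 (r i)) w *\<^sub>R (f w * wk w)" for w
        using r(2)[of i] by (auto simp: indicator_def)
      ultimately show ?thesis by (simp only: eq)
    qed
    show "integrable lborel (\<lambda>w. norm (indicator (ball 0 1) w *\<^sub>R (f w * wk w)))"
      using int by (rule integrable_norm)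
    show "AE w in lborel. (\<lambda>i. indicator (ball 0 (r i)) w *\<^sub>R (f w * wk w)) \<longlonglongrightarrow> indicator (ball 0 1) w *\<^sub>R (f w * wk w)"
    proof (rule AE_I2)
      fix w :: "complex ^ 'n"
      show "(\<lambda>i. indicator (ball 0 (r i)) w *\<^sub>R (f w * wk w)) \<longlonglongrightarrow> indicator (ball 0 1) w *\<^sub>R (f w * wk w)"
        by (rule tendsto_eventually) (use ind[of w] in eventually_elim, simp)
    qed
    show "AE w in lborel. norm (indicator (ball 0 (r i)) w *\<^sub>R (f w * wk w)) \<le> norm (indicator (ball 0 1) w *\<^sub>R (f w * wk w))" for i
      by (rule AE_I2) (use r(2)[of i] in \<open>auto simp: indicator_def\<close>)
  qed
  have S: "(LINT w|lborel. indicator (ball 0 (r i)) w *\<^sub>R (f w * wk w))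
      = (\<Sum>m. g m * of_real (c m * x ^ m * trunc_moment (r i) m))" for i
    using integral_truncated_sums[OF r] by (simp add: sums_iff g_def c_def)
  have M: "c m * trunc_moment 1 m = moment k 0 \<beta>" for m
    unfolding trunc_moment_1[of m k] c_def N_eq by (rule pochhammer_moment[OF \<beta>])
  have tm: "(\<lambda>i. trunc_moment (r i) m) \<longlonglongrightarrow> trunc_moment 1 m" for m
    unfolding trunc_moment_def
  proof (rule integral_dominated_convergence[OF _ _ trunc_integrand_integrable[of m]])
    show "AE w in lborel. (\<lambda>i. indicator (ball 0 (r i)) w * (cmod (hinner w \<zeta>) ^ (2 * m) * rho w powr \<beta>))
        \<longlonglongrightarrow> indicator (ball 0 1) w * (cmod (hinner w \<zeta>) ^ (2 * m) * rho w powr \<beta>)"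
    proof (rule AE_I2)
      fix w :: "complex ^ 'n"
      show "(\<lambda>i. indicator (ball 0 (r i)) w * (cmod (hinner w \<zeta>) ^ (2 * m) * rho w powr \<beta>))
        \<longlonglongrightarrow> indicator (ball 0 1) w * (cmod (hinner w \<zeta>) ^ (2 * m) * rho w powr \<beta>)"
        by (rule tendsto_eventually) (use ind[of w] in eventually_elim, simp)
    qed
    show "AE w in lborel. norm (indicator (ball 0 (r i)) w * (cmod (hinner w \<zeta>) ^ (2 * m) * rho w powr \<beta>))
        \<le> indicator (ball 0 1) w * (cmod (hinner w \<zeta>) ^ (2 * m) * rho w powr \<beta>)" for i
      by (rule AE_I2) (use r(2)[of i] in \<open>auto simp: indicator_def\<close>)
  qed measurable
  have tb: "0 \<le> trunc_moment (r i) m" "trunc_moment (r i) m \<le> trunc_moment 1 m" for i m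
  proof -
    show "0 \<le> trunc_moment (r i) m" unfolding trunc_moment_def by (intro Bochner_Integration.integral_nonneg) auto
    show "trunc_moment (r i) m \<le> trunc_moment 1 m"
      unfolding trunc_moment_def
    proof (rule Bochner_Integration.integral_mono[OF _ trunc_integrand_integrable])
      show "integrable lborel (\<lambda>w. indicator (ball 0 (r i)) w * (cmod (hinner w \<zeta>) ^ (2 * m) * rho w powr \<beta>))"
        by (rule Bochner_Integration.integrable_bound[OF trunc_integrand_integrable[of m]])
           (use r(2)[of i] in \<open>auto simp: indicator_def\<close>)
    qed (use r(2)[of i] in \<open>auto simp: indicator_def\<close>)
  qed
  have lim2: "(\<lambda>i. \<Sum>m. g m * of_real (c m * x ^ m * trunc_moment (r i) m))
      \<longlonglongrightarrow> (\<Sum>m. g m * of_real (c m * x ^ m * trunc_moment 1 m))"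
  proof (rule tannerys_theorem[THEN conjunct2, THEN conjunct2])
    show "(\<lambda>i. g m * of_real (c m * x ^ m * trunc_moment (r i) m)) \<longlonglongrightarrow> g m * of_real (c m * x ^ m * trunc_moment 1 m)" for m
      by (intro tendsto_intros tm)
    have "norm (g m * of_real (c m * x ^ m * trunc_moment (r i) m)) \<le> cmod (g m) * x ^ m * moment k 0 \<beta>" for m i
    proof -
      have "c m * trunc_moment (r i) m \<le> moment k 0 \<beta>"
        unfolding M[of m, symmetric] by (intro mult_left_mono tb c0)
      then have "cmod (g m) * x ^ m * (c m * trunc_moment (r i) m) \<le> cmod (g m) * x ^ m * moment k 0 \<beta>"
        using x by (intro mult_left_mono) auto
      then show ?thesis using x c0[of m] tb(1)[of i m] by (simp add: norm_mult norm_power mult_ac)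
    qed
    then show "\<forall>\<^sub>F (m, i) in at_top \<times>\<^sub>F sequentially.
        norm (g m * of_real (c m * x ^ m * trunc_moment (r i) m)) \<le> cmod (g m) * x ^ m * moment k 0 \<beta>"
      by (intro always_eventually) auto
    show "summable (\<lambda>m. cmod (g m) * x ^ m * moment k 0 \<beta>)"
      unfolding g_def by (intro summable_mult2 summable_line_coefficients x)
  qed simp
  have "(\<lambda>m. of_real (moment k 0 \<beta>) * (g m * of_real x ^ m)) sums (of_real (moment k 0 \<beta>) * f (of_real x *s \<zeta>))"
    unfolding g_def using x by (intro sums_mult line_power_series) simp
  moreover have "of_real (moment k 0 \<beta>) * (g m * of_real x ^ m) = g m * of_real (c m * x ^ m * trunc_moment 1 m)" for m
    unfolding M[of m, symmetric] by (simp add: mult_ac)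
  ultimately have "(\<Sum>m. g m * of_real (c m * x ^ m * trunc_moment 1 m)) = of_real (moment k 0 \<beta>) * f (x *\<^sub>R \<zeta>)"
    by (simp add: sums_iff scaleR_eq_scale)
  then show ?thesis using LIMSEQ_unique[OF lim1[unfolded S] lim2] by simp
qed

end

lemma integrable_weighted_measure_iff:
  fixes h :: "complex ^ 'n \<Rightarrow> complex"
  assumes \<alpha>: "\<alpha> > -1" and [measurable]: "h \<in> borel_measurable borel"
  shows "integrable (weighted_measure \<alpha>) h
    \<longleftrightarrow> integrable lborel (\<lambda>w. indicator (ball 0 1) w *\<^sub>R (weight_density \<alpha> w *\<^sub>R h w))"
proof -
  have h: "h \<in> borel_measurable (lebesgue_on (ball 0 1))"
    and wd: "(\<lambda>w :: complex ^ 'n. weight_density \<alpha> w) \<in> borel_measurable (lebesgue_on (ball 0 1))"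
    by (intro measurable_restrict_space1 measurable_completion; simp)+
  have "integrable (weighted_measure \<alpha>) h \<longleftrightarrow> integrable (lebesgue_on (ball 0 1)) (\<lambda>w. weight_density \<alpha> w *\<^sub>R h w)"
    unfolding weighted_measure_eq_density[OF \<alpha>]
    by (rule integrable_density) (use h wd weight_density_nonneg[OF \<alpha>] in auto)
  also have "\<dots> \<longleftrightarrow> integrable lebesgue (\<lambda>w. indicator (ball 0 1) w *\<^sub>R (weight_density \<alpha> w *\<^sub>R h w))"
    by (rule integrable_restrict_space) simp
  also have "\<dots> \<longleftrightarrow> integrable lborel (\<lambda>w. indicator (ball 0 1) w *\<^sub>R (weight_density \<alpha> w *\<^sub>R h w))"
    by (rule integrable_completion) measurable
  finally show ?thesis .
qed

text \<open>
  The factor \<open>rho w\<close> turns the weight into the one with exponent \<open>\<alpha> + 1\<close>, for which the kernel has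
  exponent \<open>n + 2 + \<alpha>\<close>. The point \<open>z\<close> is written as a nonnegative multiple of a unit vector \<open>\<zeta>\<close>, and
  the formula on the line through \<open>\<zeta>\<close> applies.
\<close>

lemma bergman_reproducing:
  fixes \<alpha> :: real
  assumes \<alpha>: "\<alpha> > -1"
  obtains \<kappa> where "\<kappa> > 0" and
    "\<And>(f :: complex ^ 'n \<Rightarrow> complex) z. f \<in> bergman_space \<alpha> \<Longrightarrow> norm z < 1 \<Longrightarrow>
       f z = of_real \<kappa> * (LINT w|weighted_measure \<alpha>. f w * (of_real (rho w) * bker (real CARD('n) + 2 + \<alpha>) z w))"
proof -
  obtain k :: 'n where True by simp
  let ?c = "weight_density \<alpha> (0 :: complex ^ 'n)"
  have c: "?c > 0" by (rule weight_density_0_pos[OF \<alpha>])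
  define \<beta> where "\<beta> = \<alpha> + 1"
  have \<beta>: "\<beta> > 0" using \<alpha> by (simp add: \<beta>_def)
  define N where "N = real CARD('n) + 1 + \<beta>"
  have N: "N = real CARD('n) + 2 + \<alpha>" "N > 0" using \<beta> by (auto simp: N_def \<beta>_def)
  define M where "M = moment k 0 \<beta>"
  have M: "M > 0" unfolding M_def by (rule moment_0_pos[OF \<beta>])
  show ?thesis
  proof (rule that[of "1 / (?c * M)"])
    show "1 / (?c * M) > 0" using c M by simp
    fix f :: "complex ^ 'n \<Rightarrow> complex" and z :: "complex ^ 'n"
    assume f: "f \<in> bergman_space \<alpha>" and z: "norm z < 1"
    have hol: "holomorphic_sv f (ball 0 1)" using f by (simp add: bergman_space_def)
    obtain \<zeta> where \<zeta>: "norm \<zeta> = 1" "z = norm z *\<^sub>R \<zeta>" using polar_vector[of z] by blast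
    define f0 where "f0 w = indicator (ball 0 1) w *\<^sub>R f w" for w
    have [measurable]: "f0 \<in> borel_measurable borel"
      unfolding f0_def by (intro borel_measurable_continuous_on_indicator holomorphic_sv_continuous[OF hol]) simp
    have "integrable (weighted_measure \<alpha>) f0 \<longleftrightarrow> integrable (weighted_measure \<alpha>) f"
      by (rule Bochner_Integration.integrable_cong) (auto simp: f0_def)
    then have if0: "integrable (weighted_measure \<alpha>) f0" using bergman_space_integrable[OF f] by simp
    have e: "indicator (ball 0 1) w *\<^sub>R (weight_density \<alpha> w *\<^sub>R (f0 w * (of_real (rho w) * bker N z w)))
        = of_real ?c * (indicator (ball 0 1) w *\<^sub>R (f w * (of_real (rho w powr \<beta>) * bker N z w)))" for w
    proof (cases "norm w < 1")
      case True
      have "weight_density \<alpha> w * rho w = ?c * rho w powr \<beta>"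
        using rho_pos[OF True] by (simp add: weight_density_eq[of \<alpha> w] \<beta>_def powr_add)
      then have "complex_of_real (weight_density \<alpha> w) * of_real (rho w) = of_real ?c * of_real (rho w powr \<beta>)"
        by (metis of_real_mult)
      then show ?thesis using True by (simp add: f0_def scaleR_conv_of_real mult_ac)
    qed simp
    have i1: "integrable (weighted_measure \<alpha>) (\<lambda>w. f0 w * (of_real (rho w) * bker N z w))"
    proof (rule integrable_mult_bounded_kernel[OF if0])
      show "(\<lambda>w. of_real (rho w) * bker N z w) \<in> borel_measurable (weighted_measure \<alpha>)"
        by (rule measurable_weighted_measure) simp
      fix w :: "complex ^ 'n" assume "w \<in> space (weighted_measure \<alpha>)"
      then have w: "norm w < 1" by simp
      have "\<bar>rho w\<bar> * cmod (bker N z w) \<le> 1 * (1 - norm z) powr (- N)"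
        using rho_pos[OF w] rho_le_1[of w] N w z by (intro mult_mono bker_bound) auto
      then show "cmod (of_real (rho w) * bker N z w) \<le> 1 * (1 - norm z) powr (- N)" by (simp add: norm_mult)
    qed
    then have i2: "integrable lborel (\<lambda>w. of_real ?c * (indicator (ball 0 1) w *\<^sub>R (f w * (of_real (rho w powr \<beta>) * bker N z w))))"
      by (subst (asm) integrable_weighted_measure_iff[OF \<alpha>]) (simp_all only: e, simp)
    have i3: "integrable lborel (\<lambda>w. indicator (ball 0 1) w *\<^sub>R (f w * (of_real (rho w powr \<beta>) * bker N z w)))"
      using integrable_mult_right[OF i2, of "1 / of_real ?c"] c by simp
    have "(LINT w|weighted_measure \<alpha>. f w * (of_real (rho w) * bker N z w))
        = (LINT w|weighted_measure \<alpha>. f0 w * (of_real (rho w) * bker N z w))"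
      by (rule Bochner_Integration.integral_cong) (auto simp: f0_def)
    also have "\<dots> = (LINT w|lborel. of_real ?c * (indicator (ball 0 1) w *\<^sub>R (f w * (of_real (rho w powr \<beta>) * bker N z w))))"
      by (subst integral_weighted_measure[OF \<alpha>]) (simp_all only: e, simp)
    also have "\<dots> = of_real ?c * (LINT w|lborel. indicator (ball 0 1) w *\<^sub>R (f w * (of_real (rho w powr \<beta>) * bker N z w)))"
      by (rule integral_mult_right_zero)
    also have "(LINT w|lborel. indicator (ball 0 1) w *\<^sub>R (f w * (of_real (rho w powr \<beta>) * bker N z w))) = of_real M * f z"
      using reproducing_on_line[OF hol \<zeta>(1) norm_ge_zero z \<beta> N_def, of k] i3
      unfolding \<zeta>(2)[symmetric] M_def by blast
    finally show "f z = of_real (1 / (?c * M)) *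
        (LINT w|weighted_measure \<alpha>. f w * (of_real (rho w) * bker (real CARD('n) + 2 + \<alpha>) z w))"
      using c M by (simp add: N(1)[symmetric])
  qed
qed

section \<open>Functions in the Bergman space belong to the hull\<close>

lemma continuous_on_bker:
  assumes "\<And>t. t \<in> S \<Longrightarrow> norm (g t) \<le> 1" "\<And>t. t \<in> S \<Longrightarrow> norm (h t) < 1"
    and [continuous_intros]: "continuous_on S g" "continuous_on S h"
  shows "continuous_on S (\<lambda>t. bker s (g t) (h t))"
proof -
  have pos: "0 < Re (1 - hinner (g t) (h t))" if t: "t \<in> S" for t
  proof -
    have "cmod (hinner (h t) (g t)) < 1" using assms t by (intro cmod_hinner_less_1) auto
    then show ?thesis by (intro Re_one_minus_pos) (simp add: hinner_commute_cmod)
  qed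
  have c: "continuous_on S (\<lambda>t. 1 - hinner (g t) (h t))" by (intro continuous_intros)
  have ne: "1 - hinner (g t) (h t) \<noteq> 0" if "t \<in> S" for t
    using pos[OF that] by (metis less_irrefl zero_complex.sel(1))
  show ?thesis unfolding bker_def
    by (rule continuous_on_powr_complex[OF _ _ c])
       (use pos ne in \<open>auto simp: less_imp_le intro!: continuous_on_const\<close>)
qed

lemma small_tail:
  fixes f :: "complex ^ 'n \<Rightarrow> complex"
  assumes f: "integrable (weighted_measure \<alpha>) f" and \<epsilon>: "\<epsilon> > 0"
  obtains r where "0 < r" "r < 1"
    "(LINT w|weighted_measure \<alpha>. indicator (ball 0 1 - ball 0 r) w * cmod (f w)) \<le> \<epsilon>"
proof -
  let ?M = "weighted_measure \<alpha> :: (complex ^ 'n) measure"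
  define r where "r i = 1 - 1 / real (i + 2)" for i :: nat
  have r: "0 < r i" "r i < 1" for i by (auto simp: r_def field_simps)
  have r1: "r \<longlonglongrightarrow> 1"
  proof -
    have "(\<lambda>i. 1 - 1 / real (i + 2)) \<longlonglongrightarrow> 1 - 0"
      by (intro tendsto_intros LIMSEQ_ignore_initial_segment[OF lim_1_over_n])
    then show ?thesis by (simp add: r_def[abs_def])
  qed
  have ind: "(\<lambda>w. indicator (ball 0 1 - ball 0 (r i)) w :: real) \<in> borel_measurable ?M" for i
    by (rule measurable_weighted_measure) simp
  have fm: "f \<in> borel_measurable ?M" using f by simp
  have "(\<lambda>i. LINT w|?M. indicator (ball 0 1 - ball 0 (r i)) w * cmod (f w)) \<longlonglongrightarrow> (LINT w|?M. 0)"
  proof (rule integral_dominated_convergence[where w = "\<lambda>w. cmod (f w)"])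
    show "(\<lambda>w. indicator (ball 0 1 - ball 0 (r i)) w * cmod (f w)) \<in> borel_measurable ?M" for i
      using ind fm by (intro borel_measurable_times) auto
    show "AE w in ?M. (\<lambda>i. indicator (ball 0 1 - ball 0 (r i)) w * cmod (f w)) \<longlonglongrightarrow> 0"
    proof (rule AE_I2)
      fix w assume "w \<in> space ?M"
      then have "norm w < 1" by simp
      then have "\<forall>\<^sub>F i in sequentially. norm w < r i" using r1 by (rule order_tendstoD(1)[rotated])
      then have "\<forall>\<^sub>F i in sequentially. indicator (ball 0 1 - ball 0 (r i)) w * cmod (f w) = 0"
        by eventually_elim simp
      then show "(\<lambda>i. indicator (ball 0 1 - ball 0 (r i)) w * cmod (f w)) \<longlonglongrightarrow> 0" by (rule tendsto_eventually)
    qed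
    show "AE w in ?M. norm (indicator (ball 0 1 - ball 0 (r i)) w * cmod (f w)) \<le> cmod (f w)" for i
      by (rule AE_I2) (auto simp: indicator_def)
  qed (use f in auto)
  then have "\<forall>\<^sub>F i in sequentially. (LINT w|?M. indicator (ball 0 1 - ball 0 (r i)) w * cmod (f w)) < \<epsilon>"
    using \<epsilon> by (intro order_tendstoD(2)) auto
  then obtain i where "(LINT w|?M. indicator (ball 0 1 - ball 0 (r i)) w * cmod (f w)) < \<epsilon>"
    using eventually_happens'[OF sequentially_bot] by blast
  then show ?thesis using that[of "r i"] r by simp
qed

lemma finite_partition_small:
  fixes r d :: real
  assumes d: "d > 0"
  obtains m :: nat and p :: "nat \<Rightarrow> complex ^ 'n" and E
  where "\<And>i. i < m \<Longrightarrow> p i \<in> cball 0 r" "\<And>i. E i \<in> sets borel" "\<And>i. E i \<subseteq> ball 0 r \<inter> ball (p i) d"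
    "disjoint_family E" "(\<Union>i<m. E i) = ball 0 r"
proof -
  have "compact (cball (0 :: complex ^ 'n) r)" by simp
  then obtain T where T: "T \<subseteq> cball (0 :: complex ^ 'n) r" "finite T" "cball 0 r \<subseteq> (\<Union>t\<in>T. ball t d)"
    by (rule compactE_image[where f = "\<lambda>t. ball t d" and C = "cball 0 r"]) (use d in auto)
  obtain xs where xs: "set xs = T" using finite_list[OF T(2)] by blast
  define p where "p i = xs ! i" for i
  define E where "E i = ball 0 r \<inter> disjointed (\<lambda>i. ball (p i) d) i" for i
  show ?thesis
  proof (rule that[of "length xs" p E])
    show "p i \<in> cball 0 r" if "i < length xs" for i using nth_mem[OF that] T(1) xs unfolding p_def by blast
    show "E i \<in> sets borel" for i unfolding E_def disjointed_def by auto
    show "E i \<subseteq> ball 0 r \<inter> ball (p i) d" for i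
      unfolding E_def using disjointed_subset[of "\<lambda>i. ball (p i) d" i] by blast
    show "disjoint_family E"
      using disjoint_family_disjointed[of "\<lambda>i. ball (p i) d"] unfolding E_def disjoint_family_on_def by blast
    have "(\<Union>i<length xs. disjointed (\<lambda>i. ball (p i) d) i) = (\<Union>i<length xs. ball (p i) d)"
      using UN_disjointed_eq[of "\<lambda>i. ball (p i) d"] finite_UN_disjointed_eq[of "\<lambda>i. ball (p i) d" "length xs"]
      by (simp add: lessThan_atLeast0)
    also have "\<dots> = (\<Union>t\<in>T. ball t d)"
      unfolding xs[symmetric] set_conv_nth p_def by auto
    finally show "(\<Union>i<length xs. E i) = ball 0 r" unfolding E_def using T(3) by auto
  qed
qed

text \<open>
  By the reproducing formula a function in the Bergman space is an average of normalised kernels.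
  Step functions approximate this average by finite combinations of kernels, so that it stays in
  the hull.
\<close>

lemma bergman_space_subset_hull:
  fixes q \<alpha> :: real
  assumes \<alpha>: "\<alpha> > -1" and q: "q > 1"
  obtains C where "C > 0" and
    "\<And>f :: complex ^ 'n \<Rightarrow> complex. f \<in> bergman_space \<alpha> \<Longrightarrow> atomic_hull q \<alpha> (C * bergman_norm \<alpha> f) f"
proof -
  let ?M = "weighted_measure \<alpha> :: (complex ^ 'n) measure"
  interpret finite_measure ?M by (rule finite_weighted_measure[OF \<alpha>])
  have sfm: "sigma_finite_measure ?M" by unfold_locales
  interpret pair_sigma_finite ?M ?M ..
  define V where "V = measure ?M (ball 0 1)"
  have V: "V \<ge> 0" "emeasure ?M (ball 0 1) = ennreal V" by (simp_all add: V_def emeasure_eq_measure)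
  define N where "N = real CARD('n) + 2 + \<alpha>"
  have N: "N > 0" using \<alpha> by (simp add: N_def)
  define k :: "complex ^ 'n \<Rightarrow> complex ^ 'n \<Rightarrow> complex"
    where "k w z = of_real (rho w) * bker N z w" for w z
  obtain \<kappa> where \<kappa>: "\<kappa> > 0" and rep:
    "\<And>(f :: complex ^ 'n \<Rightarrow> complex) z. f \<in> bergman_space \<alpha> \<Longrightarrow> norm z < 1 \<Longrightarrow>
       f z = of_real \<kappa> * (LINT w|?M. f w * (of_real (rho w) * bker (real CARD('n) + 2 + \<alpha>) z w))"
    using bergman_reproducing[OF \<alpha>, where 'n = 'n] by blast
  obtain C1 where C1: "C1 > 0" and hk: "\<And>w :: complex ^ 'n. norm w < 1 \<Longrightarrow>
       atomic_hull q \<alpha> C1 (\<lambda>z. of_real (rho w) * bker (real CARD('n) + 2 + \<alpha>) z w)"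
    using atomic_hull_normalised_kernel[OF \<alpha> q, where 'n = 'n] by blast
  obtain A where A: "A > 0" and at: "\<And>a :: complex ^ 'n \<Rightarrow> complex. is_atom q \<alpha> a \<Longrightarrow>
       bergman_proj \<alpha> a \<in> bergman_space \<alpha> \<and> bergman_norm \<alpha> (bergman_proj \<alpha> a) \<le> A"
    using proj_atom_bound[OF \<alpha> q, where 'n = 'n] by blast
  have hk': "atomic_hull q \<alpha> C1 (k w)" if "norm w < 1" for w
    using hk[OF that] by (simp add: k_def[abs_def] N_def)
  have nk: "bergman_norm \<alpha> (k w) \<le> A * C1" if "norm w < 1" for w
    by (rule atomic_hull_norm_le[OF \<alpha> q hk'[OF that] A]) (use at in blast)
  have kint: "integrable ?M (k w)" if "norm w < 1" for w
    using hk'[OF that] by (simp add: atomic_hull_def)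
  have kbound: "cmod (k w z) \<le> (1 - norm z) powr (- N)" if "norm w < 1" "norm z < 1" for w z
  proof -
    have "\<bar>rho w\<bar> * cmod (bker N z w) \<le> 1 * (1 - norm z) powr (- N)"
      using rho_pos[OF that(1)] rho_le_1[of w] N that by (intro mult_mono bker_bound) auto
    then show ?thesis by (simp add: k_def norm_mult)
  qed
  show ?thesis
  proof (rule that[of "\<kappa> * C1"])
    show "\<kappa> * C1 > 0" using \<kappa> C1 by simp
    fix f :: "complex ^ 'n \<Rightarrow> complex" assume f: "f \<in> bergman_space \<alpha>"
    have fi: "integrable ?M f" by (rule bergman_space_integrable[OF f])
    have [measurable]: "f \<in> borel_measurable ?M" "(\<lambda>w. w) \<in> borel_measurable ?M"
      using fi measurable_ident_weighted_measure by auto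
    define F where "F = bergman_norm \<alpha> f"
    have F: "F \<ge> 0" "F = (LINT w|?M. cmod (f w))" by (simp_all add: F_def bergman_norm_def)
    show "atomic_hull q \<alpha> (\<kappa> * C1 * bergman_norm \<alpha> f) f"
    proof (rule atomic_hull_closed[OF \<alpha> q fi])
      fix \<epsilon> :: real assume \<epsilon>: "\<epsilon> > 0"
      \<comment> \<open>The step function replaces \<open>k w\<close> by \<open>k (p i)\<close> for \<open>w\<close> in the \<open>i\<close>-th piece of a smaller ball. The
         error is uniformly small there; near the sphere it is at most \<open>A * C1\<close> in norm, and \<open>f\<close>
         has little mass. Each error receives half of \<open>\<epsilon>\<close>.\<close>
      define \<epsilon>1 where "\<epsilon>1 = \<epsilon> / (2 * \<kappa> * A * C1)"
      define \<epsilon>2 where "\<epsilon>2 = \<epsilon> / (2 * \<kappa> * (V * F + 1))"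
      have VF: "V * F + 1 > 0" using V F by (simp add: add_nonneg_pos)
      have e1: "\<epsilon>1 > 0" using \<epsilon> \<kappa> A C1 by (simp add: \<epsilon>1_def)
      have e2: "\<epsilon>2 > 0" using \<epsilon> \<kappa> VF by (simp add: \<epsilon>2_def)
      obtain r where r: "0 < r" "r < 1" and tail: "(LINT w|?M. indicator (ball 0 1 - ball 0 r) w * cmod (f w)) \<le> \<epsilon>1"
        using small_tail[OF fi e1] by blast
      let ?K = "cball (0 :: complex ^ 'n) 1 \<times> cball (0 :: complex ^ 'n) r"
      have "continuous_on ?K (\<lambda>t. k (snd t) (fst t))"
        unfolding k_def rho_def
        by (intro continuous_intros continuous_on_bker) (use r in auto)
      then have "uniformly_continuous_on ?K (\<lambda>t. k (snd t) (fst t))"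
        by (rule compact_uniformly_continuous) (intro compact_Times compact_cball)
      then obtain d where d: "d > 0" and close: "\<And>t t'. t \<in> ?K \<Longrightarrow> t' \<in> ?K \<Longrightarrow> dist t' t < d \<Longrightarrow>
          dist (k (snd t') (fst t')) (k (snd t) (fst t)) < \<epsilon>2"
        using e2 unfolding uniformly_continuous_on_def by meson
      have kclose: "cmod (k w z - k w' z) \<le> \<epsilon>2"
        if "norm z < 1" "norm w \<le> r" "norm w' \<le> r" "dist w w' < d" for w w' z
        using close[of "(z, w')" "(z, w)"] that by (simp add: dist_Pair_Pair dist_norm)
      obtain m :: nat and p :: "nat \<Rightarrow> complex ^ 'n" and E
        where p: "\<And>i. i < m \<Longrightarrow> p i \<in> cball 0 r" and E: "\<And>i. E i \<in> sets borel"
          and Esub: "\<And>i. E i \<subseteq> ball 0 r \<inter> ball (p i) d"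
          and disj: "disjoint_family E" and EU: "(\<Union>i<m. E i) = ball 0 r"
        using finite_partition_small[OF d, where 'n = 'n and r = r] by blast
      have p1: "norm (p i) < 1" if "i < m" for i using p[OF that] r by simp
      have EM: "E i \<in> sets ?M" for i
      proof -
        have "ball 0 r \<subseteq> ball (0 :: complex ^ 'n) 1" using r by auto
        then show ?thesis using E[of i] Esub[of i] by (intro sets_weighted_measureI) auto
      qed
      have [measurable]: "(\<lambda>w. indicator (E i) w :: real) \<in> borel_measurable ?M" for i
        using EM[of i] by simp
      have Esum: "(\<Sum>i<m. indicator (E i) w :: real) = indicator (ball 0 r) w" for w
      proof -
        have "(indicator (\<Union>i<m. E i) w :: real) = (\<Sum>i<m. indicator (E i) w)"
          by (rule indicator_UN_disjoint) (use disj in \<open>auto simp: disjoint_family_on_def\<close>)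
        then show ?thesis by (simp only: EU)
      qed
      define c where "c i = (LINT w|?M. indicator (E i) w *\<^sub>R f w)" for i
      have ci: "integrable ?M (\<lambda>w. indicator (E i) w *\<^sub>R f w)" for i
        by (rule integrable_mult_indicator[OF EM fi])
      have csum: "(\<Sum>i<m. cmod (c i)) \<le> F"
      proof -
        have "(\<Sum>i<m. cmod (c i)) \<le> (\<Sum>i<m. LINT w|?M. indicator (E i) w * cmod (f w))"
        proof (rule sum_mono)
          fix i
          have "cmod (c i) \<le> (LINT w|?M. norm (indicator (E i) w *\<^sub>R f w))"
            unfolding c_def by (rule integral_norm_bound)
          then show "cmod (c i) \<le> (LINT w|?M. indicator (E i) w * cmod (f w))" by simp
        qed
        also have "\<dots> = (LINT w|?M. (\<Sum>i<m. indicator (E i) w * cmod (f w)))"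
          using integrable_norm[OF ci] by (intro Bochner_Integration.integral_sum[symmetric]) simp
        also have "\<dots> = (LINT w|?M. indicator (ball 0 r) w * cmod (f w))"
          by (simp add: sum_distrib_right[symmetric] Esum)
        also have "\<dots> \<le> F"
          unfolding F(2)
        proof (rule Bochner_Integration.integral_mono)
          have "ball 0 r \<in> sets ?M" using r by (intro sets_weighted_measureI) auto
          then show "integrable ?M (\<lambda>w. indicator (ball 0 r) w * cmod (f w))"
            using integrable_mult_indicator[of "ball 0 r" ?M "\<lambda>w. cmod (f w)"] fi by simp
        qed (use fi in \<open>auto simp: indicator_def\<close>)
        finally show ?thesis .
      qed
      define st where "st w z = (\<Sum>i<m. indicator (E i) w *\<^sub>R k (p i) z)" for w z
      define h where "h z = of_real \<kappa> * (\<Sum>i<m. c i * k (p i) z)" for z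
      have hh: "atomic_hull q \<alpha> (\<kappa> * C1 * bergman_norm \<alpha> f) h"
      proof -
        have "atomic_hull q \<alpha> (\<Sum>i<m. cmod (c i) * C1) (\<lambda>z. \<Sum>i<m. c i * k (p i) z)"
          by (rule atomic_hull_sum[OF \<alpha> q]) (auto intro!: atomic_hull_scale[OF \<alpha> q] hk' p1)
        then have "atomic_hull q \<alpha> (cmod (of_real \<kappa>) * (\<Sum>i<m. cmod (c i) * C1)) h"
          unfolding h_def by (rule atomic_hull_scale[OF \<alpha> q])
        moreover have "cmod (of_real \<kappa>) * (\<Sum>i<m. cmod (c i) * C1) \<le> \<kappa> * C1 * F"
        proof -
          have "\<kappa> * ((\<Sum>i<m. cmod (c i)) * C1) \<le> \<kappa> * (F * C1)"
            using csum \<kappa> C1 by (intro mult_left_mono mult_right_mono) auto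
          moreover have "(\<Sum>i<m. cmod (c i) * C1) = (\<Sum>i<m. cmod (c i)) * C1" by (rule sum_distrib_right[symmetric])
          moreover have "cmod (of_real \<kappa>) = \<kappa>" using \<kappa> by simp
          ultimately show ?thesis by (simp only: mult_ac)
        qed
        ultimately show ?thesis unfolding F_def by (rule atomic_hull_mono[OF \<alpha> q])
      qed
      have inner: "(\<integral>\<^sup>+z. ennreal (cmod (k w z - st w z)) \<partial>?M)
          \<le> ennreal (\<epsilon>2 * V + indicator (ball 0 1 - ball 0 r) w * (A * C1))" if w: "norm w < 1" for w
      proof (cases "w \<in> ball 0 r")
        case True
        then have "w \<in> (\<Union>i<m. E i)" using EU by simp
        then obtain i where i: "i < m" "w \<in> E i" by blast
        have "st w z = k (p i) z" for z
        proof -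
          have "indicator (E j) w = (if j = i then 1 else 0 :: real)" for j
            using disj i(2) by (auto simp: indicator_def disjoint_family_on_def)
          then have "st w z = (\<Sum>j<m. if j = i then k (p i) z else 0)"
            unfolding st_def by (intro sum.cong) auto
          then show ?thesis using i by simp
        qed
        moreover have "dist w (p i) < d" "norm w < r" using Esub[of i] i(2) by (auto simp: dist_commute)
        ultimately have "cmod (k w z - st w z) \<le> \<epsilon>2" if "norm z < 1" for z
          using kclose[OF that, of w "p i"] p[OF i(1)] by simp
        then have "(\<integral>\<^sup>+z. ennreal (cmod (k w z - st w z)) \<partial>?M) \<le> (\<integral>\<^sup>+z. ennreal \<epsilon>2 \<partial>?M)"
          by (intro nn_integral_mono ennreal_leI) simp
        also have "\<dots> = ennreal (\<epsilon>2 * V)" using e2 V by (simp add: ennreal_mult)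
        finally show ?thesis using True by simp
      next
        case False
        then have "w \<notin> E i" for i using Esub by blast
        then have "st w z = 0" for z by (simp add: st_def)
        then have "(\<integral>\<^sup>+z. ennreal (cmod (k w z - st w z)) \<partial>?M) = ennreal (bergman_norm \<alpha> (k w))"
          unfolding bergman_norm_def using kint[OF w] by (simp add: nn_integral_eq_integral)
        also have "\<dots> \<le> ennreal (\<epsilon>2 * V + A * C1)"
          using nk[OF w] e2 V by (intro ennreal_leI) (simp add: add_increasing)
        finally show ?thesis using False w by simp
      qed
      have diff: "f z - h z = of_real \<kappa> * (LINT w|?M. f w * (k w z - st w z))" if z: "norm z < 1" for z
      proof -
        have i1: "integrable ?M (\<lambda>w. f w * k w z)"
          by (rule integrable_mult_bounded_kernel[OF fi, where B = "(1 - norm z) powr (- N)"])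
             (use kbound z in \<open>auto simp: k_def intro!: measurable_weighted_measure\<close>)
        have i2: "integrable ?M (\<lambda>w. f w * (indicator (E i) w *\<^sub>R k (p i) z))" for i
          using integrable_mult_left[OF ci[of i], of "k (p i) z"] by (simp add: scaleR_conv_of_real mult_ac)
        have "(LINT w|?M. f w * st w z) = (LINT w|?M. (\<Sum>i<m. f w * (indicator (E i) w *\<^sub>R k (p i) z)))"
          by (simp add: st_def sum_distrib_left)
        also have "\<dots> = (\<Sum>i<m. LINT w|?M. f w * (indicator (E i) w *\<^sub>R k (p i) z))"
          using i2 by (rule Bochner_Integration.integral_sum)
        also have "\<dots> = (\<Sum>i<m. c i * k (p i) z)"
          unfolding c_def by (intro sum.cong refl, subst integral_mult_left_zero[symmetric])
            (simp add: scaleR_conv_of_real mult_ac)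
        finally have st_int: "(LINT w|?M. f w * st w z) = (\<Sum>i<m. c i * k (p i) z)" .
        have i3: "integrable ?M (\<lambda>w. f w * st w z)"
          unfolding st_def sum_distrib_left by (intro Bochner_Integration.integrable_sum i2)
        have "(LINT w|?M. f w * (k w z - st w z)) = (LINT w|?M. f w * k w z) - (LINT w|?M. f w * st w z)"
          unfolding right_diff_distrib by (rule Bochner_Integration.integral_diff[OF i1 i3])
        moreover have "f z = of_real \<kappa> * (LINT w|?M. f w * k w z)"
          using rep[OF f z] by (simp add: k_def N_def)
        ultimately show ?thesis by (simp add: h_def st_int right_diff_distrib)
      qed
      have meas3: "(\<lambda>(w, z). ennreal (cmod (f w * (k w z - st w z)))) \<in> borel_measurable (?M \<Otimes>\<^sub>M ?M)"
      proof -
        have a: "(\<lambda>(w, z). k w z) \<in> borel_measurable (?M \<Otimes>\<^sub>M ?M)"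
          unfolding k_def rho_def by measurable
        have b: "(\<lambda>(w, z). st w z) \<in> borel_measurable (?M \<Otimes>\<^sub>M ?M)"
          unfolding st_def k_def by measurable
        show ?thesis using a b by measurable
      qed
      have hi: "integrable ?M h" using hh by (simp add: atomic_hull_def)
      have "ennreal (bergman_norm \<alpha> (\<lambda>z. f z - h z)) = (\<integral>\<^sup>+z. ennreal (cmod (f z - h z)) \<partial>?M)"
        unfolding bergman_norm_def using fi hi by (intro nn_integral_eq_integral[symmetric]) auto
      also have "\<dots> \<le> (\<integral>\<^sup>+z. ennreal \<kappa> * (\<integral>\<^sup>+w. ennreal (cmod (f w * (k w z - st w z))) \<partial>?M) \<partial>?M)"
      proof (rule nn_integral_mono)
        fix z assume "z \<in> space ?M"
        then have z: "norm z < 1" by simp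
        have "ennreal (cmod (f z - h z)) = ennreal \<kappa> * ennreal (cmod (LINT w|?M. f w * (k w z - st w z)))"
          unfolding diff[OF z] norm_mult using \<kappa> by (simp add: ennreal_mult)
        also have "ennreal (cmod (LINT w|?M. f w * (k w z - st w z)))
            \<le> (\<integral>\<^sup>+w. ennreal (cmod (f w * (k w z - st w z))) \<partial>?M)"
          by (cases "integrable ?M (\<lambda>w. f w * (k w z - st w z))")
             (simp_all add: integral_norm_bound_ennreal not_integrable_integral_eq)
        finally show "ennreal (cmod (f z - h z)) \<le> ennreal \<kappa> * (\<integral>\<^sup>+w. ennreal (cmod (f w * (k w z - st w z))) \<partial>?M)"
          by (simp add: mult_left_mono)
      qed
      also have "\<dots> = ennreal \<kappa> * (\<integral>\<^sup>+z. (\<integral>\<^sup>+w. ennreal (cmod (f w * (k w z - st w z))) \<partial>?M) \<partial>?M)"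
      proof (rule nn_integral_cmult)
        have "(\<lambda>(z, w). ennreal (cmod (f w * (k w z - st w z)))) \<in> borel_measurable (?M \<Otimes>\<^sub>M ?M)"
          using measurable_pair_swap[OF meas3] by simp
        then show "(\<lambda>z. \<integral>\<^sup>+w. ennreal (cmod (f w * (k w z - st w z))) \<partial>?M) \<in> borel_measurable ?M"
          by (rule sigma_finite_measure.borel_measurable_nn_integral[OF sfm])
      qed
      also have "(\<integral>\<^sup>+z. (\<integral>\<^sup>+w. ennreal (cmod (f w * (k w z - st w z))) \<partial>?M) \<partial>?M)
          = (\<integral>\<^sup>+w. (\<integral>\<^sup>+z. ennreal (cmod (f w * (k w z - st w z))) \<partial>?M) \<partial>?M)"
        by (rule Fubini'[OF meas3])
      also have "\<dots> \<le> (\<integral>\<^sup>+w. ennreal (cmod (f w) * (\<epsilon>2 * V + indicator (ball 0 1 - ball 0 r) w * (A * C1))) \<partial>?M)"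
      proof (rule nn_integral_mono)
        fix w assume "w \<in> space ?M"
        then have w: "norm w < 1" by simp
        have [measurable]: "(\<lambda>z. k w z) \<in> borel_measurable ?M" "(\<lambda>z. st w z) \<in> borel_measurable ?M"
          unfolding st_def k_def by measurable
        have "(\<integral>\<^sup>+z. ennreal (cmod (f w * (k w z - st w z))) \<partial>?M)
            = ennreal (cmod (f w)) * (\<integral>\<^sup>+z. ennreal (cmod (k w z - st w z)) \<partial>?M)"
          unfolding norm_mult by (simp add: ennreal_mult nn_integral_cmult)
        also have "\<dots> \<le> ennreal (cmod (f w)) * ennreal (\<epsilon>2 * V + indicator (ball 0 1 - ball 0 r) w * (A * C1))"
          by (rule mult_left_mono[OF inner[OF w]]) simp
        also have "\<dots> = ennreal (cmod (f w) * (\<epsilon>2 * V + indicator (ball 0 1 - ball 0 r) w * (A * C1)))"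
          using e2 V A C1 by (intro ennreal_mult[symmetric]) auto
        finally show "(\<integral>\<^sup>+z. ennreal (cmod (f w * (k w z - st w z))) \<partial>?M)
            \<le> ennreal (cmod (f w) * (\<epsilon>2 * V + indicator (ball 0 1 - ball 0 r) w * (A * C1)))" .
      qed
      also have "\<dots> = ennreal (F * (\<epsilon>2 * V) + (LINT w|?M. indicator (ball 0 1 - ball 0 r) w * cmod (f w)) * (A * C1))"
      proof -
        have B: "ball 0 1 - ball 0 r \<in> sets ?M" by (intro sets_weighted_measureI) auto
        have i1: "integrable ?M (\<lambda>w. indicator (ball 0 1 - ball 0 r) w * cmod (f w))"
          using integrable_mult_indicator[OF B integrable_norm[OF fi]] by simp
        have e: "cmod (f w) * (\<epsilon>2 * V + indicator (ball 0 1 - ball 0 r) w * (A * C1))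
            = cmod (f w) * (\<epsilon>2 * V) + indicator (ball 0 1 - ball 0 r) w * cmod (f w) * (A * C1)" for w
          by (simp add: algebra_simps)
        have "(LINT w|?M. cmod (f w) * (\<epsilon>2 * V) + indicator (ball 0 1 - ball 0 r) w * cmod (f w) * (A * C1))
            = F * (\<epsilon>2 * V) + (LINT w|?M. indicator (ball 0 1 - ball 0 r) w * cmod (f w)) * (A * C1)"
          unfolding F(2) using fi i1 by simp
        moreover have "integrable ?M (\<lambda>w. cmod (f w) * (\<epsilon>2 * V) + indicator (ball 0 1 - ball 0 r) w * cmod (f w) * (A * C1))"
          using fi i1 by simp
        ultimately show ?thesis
          unfolding e using e2 V A C1 by (subst nn_integral_eq_integral) auto
      qed
      also have "ennreal \<kappa> * \<dots> \<le> ennreal \<epsilon>"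
      proof -
        have "\<kappa> * (F * (\<epsilon>2 * V)) \<le> \<kappa> * (\<epsilon>2 * (V * F + 1))" using \<kappa> e2 by (simp add: algebra_simps)
        also have "\<dots> = \<epsilon> / 2" using \<kappa> VF by (simp add: \<epsilon>2_def)
        finally have 1: "\<kappa> * (F * (\<epsilon>2 * V)) \<le> \<epsilon> / 2" .
        have "\<kappa> * ((LINT w|?M. indicator (ball 0 1 - ball 0 r) w * cmod (f w)) * (A * C1)) \<le> \<kappa> * (\<epsilon>1 * (A * C1))"
          using \<kappa> A C1 tail by (intro mult_left_mono mult_right_mono) auto
        also have "\<dots> = \<epsilon> / 2" using \<kappa> A C1 by (simp add: \<epsilon>1_def)
        finally have 2: "\<kappa> * ((LINT w|?M. indicator (ball 0 1 - ball 0 r) w * cmod (f w)) * (A * C1)) \<le> \<epsilon> / 2" .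
        have "0 \<le> F * (\<epsilon>2 * V) + (LINT w|?M. indicator (ball 0 1 - ball 0 r) w * cmod (f w)) * (A * C1)"
          using F e2 V A C1 by (intro add_nonneg_nonneg mult_nonneg_nonneg Bochner_Integration.integral_nonneg) auto
        then show ?thesis using 1 2 \<kappa>
          by (subst ennreal_mult[symmetric]) (auto simp: distrib_left intro!: ennreal_leI)
      qed
      finally have "bergman_norm \<alpha> (\<lambda>z. f z - h z) \<le> \<epsilon>"
        using \<epsilon> by (simp add: ennreal_le_iff mult_left_mono)
      then show "\<exists>h. atomic_hull q \<alpha> (\<kappa> * C1 * bergman_norm \<alpha> f) h \<and> bergman_norm \<alpha> (\<lambda>z. f z - h z) \<le> \<epsilon>"
        using hh by blast
    qed
  qed
qed

section \<open>From the hull to series\<close>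

lemma bergman_space_diff:
  assumes f: "f \<in> bergman_space \<alpha>" and g: "g \<in> bergman_space \<alpha>"
  shows "(\<lambda>z. f z - g z) \<in> bergman_space \<alpha>"
proof -
  have "holomorphic_sv (\<lambda>z. f z - g z) (ball 0 1)"
    unfolding holomorphic_sv_def
  proof
    fix z assume z: "z \<in> ball (0 :: complex ^ 'a) 1"
    obtain D where D: "(f has_derivative D) (at z)" "\<forall>c v. D (c *s v) = c * D v"
      using f z unfolding bergman_space_def holomorphic_sv_def by blast
    obtain D' where D': "(g has_derivative D') (at z)" "\<forall>c v. D' (c *s v) = c * D' v"
      using g z unfolding bergman_space_def holomorphic_sv_def by blast
    show "\<exists>D. ((\<lambda>z. f z - g z) has_derivative D) (at z) \<and> (\<forall>c v. D (c *s v) = c * D v)"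
      by (rule exI[of _ "\<lambda>v. D v - D' v"])
         (use D D' in \<open>auto intro!: has_derivative_diff simp: right_diff_distrib\<close>)
  qed
  then show ?thesis
    using bergman_space_integrable[OF f] bergman_space_integrable[OF g] by (auto simp: bergman_space_def)
qed

lemma bergman_space_mult:
  assumes f: "f \<in> bergman_space \<alpha>"
  shows "(\<lambda>z. c * f z) \<in> bergman_space \<alpha>"
proof -
  have "holomorphic_sv (\<lambda>z. c * f z) (ball 0 1)"
    unfolding holomorphic_sv_def
  proof
    fix z assume z: "z \<in> ball (0 :: complex ^ 'a) 1"
    obtain D where D: "(f has_derivative D) (at z)" "\<forall>c v. D (c *s v) = c * D v"
      using f z unfolding bergman_space_def holomorphic_sv_def by blast
    show "\<exists>D. ((\<lambda>z. c * f z) has_derivative D) (at z) \<and> (\<forall>c v. D (c *s v) = c * D v)"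
      by (rule exI[of _ "\<lambda>v. c * D v"])
         (use D in \<open>auto intro!: has_derivative_mult_right simp: mult_ac\<close>)
  qed
  then show ?thesis
    using bergman_space_integrable[OF f] by (auto simp: bergman_space_def norm_mult)
qed

lemma bergman_space_zero: "(\<lambda>z. 0) \<in> bergman_space \<alpha>"
  unfolding bergman_space_def holomorphic_sv_def by (auto intro!: exI[of _ "\<lambda>_. 0"])

lemma bergman_space_add:
  assumes f: "f \<in> bergman_space \<alpha>" and g: "g \<in> bergman_space \<alpha>"
  shows "(\<lambda>z. f z + g z) \<in> bergman_space \<alpha>"
  using bergman_space_diff[OF f bergman_space_mult[OF g, of "-1"]] by simp

text \<open>
  Successive approximation: each step halves the norm of the remainder at a cost proportional to
  it. The resulting double sequence is arranged in a single one; since the coefficients are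
  absolutely summable, all partial sums converge, not only those after complete steps.
\<close>

lemma hull_imp_decomposition:
  fixes q \<alpha> C :: real and f :: "complex ^ 'n \<Rightarrow> complex"
  assumes \<alpha>: "\<alpha> > -1" and q: "q > 1" and C: "C > 0"
    and hull: "\<And>g :: complex ^ 'n \<Rightarrow> complex. g \<in> bergman_space \<alpha> \<Longrightarrow> atomic_hull q \<alpha> (C * bergman_norm \<alpha> g) g"
    and f: "f \<in> bergman_space \<alpha>"
  shows "\<exists>a l. atomic_decomposition q \<alpha> f a l \<and> (\<Sum>i. cmod (l i)) \<le> 2 * C * bergman_norm \<alpha> f"
proof -
  define n0 where "n0 = bergman_norm \<alpha> f"
  have n0: "n0 \<ge> 0" by (simp add: n0_def bergman_norm_nonneg)
  have one: "is_atom q \<alpha> (\<lambda>_ :: complex ^ 'n. 1)"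
  proof -
    interpret finite_measure "weighted_measure \<alpha> :: (complex ^ 'n) measure" by (rule finite_weighted_measure[OF \<alpha>])
    show ?thesis by (simp add: is_atom_def Lq_fun_def)
  qed
  obtain A where A: "A > 0" and at: "\<And>a :: complex ^ 'n \<Rightarrow> complex. is_atom q \<alpha> a \<Longrightarrow>
       bergman_proj \<alpha> a \<in> bergman_space \<alpha> \<and> bergman_norm \<alpha> (bergman_proj \<alpha> a) \<le> A"
    using proj_atom_bound[OF \<alpha> q, where 'n = 'n] by blast
  have sum_space: "atom_sum \<alpha> xs \<in> bergman_space \<alpha>" if "atom_list q \<alpha> xs" for xs :: "(complex \<times> (complex ^ 'n \<Rightarrow> complex)) list"
    using that
  proof (induction xs)
    case Nil
    show ?case using bergman_space_zero by (simp add: atom_sum_def[abs_def])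
  next
    case (Cons y xs)
    obtain l a where y: "y = (l, a)" by (cases y)
    have "is_atom q \<alpha> a" "atom_list q \<alpha> xs" using Cons.prems by (auto simp: atom_list_def y)
    then have "(\<lambda>z. l * bergman_proj \<alpha> a z + atom_sum \<alpha> xs z) \<in> bergman_space \<alpha>"
      using at Cons.IH by (intro bergman_space_add bergman_space_mult) auto
    then show ?case by (simp add: atom_sum_def[abs_def] y)
  qed
  show ?thesis
  proof (cases "n0 = 0")
    case True
    \<comment> \<open>No step reduces a norm that vanishes; all coefficients are zero.\<close>
    have "(\<lambda>z. 0 * bergman_proj \<alpha> (\<lambda>_. 1) z) \<in> bergman_space \<alpha>"
      using bergman_space_zero by simp
    then have "atomic_decomposition q \<alpha> f (\<lambda>_ _. 1) (\<lambda>_. 0)"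
      using one f True by (simp add: atomic_decomposition_def bergman_sums_def n0_def bergman_norm_def)
    then show ?thesis using C n0 by (intro exI[of _ "\<lambda>_ _. 1"] exI[of _ "\<lambda>_. 0"]) (simp add: n0_def)
  next
    case False
    then have n0p: "n0 > 0" using n0 by simp
    define good where "good g e xs \<longleftrightarrow> atom_list q \<alpha> xs \<and> atom_cost xs \<le> C * bergman_norm \<alpha> g \<and>
        bergman_norm \<alpha> (\<lambda>z. g z - atom_sum \<alpha> xs z) \<le> e"
      for g :: "complex ^ 'n \<Rightarrow> complex" and e :: real and xs
    have good: "good g e (SOME xs. good g e xs)" if "g \<in> bergman_space \<alpha>" "e > 0" for g e
    proof (rule someI_ex)
      show "\<exists>xs. good g e xs" using hull[OF that(1)] that(2) by (simp add: atomic_hull_def good_def)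
    qed
    define e where "e j = n0 / 2 ^ Suc j" for j :: nat
    have e: "e j > 0" for j using n0p by (simp add: e_def)
    define R where "R = rec_nat f (\<lambda>j g z. g z - atom_sum \<alpha> (SOME xs. good g (e j) xs) z)"
    define X where "X j = (SOME xs. good (R j) (e j) xs)" for j
    have R0: "R 0 = f" and RS: "R (Suc j) = (\<lambda>z. R j z - atom_sum \<alpha> (X j) z)" for j
      by (simp_all add: R_def X_def)
    have Rs: "R j \<in> bergman_space \<alpha>" for j
    proof (induction j)
      case (Suc j)
      have "atom_list q \<alpha> (X j)" using good[OF Suc.IH e[of j]] by (simp add: X_def good_def)
      then show ?case unfolding RS by (intro bergman_space_diff Suc.IH sum_space)
    qed (simp add: R0 f)
    have goodX: "good (R j) (e j) (X j)" for j
      unfolding X_def by (rule good[OF Rs e])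
    have X: "atom_list q \<alpha> (X j)" "atom_cost (X j) \<le> C * bergman_norm \<alpha> (R j)" "bergman_norm \<alpha> (R (Suc j)) \<le> e j" for j
      using goodX[of j] by (simp_all add: good_def RS)
    have Rn: "bergman_norm \<alpha> (R j) \<le> n0 / 2 ^ j" for j
      using X(3) by (cases j) (auto simp: R0 n0_def e_def)
    have cost: "atom_cost (X j) \<le> C * n0 * (1 / 2) ^ j" for j
    proof -
      have "C * bergman_norm \<alpha> (R j) \<le> C * (n0 / 2 ^ j)" using C Rn by (intro mult_left_mono) auto
      then show ?thesis using X(2)[of j] by (simp add: power_divide)
    qed
    have telescope: "f z = (\<Sum>j<J. atom_sum \<alpha> (X j) z) + R J z" for J z
      by (induction J) (simp_all add: R0 RS)
    \<comment> \<open>The lists are padded by the constant atom with coefficient zero.\<close>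
    define L where "L = (\<lambda>(j, i). if i < length (X j) then fst (X j ! i) else 0)"
    define B where "B = (\<lambda>(j, i). if i < length (X j) then snd (X j ! i) else (\<lambda>_. 1))"
    have Batom: "is_atom q \<alpha> (B p)" for p
    proof (cases p)
      case (Pair j i)
      show ?thesis
      proof (cases "i < length (X j)")
        case True
        then have "X j ! i \<in> set (X j)" by simp
        then show ?thesis using X(1)[of j] True by (auto simp: atom_list_def B_def Pair case_prod_beta)
      qed (simp add: B_def Pair one)
    qed
    have Lsum: "(\<Sum>i<I. cmod (L (j, i))) \<le> atom_cost (X j)" for j I
    proof -
      have "(\<Sum>i<I. cmod (L (j, i))) = (\<Sum>i\<in>{..<I} \<inter> {..<length (X j)}. cmod (L (j, i)))"
        by (rule sum.mono_neutral_right) (auto simp: L_def)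
      also have "\<dots> \<le> (\<Sum>i<length (X j). cmod (L (j, i)))"
        by (rule sum_mono2) auto
      also have "\<dots> = atom_cost (X j)"
        unfolding atom_cost_def sum_list_sum_nth
        by (auto simp: L_def lessThan_atLeast0 case_prod_beta intro!: sum.cong)
      finally show ?thesis .
    qed
    have geom: "(\<Sum>j\<in>{J..<K}. atom_cost (X j)) \<le> 2 * C * n0 * (1 / 2) ^ J" for J K
    proof -
      have g: "summable (\<lambda>j. C * n0 * (1 / 2 :: real) ^ (j + J))"
        by (intro summable_mult summable_ignore_initial_segment summable_geometric) simp
      have "(\<Sum>j\<in>{J..<K}. atom_cost (X j)) \<le> (\<Sum>j\<in>{J..<K}. C * n0 * (1 / 2) ^ j)"
        by (intro sum_mono cost)
      also have "\<dots> = (\<Sum>j<K - J. C * n0 * (1 / 2) ^ (j + J))"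
      proof (cases "J \<le> K")
        case True
        then show ?thesis
          using sum.shift_bounds_nat_ivl[of "\<lambda>j. C * n0 * (1 / 2) ^ j" 0 J "K - J"]
          by (simp add: lessThan_atLeast0)
      qed simp
      also have "\<dots> \<le> (\<Sum>j. C * n0 * (1 / 2) ^ (j + J))"
        using C n0 by (intro sum_le_suminf g) auto
      also have "\<dots> = C * n0 * (1 / 2) ^ J * (\<Sum>j. (1 / 2) ^ j)"
      proof -
        have "(\<Sum>j. C * n0 * (1 / 2 :: real) ^ (j + J)) = (\<Sum>j. C * n0 * (1 / 2) ^ J * (1 / 2) ^ j)"
          by (simp add: power_add mult_ac)
        also have "\<dots> = C * n0 * (1 / 2) ^ J * (\<Sum>j. (1 / 2) ^ j)"
          by (rule suminf_mult) (rule summable_geometric, simp)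
        finally show ?thesis .
      qed
      also have "(\<Sum>j. (1 / 2 :: real) ^ j) = 2" by (subst suminf_geometric) auto
      finally show ?thesis by simp
    qed
    have tail: "(\<Sum>p\<in>S. cmod (L p)) \<le> 2 * C * n0 * (1 / 2) ^ J"
      if S: "finite S" "\<And>j i. (j, i) \<in> S \<Longrightarrow> j < J \<Longrightarrow> L (j, i) = 0" for S J
    proof -
      obtain K where K: "fst ` S \<subseteq> {..<K}" using S(1) finite_nat_iff_bounded by blast
      obtain I where I: "snd ` S \<subseteq> {..<I}" using S(1) finite_nat_iff_bounded by blast
      have "(\<Sum>p\<in>S. cmod (L p)) = (\<Sum>p\<in>S \<inter> {J..<K} \<times> {..<I}. cmod (L p))"
        by (rule sum.mono_neutral_right) (use S K I in \<open>force simp: not_less\<close>)+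
      also have "\<dots> \<le> (\<Sum>p\<in>{J..<K} \<times> {..<I}. cmod (L p))" by (rule sum_mono2) auto
      also have "\<dots> = (\<Sum>j\<in>{J..<K}. \<Sum>i<I. cmod (L (j, i)))" by (simp add: sum.cartesian_product)
      also have "\<dots> \<le> (\<Sum>j\<in>{J..<K}. atom_cost (X j))" by (intro sum_mono Lsum)
      also have "\<dots> \<le> 2 * C * n0 * (1 / 2) ^ J" by (rule geom)
      finally show ?thesis .
    qed
    define a where "a i = B (prod_decode i)" for i
    define l where "l i = L (prod_decode i)" for i
    define D where "D M = prod_decode ` {..<M}" for M
    have inj: "inj_on prod_decode {..<M}" for M by (rule inj_prod_decode)
    have finD: "finite (D M)" for M by (simp add: D_def)
    have partial: "(\<Sum>i<M. cmod (l i)) \<le> 2 * C * n0" for M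
    proof -
      have "(\<Sum>i<M. cmod (l i)) = (\<Sum>p\<in>D M. cmod (L p))"
        unfolding D_def l_def by (subst sum.reindex[OF inj]) simp
      then show ?thesis using tail[OF finD[of M], of 0] by simp
    qed
    have sl: "summable (\<lambda>i. cmod (l i))" by (rule summableI_nonneg_bounded[OF _ partial]) simp
    have total: "(\<Sum>i. cmod (l i)) \<le> 2 * C * n0" by (rule suminf_le_const[OF sl partial])
    have termsp: "(\<lambda>z. l i * bergman_proj \<alpha> (a i) z) \<in> bergman_space \<alpha>" for i
      unfolding a_def using at[OF Batom] by (intro bergman_space_mult) blast
    have conv: "(\<lambda>M. bergman_norm \<alpha> (\<lambda>z. f z - (\<Sum>i<M. l i * bergman_proj \<alpha> (a i) z))) \<longlonglongrightarrow> 0"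
    proof (rule LIMSEQ_I)
      fix r :: real assume r: "r > 0"
      define c where "c = n0 + A * (2 * C * n0)"
      have c: "c > 0" using n0p A C by (simp add: c_def add_pos_pos)
      obtain J where J: "(1 / 2) ^ J < r / c" using real_arch_pow_inv[of "r / c" "1 / 2"] r c by auto
      \<comment> \<open>Once all terms of the first \<open>J\<close> steps are included, only the remainder after these steps and
         some terms of later steps are left.\<close>
      define T where "T = (SIGMA j:{..<J}. {..<length (X j)})"
      have finT: "finite T" by (simp add: T_def)
      obtain M0 where M0: "prod_encode ` T \<subseteq> {..<M0}" using finT finite_nat_iff_bounded by blast
      have "bergman_norm \<alpha> (\<lambda>z. f z - (\<Sum>i<M. l i * bergman_proj \<alpha> (a i) z)) < r" if M: "M \<ge> M0" for M
      proof -
        have TD: "T \<subseteq> D M"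
        proof
          fix p assume "p \<in> T"
          then have "prod_encode p < M" using M0 M by fastforce
          then show "p \<in> D M" unfolding D_def by (metis imageI lessThan_iff prod_encode_inverse)
        qed
        let ?g = "\<lambda>p z. L p * bergman_proj \<alpha> (B p) z"
        have gi: "integrable (weighted_measure \<alpha>) (?g p)" for p
          using at[OF Batom[of p]] bergman_space_integrable by auto
        have eq: "f z - (\<Sum>i<M. l i * bergman_proj \<alpha> (a i) z) = R J z + - (\<Sum>p\<in>D M - T. ?g p z)" for z
        proof -
          have "(\<Sum>i<M. l i * bergman_proj \<alpha> (a i) z) = (\<Sum>p\<in>D M. ?g p z)"
            unfolding D_def l_def a_def by (subst sum.reindex[OF inj]) simp
          also have "\<dots> = (\<Sum>p\<in>D M - T. ?g p z) + (\<Sum>p\<in>T. ?g p z)"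
            by (rule sum.subset_diff[OF TD finD])
          also have "(\<Sum>p\<in>T. ?g p z) = (\<Sum>j<J. \<Sum>i<length (X j). ?g (j, i) z)"
            unfolding T_def by (subst sum.Sigma) auto
          also have "\<dots> = (\<Sum>j<J. atom_sum \<alpha> (X j) z)"
            unfolding atom_sum_def sum_list_sum_nth
            by (intro sum.cong refl) (auto simp: L_def B_def lessThan_atLeast0 case_prod_beta intro!: sum.cong)
          finally show ?thesis using telescope[of z J] by simp
        qed
        have "bergman_norm \<alpha> (\<lambda>z. f z - (\<Sum>i<M. l i * bergman_proj \<alpha> (a i) z))
            \<le> bergman_norm \<alpha> (R J) + bergman_norm \<alpha> (\<lambda>z. - (\<Sum>p\<in>D M - T. ?g p z))"
          unfolding eq using gi by (intro bergman_norm_add_le bergman_space_integrable[OF Rs]) auto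
        also have "bergman_norm \<alpha> (\<lambda>z. - (\<Sum>p\<in>D M - T. ?g p z)) = bergman_norm \<alpha> (\<lambda>z. \<Sum>p\<in>D M - T. ?g p z)"
          by (simp add: bergman_norm_def)
        also have "\<dots> \<le> (\<Sum>p\<in>D M - T. bergman_norm \<alpha> (?g p))"
          using finD gi by (intro bergman_norm_sum_le) auto
        also have "\<dots> \<le> (\<Sum>p\<in>D M - T. cmod (L p) * A)"
          unfolding bergman_norm_mult using at[OF Batom] by (intro sum_mono mult_left_mono) auto
        also have "\<dots> = A * (\<Sum>p\<in>D M - T. cmod (L p))" by (simp add: sum_distrib_left mult.commute)
        also have "\<dots> \<le> A * (2 * C * n0 * (1 / 2) ^ J)"
          using A finD by (intro mult_left_mono tail) (auto simp: T_def L_def)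
        also have "bergman_norm \<alpha> (R J) \<le> n0 * (1 / 2) ^ J" using Rn[of J] by (simp add: power_divide)
        finally have "bergman_norm \<alpha> (\<lambda>z. f z - (\<Sum>i<M. l i * bergman_proj \<alpha> (a i) z)) \<le> c * (1 / 2) ^ J"
          by (simp add: c_def algebra_simps)
        also have "\<dots> < r" using J c by (simp add: field_simps)
        finally show ?thesis .
      qed
      then show "\<exists>M0. \<forall>M\<ge>M0. norm (bergman_norm \<alpha> (\<lambda>z. f z - (\<Sum>i<M. l i * bergman_proj \<alpha> (a i) z)) - 0) < r"
        by (intro exI[of _ M0]) (simp add: bergman_norm_nonneg)
    qed
    have "atomic_decomposition q \<alpha> f a l"
      unfolding atomic_decomposition_def bergman_sums_def
      using Batom sl termsp f conv by (simp add: a_def)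
    then show ?thesis using total by (auto simp: n0_def)
  qed
qed

text \<open>The reverse estimate only uses that the projections of atoms are bounded in norm.\<close>

lemma norm_le_decomposition:
  fixes f :: "complex ^ 'n \<Rightarrow> complex"
  assumes dec: "atomic_decomposition q \<alpha> f a l"
    and at: "\<And>a :: complex ^ 'n \<Rightarrow> complex. is_atom q \<alpha> a \<Longrightarrow> bergman_norm \<alpha> (bergman_proj \<alpha> a) \<le> A"
    and A: "A > 0"
  shows "bergman_norm \<alpha> f \<le> A * (\<Sum>i. cmod (l i))"
proof -
  let ?g = "\<lambda>i z. l i * bergman_proj \<alpha> (a i) z"
  have a: "is_atom q \<alpha> (a i)" and sl: "summable (\<lambda>i. cmod (l i))" and g: "?g i \<in> bergman_space \<alpha>"
    and f: "f \<in> bergman_space \<alpha>"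
    and lim: "(\<lambda>N. bergman_norm \<alpha> (\<lambda>z. f z - (\<Sum>i<N. ?g i z))) \<longlonglongrightarrow> 0" for i
    using dec by (auto simp: atomic_decomposition_def bergman_sums_def)
  have gi: "integrable (weighted_measure \<alpha>) (?g i)" for i by (rule bergman_space_integrable[OF g])
  have le: "bergman_norm \<alpha> f \<le> bergman_norm \<alpha> (\<lambda>z. f z - (\<Sum>i<N. ?g i z)) + A * (\<Sum>i. cmod (l i))" for N
  proof -
    have "bergman_norm \<alpha> f = bergman_norm \<alpha> (\<lambda>z. (f z - (\<Sum>i<N. ?g i z)) + (\<Sum>i<N. ?g i z))" by simp
    also have "\<dots> \<le> bergman_norm \<alpha> (\<lambda>z. f z - (\<Sum>i<N. ?g i z)) + bergman_norm \<alpha> (\<lambda>z. \<Sum>i<N. ?g i z)"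
      using bergman_space_integrable[OF f] gi
      by (intro bergman_norm_add_le Bochner_Integration.integrable_diff Bochner_Integration.integrable_sum)
    also have "bergman_norm \<alpha> (\<lambda>z. \<Sum>i<N. ?g i z) \<le> (\<Sum>i<N. bergman_norm \<alpha> (?g i))"
      using gi by (intro bergman_norm_sum_le) auto
    also have "\<dots> \<le> (\<Sum>i<N. cmod (l i) * A)"
      unfolding bergman_norm_mult by (intro sum_mono mult_left_mono at a) auto
    also have "\<dots> = A * (\<Sum>i<N. cmod (l i))" by (simp add: sum_distrib_left mult.commute)
    also have "\<dots> \<le> A * (\<Sum>i. cmod (l i))"
      using A by (intro mult_left_mono sum_le_suminf sl) auto
    finally show ?thesis by simp
  qed
  have "(\<lambda>N. bergman_norm \<alpha> (\<lambda>z. f z - (\<Sum>i<N. ?g i z)) + A * (\<Sum>i. cmod (l i))) \<longlonglongrightarrow> 0 + A * (\<Sum>i. cmod (l i))"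
    by (intro tendsto_add lim tendsto_const)
  then show ?thesis using LIMSEQ_le_const le by fastforce
qed

section \<open>The atomic decomposition\<close>

theorem theorem3p1:
  fixes q \<alpha> :: real
  assumes "1 < q" and "\<alpha> > -1"
  shows "(\<exists>C>0. \<forall>f \<in> (bergman_space \<alpha> :: (complex ^ 'n \<Rightarrow> complex) set).
            \<exists>a l. atomic_decomposition q \<alpha> f a l \<and>
                  (\<Sum>i. cmod (l i)) \<le> C * bergman_norm \<alpha> f) \<and>
         (\<exists>C>0. \<forall>f \<in> (bergman_space \<alpha> :: (complex ^ 'n \<Rightarrow> complex) set).
            inverse C * atomic_norm q \<alpha> f \<le> bergman_norm \<alpha> f \<and>
            bergman_norm \<alpha> f \<le> C * atomic_norm q \<alpha> f)"
proof -
  obtain C where C: "C > 0" and hull: "\<And>f :: complex ^ 'n \<Rightarrow> complex. f \<in> bergman_space \<alpha> \<Longrightarrow>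
      atomic_hull q \<alpha> (C * bergman_norm \<alpha> f) f"
    using bergman_space_subset_hull[OF assms(2,1), where 'n = 'n] by blast
  have dec: "\<exists>a l. atomic_decomposition q \<alpha> f a l \<and> (\<Sum>i. cmod (l i)) \<le> 2 * C * bergman_norm \<alpha> f"
    if "f \<in> bergman_space \<alpha>" for f :: "complex ^ 'n \<Rightarrow> complex"
    by (rule hull_imp_decomposition[OF assms(2,1) C hull that])
  obtain A where A: "A > 0" and at: "\<And>a :: complex ^ 'n \<Rightarrow> complex. is_atom q \<alpha> a \<Longrightarrow>
       bergman_proj \<alpha> a \<in> bergman_space \<alpha> \<and> bergman_norm \<alpha> (bergman_proj \<alpha> a) \<le> A"
    using proj_atom_bound[OF assms(2,1), where 'n = 'n] by blast
  define K where "K = max (2 * C) A"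
  have K: "K > 0" "2 * C \<le> K" "A \<le> K" using C by (auto simp: K_def)
  have two: "inverse K * atomic_norm q \<alpha> f \<le> bergman_norm \<alpha> f \<and> bergman_norm \<alpha> f \<le> K * atomic_norm q \<alpha> f"
    if f: "f \<in> bergman_space \<alpha>" for f :: "complex ^ 'n \<Rightarrow> complex"
  proof
    let ?S = "{\<Sum>i. cmod (l i) |a l. atomic_decomposition q \<alpha> f a l}"
    obtain a l where al: "atomic_decomposition q \<alpha> f a l" "(\<Sum>i. cmod (l i)) \<le> 2 * C * bergman_norm \<alpha> f"
      using dec[OF f] by blast
    have ne: "?S \<noteq> {}" using al(1) by blast
    have "bdd_below ?S"
      by (rule bdd_belowI[of _ 0]) (auto simp: atomic_decomposition_def intro!: suminf_nonneg)
    then have "atomic_norm q \<alpha> f \<le> (\<Sum>i. cmod (l i))"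
      unfolding atomic_norm_def using al(1) by (intro cInf_lower) auto
    also have "\<dots> \<le> K * bergman_norm \<alpha> f"
      using al(2) mult_right_mono[OF K(2) bergman_norm_nonneg[of \<alpha> f]] by linarith
    finally show "inverse K * atomic_norm q \<alpha> f \<le> bergman_norm \<alpha> f" using K(1) by (simp add: field_simps)
    have "bergman_norm \<alpha> f / K \<le> atomic_norm q \<alpha> f"
      unfolding atomic_norm_def
    proof (rule cInf_greatest[OF ne])
      fix y assume "y \<in> ?S"
      then obtain a' l' where *: "y = (\<Sum>i. cmod (l' i))" "atomic_decomposition q \<alpha> f a' l'" by blast
      have "bergman_norm \<alpha> f \<le> A * y"
        unfolding *(1) by (rule norm_le_decomposition[OF *(2) _ A]) (use at in blast)
      also have "\<dots> \<le> K * y"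
        using K(3) *(2) by (intro mult_right_mono) (auto simp: *(1) atomic_decomposition_def intro!: suminf_nonneg)
      finally show "bergman_norm \<alpha> f / K \<le> y" using K(1) by (simp add: field_simps)
    qed
    then show "bergman_norm \<alpha> f \<le> K * atomic_norm q \<alpha> f" using K(1) by (simp add: field_simps)
  qed
  show ?thesis
  proof
    show "\<exists>C>0. \<forall>f \<in> (bergman_space \<alpha> :: (complex ^ 'n \<Rightarrow> complex) set).
            \<exists>a l. atomic_decomposition q \<alpha> f a l \<and> (\<Sum>i. cmod (l i)) \<le> C * bergman_norm \<alpha> f"
      using dec C by (intro exI[of _ "2 * C"]) auto
    show "\<exists>C>0. \<forall>f \<in> (bergman_space \<alpha> :: (complex ^ 'n \<Rightarrow> complex) set).
            inverse C * atomic_norm q \<alpha> f \<le> bergman_norm \<alpha> f \<and> bergman_norm \<alpha> f \<le> C * atomic_norm q \<alpha> f"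
      using two K(1) by blast
  qed
qed

end
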